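(* Let $(M,\circ,e,F)$ be a massive $n$-dimensional F-manifold with generating function $F$ and in standard form, with projection $pr_e:M\to M^{(r)}$ to the space of orbits of $e$. Then the multiplication can be recovered from the discriminant $\mathcal D$ and the unit field $e$ in the following way. The multiplication is semisimple outside of the bifurcation diagram $\mathcal B=pr_e^{-1}(pr_e(\mathcal D_{sing}))$. For a point $p\in M-\mathcal B$, the idempotent vectors $e_1(p),\dots,e_n(p)\in T_pM$ with $e_i(p)\circ e_j(p)=\delta_{ij}e_i(p)$ are uniquely determined (up to numbering) by (i) and (ii): (i) $e(p)=\sum_{i=1}^ne_i(p)$; (ii) the multigerm $(\mathcal D,\mathcal D\cap pr_e^{-1}(pr_e(p)))$ has exactly $n$ tangent hyperplanes; their shifts to $T_pM$ with (the flow of) $e$ are the hyperplanes $\bigoplus_{i\ne k}\mathbb C\cdot e_i(p)\subset T_pM$, $k=1,\dots,n$.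
   Context: An F-manifold is a triple $(M,\circ,e)$ with $M$ a connected complex manifold of dimension $n\ge1$, $\circ$ a commutative, associative $\mathcal O_M$-bilinear multiplication on the tangent sheaf $\mathcal T_M$, and $e$ a global unit field, such that $\mathrm{Lie}_{X\circ Y}(\circ)=X\circ \mathrm{Lie}_Y(\circ)+Y\circ\mathrm{Lie}_X(\circ)$ for all local vector fields $X,Y$. It is massive if $T_pM$ is a semisimple algebra ($\cong\mathbb C^n$) for generic $p$. Its analytic spectrum $L\subset T^*M$ is the set of all unital algebra homomorphisms $T_pM\to\mathbb C$, $p\in M$ (for a massive F-manifold a reduced Lagrange variety, finite and flat of degree $n$ over $M$); $\pi:L\to M$ is the projection and $\alpha$ the canonical 1-form on $T^*M$. A generating function is a continuous function $F:L\to\mathbb C$, holomorphic on $L_{reg}$, with $dF|_{L_{reg}}=\alpha|_{L_{reg}}$. The bifurcation diagram $\mathcal B\subset M$ of $(M,\circ,e,F)$ is the set of points $p$ such that $F$ has fewer than $n$ different values on $\pi^{-1}(p)$. The discriminant is the hypersurface $\mathcal D=\pi(F^{-1}(0))\subset M$; $\mathcal D_{sing}$ is its singular locus. $(M,\circ,e,F)$ is in standard form if there is globally a projection $pr_e:M\to M^{(r)}$ to a manifold $M^{(r)}$ such that: the fibers are the orbits of $e$ (hence connected); the fibers, with their affine linear structure, are isomorphic to open connected subsets of $\mathbb C$; and $pr_e:\mathcal D\to M^{(r)}$ is a branched covering of degree $n$. *)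

theory Defs
  imports "HOL-Analysis.Analysis" "HOL-Library.Function_Algebras"
begin

section \<open>Holomorphic functions of several variables\<close>

text \<open>
  Manifolds of dimension \<open>d\<close> are modelled on a coordinate subspace of \<open>complex^'k\<close> in which exactly
  \<open>d\<close> coordinates are free.  This allows dimension \<open>0\<close>, which is impossible with
  \<open>complex^'k\<close> alone; dimension \<open>0\<close> occurs for the orbit space when \<open>n = 1\<close>.
\<close>

definition coord_space :: "'k::finite set \<Rightarrow> (complex^'k) set" where
  "coord_space J = {z. \<forall>i. i \<notin> J \<longrightarrow> z $ i = 0}"

text \<open>To be used for sets \<open>S\<close> that are relatively open in some coordinate subspace.\<close>

definition cholomorphic :: "(complex^'k::finite) set \<Rightarrow> (complex^'k \<Rightarrow> complex) \<Rightarrow> bool" where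
  "cholomorphic S f \<longleftrightarrow>
     (\<forall>z\<in>S. \<exists>f'. (f has_derivative f') (at z within S) \<and> (\<forall>c v. f' (c *s v) = c * f' v))"

definition cholomorphic_vec ::
    "(complex^'k::finite) set \<Rightarrow> (complex^'k \<Rightarrow> complex^'l::finite) \<Rightarrow> bool" where
  "cholomorphic_vec S f \<longleftrightarrow> (\<forall>i. cholomorphic S (\<lambda>z. f z $ i))"

text \<open>
  The complex directional derivative.  For a function that is holomorphic on a relatively open
  subset of a coordinate subspace and \<open>v\<close> in that subspace, it is the value at \<open>v\<close> of the
  differential.
\<close>

definition dir_deriv :: "(complex^'k::finite \<Rightarrow> complex^'l::finite) \<Rightarrow> complex^'k \<Rightarrow> complex^'k \<Rightarrow> complex^'l" where
  "dir_deriv f z v = (\<chi> i. deriv (\<lambda>t. f (z + t *s v) $ i) 0)"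


section \<open>Complex manifolds\<close>

text \<open>
  A chart is a domain together with a coordinate map.  The underlying point set and the topology of a
  manifold are determined by its atlas; \<open>coords\<close> is the set of free coordinates.
\<close>

type_synonym ('a, 'k) chart = "'a set \<times> ('a \<Rightarrow> complex^'k)"

record ('a, 'k) cmanifold =
  atlas :: "('a, 'k) chart set"
  coords :: "'k set"

definition points :: "('a, 'k::finite) cmanifold \<Rightarrow> 'a set" where
  "points M = (\<Union>c\<in>atlas M. fst c)"

definition mtop :: "('a, 'k::finite) cmanifold \<Rightarrow> 'a topology" where
  "mtop M = topology_generated_by {fst c \<inter> snd c -` A | c A. c \<in> atlas M \<and> open A}"

lemma topspace_mtop: "topspace (mtop M) = points M"
proof -
  have "fst c \<in> {fst c \<inter> snd c -` A | c A. c \<in> atlas M \<and> open A}" if "c \<in> atlas M" for c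
    using that open_UNIV by (intro CollectI exI[of _ c] exI[of _ UNIV]) auto
  then have "\<Union>{fst c \<inter> snd c -` A | c A. c \<in> atlas M \<and> open A} = (\<Union>c\<in>atlas M. fst c)"
    by blast
  then show ?thesis
    by (simp add: mtop_def points_def)
qed

definition chart_inv :: "('a, 'k) chart \<Rightarrow> complex^'k \<Rightarrow> 'a" where
  "chart_inv c = inv_into (fst c) (snd c)"

definition transition :: "('a, 'k) chart \<Rightarrow> ('a, 'k) chart \<Rightarrow> complex^'k \<Rightarrow> complex^'k" where
  "transition c c' = snd c' \<circ> chart_inv c"

definition holo_transition :: "('a, 'k::finite) chart \<Rightarrow> ('a, 'k) chart \<Rightarrow> bool" where
  "holo_transition c c' \<longleftrightarrow> cholomorphic_vec (snd c ` (fst c \<inter> fst c')) (transition c c')"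

definition complex_manifold :: "('a, 'k::finite) cmanifold \<Rightarrow> bool" where
  "complex_manifold M \<longleftrightarrow>
     points M \<noteq> {} \<and>
     (\<forall>c\<in>atlas M. inj_on (snd c) (fst c) \<and>
        (\<forall>c'\<in>atlas M.
           openin (top_of_set (coord_space (coords M))) (snd c ` (fst c \<inter> fst c')) \<and>
           holo_transition c c')) \<and>
     Hausdorff_space (mtop M) \<and> second_countable (mtop M)"

definition charts_at :: "('a, 'k::finite) cmanifold \<Rightarrow> 'a \<Rightarrow> ('a, 'k) chart set" where
  "charts_at M p = {c \<in> atlas M. p \<in> fst c}"

text \<open>Members of the maximal atlas.\<close>

definition compatible_chart :: "('a, 'k::finite) cmanifold \<Rightarrow> ('a, 'k) chart \<Rightarrow> bool" where
  "compatible_chart M c \<longleftrightarrow>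
     openin (mtop M) (fst c) \<and> inj_on (snd c) (fst c) \<and>
     openin (top_of_set (coord_space (coords M))) (snd c ` fst c) \<and>
     (\<forall>c'\<in>atlas M. holo_transition c c' \<and> holo_transition c' c)"

definition holo_fun :: "('a, 'k::finite) cmanifold \<Rightarrow> 'a set \<Rightarrow> ('a \<Rightarrow> complex) \<Rightarrow> bool" where
  "holo_fun M W f \<longleftrightarrow> (\<forall>c\<in>atlas M. cholomorphic (snd c ` (fst c \<inter> W)) (f \<circ> chart_inv c))"

definition holo_map ::
    "('a, 'k::finite) cmanifold \<Rightarrow> 'a set \<Rightarrow> ('b, 'l::finite) cmanifold \<Rightarrow> ('a \<Rightarrow> 'b) \<Rightarrow> bool" where
  "holo_map M W N f \<longleftrightarrow>
     continuous_map (subtopology (mtop M) W) (mtop N) f \<and>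
     (\<forall>c\<in>atlas M. \<forall>d\<in>atlas N.
        cholomorphic_vec (snd c ` (fst c \<inter> W \<inter> f -` fst d)) (snd d \<circ> f \<circ> chart_inv c))"

definition analytic_subset :: "('a, 'k::finite) cmanifold \<Rightarrow> 'a set \<Rightarrow> bool" where
  "analytic_subset M A \<longleftrightarrow> A \<subseteq> points M \<and>
     (\<forall>p\<in>points M. \<exists>W G. openin (mtop M) W \<and> p \<in> W \<and> finite G \<and> (\<forall>g\<in>G. holo_fun M W g) \<and>
        A \<inter> W = {x\<in>W. \<forall>g\<in>G. g x = 0})"

text \<open>Points near which a subset is a complex submanifold.\<close>

definition reg_points :: "('a, 'k::finite) cmanifold \<Rightarrow> 'a set \<Rightarrow> 'a set" where
  "reg_points M S = {x \<in> S. \<exists>c J. compatible_chart M c \<and> x \<in> fst c \<and> J \<subseteq> coords M \<and>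
     snd c ` (S \<inter> fst c) = snd c ` fst c \<inter> coord_space J}"

definition sing_points :: "('a, 'k::finite) cmanifold \<Rightarrow> 'a set \<Rightarrow> 'a set" where
  "sing_points M S = S - reg_points M S"


section \<open>Tangent vectors, vector fields, differentials\<close>

text \<open>
  A tangent vector at \<open>p\<close> is the family of its coordinate vectors in all charts of the atlas around
  \<open>p\<close> (and \<open>0\<close> at all other charts), transforming with the differentials of the transition maps.
  Addition and \<open>0\<close> are pointwise.
\<close>

type_synonym ('a, 'k) tvec = "('a, 'k) chart \<Rightarrow> complex^'k"

definition tscale :: "complex \<Rightarrow> ('a, 'k::finite) tvec \<Rightarrow> ('a, 'k) tvec" where
  "tscale a v = (\<lambda>c. a *s v c)"

definition tangent_space :: "('a, 'k::finite) cmanifold \<Rightarrow> 'a \<Rightarrow> ('a, 'k) tvec set" where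
  "tangent_space M p = {v.
     (\<forall>c. c \<notin> charts_at M p \<longrightarrow> v c = 0) \<and>
     (\<forall>c\<in>charts_at M p. v c \<in> coord_space (coords M) \<and>
        (\<forall>c'\<in>charts_at M p. v c' = dir_deriv (transition c c') (snd c p) (v c)))}"

definition coord_vec :: "('a, 'k::finite) cmanifold \<Rightarrow> ('a, 'k) chart \<Rightarrow> 'a \<Rightarrow> 'k \<Rightarrow> ('a, 'k) tvec" where
  "coord_vec M c p i =
     (\<lambda>c'. if c' \<in> charts_at M p then dir_deriv (transition c c') (snd c p) (axis i 1) else 0)"

definition differential ::
    "('a, 'k::finite) cmanifold \<Rightarrow> ('b, 'l::finite) cmanifold \<Rightarrow> ('a \<Rightarrow> 'b) \<Rightarrow> 'a \<Rightarrow>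
     ('a, 'k) tvec \<Rightarrow> ('b, 'l) tvec" where
  "differential M N f p v =
     (let c = (SOME c. c \<in> charts_at M p) in
      (\<lambda>d. if d \<in> charts_at N (f p) then dir_deriv (snd d \<circ> f \<circ> chart_inv c) (snd c p) (v c) else 0))"

definition vector_field ::
    "('a, 'k::finite) cmanifold \<Rightarrow> 'a set \<Rightarrow> ('a \<Rightarrow> ('a, 'k) tvec) \<Rightarrow> bool" where
  "vector_field M W X \<longleftrightarrow>
     (\<forall>p\<in>W. X p \<in> tangent_space M p) \<and>
     (\<forall>c\<in>atlas M. cholomorphic_vec (snd c ` (fst c \<inter> W)) (\<lambda>z. X (chart_inv c z) c))"

definition lie_bracket ::
    "('a, 'k::finite) cmanifold \<Rightarrow> ('a \<Rightarrow> ('a, 'k) tvec) \<Rightarrow> ('a \<Rightarrow> ('a, 'k) tvec) \<Rightarrow> 'a \<Rightarrow> ('a, 'k) tvec" where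
  "lie_bracket M X Y p =
     (\<lambda>c. if c \<in> charts_at M p
          then dir_deriv (\<lambda>z. Y (chart_inv c z) c) (snd c p) (X p c)
             - dir_deriv (\<lambda>z. X (chart_inv c z) c) (snd c p) (Y p c)
          else 0)"

definition holo_curve :: "('a, 'k::finite) cmanifold \<Rightarrow> complex set \<Rightarrow> (complex \<Rightarrow> 'a) \<Rightarrow> bool" where
  "holo_curve M \<Omega> \<gamma> \<longleftrightarrow> open \<Omega> \<and> continuous_map (top_of_set \<Omega>) (mtop M) \<gamma> \<and>
     (\<forall>c\<in>atlas M. \<forall>i. (\<lambda>t. snd c (\<gamma> t) $ i) holomorphic_on (\<Omega> \<inter> \<gamma> -` fst c))"

definition velocity :: "('a, 'k::finite) cmanifold \<Rightarrow> (complex \<Rightarrow> 'a) \<Rightarrow> complex \<Rightarrow> ('a, 'k) tvec" where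
  "velocity M \<gamma> t =
     (\<lambda>c. if c \<in> charts_at M (\<gamma> t) then (\<chi> i. deriv (\<lambda>s. snd c (\<gamma> s) $ i) t) else 0)"

text \<open>
  Velocities of holomorphic curves inside a subset; at a regular point of the subset this is the
  tangent space of the submanifold.
\<close>

definition tangent_to :: "('a, 'k::finite) cmanifold \<Rightarrow> 'a set \<Rightarrow> 'a \<Rightarrow> ('a, 'k) tvec set" where
  "tangent_to M S p =
     {velocity M \<gamma> 0 | \<gamma> \<Omega>. holo_curve M \<Omega> \<gamma> \<and> 0 \<in> \<Omega> \<and> \<gamma> 0 = p \<and> \<gamma> ` \<Omega> \<subseteq> S}"


section \<open>The cotangent bundle\<close>

text \<open>Covectors are extended by \<open>0\<close> outside of the tangent space.\<close>

type_synonym ('a, 'k) covec = "('a, 'k) tvec \<Rightarrow> complex"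

definition cotangent_space :: "('a, 'k::finite) cmanifold \<Rightarrow> 'a \<Rightarrow> ('a, 'k) covec set" where
  "cotangent_space M p = {l.
     (\<forall>v. v \<notin> tangent_space M p \<longrightarrow> l v = 0) \<and>
     (\<forall>v\<in>tangent_space M p. \<forall>w\<in>tangent_space M p. l (v + w) = l v + l w) \<and>
     (\<forall>a. \<forall>v\<in>tangent_space M p. l (tscale a v) = a * l v)}"

text \<open>The usual coordinates on the cotangent bundle: base coordinates and values on coordinate fields.\<close>

definition cotangent_chart ::
    "('a, 'k::finite) cmanifold \<Rightarrow> ('a, 'k) chart \<Rightarrow> ('a \<times> ('a, 'k) covec, 'k + 'k) chart" where
  "cotangent_chart M c =
     ({(p, l). p \<in> fst c \<and> l \<in> cotangent_space M p},
      \<lambda>(p, l). \<chi> k. case k of Inl i \<Rightarrow> snd c p $ i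
                            | Inr i \<Rightarrow> if i \<in> coords M then l (coord_vec M c p i) else 0)"

definition cotangent_bundle :: "('a, 'k::finite) cmanifold \<Rightarrow> ('a \<times> ('a, 'k) covec, 'k + 'k) cmanifold" where
  "cotangent_bundle M = \<lparr>atlas = cotangent_chart M ` atlas M, coords = coords M <+> coords M\<rparr>"

definition canonical_form ::
    "('a, 'k::finite) cmanifold \<Rightarrow> 'a \<times> ('a, 'k) covec \<Rightarrow> ('a \<times> ('a, 'k) covec, 'k + 'k) tvec \<Rightarrow> complex" where
  "canonical_form M x \<xi> = snd x (differential (cotangent_bundle M) M fst x \<xi>)"


section \<open>F-manifolds\<close>

text \<open>
  The multiplication on the tangent sheaf is given by multiplications on the tangent spaces
  (an \<open>O\<close>-bilinear map of locally free sheaves is a holomorphic family of bilinear maps of the fibres).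
\<close>

type_synonym ('a, 'k) tmult = "'a \<Rightarrow> ('a, 'k) tvec \<Rightarrow> ('a, 'k) tvec \<Rightarrow> ('a, 'k) tvec"

text \<open>\<open>lie_mult M m X Z V\<close> is \<open>Lie_X(m)(Z, V)\<close>.\<close>

definition lie_mult ::
    "('a, 'k::finite) cmanifold \<Rightarrow> ('a, 'k) tmult \<Rightarrow> ('a \<Rightarrow> ('a, 'k) tvec) \<Rightarrow>
     ('a \<Rightarrow> ('a, 'k) tvec) \<Rightarrow> ('a \<Rightarrow> ('a, 'k) tvec) \<Rightarrow> 'a \<Rightarrow> ('a, 'k) tvec" where
  "lie_mult M m X Z V p =
     lie_bracket M X (\<lambda>q. m q (Z q) (V q)) p
     - m p (lie_bracket M X Z p) (V p) - m p (Z p) (lie_bracket M X V p)"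

definition F_manifold ::
    "('a, 'n::finite) cmanifold \<Rightarrow> ('a, 'n) tmult \<Rightarrow> ('a \<Rightarrow> ('a, 'n) tvec) \<Rightarrow> bool" where
  "F_manifold M m e \<longleftrightarrow>
     complex_manifold M \<and> coords M = UNIV \<and> connected_space (mtop M) \<and>
     (\<forall>p\<in>points M. \<forall>u\<in>tangent_space M p. \<forall>v\<in>tangent_space M p. \<forall>w\<in>tangent_space M p.
        m p u v \<in> tangent_space M p \<and>
        m p (u + v) w = m p u w + m p v w \<and>
        (\<forall>a. m p (tscale a u) v = tscale a (m p u v)) \<and>
        m p u v = m p v u \<and>
        m p (m p u v) w = m p u (m p v w) \<and>
        m p (e p) u = u) \<and>
     (\<forall>W X Y. openin (mtop M) W \<and> vector_field M W X \<and> vector_field M W Y \<longrightarrow>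
        vector_field M W (\<lambda>p. m p (X p) (Y p))) \<and>
     vector_field M (points M) e \<and>
     (\<forall>W X Y Z V. openin (mtop M) W \<and> vector_field M W X \<and> vector_field M W Y \<and>
        vector_field M W Z \<and> vector_field M W V \<longrightarrow>
        (\<forall>p\<in>W. lie_mult M m (\<lambda>q. m q (X q) (Y q)) Z V p =
                m p (X p) (lie_mult M m Y Z V p) + m p (Y p) (lie_mult M m X Z V p)))"

text \<open>\<open>T_pM\<close> is isomorphic to \<open>\<complex>\<^sup>n\<close> with the componentwise product, the product \<open>*\<close> of \<open>complex^'n\<close>.\<close>

definition semisimple_at :: "('a, 'n::finite) cmanifold \<Rightarrow> ('a, 'n) tmult \<Rightarrow> 'a \<Rightarrow> bool" where
  "semisimple_at M m p \<longleftrightarrow>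
     (\<exists>\<Phi> :: ('a, 'n) tvec \<Rightarrow> complex^'n. bij_betw \<Phi> (tangent_space M p) UNIV \<and>
        (\<forall>v\<in>tangent_space M p. \<forall>w\<in>tangent_space M p.
           \<Phi> (v + w) = \<Phi> v + \<Phi> w \<and> (\<forall>a. \<Phi> (tscale a v) = a *s \<Phi> v) \<and> \<Phi> (m p v w) = \<Phi> v * \<Phi> w))"

text \<open>Generic points: the points outside of some proper analytic subset.\<close>

definition massive_F_manifold ::
    "('a, 'n::finite) cmanifold \<Rightarrow> ('a, 'n) tmult \<Rightarrow> ('a \<Rightarrow> ('a, 'n) tvec) \<Rightarrow> bool" where
  "massive_F_manifold M m e \<longleftrightarrow> F_manifold M m e \<and>
     (\<exists>K. analytic_subset M K \<and> K \<noteq> points M \<and> (\<forall>p\<in>points M - K. semisimple_at M m p))"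

definition analytic_spectrum ::
    "('a, 'n::finite) cmanifold \<Rightarrow> ('a, 'n) tmult \<Rightarrow> ('a \<Rightarrow> ('a, 'n) tvec) \<Rightarrow> ('a \<times> ('a, 'n) covec) set" where
  "analytic_spectrum M m e = {(p, l). p \<in> points M \<and> l \<in> cotangent_space M p \<and> l (e p) = 1 \<and>
     (\<forall>v\<in>tangent_space M p. \<forall>w\<in>tangent_space M p. l (m p v w) = l v * l w)}"

text \<open>
  Holomorphy on the submanifold \<open>L_reg\<close> is existence of local holomorphic extensions.  The identity
  \<open>dF = \<alpha>\<close> on \<open>L_reg\<close> is evaluated on the velocities of holomorphic curves in \<open>L_reg\<close>, which are all of its
  tangent vectors.
\<close>

definition generating_function ::
    "('a, 'n::finite) cmanifold \<Rightarrow> ('a, 'n) tmult \<Rightarrow> ('a \<Rightarrow> ('a, 'n) tvec) \<Rightarrow>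
     ('a \<times> ('a, 'n) covec \<Rightarrow> complex) \<Rightarrow> bool" where
  "generating_function M m e F \<longleftrightarrow>
     (let T = cotangent_bundle M; L = analytic_spectrum M m e; Lreg = reg_points T L in
        continuous_map (subtopology (mtop T) L) euclidean F \<and>
        (\<forall>x\<in>Lreg. \<exists>W G. openin (mtop T) W \<and> x \<in> W \<and> holo_fun T W G \<and> (\<forall>y\<in>W \<inter> L. G y = F y)) \<and>
        (\<forall>\<Omega> \<gamma>. holo_curve T \<Omega> \<gamma> \<and> \<gamma> ` \<Omega> \<subseteq> Lreg \<longrightarrow>
           (\<forall>t\<in>\<Omega>. deriv (\<lambda>s. F (\<gamma> s)) t = canonical_form M (\<gamma> t) (velocity T \<gamma> t))))"

text \<open>
  An \<open>n\<close>-dimensional algebra has at most \<open>n\<close> characters, so \<open>card\<close> is applied to a finite set here.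
\<close>

definition bifurcation_diagram ::
    "('a, 'n::finite) cmanifold \<Rightarrow> ('a, 'n) tmult \<Rightarrow> ('a \<Rightarrow> ('a, 'n) tvec) \<Rightarrow>
     ('a \<times> ('a, 'n) covec \<Rightarrow> complex) \<Rightarrow> 'a set" where
  "bifurcation_diagram M m e F =
     {p \<in> points M. card (F ` {x \<in> analytic_spectrum M m e. fst x = p}) < CARD('n)}"

definition discriminant ::
    "('a, 'n::finite) cmanifold \<Rightarrow> ('a, 'n) tmult \<Rightarrow> ('a \<Rightarrow> ('a, 'n) tvec) \<Rightarrow>
     ('a \<times> ('a, 'n) covec \<Rightarrow> complex) \<Rightarrow> 'a set" where
  "discriminant M m e F = fst ` {x \<in> analytic_spectrum M m e. F x = 0}"


section \<open>Orbits of the unit field and standard form\<close>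

definition integral_curve ::
    "('a, 'k::finite) cmanifold \<Rightarrow> ('a \<Rightarrow> ('a, 'k) tvec) \<Rightarrow> complex set \<Rightarrow> (complex \<Rightarrow> 'a) \<Rightarrow> bool" where
  "integral_curve M e \<Omega> \<gamma> \<longleftrightarrow> connected \<Omega> \<and> holo_curve M \<Omega> \<gamma> \<and> (\<forall>t\<in>\<Omega>. velocity M \<gamma> t = e (\<gamma> t))"

definition flow_rel :: "('a, 'k::finite) cmanifold \<Rightarrow> ('a \<Rightarrow> ('a, 'k) tvec) \<Rightarrow> complex \<Rightarrow> 'a \<Rightarrow> 'a \<Rightarrow> bool" where
  "flow_rel M e s p q \<longleftrightarrow> (\<exists>\<Omega> \<gamma>. integral_curve M e \<Omega> \<gamma> \<and> 0 \<in> \<Omega> \<and> s \<in> \<Omega> \<and> \<gamma> 0 = p \<and> \<gamma> s = q)"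

text \<open>The transitive closure is needed since the flow time may be multivalued on an orbit.\<close>

definition flow_orbit :: "('a, 'k::finite) cmanifold \<Rightarrow> ('a \<Rightarrow> ('a, 'k) tvec) \<Rightarrow> 'a \<Rightarrow> 'a set" where
  "flow_orbit M e p = {q \<in> points M. (\<lambda>x y. \<exists>s. flow_rel M e s x y)\<^sup>*\<^sup>* p q}"

text \<open>
  Analytic branched covering of a subset \<open>D\<close> of \<open>M\<close> over \<open>N\<close>: finite, surjective and, outside of a thin
  analytic subset \<open>A\<close> of \<open>N\<close> with thin preimage in \<open>D\<close>, locally a disjoint union of \<open>d\<close> holomorphic sections.
\<close>

definition branched_covering ::
    "('a, 'k::finite) cmanifold \<Rightarrow> ('b, 'l::finite) cmanifold \<Rightarrow> 'a set \<Rightarrow> ('a \<Rightarrow> 'b) \<Rightarrow> nat \<Rightarrow> bool" where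
  "branched_covering M N D f d \<longleftrightarrow>
     proper_map (subtopology (mtop M) D) (mtop N) f \<and>
     (\<forall>y\<in>points N. finite {x\<in>D. f x = y}) \<and>
     f ` D = points N \<and>
     (\<exists>A. analytic_subset N A \<and> mtop N interior_of A = {} \<and>
        subtopology (mtop M) D interior_of {x\<in>D. f x \<in> A} = {} \<and>
        (\<forall>y\<in>points N - A. \<exists>V s. openin (mtop N) V \<and> y \<in> V \<and>
           (\<forall>k<d. holo_map N V M (s k) \<and> (\<forall>x\<in>V. f (s k x) = x)) \<and>
           (\<forall>k<d. \<forall>l<d. k \<noteq> l \<longrightarrow> s k ` V \<inter> s l ` V = {}) \<and>
           {x\<in>D. f x \<in> V} = (\<Union>k<d. s k ` V)))"

text \<open>
  A projection is a surjective holomorphic submersion.  The affine structure of an orbit of \<open>e\<close> is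
  given by the flow time, so an affine isomorphism with a domain in \<open>\<complex>\<close> is, up to rescaling of this
  domain, the inverse of a bijective integral curve.
\<close>

definition standard_form ::
    "('a, 'n::finite) cmanifold \<Rightarrow> ('a \<Rightarrow> ('a, 'n) tvec) \<Rightarrow> 'a set \<Rightarrow>
     ('b, 'm::finite) cmanifold \<Rightarrow> ('a \<Rightarrow> 'b) \<Rightarrow> bool" where
  "standard_form M e D N pr \<longleftrightarrow>
     complex_manifold N \<and>
     holo_map M (points M) N pr \<and> pr ` points M = points N \<and>
     (\<forall>p\<in>points M. differential M N pr p ` tangent_space M p = tangent_space N (pr p)) \<and>
     (\<forall>p\<in>points M. {q\<in>points M. pr q = pr p} = flow_orbit M e p) \<and>
     (\<forall>p\<in>points M. \<exists>\<Omega> \<gamma>. integral_curve M e \<Omega> \<gamma> \<and> bij_betw \<gamma> \<Omega> {q\<in>points M. pr q = pr p}) \<and>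
     branched_covering M N D pr CARD('n)"


section \<open>Idempotent vectors and tangent hyperplanes of the discriminant\<close>

definition idempotent_frame ::
    "('a, 'n::finite) cmanifold \<Rightarrow> ('a, 'n) tmult \<Rightarrow> 'a \<Rightarrow> ('n \<Rightarrow> ('a, 'n) tvec) \<Rightarrow> bool" where
  "idempotent_frame M m p f \<longleftrightarrow>
     (\<forall>i. f i \<in> tangent_space M p \<and> f i \<noteq> 0) \<and>
     (\<forall>i j. m p (f i) (f j) = (if i = j then f i else 0))"

text \<open>
  The tangent hyperplanes of the multigerm of \<open>D\<close> along the fibre of \<open>pr\<close> through \<open>p\<close>, each with the point at
  which it is attached.
\<close>

definition tangent_hyperplanes ::
    "('a, 'n::finite) cmanifold \<Rightarrow> 'a set \<Rightarrow> ('a \<Rightarrow> 'b) \<Rightarrow> 'a \<Rightarrow> ('a \<times> ('a, 'n) tvec set) set" where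
  "tangent_hyperplanes M D pr p =
     {(q, tangent_to M D q) | q. q \<in> reg_points M D \<and> pr q = pr p}"

text \<open>\<open>H'\<close> at \<open>p\<close> is the image of \<open>H\<close> at \<open>q\<close> under the differential of a local flow map of \<open>e\<close> taking \<open>q\<close> to \<open>p\<close>.\<close>

definition flow_shift ::
    "('a, 'k::finite) cmanifold \<Rightarrow> ('a \<Rightarrow> ('a, 'k) tvec) \<Rightarrow> 'a \<Rightarrow> 'a \<Rightarrow>
     ('a, 'k) tvec set \<Rightarrow> ('a, 'k) tvec set \<Rightarrow> bool" where
  "flow_shift M e q p H H' \<longleftrightarrow>
     (\<exists>s W \<theta>. openin (mtop M) W \<and> q \<in> W \<and> holo_map M W M \<theta> \<and> \<theta> q = p \<and>
        (\<forall>x\<in>W. flow_rel M e s x (\<theta> x)) \<and> H' = differential M M \<theta> q ` H)"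

definition coord_hyperplane :: "('n::finite \<Rightarrow> ('a, 'n) tvec) \<Rightarrow> 'n \<Rightarrow> ('a, 'n) tvec set" where
  "coord_hyperplane f k = {(\<Sum>i\<in>UNIV - {k}. tscale (a i) (f i)) | a. True}"

definition cond_unit :: "('a \<Rightarrow> ('a, 'n::finite) tvec) \<Rightarrow> 'a \<Rightarrow> ('n \<Rightarrow> ('a, 'n) tvec) \<Rightarrow> bool" where
  "cond_unit e p f \<longleftrightarrow> e p = (\<Sum>i\<in>UNIV. f i)"

definition cond_hyperplanes ::
    "('a, 'n::finite) cmanifold \<Rightarrow> ('a \<Rightarrow> ('a, 'n) tvec) \<Rightarrow> 'a set \<Rightarrow> ('a \<Rightarrow> 'b) \<Rightarrow> 'a \<Rightarrow>
     ('n \<Rightarrow> ('a, 'n) tvec) \<Rightarrow> bool" where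
  "cond_hyperplanes M e D pr p f \<longleftrightarrow>
     finite (tangent_hyperplanes M D pr p) \<and> card (tangent_hyperplanes M D pr p) = CARD('n) \<and>
     {H'. \<exists>(q, H)\<in>tangent_hyperplanes M D pr p. flow_shift M e q p H H'} = range (coord_hyperplane f)"

end

theory Submission
  imports Defs "HOL-Complex_Analysis.Conformal_Mappings" "HOL-Real_Asymp.Real_Asymp"
begin

text \<open>
  Where \<open>F\<close> takes \<open>n\<close> different values on the fibre of \<open>L\<close>, these values are local coordinates \<open>x\<^sub>1, \<dots>, x\<^sub>n\<close> of \<open>M\<close>
  whose differentials are the characters (because of \<open>dF = \<alpha>\<close>).  So the idempotents are the coordinate
  fields, \<open>e\<close> is their sum, and \<open>\<D>\<close> is the union of the hyperplanes \<open>x\<^sub>k = 0\<close>.  The flow of \<open>e\<close> adds its time to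
  every value; hence the orbit of \<open>p\<close> meets \<open>\<D>\<close> in the \<open>n\<close> points at the times \<open>-x\<^sub>k(p)\<close>, where \<open>\<D>\<close> is regular,
  and the tangent hyperplanes there are shifted to the kernels of the \<open>dx\<^sub>k\<close> at \<open>p\<close>.

  Conversely, let \<open>\<D>\<close> be regular at all points of the orbit of \<open>p\<close>.  At such a point \<open>e\<close> is transversal to \<open>\<D>\<close>:
  the conormal is a limit of multiples of characters, and characters take the value \<open>1\<close> on \<open>e\<close>.  Therefore
  nearby generic orbits cannot return to \<open>\<D>\<close> within a short time, which keeps the \<open>n\<close> values of \<open>F\<close> apart in
  the limit, and \<open>p\<close> lies outside of \<open>\<B>\<close>.  So \<open>\<D>\<close> and \<open>e\<close> determine \<open>\<B>\<close>, the multiplication on the dense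
  complement of \<open>\<B>\<close>, and by continuity the multiplication everywhere.
\<close>

section \<open>Complex differentiability in several variables\<close>

text \<open>That the discriminant and the unit field determine the multiplication is expressed by
  comparing two structures with the same unit field, discriminant and projection. The delicate
  points are these. The identity dF = \<alpha> is assumed only on the regular part of L, so the
  characters at a semisimple point must be continued to holomorphic sections of L before it can be
  used; the equation u \<circ> u = u and the inverse function theorem do this. Limits of values of F
  exist because characters over a convergent sequence of points are bounded, by their
  multiplicativity. The flow of e is constructed only near good points, as a translation in
  canonical coordinates; long flow times come from the parametrization of the orbits contained in
  the standard form. The degree n of the covering enters through a count: over a good point the
  fibre of the discriminant injects into the n values of F, and it has at least n points, because
  the discriminant is locally injective over the orbit space there and nearby unramified fibres have
  n points.\<close>

definition cdot :: "complex^'k \<Rightarrow> complex^'k::finite \<Rightarrow> complex" where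
  "cdot y v = (\<Sum>i\<in>UNIV. y $ i * v $ i)"

text \<open>Built from \<open>deriv\<close>, this is defined for every function; it represents the
  differential only where \<open>f\<close> has a complex linear derivative (\<open>cgrad_eq\<close>,
  \<open>cholomorphicD\<close>).\<close>

definition cgrad :: "(complex^'k::finite \<Rightarrow> complex) \<Rightarrow> complex^'k \<Rightarrow> complex^'k" where
  "cgrad f z = (\<chi> i. deriv (\<lambda>t. f (z + t *s axis i 1)) 0)"

definition cjac :: "(complex^'k::finite \<Rightarrow> complex^'l::finite) \<Rightarrow> complex^'k \<Rightarrow> complex^'k^'l" where
  "cjac f z = (\<chi> i. cgrad (\<lambda>w. f w $ i) z)"

lemma cdot_add_right: "cdot y (v + w) = cdot y v + cdot y w"
  by (simp add: cdot_def algebra_simps sum.distrib)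

lemma cdot_add_left: "cdot (y + y') v = cdot y v + cdot y' v"
  by (simp add: cdot_def algebra_simps sum.distrib)

lemma cdot_diff_right: "cdot y (v - w) = cdot y v - cdot y w"
  by (simp add: cdot_def algebra_simps sum_subtractf)

lemma cdot_smult_right: "cdot y (c *s v) = c * cdot y v"
  by (simp add: cdot_def algebra_simps sum_distrib_left)

lemma cdot_smult_left: "cdot (c *s y) v = c * cdot y v"
  by (simp add: cdot_def algebra_simps sum_distrib_left)

lemma cdot_zero [simp]: "cdot y 0 = 0" "cdot 0 v = 0"
  by (simp_all add: cdot_def)

lemma cdot_axis [simp]: "cdot y (axis i 1) = y $ i"
  by (simp add: cdot_def axis_def if_distrib cong: if_cong)

lemma axis_cdot [simp]: "cdot (axis i 1) v = v $ i"
  by (simp add: cdot_def axis_def if_distrib if_distribR cong: if_cong)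

lemma cdot_sum_right: "cdot y (\<Sum>i\<in>I. g i) = (\<Sum>i\<in>I. cdot y (g i))"
  by (induction I rule: infinite_finite_induct) (auto simp: cdot_add_right)

lemma matrix_vector_cdot: "(A *v x) $ i = cdot (A $ i) x"
  by (simp add: matrix_vector_mult_def cdot_def)

lemma matrix_vector_smult: "A *v (c *s x) = c *s (A *v x)" for A :: "complex^'k::finite^'l::finite"
  by (simp add: vec_eq_iff matrix_vector_cdot cdot_smult_right)

lemma norm_complex_smult: "norm (c *s v) = cmod c * norm v" for v :: "complex^'k::finite"
proof -
  have "(\<Sum>i\<in>UNIV. (cmod c * cmod (v $ i))\<^sup>2) = (cmod c)\<^sup>2 * (\<Sum>i\<in>UNIV. (cmod (v $ i))\<^sup>2)"
    by (simp add: power_mult_distrib sum_distrib_left)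
  then show ?thesis
    by (simp add: norm_vec_def L2_set_def norm_mult real_sqrt_mult)
qed

lemma norm_axis_complex [simp]: "norm (axis i 1 :: complex^'k::finite) = 1"
  by (simp add: norm_vec_def axis_def L2_set_def if_distrib[of norm] if_distrib[of "\<lambda>x. x^2"] cong: if_cong)

lemma scaleR_complex_smult: "r *\<^sub>R v = complex_of_real r *s v" for v :: "complex^'k::finite"
  by (simp only: vec_eq_iff vector_scaleR_component vector_smult_component scaleR_conv_of_real[where 'a=complex]) simp

lemma bounded_linear_smult_left: "bounded_linear (\<lambda>t. t *s (v::complex^'k::finite))"
  by (rule bounded_linear_intro[where K="norm v"])
     (auto simp: algebra_simps norm_complex_smult vec_eq_iff)

lemma bounded_bilinear_cdot: "bounded_bilinear (cdot :: complex^'k::finite \<Rightarrow> _)"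
proof
  fix a a' b b' :: "complex^'k" and r :: real
  show "cdot (a + a') b = cdot a b + cdot a' b" "cdot a (b + b') = cdot a b + cdot a b'"
    by (simp_all add: cdot_add_left cdot_add_right)
  show "cdot (r *\<^sub>R a) b = r *\<^sub>R cdot a b" "cdot a (r *\<^sub>R b) = r *\<^sub>R cdot a b"
    by (simp_all add: scaleR_complex_smult cdot_smult_left cdot_smult_right scaleR_conv_of_real)
  have "norm (cdot a b) \<le> norm a * norm b * real CARD('k)" for a b :: "complex^'k"
  proof -
    have "norm (cdot a b) \<le> (\<Sum>i::'k\<in>UNIV. norm a * norm b)"
      unfolding cdot_def
      by (intro sum_norm_le) (auto simp: norm_mult intro!: mult_mono Finite_Cartesian_Product.norm_nth_le)
    then show ?thesis
      by (simp add: mult_ac)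
  qed
  then show "\<exists>K. \<forall>a b :: complex^'k. norm (cdot a b) \<le> norm a * norm b * K"
    by blast
qed

lemmas bounded_linear_cdot [simp, intro] = bounded_bilinear.bounded_linear_right[OF bounded_bilinear_cdot]
lemmas continuous_on_cdot [continuous_intros] = bounded_bilinear.continuous_on[OF bounded_bilinear_cdot]
lemmas tendsto_cdot [tendsto_intros] = bounded_bilinear.tendsto[OF bounded_bilinear_cdot]

lemma continuous_on_smult [continuous_intros]:
  fixes g :: "'a::topological_space \<Rightarrow> complex^'k::finite"
  assumes "continuous_on S f" "continuous_on S g"
  shows "continuous_on S (\<lambda>x. f x *s g x)"
  unfolding continuous_on_componentwise
proof -
  show ?thesis
    unfolding vector_scalar_mult_def
    by (intro continuous_intros continuous_on_vec_lambda assms)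
qed

text \<open>Expansion in the standard basis. The derivatives in \<open>cholomorphic\<close> are real
  linear maps commuting with complex scalars, and this turns them into coordinate vectors.\<close>

lemma complex_linear_eq_cdot:
  fixes f' :: "complex^'k::finite \<Rightarrow> complex"
  assumes "linear f'" "\<And>c v. f' (c *s v) = c * f' v"
  shows "f' = cdot (\<chi> i. f' (axis i 1))"
proof
  fix v :: "complex^'k"
  have "f' v = f' (\<Sum>i\<in>UNIV. (v $ i) *s axis i 1)"
    by (simp add: basis_expansion)
  also have "\<dots> = (\<Sum>i\<in>UNIV. v $ i * f' (axis i 1))"
    by (simp add: linear_sum[OF assms(1)] assms(2))
  finally show "f' v = cdot (\<chi> i. f' (axis i 1)) v"
    by (simp add: cdot_def mult.commute)
qed

lemma complex_line_has_derivative: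
  "((\<lambda>t. z + t *s v) has_derivative (\<lambda>t. t *s v)) (at u within A)" for v :: "complex^'k::finite"
  by (rule has_derivative_eq_rhs[OF has_derivative_add[OF has_derivative_const
        bounded_linear.has_derivative[OF bounded_linear_smult_left has_derivative_ident]]]) simp

lemma has_field_derivative_complex_line:
  assumes "(f has_derivative cdot g) (at (z + u *s v))"
  shows "((\<lambda>t. f (z + t *s v)) has_field_derivative cdot g v) (at u)"
  unfolding has_field_derivative_def
  by (rule has_derivative_eq_rhs[OF has_derivative_compose[OF complex_line_has_derivative assms]])
     (auto simp: cdot_smult_right mult.commute)

lemma cgrad_eq:
  assumes "(f has_derivative cdot g) (at z)"
  shows "cgrad f z = g"
proof -
  have "deriv (\<lambda>t. f (z + t *s axis i 1)) 0 = g $ i" for i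
    using has_field_derivative_complex_line[where u = 0 and z = z and v = "axis i 1", of f g] assms
    by (simp add: DERIV_imp_deriv)
  then show ?thesis
    by (simp add: cgrad_def vec_eq_iff)
qed

lemma cholomorphicD:
  assumes "open S" "cholomorphic S f" "z \<in> S"
  shows "(f has_derivative cdot (cgrad f z)) (at z)"
proof -
  obtain f' where f': "(f has_derivative f') (at z)" "\<forall>c v. f' (c *s v) = c * f' v"
    using assms by (auto simp: cholomorphic_def at_within_open[OF assms(3,1)])
  have "f' = cdot (\<chi> i. f' (axis i 1))"
    using f' by (intro complex_linear_eq_cdot) (auto simp: has_derivative_def bounded_linear.linear)
  with f' show ?thesis
    using cgrad_eq by metis
qed

lemma cholomorphicI:
  assumes "\<And>z. z \<in> S \<Longrightarrow> (f has_derivative cdot (g z)) (at z)"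
  shows "cholomorphic S f"
  unfolding cholomorphic_def using assms by (meson has_derivative_at_withinI cdot_smult_right)

lemma cholomorphic_subset: "cholomorphic S f \<Longrightarrow> T \<subseteq> S \<Longrightarrow> cholomorphic T f"
  unfolding cholomorphic_def by (meson has_derivative_subset subsetD)

lemma cholomorphic_vec_subset: "cholomorphic_vec S f \<Longrightarrow> T \<subseteq> S \<Longrightarrow> cholomorphic_vec T f"
  unfolding cholomorphic_vec_def using cholomorphic_subset by blast

lemma cholomorphic_cong:
  assumes "\<And>z. z \<in> S \<Longrightarrow> f z = g z"
  shows "cholomorphic S f \<longleftrightarrow> cholomorphic S g"
proof -
  have "(f has_derivative f') (at z within S) \<longleftrightarrow> (g has_derivative f') (at z within S)" if "z \<in> S" for z f'
    using has_derivative_transform[OF that, of f g f'] has_derivative_transform[OF that, of g f f'] assms by auto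
  then show ?thesis
    unfolding cholomorphic_def by simp
qed

lemma cholomorphic_vec_cong:
  assumes "\<And>z. z \<in> S \<Longrightarrow> f z = g z"
  shows "cholomorphic_vec S f \<longleftrightarrow> cholomorphic_vec S g"
  using cholomorphic_cong[of S "\<lambda>z. f z $ i" "\<lambda>z. g z $ i" for i] assms
  by (simp add: cholomorphic_vec_def)

lemma cholomorphic_continuous_on: "cholomorphic S f \<Longrightarrow> continuous_on S f"
  unfolding cholomorphic_def by (meson continuous_on_eq_continuous_within has_derivative_continuous)

lemma cholomorphic_vec_continuous_on: "cholomorphic_vec S f \<Longrightarrow> continuous_on S f"
  using continuous_on_vec_lambda[of S "\<lambda>i z. f z $ i"] cholomorphic_continuous_on
  by (auto simp: cholomorphic_vec_def)

lemma has_derivative_vecI: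
  fixes f :: "complex^'k::finite \<Rightarrow> complex^'l::finite"
  assumes "\<And>i. ((\<lambda>z. f z $ i) has_derivative cdot (A $ i)) (at z within S)"
  shows "(f has_derivative (*v) A) (at z within S)"
proof -
  have "((\<lambda>z. \<Sum>i\<in>UNIV. (f z $ i) *s axis i 1) has_derivative (\<lambda>v. \<Sum>i\<in>UNIV. (cdot (A $ i) v) *s axis i (1::complex))) (at z within S)"
    by (intro has_derivative_sum bounded_linear.has_derivative[OF bounded_linear_smult_left] assms)
  then show ?thesis
    by (simp only: basis_expansion flip: matrix_vector_cdot)
qed

lemma has_derivative_vec_nth:
  assumes "(f has_derivative (*v) A) (at z within S)"
  shows "((\<lambda>z. f z $ i) has_derivative cdot (A $ i)) (at z within S)"
  using bounded_linear.has_derivative[OF bounded_linear_vec_nth assms, of i]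
  by (simp add: matrix_vector_cdot)

lemma cjac_eq:
  assumes "(f has_derivative (*v) A) (at z)"
  shows "cjac f z = A"
proof -
  have "cgrad (\<lambda>w. f w $ i) z = A $ i" for i
    by (rule cgrad_eq[OF has_derivative_vec_nth[OF assms]])
  then show ?thesis
    by (simp add: cjac_def vec_eq_iff)
qed

lemma cholomorphic_vecD:
  assumes "open S" "cholomorphic_vec S f" "z \<in> S"
  shows "(f has_derivative (*v) (cjac f z)) (at z)"
  using assms cholomorphicD[OF assms(1) _ assms(3)]
  by (intro has_derivative_vecI) (auto simp: cjac_def cholomorphic_vec_def)

lemma cholomorphic_vecI:
  assumes "\<And>z. z \<in> S \<Longrightarrow> (f has_derivative (*v) (A z)) (at z)"
  shows "cholomorphic_vec S f"
  unfolding cholomorphic_vec_def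
  using has_derivative_vec_nth[OF assms] by (intro allI cholomorphicI)

lemma dir_deriv_eq:
  assumes "(f has_derivative (*v) A) (at z)"
  shows "dir_deriv f z v = A *v v"
proof -
  have "deriv (\<lambda>t. f (z + t *s v) $ i) 0 = cdot (A $ i) v" for i
    using has_field_derivative_complex_line[where u = 0 and z = z and v = v and f = "\<lambda>z. f z $ i"]
      has_derivative_vec_nth[OF assms]
    by (simp add: DERIV_imp_deriv)
  then show ?thesis
    by (simp add: dir_deriv_def vec_eq_iff matrix_vector_cdot)
qed

lemma cholomorphic_compose_vec:
  assumes "open S" "open T" "cholomorphic_vec S f" "cholomorphic T g" "f ` S \<subseteq> T"
  shows "cholomorphic S (g \<circ> f)"
proof (rule cholomorphicI)
  fix z assume z: "z \<in> S"
  then have "f z \<in> T" using assms by auto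
  then have "((g \<circ> f) has_derivative (cdot (cgrad g (f z)) \<circ> (*v) (cjac f z))) (at z)"
    using diff_chain_at cholomorphic_vecD[OF assms(1,3) z] cholomorphicD[OF assms(2,4)] by blast
  moreover have "cdot (cgrad g (f z)) \<circ> (*v) (cjac f z) = cdot (cgrad g (f z) v* cjac f z)"
  proof
    fix v
    have "cdot (cgrad g (f z)) (cjac f z *v v) = (\<Sum>i\<in>UNIV. \<Sum>j\<in>UNIV. cgrad g (f z) $ i * (cjac f z $ i $ j * v $ j))"
      by (simp add: cdot_def matrix_vector_mult_def sum_distrib_left)
    also have "\<dots> = (\<Sum>j\<in>UNIV. \<Sum>i\<in>UNIV. cgrad g (f z) $ i * (cjac f z $ i $ j * v $ j))"
      by (rule sum.swap)
    finally show "(cdot (cgrad g (f z)) \<circ> (*v) (cjac f z)) v = cdot (cgrad g (f z) v* cjac f z) v"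
      by (simp add: cdot_def vector_matrix_mult_def sum_distrib_right sum_distrib_left mult_ac)
  qed
  ultimately show "((g \<circ> f) has_derivative cdot (cgrad g (f z) v* cjac f z)) (at z)"
    by simp
qed

lemma cholomorphic_vec_compose:
  assumes "open S" "open T" "cholomorphic_vec S f" "cholomorphic_vec T g" "f ` S \<subseteq> T"
  shows "cholomorphic_vec S (g \<circ> f)"
  using assms(4) cholomorphic_compose_vec[OF assms(1,2,3) _ assms(5)]
  by (auto simp: cholomorphic_vec_def o_def)

lemma cholomorphic_const [simp]: "cholomorphic S (\<lambda>z. c)"
  by (rule cholomorphicI[where g="\<lambda>z. 0"]) (auto intro!: has_derivative_eq_rhs[OF has_derivative_const])

lemma cholomorphic_nth [simp]: "cholomorphic S (\<lambda>z. z $ i)"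
  by (rule cholomorphicI[where g="\<lambda>z. axis i 1"])
     (auto intro!: has_derivative_eq_rhs[OF bounded_linear.has_derivative[OF bounded_linear_vec_nth has_derivative_ident]])

lemma cholomorphic_add:
  assumes "cholomorphic S f" "cholomorphic S g"
  shows "cholomorphic S (\<lambda>z. f z + g z)"
  unfolding cholomorphic_def
proof
  fix z assume "z \<in> S"
  then obtain f' g' where
    "(f has_derivative f') (at z within S)" "\<forall>c v. f' (c *s v) = c * f' v"
    "(g has_derivative g') (at z within S)" "\<forall>c v. g' (c *s v) = c * g' v"
    using assms unfolding cholomorphic_def by meson
  then show "\<exists>f'. ((\<lambda>z. f z + g z) has_derivative f') (at z within S) \<and> (\<forall>c v. f' (c *s v) = c * f' v)"
    by (intro exI[of _ "\<lambda>v. f' v + g' v"]) (auto intro!: has_derivative_add simp: algebra_simps)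
qed

lemma cholomorphic_mult:
  assumes "cholomorphic S f" "cholomorphic S g"
  shows "cholomorphic S (\<lambda>z. f z * g z)"
  unfolding cholomorphic_def
proof
  fix z assume "z \<in> S"
  then obtain f' g' where
    "(f has_derivative f') (at z within S)" "\<forall>c v. f' (c *s v) = c * f' v"
    "(g has_derivative g') (at z within S)" "\<forall>c v. g' (c *s v) = c * g' v"
    using assms unfolding cholomorphic_def by meson
  then show "\<exists>f'. ((\<lambda>z. f z * g z) has_derivative f') (at z within S) \<and> (\<forall>c v. f' (c *s v) = c * f' v)"
    by (intro exI[of _ "\<lambda>v. f z * g' v + f' v * g z"]) (auto intro!: has_derivative_mult simp: algebra_simps)
qed

lemma cholomorphic_inverse:
  assumes "cholomorphic S f" "\<And>z. z \<in> S \<Longrightarrow> f z \<noteq> 0"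
  shows "cholomorphic S (\<lambda>z. inverse (f z))"
  unfolding cholomorphic_def
proof
  fix z assume "z \<in> S"
  then obtain f' where
    "(f has_derivative f') (at z within S)" "\<forall>c v. f' (c *s v) = c * f' v" "f z \<noteq> 0"
    using assms unfolding cholomorphic_def by meson
  then show "\<exists>f'. ((\<lambda>z. inverse (f z)) has_derivative f') (at z within S) \<and> (\<forall>c v. f' (c *s v) = c * f' v)"
    using Deriv.has_derivative_inverse[where f = f and f' = f' and x = z and S = S]
    by (intro exI[of _ "\<lambda>v. - (inverse (f z) * f' v * inverse (f z))"]) (simp add: mult_ac)
qed

lemma cholomorphic_diff:
  assumes "cholomorphic S f" "cholomorphic S g"
  shows "cholomorphic S (\<lambda>z. f z - g z)"
  using cholomorphic_add[OF assms(1) cholomorphic_mult[OF cholomorphic_const[of S "-1"] assms(2)]] by simp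

lemma cholomorphic_sum:
  assumes "\<And>i. i \<in> I \<Longrightarrow> cholomorphic S (f i)"
  shows "cholomorphic S (\<lambda>z. \<Sum>i\<in>I. f i z)"
  using assms by (induction I rule: infinite_finite_induct) (auto intro: cholomorphic_add)

lemma cholomorphic_cdot:
  assumes "cholomorphic_vec S f" "cholomorphic_vec S g"
  shows "cholomorphic S (\<lambda>z. cdot (f z) (g z))"
  unfolding cdot_def using assms
  by (intro cholomorphic_sum cholomorphic_mult) (auto simp: cholomorphic_vec_def)

lemma cholomorphic_vec_ident [simp]: "cholomorphic_vec S (\<lambda>z. z)"
  by (simp add: cholomorphic_vec_def)

lemma cholomorphic_vec_const [simp]: "cholomorphic_vec S (\<lambda>z. c)"
  by (simp add: cholomorphic_vec_def)

lemma cholomorphic_holomorphic_line: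
  assumes "open S" "cholomorphic S f" "\<And>t. t \<in> T \<Longrightarrow> z + t *s v \<in> S"
  shows "(\<lambda>t. f (z + t *s v)) holomorphic_on T"
  unfolding holomorphic_on_def field_differentiable_def
  using has_field_derivative_complex_line[OF cholomorphicD[OF assms(1,2)]] assms(3)
  by (meson has_field_derivative_at_within)

subsection \<open>Derivatives of holomorphic functions\<close>

text \<open>Cauchy's formula for the first derivative. It is written over the unit interval so that
  the theorems on integrals with a parameter apply when the centre moves in the other
  variables.\<close>

lemma deriv_zero_eq_integral:
  assumes "continuous_on (cball 0 r) f" "f holomorphic_on ball 0 r" "0 < r"
  defines "c \<equiv> \<lambda>x::real. r * exp (2 * of_real pi * \<i> * x)"
  shows "deriv f 0 = integral {0..1} (\<lambda>x. f (c x) / c x)"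
proof -
  have c0: "c x \<noteq> 0" for x using assms(3) by (simp add: c_def)
  have "(2 * pi * \<i>) * deriv f 0 = contour_integral (circlepath 0 r) (\<lambda>u. f u / (u - 0)^2)"
    using Cauchy_contour_integral_circlepath_2[OF assms(1,2), of 0] assms(3) by simp
  also have "\<dots> = integral {0..1} (\<lambda>x. f (c x) / (c x)^2 * (2 * pi * \<i> * c x))"
    unfolding contour_integral_integral vector_derivative_circlepath unfolding circlepath
    by (simp add: c_def mult_ac)
  also have "\<dots> = integral {0..1} (\<lambda>x. (2 * pi * \<i>) * (f (c x) / c x))"
    by (rule integral_cong) (use c0 in \<open>auto simp: power2_eq_square field_simps\<close>)
  also have "\<dots> = (2 * pi * \<i>) * integral {0..1} (\<lambda>x. f (c x) / c x)"
    by (rule integral_mult_right)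
  finally show ?thesis by simp
qed

text \<open>Cauchy's formula on the complex line in direction \<open>i\<close>. One radius serves
  all \<open>z\<close> near \<open>z0\<close>, so that \<open>z\<close> may vary under the integral
  sign.\<close>

lemma cgrad_nth_integral_formula:
  fixes f :: "complex^'k::finite \<Rightarrow> complex"
  assumes "open S" "cholomorphic S f" "z0 \<in> S"
  obtains d r where "0 < d" "0 < r" "ball z0 d \<subseteq> S"
    "\<And>z t. z \<in> ball z0 d \<Longrightarrow> cmod t \<le> r \<Longrightarrow> z + t *s axis i 1 \<in> S"
    "\<And>z. z \<in> ball z0 d \<Longrightarrow> cgrad f z $ i =
       integral {0..1} (\<lambda>x. f (z + (r * exp (2 * of_real pi * \<i> * complex_of_real x)) *s axis i 1)
          / (r * exp (2 * of_real pi * \<i> * complex_of_real x)))"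
proof -
  obtain e where e: "0 < e" "ball z0 e \<subseteq> S"
    using assms openE by blast
  \<comment> \<open>The centre moves by less than e/2 and the circle has radius e/3; the sum stays
    below e, so that all circles lie in \<open>S\<close>.\<close>
  define d r where "d = e/2" and "r = e/3"
  have in_S: "z + t *s axis i 1 \<in> S" if "z \<in> ball z0 d" "cmod t \<le> r" for z t
  proof -
    have "dist z0 (z + t *s axis i 1) \<le> dist z0 z + norm (t *s axis i (1::complex) :: complex^'k)"
      by (metis add.commute dist_add_cancel2 dist_commute dist_norm dist_triangle2 diff_add_cancel add_diff_cancel_left')
    also have "\<dots> < e"
      using that e by (simp add: norm_complex_smult d_def r_def)
    finally show ?thesis using e by auto
  qed
  show ?thesis
  proof
    show "0 < d" "0 < r" using e by (auto simp: d_def r_def)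
    show "ball z0 d \<subseteq> S" using e by (auto simp: d_def)
    show "\<And>z t. z \<in> ball z0 d \<Longrightarrow> cmod t \<le> r \<Longrightarrow> z + t *s axis i 1 \<in> S" by (rule in_S)
    fix z assume z: "z \<in> ball z0 d"
    have hol: "(\<lambda>t. f (z + t *s axis i 1)) holomorphic_on cball 0 r"
      by (rule cholomorphic_holomorphic_line[OF assms(1,2)]) (use in_S z in auto)
    then show "cgrad f z $ i =
       integral {0..1} (\<lambda>x. f (z + (r * exp (2 * of_real pi * \<i> * complex_of_real x)) *s axis i 1)
          / (r * exp (2 * of_real pi * \<i> * complex_of_real x)))"
      using deriv_zero_eq_integral[OF holomorphic_on_imp_continuous_on[OF hol], of ] e
        holomorphic_on_subset[OF hol ball_subset_cball]
      by (simp add: cgrad_def r_def)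
  qed
qed

text \<open>\<open>cholomorphic\<close> asks only for a complex derivative at each point. Its
  continuity follows from Cauchy's formula, whose integrand is jointly continuous because
  \<open>f\<close> is.\<close>

lemma continuous_on_cgrad:
  fixes f :: "complex^'k::finite \<Rightarrow> complex"
  assumes "open S" "cholomorphic S f"
  shows "continuous_on S (cgrad f)"
proof -
  have "continuous (at z0) (\<lambda>z. cgrad f z $ i)" if z0: "z0 \<in> S" for z0 i
  proof -
    obtain d r where dr: "0 < d" "0 < r" "ball z0 d \<subseteq> S"
      and in_S: "\<And>z t. z \<in> ball z0 d \<Longrightarrow> cmod t \<le> r \<Longrightarrow> z + t *s axis i 1 \<in> S"
      and eq: "\<And>z. z \<in> ball z0 d \<Longrightarrow> cgrad f z $ i =
       integral {0..1} (\<lambda>x. f (z + (r * exp (2 * of_real pi * \<i> * complex_of_real x)) *s axis i 1)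
          / (r * exp (2 * of_real pi * \<i> * complex_of_real x)))"
      by (rule cgrad_nth_integral_formula[OF assms z0, where i = i]) (rule that)
    have "continuous_on (ball z0 d) (\<lambda>z. integral (cbox 0 1) (\<lambda>x. f (z + (r * exp (2 * of_real pi * \<i> * complex_of_real x)) *s axis i 1)
          / (r * exp (2 * of_real pi * \<i> * complex_of_real x))))"
    proof (rule integral_continuous_on_param)
      have "continuous_on (ball z0 d \<times> cbox 0 1) (\<lambda>p. f (fst p + (r * exp (2 * of_real pi * \<i> * complex_of_real (snd p))) *s axis i 1))"
        by (rule continuous_on_compose2[OF cholomorphic_continuous_on[OF assms(2)]])
           (use dr in \<open>auto intro!: continuous_intros in_S simp: norm_mult\<close>)
      then show "continuous_on (ball z0 d \<times> cbox 0 1) (\<lambda>(z, x). f (z + (r * exp (2 * of_real pi * \<i> * complex_of_real x)) *s axis i 1)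
          / (r * exp (2 * of_real pi * \<i> * complex_of_real x)))"
        using dr by (auto simp: case_prod_beta intro!: continuous_intros)
    qed
    then have "continuous_on (ball z0 d) (\<lambda>z. cgrad f z $ i)"
      by (rule continuous_on_eq) (simp add: eq)
    then show ?thesis
      using dr by (simp add: continuous_on_eq_continuous_at)
  qed
  then have "continuous_on S (\<lambda>z. cgrad f z $ i)" for i
    using assms(1) by (simp add: continuous_on_eq_continuous_at)
  then have "continuous_on S (\<lambda>z. \<chi> i. cgrad f z $ i)"
    by (intro continuous_on_vec_lambda)
  then show ?thesis by simp
qed

text \<open>Differentiation under the Cauchy integral; the differentiated integrand is continuous by
  the previous lemma. This makes the Jacobians of transition maps holomorphic, on which coordinate
  fields and the charts of the cotangent bundle depend.\<close>

lemma cholomorphic_cgrad: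
  fixes f :: "complex^'k::finite \<Rightarrow> complex"
  assumes "open S" "cholomorphic S f"
  shows "cholomorphic_vec S (cgrad f)"
  unfolding cholomorphic_vec_def
proof
  fix i
  have "\<exists>g. ((\<lambda>z. cgrad f z $ i) has_derivative cdot g) (at z0)" if z0: "z0 \<in> S" for z0
  proof -
    obtain d r where dr: "0 < d" "0 < r" "ball z0 d \<subseteq> S"
      and in_S: "\<And>z t. z \<in> ball z0 d \<Longrightarrow> cmod t \<le> r \<Longrightarrow> z + t *s axis i 1 \<in> S"
      and eq: "\<And>z. z \<in> ball z0 d \<Longrightarrow> cgrad f z $ i =
       integral {0..1} (\<lambda>x. f (z + (r * exp (2 * of_real pi * \<i> * complex_of_real x)) *s axis i 1)
          / (r * exp (2 * of_real pi * \<i> * complex_of_real x)))"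
      by (rule cgrad_nth_integral_formula[OF assms z0, where i = i]) (rule that)
    define c where "c = (\<lambda>x::real. r * exp (2 * of_real pi * \<i> * complex_of_real x))"
    have c: "norm (c x) = r" "c x \<noteq> 0" for x using dr by (auto simp: c_def norm_mult)
    have cont_c [continuous_intros]: "continuous_on A c" for A
      unfolding c_def by (intro continuous_intros)
    define G where "G = (\<lambda>z x. Blinfun (\<lambda>v. cdot (cgrad f (z + c x *s axis i 1)) v / c x))"
    have G: "blinfun_apply (G z x) = (\<lambda>v. cdot (cgrad f (z + c x *s axis i 1)) v / c x)" for z x
      unfolding G_def
      by (intro bounded_linear_Blinfun_apply bounded_linear_compose[OF bounded_linear_divide bounded_linear_cdot])
    have cont_comp: "continuous_on (ball z0 d \<times> cbox 0 1) (\<lambda>p. h (fst p + c (snd p) *s axis i 1))"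
      if "continuous_on S h" for h :: "complex^'k \<Rightarrow> 'b::topological_space"
      by (rule continuous_on_compose2[OF that])
         (use dr c in \<open>auto intro!: continuous_intros in_S continuous_on_compose2[OF cont_c[of UNIV]]\<close>)
    have within: "((\<lambda>z. integral (cbox 0 1) (\<lambda>x. f (z + c x *s axis i 1) / c x)) has_derivative integral (cbox 0 1) (G z0)) (at z0 within ball z0 d)"
    proof (rule leibniz_rule)
      fix z x assume z: "z \<in> ball z0 d"
      then have "z + c x *s axis i 1 \<in> S" using in_S c by simp
      then have D: "(f has_derivative cdot (cgrad f (z + c x *s axis i 1))) (at (z + c x *s axis i 1))"
        using cholomorphicD assms by blast
      have "((\<lambda>z. f (z + c x *s axis i 1)) has_derivative cdot (cgrad f (z + c x *s axis i 1))) (at z)"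
        by (rule has_derivative_eq_rhs[OF has_derivative_compose[where g = f and f = "\<lambda>z. z + c x *s axis i 1", OF _ D]])
           (auto intro!: derivative_eq_intros)
      then have "((\<lambda>z. f (z + c x *s axis i 1)) has_derivative cdot (cgrad f (z + c x *s axis i 1))) (at z within ball z0 d)"
        by (rule has_derivative_at_withinI)
      then show "((\<lambda>z. f (z + c x *s axis i 1) / c x) has_derivative blinfun_apply (G z x)) (at z within ball z0 d)"
        unfolding G by (rule bounded_linear.has_derivative[OF bounded_linear_divide])
    next
      fix z assume z: "z \<in> ball z0 d"
      have "continuous_on (cbox 0 1) (\<lambda>x. f (z + c x *s axis i 1))"
        by (rule continuous_on_compose2[OF cholomorphic_continuous_on[OF assms(2)]])
           (use dr c z in \<open>auto intro!: continuous_intros in_S\<close>)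
      then show "(\<lambda>x. f (z + c x *s axis i 1) / c x) integrable_on cbox 0 1"
        using c by (intro integrable_continuous continuous_intros) auto
    next
      show "continuous_on (ball z0 d \<times> cbox 0 1) (\<lambda>(z, x). G z x)"
      proof (rule continuous_on_blinfun_componentwise)
        fix v :: "complex^'k"
        show "continuous_on (ball z0 d \<times> cbox 0 1) (\<lambda>p. blinfun_apply (case p of (z, x) \<Rightarrow> G z x) v)"
          unfolding case_prod_beta G using c
          by (intro continuous_on_divide continuous_on_cdot continuous_on_const cont_comp[OF continuous_on_cgrad[OF assms]]
              continuous_on_compose2[OF cont_c[of UNIV] continuous_on_snd[OF continuous_on_id]]) auto
      qed
    qed (use dr in auto)
    have at: "at z0 within ball z0 d = at z0"
      using dr by (intro at_within_open) auto
    have D: "((\<lambda>z. integral (cbox 0 1) (\<lambda>x. f (z + c x *s axis i 1) / c x)) has_derivative integral (cbox 0 1) (G z0)) (at z0)"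
      using within unfolding at .
    have int: "G z0 integrable_on cbox 0 1"
    proof (rule integrable_continuous, rule continuous_on_blinfun_componentwise)
      fix v :: "complex^'k"
      have "continuous_on (cbox 0 1) (\<lambda>x. cgrad f (z0 + c x *s axis i 1))"
        by (rule continuous_on_compose2[OF continuous_on_cgrad[OF assms]])
           (use dr c in \<open>auto intro!: continuous_intros in_S\<close>)
      then show "continuous_on (cbox 0 1) (\<lambda>x. blinfun_apply (G z0 x) v)"
        using c by (auto simp: G intro!: continuous_intros)
    qed
    \<comment> \<open>The Leibniz rule yields a real linear derivative; its complex linearity is
      inherited from the integrand.\<close>
    have "blinfun_apply (integral (cbox 0 1) (G z0)) (a *s v) = a * blinfun_apply (integral (cbox 0 1) (G z0)) v" for a v
    proof -
      have "integral (cbox 0 1) (\<lambda>x. cdot (cgrad f (z0 + c x *s axis i 1)) (a *s v) / c x) =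
        integral (cbox 0 1) (\<lambda>x. a * (cdot (cgrad f (z0 + c x *s axis i 1)) v / c x))"
        by (simp add: cdot_smult_right)
      then show ?thesis
        by (simp only: blinfun_apply_integral[OF int] G integral_mult_right)
    qed
    then have "blinfun_apply (integral (cbox 0 1) (G z0)) = cdot (\<chi> j. blinfun_apply (integral (cbox 0 1) (G z0)) (axis j 1))"
      by (intro complex_linear_eq_cdot) (auto intro: bounded_linear.linear blinfun.bounded_linear_right)
    with D have D': "((\<lambda>z. integral (cbox 0 1) (\<lambda>x. f (z + c x *s axis i 1) / c x)) has_derivative
       cdot (\<chi> j. blinfun_apply (integral (cbox 0 1) (G z0)) (axis j 1))) (at z0)"
      by simp
    have "((\<lambda>z. cgrad f z $ i) has_derivative
       cdot (\<chi> j. blinfun_apply (integral (cbox 0 1) (G z0)) (axis j 1))) (at z0)"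
      by (rule has_derivative_transform_within_open[OF D' open_ball[of z0 d]]) (use dr in \<open>auto simp: eq c_def\<close>)
    then show ?thesis by blast
  qed
  then obtain g where "\<And>z0. z0 \<in> S \<Longrightarrow> ((\<lambda>z. cgrad f z $ i) has_derivative cdot (g z0)) (at z0)"
    by metis
  then show "cholomorphic S (\<lambda>z. cgrad f z $ i)"
    by (rule cholomorphicI)
qed

subsection \<open>The holomorphic inverse function theorem\<close>

lemma matrix_inv_inverse:
  assumes "invertible A"
  shows "matrix_inv A ** A = mat 1" "A ** matrix_inv A = mat 1"
  using someI_ex[OF assms[unfolded invertible_def]] unfolding matrix_inv_def by auto

lemma has_derivative_inverse_matrix:
  fixes A :: "complex^'k::finite^'k"
  assumes "invertible A"
  shows "inv ((*v) A) = (*v) (matrix_inv A)"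
  using assms by (intro inv_equality) (auto simp: matrix_vector_mul_assoc matrix_inv_inverse)

text \<open>The real inverse function theorem applies, since Cauchy's formula makes the Jacobian
  continuous. The derivative of the inverse map is the inverse of a complex matrix and hence complex
  linear again.\<close>

lemma holomorphic_inverse_function:
  fixes f :: "complex^'k::finite \<Rightarrow> complex^'k"
  assumes "open S" "cholomorphic_vec S f" "z0 \<in> S" "invertible (cjac f z0)"
  obtains U V g where "open U" "U \<subseteq> S" "z0 \<in> U" "open V" "f z0 \<in> V" "homeomorphism U V f g"
    "cholomorphic_vec V g" "\<And>z. z \<in> U \<Longrightarrow> invertible (cjac f z)"
    "\<And>z. z \<in> U \<Longrightarrow> cjac g (f z) = matrix_inv (cjac f z)"
proof -
  define J where "J = (\<lambda>z. Blinfun ((*v) (cjac f z)))"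
  have J: "blinfun_apply (J z) = (*v) (cjac f z)" for z
    unfolding J_def by (intro bounded_linear_Blinfun_apply matrix_vector_mul_bounded_linear)
  define I where "I = Blinfun ((*v) (matrix_inv (cjac f z0)))"
  have I: "blinfun_apply I = (*v) (matrix_inv (cjac f z0))"
    unfolding I_def by (intro bounded_linear_Blinfun_apply matrix_vector_mul_bounded_linear)
  have contJ: "continuous_on S J"
  proof (rule continuous_on_blinfun_componentwise)
    fix v :: "complex^'k"
    have "continuous_on S (\<lambda>z. cjac f z $ i)" for i
      using assms(2) by (simp add: cjac_def cholomorphic_vec_def continuous_on_cgrad[OF assms(1)])
    then have "continuous_on S (\<lambda>z. \<chi> i. cdot (cjac f z $ i) v)"
      by (intro continuous_on_vec_lambda continuous_on_cdot continuous_on_const)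
    then show "continuous_on S (\<lambda>z. blinfun_apply (J z) v)"
      by (simp add: J flip: matrix_vector_cdot)
  qed
  have inv: "I o\<^sub>L J z0 = id_blinfun"
    by (rule blinfun_eqI) (simp add: I J matrix_vector_mul_assoc matrix_inv_inverse assms(4))
  have derf: "(f has_derivative blinfun_apply (J z)) (at z)" if "z \<in> S" for z
    using cholomorphic_vecD[OF assms(1,2) that] by (simp add: J)
  obtain U V g g' where *: "open U" "U \<subseteq> S" "z0 \<in> U" "open V" "f z0 \<in> V" "homeomorphism U V f g"
    "\<And>y. y \<in> V \<Longrightarrow> (g has_derivative (g' y)) (at y)"
    "\<And>y. y \<in> V \<Longrightarrow> g' y = inv (blinfun_apply (J (g y)))"
    "\<And>y. y \<in> V \<Longrightarrow> bij (blinfun_apply (J (g y)))"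
    by (rule inverse_function_theorem[OF assms(1) derf contJ assms(3) inv]) (assumption, rule that)
  have inverti: "invertible (cjac f (g y))" if "y \<in> V" for y
    using *(9)[OF that] by (simp add: J invertible_left_inverse matrix_left_invertible_injective bij_is_inj)
  have D: "(g has_derivative (*v) (matrix_inv (cjac f (g y)))) (at y)" if "y \<in> V" for y
    using *(7,8)[OF that] has_derivative_inverse_matrix[OF inverti[OF that]] by (simp add: J)
  have gf: "f z \<in> V" "g (f z) = z" if "z \<in> U" for z
    using *(6) that by (auto simp: homeomorphism_def)
  show ?thesis
  proof (rule that[of U V g])
    show "cholomorphic_vec V g" using D by (rule cholomorphic_vecI)
    show "invertible (cjac f z)" if "z \<in> U" for z using inverti[of "f z"] gf that by simp
    show "cjac g (f z) = matrix_inv (cjac f z)" if "z \<in> U" for z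
      using cjac_eq[OF D[of "f z"]] gf that by simp
  qed (use * in auto)
qed

section \<open>Commutative algebra structures on \<open>\<complex>\<^sup>n\<close>\<close>

text \<open>The algebra of a single tangent space, carried to coordinate space by a chart; it is
  interpreted separately at every point.\<close>

locale cn_algebra =
  fixes star :: "complex^'n::finite \<Rightarrow> complex^'n \<Rightarrow> complex^'n" and one :: "complex^'n"
  assumes add_left: "star (u + v) w = star u w + star v w"
    and smult_left: "star (c *s u) v = c *s star u v"
    and comm: "star u v = star v u"
    and assoc: "star (star u v) w = star u (star v w)"
    and one_left: "star one u = u"
begin

text \<open>Linear forms are given by their coordinate vectors, so these are the points of the
  analytic spectrum over one base point (\<open>L_iff\<close>).\<close>

definition characters :: "(complex^'n) set" where
  "characters = {y. cdot y one = 1 \<and> (\<forall>u v. cdot y (star u v) = cdot y u * cdot y v)}"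

text \<open>The index type has as many elements as the dimension; therefore a frame is automatically
  a basis with sum \<open>one\<close> (\<open>frame_dual\<close>).\<close>

definition frame :: "('n \<Rightarrow> complex^'n) \<Rightarrow> bool" where
  "frame f \<longleftrightarrow> (\<forall>i. f i \<noteq> 0) \<and> (\<forall>i j. star (f i) (f j) = (if i = j then f i else 0))"

lemma add_right: "star w (u + v) = star w u + star w v"
  using add_left comm by metis

lemma smult_right: "star v (c *s u) = c *s star v u"
  using smult_left comm by metis

lemma zero_left [simp]: "star 0 u = 0"
  using smult_left[of 0 0 u] by simp

lemma zero_right [simp]: "star u 0 = 0"
  using comm zero_left by metis

lemma sum_left: "star (\<Sum>i\<in>I. g i) v = (\<Sum>i\<in>I. star (g i) v)"
  by (induction I rule: infinite_finite_induct) (auto simp: add_left)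

lemma sum_right: "star v (\<Sum>i\<in>I. g i) = (\<Sum>i\<in>I. star v (g i))"
  by (induction I rule: infinite_finite_induct) (auto simp: add_right)

lemma characters_mult: "y \<in> characters \<Longrightarrow> cdot y (star u v) = cdot y u * cdot y v"
  and characters_one: "y \<in> characters \<Longrightarrow> cdot y one = 1"
  by (auto simp: characters_def)

text \<open>A quantitative form of the independence of characters: a product of factors, each of
  which kills one character of \<open>Y\<close> and not \<open>y0\<close>.\<close>

lemma characters_separated:
  assumes "finite Y" "Y \<subseteq> characters" "y0 \<in> characters" "y0 \<notin> Y"
  shows "\<exists>u. cdot y0 u = 1 \<and> (\<forall>y\<in>Y. cdot y u = 0)"
  using assms
proof (induction Y rule: finite_induct)
  case empty
  then show ?case using characters_one by auto
next
  case (insert y Y)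
  then obtain u where u: "cdot y0 u = 1" "\<forall>y\<in>Y. cdot y u = 0" by auto
  have "y \<noteq> y0" using insert by auto
  then obtain i where "y $ i \<noteq> y0 $ i" by (auto simp: vec_eq_iff)
  \<comment> \<open>On a basis vector where the two characters differ, subtracting
    \<open>y $ i\<close> times the unit makes \<open>y\<close> vanish but not \<open>y0\<close>.
    Multiplication by \<open>u\<close> keeps the zeros already obtained.\<close>
  define w where "w = (axis i 1 - (y $ i) *s one)"
  have w: "cdot y w = 0" "cdot y0 w \<noteq> 0"
    using insert \<open>y $ i \<noteq> y0 $ i\<close> by (auto simp: w_def cdot_diff_right cdot_smult_right characters_one)
  have "cdot y0 (star (inverse (cdot y0 w) *s w) u) = 1" "\<forall>y'\<in>insert y Y. cdot y' (star (inverse (cdot y0 w) *s w) u) = 0"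
    using insert u w by (auto simp: characters_mult cdot_smult_right)
  then show ?case by blast
qed

text \<open>Pairing a linear relation between characters with an element that separates one of them
  from the others isolates its coefficient.\<close>

lemma characters_card_le:
  assumes "finite Y" "Y \<subseteq> characters"
  shows "card Y \<le> CARD('n)"
proof -
  have "vec.independent Y"
  proof
    assume "vec.dependent Y"
    then obtain U a y0 where "finite U" "U \<subseteq> Y" "(\<Sum>v\<in>U. a v *s v) = 0" "y0 \<in> U" "a y0 \<noteq> 0"
      by (auto simp: vec.dependent_explicit)
    moreover obtain u where u: "cdot y0 u = 1" "\<forall>y\<in>U - {y0}. cdot y u = 0"
      using characters_separated[of "U - {y0}" y0] calculation assms by auto
    moreover have "cdot (\<Sum>v\<in>U. a v *s v) u = (\<Sum>v\<in>U. a v * cdot v u)"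
      by (induction U rule: infinite_finite_induct) (auto simp: cdot_add_left cdot_smult_left)
    moreover have "(\<Sum>v\<in>U. a v * cdot v u) = a y0 * cdot y0 u + (\<Sum>v\<in>U - {y0}. a v * cdot v u)"
      using calculation by (simp add: sum.remove)
    ultimately show False by auto
  qed
  then show ?thesis
    using vec.independent_card_le_dim[of Y UNIV] by (simp add: card_cart_basis)
qed

lemma finite_characters: "finite characters"
  and card_characters_le: "card characters \<le> CARD('n)"
proof -
  show "finite characters"
    using characters_card_le finite_if_finite_subsets_card_bdd[of characters "CARD('n)"] by auto
  then show "card characters \<le> CARD('n)"
    using characters_card_le by blast
qed

text \<open>Multiplication with \<open>f k\<close> cuts out the k-th term of any combination of the
  frame. This one fact gives independence, the expansion of the unit and the product in frame
  coordinates.\<close>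

lemma frame_dual:
  assumes "frame f"
  obtains y where "\<And>a b. cdot (y a) (f b) = (if a = b then 1 else 0)"
    "\<And>v. v = (\<Sum>a\<in>UNIV. cdot (y a) v *s f a)"
    "characters = range y" "inj y" "one = (\<Sum>a\<in>UNIV. f a)"
    "\<And>x. (\<And>a. cdot (y a) x = 0) \<Longrightarrow> x = 0"
proof -
  define P :: "complex^'n^'n" where "P = (\<chi> i j. f j $ i)"
  have Pv: "P *v x = (\<Sum>j\<in>UNIV. x $ j *s f j)" for x
    by (simp add: P_def matrix_vector_mult_def vec_eq_iff mult.commute)
  have st: "star (f k) (\<Sum>j\<in>UNIV. g j *s f j) = g k *s f k" for g k
  proof -
    have "(\<Sum>j\<in>UNIV. g j *s star (f k) (f j)) = (\<Sum>j\<in>UNIV. if k = j then g j *s f j else 0)"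
      using assms by (intro sum.cong) (auto simp: frame_def)
    then show ?thesis
      by (simp add: sum_right smult_right)
  qed
  have "x = 0" if "P *v x = 0" for x
  proof -
    have "x $ k *s f k = 0" for k
      using st[of k "\<lambda>j. x $ j"] that by (simp add: Pv)
    then have "x $ k = 0" for k
      using assms vector_mul_eq_0[of "x $ k" "f k"] by (auto simp: frame_def)
    then show ?thesis by (simp add: vec_eq_iff)
  qed
  then have invP: "invertible P"
    by (auto simp: invertible_left_inverse matrix_left_invertible_ker)
  define y where "y = (\<lambda>a. matrix_inv P $ a)"
  have y: "cdot (y a) v = (matrix_inv P *v v) $ a" for a v
    by (simp add: y_def matrix_vector_cdot)
  have expand: "v = (\<Sum>a\<in>UNIV. cdot (y a) v *s f a)" for v
    using Pv[of "matrix_inv P *v v"] invP by (simp add: y matrix_vector_mul_assoc matrix_inv_inverse)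
  have dual: "cdot (y a) (f b) = (if a = b then 1 else 0)" for a b
  proof -
    have "f b = P *v axis b 1"
      by (simp add: Pv axis_def if_distrib if_distribR cong: if_cong)
    then have "matrix_inv P *v f b = axis b 1"
      using invP by (simp add: matrix_vector_mul_assoc matrix_inv_inverse)
    then show ?thesis by (auto simp: y axis_def)
  qed
  have one: "one = (\<Sum>a\<in>UNIV. f a)"
  proof -
    have "cdot (y a) one *s f a = f a" for a
      using st[of a "\<lambda>a. cdot (y a) one"] expand[of one] one_left[of "f a"] comm by metis
    then show ?thesis using expand[of one] by simp
  qed
  have cdot_sum: "cdot (y a) (\<Sum>b\<in>UNIV. g b *s f b) = g a" for a g
    by (simp add: cdot_sum_right cdot_smult_right dual if_distrib cong: if_cong)
  have mult: "star u v = (\<Sum>b\<in>UNIV. (cdot (y b) u * cdot (y b) v) *s f b)" for u v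
  proof -
    have "star u v = star (\<Sum>a\<in>UNIV. cdot (y a) u *s f a) (\<Sum>a\<in>UNIV. cdot (y a) v *s f a)"
      using expand by metis
    then show ?thesis by (simp only: sum_left smult_left st) (simp add: mult_ac)
  qed
  have ych: "y a \<in> characters" for a
    unfolding characters_def using cdot_sum[of a "\<lambda>_. 1"] cdot_sum
    by (auto simp: mult one)
  \<comment> \<open>As the \<open>f a\<close> add up to the unit, a character is nonzero on one of
    them. Orthogonality then forces the value 0 on the others, and idempotency forces the value 1 on
    this one.\<close>
  have "l \<in> range y" if l: "l \<in> characters" for l
  proof -
    have "cdot l one = (\<Sum>a\<in>UNIV. cdot l (f a))" by (simp add: one cdot_sum_right)
    then obtain a where a: "cdot l (f a) \<noteq> 0"
      using characters_one[OF l] by (metis sum.neutral zero_neq_one)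
    have la: "cdot l (f b) = (if b = a then 1 else 0)" for b
      using characters_mult[OF l, of "f a" "f b"] assms a by (auto simp: frame_def split: if_splits)
    have "cdot l v = cdot (y a) v" for v
    proof -
      have "cdot l v = cdot l (\<Sum>a\<in>UNIV. cdot (y a) v *s f a)" using expand by metis
      then show ?thesis by (simp add: cdot_sum_right cdot_smult_right la if_distrib cong: if_cong)
    qed
    then have "l = y a" by (metis cdot_axis vec_eq_iff)
    then show ?thesis by simp
  qed
  then have "characters = range y" using ych by auto
  moreover have "inj y"
    by (rule injI) (metis dual zero_neq_one)
  moreover have "x = 0" if "\<And>a. cdot (y a) x = 0" for x
    using expand[of x] that by simp
  ultimately show ?thesis using that dual expand one by blast
qed

text \<open>The separating elements of n characters form their dual basis, so a vector is determined
  by its values under the characters. Tested on these, the dual basis consists of orthogonal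
  idempotents.\<close>

lemma frame_exists:
  assumes "card characters = CARD('n)"
  shows "\<exists>f. frame f"
proof -
  obtain y where y: "bij_betw y (UNIV :: 'n set) characters"
    using assms finite_characters by (metis finite_same_card_bij finite_code)
  then have ych: "y a \<in> characters" for a by (auto simp: bij_betw_def)
  have "\<exists>u. cdot (y b) u = 1 \<and> (\<forall>z\<in>characters - {y b}. cdot z u = 0)" for b
    using characters_separated[of "characters - {y b}" "y b"] ych finite_characters by auto
  then obtain u where u: "cdot (y b) (u b) = 1" "\<And>z. z \<in> characters \<Longrightarrow> z \<noteq> y b \<Longrightarrow> cdot z (u b) = 0" for b
    by (metis Diff_iff singletonD)
  have yu: "cdot (y a) (u b) = (if a = b then 1 else 0)" for a b
    using u ych y by (metis bij_betw_def inj_eq)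
  define Y :: "complex^'n^'n" where "Y = (\<chi> a. y a)"
  define U :: "complex^'n^'n" where "U = (\<chi> i b. u b $ i)"
  have "Y ** U = mat 1"
  proof -
    have "(Y ** U) $ a $ b = cdot (y a) (u b)" for a b
      by (simp add: Y_def U_def matrix_matrix_mult_def cdot_def)
    then show ?thesis by (simp add: vec_eq_iff yu mat_def)
  qed
  then have "U ** Y = mat 1" by (simp add: matrix_left_right_inverse)
  then have inj: "x = x'" if "\<And>a. cdot (y a) x = cdot (y a) x'" for x x'
  proof -
    have "Y *v x = Y *v x'" using that by (simp add: vec_eq_iff matrix_vector_cdot Y_def)
    then show ?thesis using \<open>U ** Y = mat 1\<close> by (metis matrix_vector_mul_assoc matrix_vector_mul_lid)
  qed
  have "star (u i) (u j) = (if i = j then u i else 0)" for i j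
    by (rule inj) (auto simp: characters_mult[OF ych] yu)
  moreover have "u i \<noteq> 0" for i using yu[of i i] by auto
  ultimately show ?thesis unfolding frame_def by blast
qed

lemma card_characters_frame:
  assumes "frame f"
  shows "card characters = CARD('n)"
  using frame_dual[OF assms] card_image by (metis)

end

declare split_paired_All [simp del] split_paired_Ex [simp del]

section \<open>Manifolds modelled on \<open>\<complex>\<^sup>k\<close>\<close>

lemma coord_space_UNIV [simp]: "coord_space UNIV = UNIV"
  by (simp add: coord_space_def)

lemma chart_inv_left: "inj_on (snd c) (fst c) \<Longrightarrow> p \<in> fst c \<Longrightarrow> chart_inv c (snd c p) = p"
  by (simp add: chart_inv_def)

lemma chart_inv_right: "z \<in> snd c ` fst c \<Longrightarrow> snd c (chart_inv c z) = z"
  and chart_inv_mem: "z \<in> snd c ` fst c \<Longrightarrow> chart_inv c z \<in> fst c"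
  unfolding chart_inv_def by (rule f_inv_into_f, assumption) (rule inv_into_into)

text \<open>Inverse to the evaluation of tangent vectors at the chart \<open>c\<close>
  (\<open>tvec_of_self\<close>, \<open>tangent_eq_tvec_of\<close>); this identifies the tangent
  space with coordinate space.\<close>

definition tvec_of :: "('a, 'k::finite) cmanifold \<Rightarrow> ('a, 'k) chart \<Rightarrow> 'a \<Rightarrow> complex^'k \<Rightarrow> ('a, 'k) tvec" where
  "tvec_of M c p u = (\<lambda>c'. if c' \<in> charts_at M p then dir_deriv (transition c c') (snd c p) u else 0)"

text \<open>The value 0 off the tangent space follows the convention of
  \<open>cotangent_space\<close>; \<open>covec_coords\<close> is the inverse there.\<close>

definition covec_of :: "('a, 'k::finite) cmanifold \<Rightarrow> ('a, 'k) chart \<Rightarrow> 'a \<Rightarrow> complex^'k \<Rightarrow> ('a, 'k) covec" where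
  "covec_of M c p y = (\<lambda>v. if v \<in> tangent_space M p then cdot y (v c) else 0)"

definition covec_coords :: "('a, 'k::finite) cmanifold \<Rightarrow> ('a, 'k) chart \<Rightarrow> 'a \<Rightarrow> ('a, 'k) covec \<Rightarrow> complex^'k" where
  "covec_coords M c p l = (\<chi> i. l (coord_vec M c p i))"

definition jacobian_at :: "('a, 'k::finite) chart \<Rightarrow> ('a, 'k) chart \<Rightarrow> 'a \<Rightarrow> complex^'k^'k" where
  "jacobian_at c c' p = cjac (transition c c') (snd c p)"

lemma sum_tvec_apply: "(\<Sum>i\<in>I. g i) c = (\<Sum>i\<in>I. g i c)" for g :: "'i \<Rightarrow> ('a, 'k::finite) tvec"
  by (induction I rule: infinite_finite_induct) auto

text \<open>The structure common to \<open>M\<close> and its cotangent bundle, with all coordinates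
  free; the calculus of charts, tangent vectors and curves below serves both.\<close>

locale full_atlas =
  fixes M :: "('a, 'k::finite) cmanifold"
  assumes coords_UNIV: "coords M = UNIV"
    and chart_inj: "c \<in> atlas M \<Longrightarrow> inj_on (snd c) (fst c)"
    and overlap_open: "c \<in> atlas M \<Longrightarrow> c' \<in> atlas M \<Longrightarrow> open (snd c ` (fst c \<inter> fst c'))"
    and transition_holo: "c \<in> atlas M \<Longrightarrow> c' \<in> atlas M \<Longrightarrow>
      cholomorphic_vec (snd c ` (fst c \<inter> fst c')) (transition c c')"
begin

lemma chart_open: "c \<in> atlas M \<Longrightarrow> open (snd c ` fst c)"
  using overlap_open[of c c] by simp

lemma chart_inv_snd [simp]: "c \<in> atlas M \<Longrightarrow> p \<in> fst c \<Longrightarrow> chart_inv c (snd c p) = p"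
  by (rule chart_inv_left[OF chart_inj])

lemma chart_subset: "c \<in> atlas M \<Longrightarrow> fst c \<subseteq> points M"
  by (auto simp: points_def)

lemma points_chart: "p \<in> points M \<Longrightarrow> \<exists>c. c \<in> charts_at M p"
  by (auto simp: points_def charts_at_def)

lemma transition_snd [simp]: "c \<in> atlas M \<Longrightarrow> p \<in> fst c \<Longrightarrow> transition c c' (snd c p) = snd c' p"
  by (simp add: transition_def)

lemma transition_continuous:
  "c \<in> atlas M \<Longrightarrow> c' \<in> atlas M \<Longrightarrow> continuous_on (snd c ` (fst c \<inter> fst c')) (transition c c')"
  by (rule cholomorphic_vec_continuous_on[OF transition_holo])

text \<open>The topology is given by generators, each visible in one chart, so one direction goes by
  induction over the generation of an open set. Continuity of the transition maps carries openness
  from one chart to all.\<close>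

lemma openin_mtop_iff:
  "openin (mtop M) W \<longleftrightarrow> W \<subseteq> points M \<and> (\<forall>c\<in>atlas M. open (snd c ` (fst c \<inter> W)))"
proof
  assume W: "openin (mtop M) W"
  have "generate_topology_on {fst c \<inter> snd c -` A | c A. c \<in> atlas M \<and> open A} W"
    using W by (simp add: mtop_def openin_topology_generated_by_iff)
  then have "\<forall>c\<in>atlas M. open (snd c ` (fst c \<inter> W))"
  proof induction
    case (Int a b)
    show ?case
    proof
      fix c assume c: "c \<in> atlas M"
      have "snd c ` (fst c \<inter> (a \<inter> b)) = snd c ` (fst c \<inter> a) \<inter> snd c ` (fst c \<inter> b)"
        using inj_on_image_Int[OF chart_inj[OF c], of "fst c \<inter> a" "fst c \<inter> b"] by (simp add: Int_ac)
      then show "open (snd c ` (fst c \<inter> (a \<inter> b)))"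
        using Int c by auto
    qed
  next
    case (UN K)
    have "snd c ` (fst c \<inter> \<Union>K) = (\<Union>k\<in>K. snd c ` (fst c \<inter> k))" for c by auto
    moreover have "open (\<Union>k\<in>K. snd c ` (fst c \<inter> k))" if "c \<in> atlas M" for c
      using UN that by (intro open_UN ballI) blast
    ultimately show ?case by metis
  next
    case (Basis s)
    then obtain c' A where s: "s = fst c' \<inter> snd c' -` A" "c' \<in> atlas M" "open A" by blast
    show ?case
    proof
      fix c assume c: "c \<in> atlas M"
      have "snd c ` (fst c \<inter> s) = (snd c ` (fst c \<inter> fst c')) \<inter> transition c c' -` A"
        using c by (auto simp: s image_iff)
      then show "open (snd c ` (fst c \<inter> s))"
        using continuous_open_preimage[OF transition_continuous overlap_open] c s by simp
    qed
  qed auto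
  then show "W \<subseteq> points M \<and> (\<forall>c\<in>atlas M. open (snd c ` (fst c \<inter> W)))"
    using openin_subset[OF W] by (simp add: topspace_mtop)
next
  assume W: "W \<subseteq> points M \<and> (\<forall>c\<in>atlas M. open (snd c ` (fst c \<inter> W)))"
  have "W = (\<Union>c\<in>atlas M. fst c \<inter> snd c -` (snd c ` (fst c \<inter> W)))"
  proof
    show "W \<subseteq> (\<Union>c\<in>atlas M. fst c \<inter> snd c -` (snd c ` (fst c \<inter> W)))"
      using W by (force simp: points_def)
    show "(\<Union>c\<in>atlas M. fst c \<inter> snd c -` (snd c ` (fst c \<inter> W))) \<subseteq> W"
      using chart_inj by (auto dest: inj_onD)
  qed
  moreover have "openin (mtop M) (\<Union>c\<in>atlas M. fst c \<inter> snd c -` (snd c ` (fst c \<inter> W)))"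
    unfolding mtop_def
    by (intro openin_Union ballI, elim imageE, simp only:, intro topology_generated_by_Basis CollectI) (use W in blast)
  ultimately show "openin (mtop M) W" by simp
qed

lemma openin_chart_image: "openin (mtop M) W \<Longrightarrow> c \<in> atlas M \<Longrightarrow> open (snd c ` (fst c \<inter> W))"
  by (simp add: openin_mtop_iff)

lemma openin_chart_preimage:
  assumes "c \<in> atlas M" "open A"
  shows "openin (mtop M) {p \<in> fst c. snd c p \<in> A}"
proof -
  have "{p \<in> fst c. snd c p \<in> A} = fst c \<inter> snd c -` A" by auto
  moreover have "openin (mtop M) (fst c \<inter> snd c -` A)"
    unfolding mtop_def by (rule topology_generated_by_Basis) (use assms in blast)
  ultimately show ?thesis by metis
qed

lemma openin_chart: "c \<in> atlas M \<Longrightarrow> openin (mtop M) (fst c)"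
  using openin_chart_preimage[of c UNIV] by simp

lemma openin_chart_inv_image:
  assumes "c \<in> atlas M" "open A" "A \<subseteq> snd c ` fst c"
  shows "openin (mtop M) (chart_inv c ` A)"
proof -
  have "chart_inv c ` A = {p \<in> fst c. snd c p \<in> A}"
  proof
    show "chart_inv c ` A \<subseteq> {p \<in> fst c. snd c p \<in> A}"
      using assms chart_inv_right[of _ c] chart_inv_mem[of _ c] by (auto simp: subset_eq simp del: split_paired_All)
    show "{p \<in> fst c. snd c p \<in> A} \<subseteq> chart_inv c ` A"
      using chart_inv_snd[OF assms(1)] by (metis (mono_tags, lifting) imageI mem_Collect_eq subsetI)
  qed
  then show ?thesis using openin_chart_preimage assms by simp
qed

lemma continuous_into_chart:
  assumes "c \<in> atlas M" "f ` topspace X \<subseteq> fst c" "continuous_map X euclidean (\<lambda>x. snd c (f x))"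
  shows "continuous_map X (mtop M) f"
  unfolding continuous_map_def
proof (intro conjI allI impI)
  show "f \<in> topspace X \<rightarrow> topspace (mtop M)"
    using assms(2) chart_subset[OF assms(1)] by (auto simp: topspace_mtop)
  fix W assume W: "openin (mtop M) W"
  have "{x \<in> topspace X. f x \<in> W} = {x \<in> topspace X. snd c (f x) \<in> snd c ` (fst c \<inter> W)}"
  proof -
    have "f x \<in> W" if "x \<in> topspace X" "snd c (f x) \<in> snd c ` (fst c \<inter> W)" for x
    proof -
      have "f x \<in> fst c" using assms(2) that by auto
      then show ?thesis using that chart_inj[OF assms(1)] by (auto dest: inj_onD)
    qed
    then show ?thesis using assms(2) by auto
  qed
  then show "openin X {x \<in> topspace X. f x \<in> W}"
    using assms(3) openin_chart_image[OF W assms(1)]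
    by (simp add: continuous_map_def)
qed

lemma continuous_map_chart:
  assumes "c \<in> atlas M"
  shows "continuous_map (subtopology (mtop M) (fst c)) euclidean (snd c)"
  using openin_chart_preimage[OF assms] openin_chart[OF assms] chart_subset[OF assms]
  by (auto simp: continuous_map_def topspace_mtop openin_open_subtopology Int_absorb1 Int_commute)

lemma transition_has_derivative:
  assumes "c \<in> charts_at M p" "c' \<in> charts_at M p"
  shows "(transition c c' has_derivative (*v) (jacobian_at c c' p)) (at (snd c p))"
  unfolding jacobian_at_def
  using assms by (intro cholomorphic_vecD[OF overlap_open transition_holo]) (auto simp: charts_at_def)

lemma dir_deriv_transition:
  assumes "c \<in> charts_at M p" "c' \<in> charts_at M p"
  shows "dir_deriv (transition c c') (snd c p) u = jacobian_at c c' p *v u"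
  by (rule dir_deriv_eq[OF transition_has_derivative[OF assms]])

lemma jacobian_at_compose:
  assumes "c \<in> charts_at M p" "c' \<in> charts_at M p" "c'' \<in> charts_at M p"
  shows "jacobian_at c' c'' p ** jacobian_at c c' p = jacobian_at c c'' p"
proof -
  note ch = assms[unfolded charts_at_def, simplified]
  have D: "((transition c' c'' \<circ> transition c c') has_derivative (*v) (jacobian_at c' c'' p ** jacobian_at c c' p)) (at (snd c p))"
  proof -
    have "(transition c' c'' has_derivative (*v) (jacobian_at c' c'' p)) (at (transition c c' (snd c p)))"
      using transition_has_derivative[OF assms(2,3)] ch by simp
    from diff_chain_at[OF transition_has_derivative[OF assms(1,2)] this] show ?thesis
      by (rule has_derivative_eq_rhs) (auto simp: matrix_vector_mul_assoc)
  qed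
  have op: "open (snd c ` (fst c \<inter> (fst c' \<inter> fst c'')))"
    by (rule openin_chart_image) (use ch in \<open>auto intro!: openin_Int openin_chart\<close>)
  have "(transition c c'' has_derivative (*v) (jacobian_at c' c'' p ** jacobian_at c c' p)) (at (snd c p))"
    by (rule has_derivative_transform_within_open[OF D op]) (use ch in auto)
  then show ?thesis
    using cjac_eq jacobian_at_def by metis
qed

lemma jacobian_at_self [simp]:
  assumes "c \<in> charts_at M p"
  shows "jacobian_at c c p = mat 1"
proof -
  note ch = assms[unfolded charts_at_def, simplified]
  have D: "((\<lambda>z. z) has_derivative (*v) (mat 1)) (at (snd c p))"
    by (rule has_derivative_eq_rhs[OF has_derivative_ident]) auto
  have "(transition c c has_derivative (*v) (mat 1)) (at (snd c p))"
    by (rule has_derivative_transform_within_open[OF D chart_open]) (use ch in auto)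
  then show ?thesis
    using cjac_eq jacobian_at_def by metis
qed

lemma coord_vec_eq: "coord_vec M c p i = tvec_of M c p (axis i 1)"
  by (simp add: coord_vec_def tvec_of_def)

lemma tvec_of_apply:
  assumes "c \<in> charts_at M p"
  shows "tvec_of M c p u c' = (if c' \<in> charts_at M p then jacobian_at c c' p *v u else 0)"
  using dir_deriv_transition[OF assms] by (simp add: tvec_of_def)

lemma tvec_of_self [simp]: "c \<in> charts_at M p \<Longrightarrow> tvec_of M c p u c = u"
  by (simp add: tvec_of_apply)

lemma tangent_space_iff:
  "v \<in> tangent_space M p \<longleftrightarrow> (\<forall>c. c \<notin> charts_at M p \<longrightarrow> v c = 0) \<and>
     (\<forall>c\<in>charts_at M p. \<forall>c'\<in>charts_at M p. v c' = jacobian_at c c' p *v v c)"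
  unfolding tangent_space_def coords_UNIV coord_space_UNIV mem_Collect_eq
  by (intro conj_cong refl ball_cong) (simp add: dir_deriv_transition)

lemma tvec_of_in [simp]:
  assumes "c \<in> charts_at M p"
  shows "tvec_of M c p u \<in> tangent_space M p"
  unfolding tangent_space_iff
proof (intro conjI allI impI ballI)
  fix c1 c2 assume "c1 \<in> charts_at M p" "c2 \<in> charts_at M p"
  then show "tvec_of M c p u c2 = jacobian_at c1 c2 p *v tvec_of M c p u c1"
    using assms by (simp add: tvec_of_apply matrix_vector_mul_assoc jacobian_at_compose)
qed (simp add: tvec_of_def)

lemma tangent_eq_tvec_of:
  assumes "v \<in> tangent_space M p" "c \<in> charts_at M p"
  shows "tvec_of M c p (v c) = v"
proof
  fix c'
  show "tvec_of M c p (v c) c' = v c'"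
    using assms(1)[unfolded tangent_space_iff, THEN conjunct1, rule_format, of c']
      assms(1)[unfolded tangent_space_iff, THEN conjunct2, rule_format, OF assms(2), of c']
    unfolding tvec_of_apply[OF assms(2)] by auto
qed

lemma tangent_transform:
  assumes "v \<in> tangent_space M p" "c \<in> charts_at M p" "c' \<in> charts_at M p"
  shows "v c' = jacobian_at c c' p *v v c"
  using assms(1)[unfolded tangent_space_iff, THEN conjunct2] assms(2,3) by (elim ballE) (assumption | erule notE)+

lemma tangent_eqI:
  assumes "v \<in> tangent_space M p" "w \<in> tangent_space M p" "c \<in> charts_at M p" "v c = w c"
  shows "v = w"
  by (rule trans[OF tangent_eq_tvec_of[OF assms(1,3), symmetric]])
     (simp only: assms(4) tangent_eq_tvec_of[OF assms(2,3)])

lemma tangentI: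
  assumes "c \<in> charts_at M p" "\<And>c'. v c' = (if c' \<in> charts_at M p then jacobian_at c c' p *v u else 0)"
  shows "v \<in> tangent_space M p"
proof -
  have "v = tvec_of M c p u"
    using assms by (auto simp: tvec_of_apply)
  then show ?thesis
    using assms by simp
qed

lemma tangent_add:
  assumes "v \<in> tangent_space M p" "w \<in> tangent_space M p"
  shows "v + w \<in> tangent_space M p"
  unfolding tangent_space_iff plus_fun_apply matrix_vector_right_distrib
proof (intro conjI allI impI ballI)
  show "v c + w c = 0" if "c \<notin> charts_at M p" for c
    using assms that by (simp only: tangent_space_iff) simp
  show "v c' + w c' = jacobian_at c c' p *v v c + jacobian_at c c' p *v w c"
    if "c \<in> charts_at M p" "c' \<in> charts_at M p" for c c'
    using tangent_transform[OF assms(1) that] tangent_transform[OF assms(2) that] by (rule arg_cong2)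
qed

lemma tangent_scale:
  assumes "v \<in> tangent_space M p"
  shows "tscale a v \<in> tangent_space M p"
  unfolding tangent_space_iff tscale_def matrix_vector_smult
proof (intro conjI allI impI ballI)
  show "a *s v c = 0" if "c \<notin> charts_at M p" for c
    using assms that by (simp only: tangent_space_iff) simp
  show "a *s v c' = a *s (jacobian_at c c' p *v v c)"
    if "c \<in> charts_at M p" "c' \<in> charts_at M p" for c c'
    using tangent_transform[OF assms(1) that] by (rule arg_cong)
qed

lemma tangent_zero: "0 \<in> tangent_space M p"
  unfolding tangent_space_iff by simp

lemma tangent_sum:
  assumes "\<And>i. i \<in> I \<Longrightarrow> g i \<in> tangent_space M p"
  shows "(\<Sum>i\<in>I. g i) \<in> tangent_space M p"
  using assms by (induction I rule: infinite_finite_induct) (auto intro: tangent_add tangent_zero)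

lemma tvec_of_add: "c \<in> charts_at M p \<Longrightarrow> tvec_of M c p (u + v) = tvec_of M c p u + tvec_of M c p v"
  by (rule tangent_eqI[where c = c]) (auto intro: tangent_add)

lemma tvec_of_scale: "c \<in> charts_at M p \<Longrightarrow> tvec_of M c p (a *s u) = tscale a (tvec_of M c p u)"
  by (rule tangent_eqI[where c = c]) (simp_all add: tangent_scale, simp add: tscale_def)

lemma tangent_scale_iff:
  assumes "a \<noteq> 0"
  shows "tscale a v \<in> tangent_space M p \<longleftrightarrow> v \<in> tangent_space M p"
proof -
  have "tscale (inverse a) (tscale a v) = v"
    using assms by (simp add: tscale_def)
  then show ?thesis using tangent_scale by metis
qed

lemma covec_of_in [simp]:
  assumes "c \<in> charts_at M p"
  shows "covec_of M c p y \<in> cotangent_space M p"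
proof -
  have "covec_of M c p y (tscale a v) = a * covec_of M c p y v" for a v
  proof (cases "a = 0")
    case True
    then show ?thesis by (simp add: covec_of_def tscale_def)
  next
    case False
    then show ?thesis
      using tangent_scale_iff[OF False, of v p] by (simp add: covec_of_def) (simp add: tscale_def cdot_smult_right)
  qed
  then show ?thesis
    by (simp add: cotangent_space_def) (simp add: covec_of_def tangent_add cdot_add_right)
qed

lemma covec_of_apply: "v \<in> tangent_space M p \<Longrightarrow> covec_of M c p y v = cdot y (v c)"
  by (simp add: covec_of_def)

lemma covec_coords_covec_of [simp]:
  assumes "c \<in> charts_at M p"
  shows "covec_coords M c p (covec_of M c p y) = y"
  using assms by (simp add: covec_coords_def coord_vec_eq covec_of_apply vec_eq_iff)

lemma cotangent_apply:
  assumes "l \<in> cotangent_space M p" "c \<in> charts_at M p" "v \<in> tangent_space M p"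
  shows "l v = cdot (covec_coords M c p l) (v c)"
proof -
  have add: "l (u + w) = l u + l w" if "u \<in> tangent_space M p" "w \<in> tangent_space M p" for u w
    using assms(1) that by (simp add: cotangent_space_def)
  have sc: "l (tscale a w) = a * l w" if "w \<in> tangent_space M p" for a w
    using assms(1) that by (simp add: cotangent_space_def)
  have "l 0 = 0"
    using sc[OF tangent_zero, of 0] by (simp add: tscale_def zero_fun_def)
  then have sum: "l (\<Sum>i\<in>I. g i) = (\<Sum>i\<in>I. l (g i))" if "\<And>i. i \<in> I \<Longrightarrow> g i \<in> tangent_space M p" for I :: "'k set" and g
    using that by (induction I rule: infinite_finite_induct) (auto simp: add tangent_sum)
  have "v = (\<Sum>i\<in>UNIV. tscale (v c $ i) (coord_vec M c p i))"
  proof (rule tangent_eqI[OF assms(3) tangent_sum assms(2)])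
    show "v c = (\<Sum>i\<in>UNIV. tscale (v c $ i) (coord_vec M c p i)) c"
      using assms(2) basis_expansion[of "v c"] by (simp add: sum_tvec_apply coord_vec_eq tscale_def)
  qed (use assms in \<open>simp add: coord_vec_eq tangent_scale\<close>)
  then have "l v = (\<Sum>i\<in>UNIV. l (tscale (v c $ i) (coord_vec M c p i)))"
    using sum[of UNIV "\<lambda>i. tscale (v c $ i) (coord_vec M c p i)"] assms(2)
    by (simp add: coord_vec_eq tangent_scale)
  then show ?thesis
    using assms(2) by (simp add: sc coord_vec_eq cdot_def covec_coords_def mult.commute)
qed

lemma covec_of_covec_coords [simp]:
  assumes "l \<in> cotangent_space M p" "c \<in> charts_at M p"
  shows "covec_of M c p (covec_coords M c p l) = l"
  using assms cotangent_apply[OF assms] by (auto simp: covec_of_def cotangent_space_def)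

text \<open>Covectors change by the Jacobian in the opposite direction, acting from the right. This
  is the fibre part of the transition maps of the cotangent bundle.\<close>

lemma covec_coords_transform:
  assumes "l \<in> cotangent_space M p" "c \<in> charts_at M p" "c' \<in> charts_at M p"
  shows "covec_coords M c' p l = covec_coords M c p l v* jacobian_at c' c p"
proof -
  have "covec_coords M c' p l $ i = (covec_coords M c p l v* jacobian_at c' c p) $ i" for i
  proof -
    have "covec_coords M c' p l $ i = cdot (covec_coords M c p l) (tvec_of M c' p (axis i 1) c)"
      using cotangent_apply[OF assms(1,2), of "tvec_of M c' p (axis i 1)"] assms
      by (simp add: covec_coords_def coord_vec_eq)
    also have "tvec_of M c' p (axis i 1) c = column i (jacobian_at c' c p)"
      using assms by (simp add: tvec_of_apply) (simp add: vec_eq_iff matrix_vector_cdot column_def)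
    finally show ?thesis
      by (simp add: cdot_def column_def vector_matrix_mult_def mult.commute)
  qed
  then show ?thesis by (simp add: vec_eq_iff)
qed

end

subsection \<open>Holomorphic curves\<close>

lemma has_derivative_curve_iff:
  fixes g :: "complex \<Rightarrow> complex^'k::finite"
  shows "(g has_derivative (\<lambda>h. h *s u)) (at t) \<longleftrightarrow> (\<forall>i. ((\<lambda>s. g s $ i) has_field_derivative u $ i) (at t))"
proof
  assume g: "(g has_derivative (\<lambda>h. h *s u)) (at t)"
  have "((\<lambda>s. g s $ i) has_derivative (\<lambda>h. u $ i * h)) (at t)" for i
    by (rule has_derivative_eq_rhs[OF bounded_linear.has_derivative[OF bounded_linear_vec_nth g]]) auto
  then show "\<forall>i. ((\<lambda>s. g s $ i) has_field_derivative u $ i) (at t)"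
    by (simp add: has_field_derivative_def)
next
  assume "\<forall>i. ((\<lambda>s. g s $ i) has_field_derivative u $ i) (at t)"
  then have "((\<lambda>s. g s $ i) has_derivative (\<lambda>h. u $ i * h)) (at t)" for i
    by (simp add: has_field_derivative_def)
  then have "((\<lambda>s. \<Sum>i\<in>UNIV. (g s $ i) *s axis i 1) has_derivative (\<lambda>h. \<Sum>i\<in>UNIV. (u $ i * h) *s axis i (1::complex))) (at t)"
    by (intro has_derivative_sum bounded_linear.has_derivative[OF bounded_linear_smult_left])
  moreover have "(\<Sum>i\<in>UNIV. (u $ i * h) *s axis i (1::complex)) = h *s u" for h
    using basis_expansion[of "h *s u"] by (simp add: mult.commute)
  ultimately show "(g has_derivative (\<lambda>h. h *s u)) (at t)"
    by (simp only: basis_expansion)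
qed

lemma curve_chain_vec:
  fixes A :: "complex^'k::finite^'l::finite"
  assumes "(g has_derivative (\<lambda>h. h *s u)) (at t)" "(f has_derivative (*v) A) (at (g t))"
  shows "((\<lambda>s. f (g s)) has_derivative (\<lambda>h. h *s (A *v u))) (at t)"
  by (rule has_derivative_eq_rhs[OF has_derivative_compose[OF assms]]) (auto simp: matrix_vector_smult)

lemma curve_chain_scalar:
  assumes "(g has_derivative (\<lambda>h. h *s u)) (at t)" "(f has_derivative cdot y) (at (g t))"
  shows "((\<lambda>s. f (g s)) has_field_derivative cdot y u) (at t)"
  unfolding has_field_derivative_def
  by (rule has_derivative_eq_rhs[OF has_derivative_compose[OF assms]]) (auto simp: cdot_smult_right)

context full_atlas
begin

lemma continuous_map_localI:
  assumes "\<And>t. t \<in> topspace X \<Longrightarrow> \<exists>O'. openin X O' \<and> t \<in> O' \<and> continuous_map (subtopology X O') (mtop M) \<gamma>"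
  shows "continuous_map X (mtop M) \<gamma>"
proof -
  obtain O' where O': "\<And>t. t \<in> topspace X \<Longrightarrow> openin X (O' t) \<and> t \<in> O' t \<and> continuous_map (subtopology X (O' t)) (mtop M) \<gamma>"
    using assms by metis
  show ?thesis
  proof (rule pasting_lemma[where I = "topspace X" and T = O' and f = "\<lambda>_. \<gamma>"])
    show "\<And>x. x \<in> topspace X \<Longrightarrow> \<exists>j. j \<in> topspace X \<and> x \<in> O' j \<and> \<gamma> x = \<gamma> x" using O' by blast
  qed (use O' in auto)
qed

text \<open>One chart around each time is enough: the chain rule for the transition maps supplies
  the remaining charts over which \<open>holo_curve\<close> quantifies.\<close>

lemma holo_curveI:
  assumes "open \<Omega>"
    and loc: "\<And>t. t \<in> \<Omega> \<Longrightarrow> \<exists>c O' g. c \<in> atlas M \<and> open O' \<and> t \<in> O' \<and> O' \<subseteq> \<Omega> \<and> \<gamma> ` O' \<subseteq> fst c \<and>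
        (\<forall>s\<in>O'. ((\<lambda>s. snd c (\<gamma> s)) has_derivative (\<lambda>h. h *s g s)) (at s))"
  shows "holo_curve M \<Omega> \<gamma>"
proof -
  have cont: "continuous_map (top_of_set \<Omega>) (mtop M) \<gamma>"
  proof (rule continuous_map_localI)
    fix t assume "t \<in> topspace (top_of_set \<Omega>)"
    then have "t \<in> \<Omega>" by simp
    from loc[OF this] obtain c O' g where *: "c \<in> atlas M" "open O'" "t \<in> O'" "O' \<subseteq> \<Omega>" "\<gamma> ` O' \<subseteq> fst c"
        "\<forall>s\<in>O'. ((\<lambda>s. snd c (\<gamma> s)) has_derivative (\<lambda>h. h *s g s)) (at s)"
      by blast
    have "continuous_on O' (\<lambda>s. snd c (\<gamma> s))"
      using *(6) by (meson continuous_at_imp_continuous_on has_derivative_continuous)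
    then have "continuous_map (top_of_set O') (mtop M) \<gamma>"
      using * by (intro continuous_into_chart[where c = c]) auto
    moreover have "subtopology (top_of_set \<Omega>) O' = top_of_set O'"
      using * by (simp add: subtopology_subtopology Int_absorb1)
    ultimately show "\<exists>O'. openin (top_of_set \<Omega>) O' \<and> t \<in> O' \<and> continuous_map (subtopology (top_of_set \<Omega>) O') (mtop M) \<gamma>"
      using * assms(1) by (intro exI[of _ O']) (auto simp: openin_open_eq)
  qed
  have "(\<lambda>t. snd c' (\<gamma> t) $ i) holomorphic_on (\<Omega> \<inter> \<gamma> -` fst c')" if c': "c' \<in> atlas M" for c' i
    unfolding holomorphic_on_def
  proof
    fix t assume t: "t \<in> \<Omega> \<inter> \<gamma> -` fst c'"
    then have "t \<in> \<Omega>" by simp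
    from loc[OF this] obtain c O' g where *: "c \<in> atlas M" "open O'" "t \<in> O'" "O' \<subseteq> \<Omega>" "\<gamma> ` O' \<subseteq> fst c"
        "\<forall>s\<in>O'. ((\<lambda>s. snd c (\<gamma> s)) has_derivative (\<lambda>h. h *s g s)) (at s)"
      by blast
    have ch: "c \<in> charts_at M (\<gamma> t)" "c' \<in> charts_at M (\<gamma> t)"
      using * t c' by (auto simp: charts_at_def)
    have "openin (top_of_set \<Omega>) {s \<in> \<Omega>. \<gamma> s \<in> fst c'}"
      using cont openin_chart[OF c'] by (auto simp: continuous_map_def)
    then have op: "open {s \<in> \<Omega>. \<gamma> s \<in> fst c'}"
      using assms(1) by (simp add: openin_open_eq)
    have "((\<lambda>s. transition c c' (snd c (\<gamma> s))) has_derivative (\<lambda>h. h *s (jacobian_at c c' (\<gamma> t) *v g t))) (at t)"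
      by (rule curve_chain_vec[OF *(6)[rule_format, OF *(3)] transition_has_derivative[OF ch]])
    then have "((\<lambda>s. snd c' (\<gamma> s)) has_derivative (\<lambda>h. h *s (jacobian_at c c' (\<gamma> t) *v g t))) (at t)"
      by (rule has_derivative_transform_within_open[OF _ open_Int[OF op *(2)]]) (use * t in auto)
    then show "(\<lambda>t. snd c' (\<gamma> t) $ i) field_differentiable at t within \<Omega> \<inter> \<gamma> -` fst c'"
      unfolding has_derivative_curve_iff field_differentiable_def
      by (meson has_field_derivative_at_within)
  qed
  with cont assms(1) show ?thesis
    by (simp add: holo_curve_def)
qed

lemma holo_curve_preimage_open:
  assumes "holo_curve M \<Omega> \<gamma>" "openin (mtop M) W"
  shows "open {s \<in> \<Omega>. \<gamma> s \<in> W}"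
proof -
  have "openin (top_of_set \<Omega>) {s \<in> \<Omega>. \<gamma> s \<in> W}" "open \<Omega>"
    using assms by (auto simp: holo_curve_def continuous_map_def)
  then show ?thesis by (simp add: openin_open_eq)
qed

lemma holo_curve_points:
  assumes "holo_curve M \<Omega> \<gamma>" "t \<in> \<Omega>"
  shows "\<gamma> t \<in> points M"
  using assms by (auto simp: holo_curve_def continuous_map_def topspace_mtop Pi_iff)

lemma velocity_eqI:
  assumes "c \<in> charts_at M (\<gamma> t)" "((\<lambda>s. snd c (\<gamma> s)) has_derivative (\<lambda>h. h *s u)) (at t)"
  shows "velocity M \<gamma> t c = u"
  using assms unfolding has_derivative_curve_iff
  by (simp add: velocity_def vec_eq_iff DERIV_imp_deriv)

lemma holo_curveD:
  assumes "holo_curve M \<Omega> \<gamma>" "t \<in> \<Omega>" "c \<in> charts_at M (\<gamma> t)"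
  shows "((\<lambda>s. snd c (\<gamma> s)) has_derivative (\<lambda>h. h *s velocity M \<gamma> t c)) (at t)"
proof -
  have c: "c \<in> atlas M" "\<gamma> t \<in> fst c" using assms(3) by (auto simp: charts_at_def)
  have op: "open {s \<in> \<Omega>. \<gamma> s \<in> fst c}"
    by (rule holo_curve_preimage_open[OF assms(1) openin_chart[OF c(1)]])
  have "((\<lambda>s. snd c (\<gamma> s) $ i) has_field_derivative velocity M \<gamma> t c $ i) (at t)" for i
  proof -
    have "(\<lambda>s. snd c (\<gamma> s) $ i) holomorphic_on {s \<in> \<Omega>. \<gamma> s \<in> fst c}"
      using assms(1) c by (auto simp: holo_curve_def Int_def vimage_def)
    then have "(\<lambda>s. snd c (\<gamma> s) $ i) field_differentiable at t"
      using op c assms(2) by (auto intro: holomorphic_on_imp_differentiable_at)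
    then have "((\<lambda>s. snd c (\<gamma> s) $ i) has_field_derivative deriv (\<lambda>s. snd c (\<gamma> s) $ i) t) (at t)"
      by (simp add: DERIV_deriv_iff_field_differentiable)
    then show ?thesis using assms(3) by (simp add: velocity_def)
  qed
  then show ?thesis by (simp add: has_derivative_curve_iff)
qed

lemma velocity_tangent:
  assumes "holo_curve M \<Omega> \<gamma>" "t \<in> \<Omega>"
  shows "velocity M \<gamma> t \<in> tangent_space M (\<gamma> t)"
proof -
  obtain c where c: "c \<in> charts_at M (\<gamma> t)"
    using points_chart[OF holo_curve_points[OF assms]] by blast
  show ?thesis
  proof (rule tangentI[OF c])
    fix c'
    show "velocity M \<gamma> t c' = (if c' \<in> charts_at M (\<gamma> t) then jacobian_at c c' (\<gamma> t) *v velocity M \<gamma> t c else 0)"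
    proof (cases "c' \<in> charts_at M (\<gamma> t)")
      case True
      note ca = c[unfolded charts_at_def, simplified] True[unfolded charts_at_def, simplified]
      have op: "open ({s \<in> \<Omega>. \<gamma> s \<in> fst c})"
        by (rule holo_curve_preimage_open[OF assms(1) openin_chart]) (use ca in auto)
      have "((\<lambda>s. transition c c' (snd c (\<gamma> s))) has_derivative (\<lambda>h. h *s (jacobian_at c c' (\<gamma> t) *v velocity M \<gamma> t c))) (at t)"
        by (rule curve_chain_vec[OF holo_curveD[OF assms c] transition_has_derivative[OF c True]])
      then have "((\<lambda>s. snd c' (\<gamma> s)) has_derivative (\<lambda>h. h *s (jacobian_at c c' (\<gamma> t) *v velocity M \<gamma> t c))) (at t)"
        by (rule has_derivative_transform_within_open[OF _ op]) (use ca assms in auto)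
      then show ?thesis using True velocity_eqI by simp
    qed (simp add: velocity_def)
  qed
qed

subsection \<open>Compatible charts and holomorphic maps\<close>

text \<open>The source of the charts of the maximal atlas that \<open>reg_points\<close> asks for: a
  chart of the atlas followed by local biholomorphic coordinates \<open>\<phi>\<close> with inverse
  \<open>g\<close>. It straightens both the analytic spectrum and the discriminant.\<close>

lemma compatible_chartI:
  assumes c: "c \<in> atlas M" and W: "openin (mtop M) W" "W \<subseteq> fst c"
    and phi: "cholomorphic_vec (snd c ` W) \<phi>" and V: "open V" and g: "cholomorphic_vec V g"
    and img: "\<phi> ` snd c ` W = V" and gphi: "\<And>p. p \<in> W \<Longrightarrow> g (\<phi> (snd c p)) = snd c p"
  shows "compatible_chart M (W, \<phi> \<circ> snd c)"
proof -
  have inj: "inj_on (\<phi> \<circ> snd c) W"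
  proof (rule inj_onI)
    fix p q assume pq: "p \<in> W" "q \<in> W" "(\<phi> \<circ> snd c) p = (\<phi> \<circ> snd c) q"
    then have "snd c p = snd c q" using gphi by (metis comp_apply)
    then show "p = q" using pq W chart_inj[OF c] by (auto dest: inj_onD)
  qed
  have chi: "chart_inv (W, \<phi> \<circ> snd c) (\<phi> (snd c p)) = p" if "p \<in> W" for p
    using chart_inv_left[of "(W, \<phi> \<circ> snd c)" p] inj that by simp
  have h1: "holo_transition (W, \<phi> \<circ> snd c) c'" if c': "c' \<in> atlas M" for c'
  proof -
    have Wc: "openin (mtop M) (W \<inter> fst c')" using W(1) openin_chart[OF c'] by auto
    define S where "S = (\<phi> \<circ> snd c) ` (W \<inter> fst c')"
    have opc: "open (snd c ` (W \<inter> fst c'))"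
      using openin_chart_image[OF Wc c] W(2) by (simp add: Int_absorb1 Int_assoc[symmetric])
    have "S = V \<inter> g -` (snd c ` (W \<inter> fst c'))"
    proof
      show "S \<subseteq> V \<inter> g -` (snd c ` (W \<inter> fst c'))"
        using gphi img by (auto simp: S_def)
      show "V \<inter> g -` (snd c ` (W \<inter> fst c')) \<subseteq> S"
      proof
        fix w assume w: "w \<in> V \<inter> g -` (snd c ` (W \<inter> fst c'))"
        then obtain p where p: "p \<in> W" "w = \<phi> (snd c p)" using img by auto
        obtain q where q: "q \<in> W \<inter> fst c'" "g w = snd c q" using w by auto
        have "snd c p = snd c q" using p q gphi by simp
        then have "p = q" using p q W chart_inj[OF c] by (auto dest: inj_onD)
        then show "w \<in> S" using p q by (auto simp: S_def)
      qed
    qed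
    then have opS: "open S"
      using continuous_open_preimage[OF cholomorphic_vec_continuous_on[OF g] V opc] by simp
    have SV: "S \<subseteq> V" "g ` S \<subseteq> snd c ` (fst c \<inter> fst c')"
      using img W gphi by (auto simp: S_def)
    have "cholomorphic_vec S (transition c c' \<circ> g)"
      by (rule cholomorphic_vec_compose[OF opS overlap_open[OF c c'] cholomorphic_vec_subset[OF g SV(1)]
            transition_holo[OF c c'] SV(2)])
    moreover have "transition (W, \<phi> \<circ> snd c) c' w = (transition c c' \<circ> g) w" if "w \<in> S" for w
      using that chi gphi W c by (auto simp: S_def transition_def)
    ultimately have "cholomorphic_vec S (transition (W, \<phi> \<circ> snd c) c')"
      using cholomorphic_vec_cong by metis
    then show ?thesis
      by (simp add: holo_transition_def S_def)
  qed
  have h2: "holo_transition c' (W, \<phi> \<circ> snd c)" if c': "c' \<in> atlas M" for c'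
  proof -
    have op: "open (snd c' ` (fst c' \<inter> W))" by (rule openin_chart_image[OF W(1) c'])
    have opW: "open (snd c ` W)" using openin_chart_image[OF W(1) c] W(2) by (simp add: Int_absorb1)
    have "cholomorphic_vec (snd c' ` (fst c' \<inter> W)) (\<phi> \<circ> transition c' c)"
      by (rule cholomorphic_vec_compose[OF op opW cholomorphic_vec_subset[OF transition_holo[OF c' c]] phi])
         (use W c' in auto)
    moreover have "transition c' (W, \<phi> \<circ> snd c) w = (\<phi> \<circ> transition c' c) w" for w
      by (simp add: transition_def)
    ultimately have "cholomorphic_vec (snd c' ` (fst c' \<inter> W)) (transition c' (W, \<phi> \<circ> snd c))"
      using cholomorphic_vec_cong[of _ "transition c' (W, \<phi> \<circ> snd c)"] by blast
    then show ?thesis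
      by (simp add: holo_transition_def)
  qed
  show ?thesis
    unfolding compatible_chart_def
    using W(1) inj V img h1 h2 by (simp add: image_comp coords_UNIV)
qed

text \<open>A local criterion with one pair of charts of free choice; \<open>holo_mapI\<close>
  passes from it to all pairs.\<close>

definition holo_at :: "('a \<Rightarrow> 'a) \<Rightarrow> 'a \<Rightarrow> bool" where
  "holo_at \<theta> p \<longleftrightarrow> (\<exists>c d W. c \<in> atlas M \<and> d \<in> atlas M \<and> openin (mtop M) W \<and> p \<in> W \<and> W \<subseteq> fst c \<and> \<theta> ` W \<subseteq> fst d \<and>
     cholomorphic_vec (snd c ` W) (snd d \<circ> \<theta> \<circ> chart_inv c))"

lemma holo_mapI:
  assumes W: "openin (mtop M) W" and h: "\<And>p. p \<in> W \<Longrightarrow> holo_at \<theta> p"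
  shows "holo_map M W M \<theta>"
proof -
  have tW: "topspace (subtopology (mtop M) W) = W" using openin_subset[OF W] by auto
  have cont: "continuous_map (subtopology (mtop M) W) (mtop M) \<theta>"
  proof (rule continuous_map_localI)
    fix p assume "p \<in> topspace (subtopology (mtop M) W)"
    then obtain c d U where *: "c \<in> atlas M" "d \<in> atlas M" "openin (mtop M) U" "p \<in> U" "U \<subseteq> fst c" "\<theta> ` U \<subseteq> fst d"
       "cholomorphic_vec (snd c ` U) (snd d \<circ> \<theta> \<circ> chart_inv c)" "p \<in> W"
      using h[of p] tW unfolding holo_at_def by blast
    have tU: "topspace (subtopology (mtop M) U) = U" using openin_subset[OF *(3)] by auto
    have "continuous_map (subtopology (mtop M) U) (mtop M) \<theta>"
    proof (rule continuous_into_chart[OF *(2)])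
      have "continuous_map (subtopology (mtop M) U) (top_of_set (snd c ` U)) (snd c)"
        using continuous_map_from_subtopology_mono[OF continuous_map_chart[OF *(1)] *(5)]
        by (auto simp: continuous_map_in_subtopology)
      moreover have "continuous_map (top_of_set (snd c ` U)) euclidean (snd d \<circ> \<theta> \<circ> chart_inv c)"
        using cholomorphic_vec_continuous_on[OF *(7)] by simp
      ultimately have "continuous_map (subtopology (mtop M) U) euclidean ((snd d \<circ> \<theta> \<circ> chart_inv c) \<circ> snd c)"
        by (rule continuous_map_compose)
      then show "continuous_map (subtopology (mtop M) U) euclidean (\<lambda>x. snd d (\<theta> x))"
        by (rule continuous_map_eq) (use * tU in auto)
    qed (use * in auto)
    then have "continuous_map (subtopology (mtop M) (W \<inter> U)) (mtop M) \<theta>"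
      by (rule continuous_map_from_subtopology_mono) auto
    then show "\<exists>O'. openin (subtopology (mtop M) W) O' \<and> p \<in> O' \<and>
        continuous_map (subtopology (subtopology (mtop M) W) O') (mtop M) \<theta>"
      using * W by (intro exI[of _ "W \<inter> U"])
        (auto simp: subtopology_subtopology Int_absorb1 Int_assoc[symmetric] openin_open_subtopology)
  qed
  have "cholomorphic_vec (snd c' ` (fst c' \<inter> W \<inter> \<theta> -` fst d')) (snd d' \<circ> \<theta> \<circ> chart_inv c')"
    if c': "c' \<in> atlas M" and d': "d' \<in> atlas M" for c' d'
  proof (rule cholomorphic_vecI)
    have "\<exists>A. ((snd d' \<circ> \<theta> \<circ> chart_inv c') has_derivative (*v) A) (at z)"
      if z: "z \<in> snd c' ` (fst c' \<inter> W \<inter> \<theta> -` fst d')" for z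
    proof -
      obtain p where p: "z = snd c' p" "p \<in> fst c'" "p \<in> W" "\<theta> p \<in> fst d'" using z by auto
      obtain c d U where *: "c \<in> atlas M" "d \<in> atlas M" "openin (mtop M) U" "p \<in> U" "U \<subseteq> fst c" "\<theta> ` U \<subseteq> fst d"
       "cholomorphic_vec (snd c ` U) (snd d \<circ> \<theta> \<circ> chart_inv c)"
        using h[OF p(3)] unfolding holo_at_def by blast
      have opU: "open (snd c ` U)" using openin_chart_image[OF *(3,1)] *(5) by (simp add: Int_absorb1)
      have ch: "c \<in> charts_at M p" "c' \<in> charts_at M p" "d \<in> charts_at M (\<theta> p)" "d' \<in> charts_at M (\<theta> p)"
        using * p c' d' by (auto simp: charts_at_def)
      have D1: "(transition c' c has_derivative (*v) (jacobian_at c' c p)) (at z)"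
        using transition_has_derivative[OF ch(2,1)] p by simp
      obtain B where B: "((snd d \<circ> \<theta> \<circ> chart_inv c) has_derivative (*v) B) (at (transition c' c z))"
        using cholomorphic_vecD[OF opU *(7), of "snd c p"] p * c' by auto
      have D2: "(transition d d' has_derivative (*v) (jacobian_at d d' (\<theta> p))) (at ((snd d \<circ> \<theta> \<circ> chart_inv c) (transition c' c z)))"
        using transition_has_derivative[OF ch(3,4)] p * c' by auto
      have D: "((\<lambda>w. transition d d' ((snd d \<circ> \<theta> \<circ> chart_inv c) (transition c' c w))) has_derivative
          (\<lambda>v. jacobian_at d d' (\<theta> p) *v (B *v (jacobian_at c' c p *v v)))) (at z)"
        by (rule has_derivative_compose[OF has_derivative_compose[OF D1 B] D2])
      define U' where "U' = {x \<in> W. \<theta> x \<in> fst d'} \<inter> (U \<inter> fst c')"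
      have "openin (subtopology (mtop M) W) {x \<in> W. \<theta> x \<in> fst d'}"
        using openin_continuous_map_preimage[OF cont openin_chart[OF d']] unfolding tW .
      then have U': "openin (mtop M) U'" "p \<in> U'"
        using W * p openin_chart[OF c'] by (auto simp: U'_def openin_open_subtopology)
      have op': "open (snd c' ` U')"
        using openin_chart_image[OF U'(1) c'] by (simp add: U'_def Int_ac)
      have "((snd d' \<circ> \<theta> \<circ> chart_inv c') has_derivative
          (\<lambda>v. jacobian_at d d' (\<theta> p) *v (B *v (jacobian_at c' c p *v v)))) (at z)"
      proof (rule has_derivative_transform_within_open[OF D op'])
        show "z \<in> snd c' ` U'" using p U' by auto
        fix w assume "w \<in> snd c' ` U'"
        then obtain x where x: "w = snd c' x" "x \<in> U'" by auto
        then have "\<theta> x \<in> fst d" "x \<in> fst c" "x \<in> fst c'" "\<theta> x \<in> fst d'" using * by (auto simp: U'_def)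
        then show "transition d d' ((snd d \<circ> \<theta> \<circ> chart_inv c) (transition c' c w)) = (snd d' \<circ> \<theta> \<circ> chart_inv c') w"
          using x * c' by auto
      qed
      then show ?thesis by (auto simp: matrix_vector_mul_assoc)
    qed
    then show "\<And>z. z \<in> snd c' ` (fst c' \<inter> W \<inter> \<theta> -` fst d') \<Longrightarrow>
      ((snd d' \<circ> \<theta> \<circ> chart_inv c') has_derivative (*v) (SOME A. ((snd d' \<circ> \<theta> \<circ> chart_inv c') has_derivative (*v) A) (at z))) (at z)"
      by (rule someI_ex)
  qed
  with cont show ?thesis by (simp add: holo_map_def)
qed

lemma holo_map_preimage_open:
  assumes "holo_map M W M \<theta>" "openin (mtop M) W" "openin (mtop M) U"
  shows "openin (mtop M) {x \<in> W. \<theta> x \<in> U}"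
proof -
  have tW: "topspace (subtopology (mtop M) W) = W" using openin_subset[OF assms(2)] by auto
  have "openin (subtopology (mtop M) W) {x \<in> W. \<theta> x \<in> U}"
    using openin_continuous_map_preimage[OF _ assms(3), of "subtopology (mtop M) W" \<theta>] assms(1)
    unfolding tW holo_map_def by blast
  then show ?thesis using assms(2) by (simp add: openin_open_subtopology)
qed

lemma holo_map_points:
  assumes "holo_map M W M \<theta>" "openin (mtop M) W" "x \<in> W"
  shows "\<theta> x \<in> points M"
  using assms openin_subset[OF assms(2)] by (auto simp: holo_map_def continuous_map_def topspace_mtop Pi_iff)

lemma holo_map_chartD:
  assumes "holo_map M W M \<theta>" "openin (mtop M) W" "p \<in> W" "c \<in> charts_at M p" "d \<in> charts_at M (\<theta> p)"
  defines "U \<equiv> {x \<in> W. \<theta> x \<in> fst d} \<inter> fst c"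
  shows "openin (mtop M) U" "p \<in> U" "open (snd c ` U)" "cholomorphic_vec (snd c ` U) (snd d \<circ> \<theta> \<circ> chart_inv c)"
proof -
  have cd: "c \<in> atlas M" "d \<in> atlas M" using assms by (auto simp: charts_at_def)
  show U: "openin (mtop M) U"
    unfolding U_def using holo_map_preimage_open[OF assms(1,2) openin_chart[OF cd(2)]] openin_chart[OF cd(1)] by auto
  show "p \<in> U" using assms by (auto simp: U_def charts_at_def)
  show "open (snd c ` U)" using openin_chart_image[OF U cd(1)] by (simp add: U_def Int_ac)
  have "U = fst c \<inter> W \<inter> \<theta> -` fst d" by (auto simp: U_def)
  then show "cholomorphic_vec (snd c ` U) (snd d \<circ> \<theta> \<circ> chart_inv c)"
    using assms(1) cd by (simp add: holo_map_def)
qed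

lemma holo_map_compose:
  assumes \<theta>: "holo_map M W M \<theta>" "openin (mtop M) W" and \<kappa>: "holo_map M V M \<kappa>" "openin (mtop M) V"
  shows "holo_map M {x \<in> W. \<theta> x \<in> V} M (\<lambda>x. \<kappa> (\<theta> x))"
proof (rule holo_mapI)
  show op: "openin (mtop M) {x \<in> W. \<theta> x \<in> V}" by (rule holo_map_preimage_open[OF \<theta> \<kappa>(2)])
  fix p assume p: "p \<in> {x \<in> W. \<theta> x \<in> V}"
  have "p \<in> points M" using p openin_subset[OF \<theta>(2)] by (auto simp: topspace_mtop)
  then obtain c where c: "c \<in> charts_at M p" using points_chart by blast
  obtain d where d: "d \<in> charts_at M (\<theta> p)" using p holo_map_points[OF \<theta>] points_chart by blast
  obtain d' where d': "d' \<in> charts_at M (\<kappa> (\<theta> p))" using p holo_map_points[OF \<kappa>] points_chart by blast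
  have pW: "p \<in> W" "\<theta> p \<in> V" using p by auto
  define U where "U = {x \<in> W. \<theta> x \<in> fst d} \<inter> fst c"
  define U2 where "U2 = {x \<in> V. \<kappa> x \<in> fst d'} \<inter> fst d"
  note A = holo_map_chartD[OF \<theta> pW(1) c d, folded U_def]
  note B = holo_map_chartD[OF \<kappa> pW(2) d d', folded U2_def]
  have ca: "c \<in> atlas M" "d \<in> atlas M" "d' \<in> atlas M" using c d d' by (auto simp: charts_at_def)
  define U3 where "U3 = U \<inter> {x \<in> W. \<theta> x \<in> U2}"
  have U3: "openin (mtop M) U3" unfolding U3_def using A(1) holo_map_preimage_open[OF \<theta> B(1)] by auto
  have op3: "open (snd c ` U3)" using openin_chart_image[OF U3 ca(1)] by (simp add: U3_def U_def Int_ac)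
  have "cholomorphic_vec (snd c ` U3) ((snd d' \<circ> \<kappa> \<circ> chart_inv d) \<circ> (snd d \<circ> \<theta> \<circ> chart_inv c))"
    by (rule cholomorphic_vec_compose[OF op3 B(3) cholomorphic_vec_subset[OF A(4)] B(4)])
       (use ca in \<open>auto simp: U3_def U_def\<close>)
  moreover have "((snd d' \<circ> \<kappa> \<circ> chart_inv d) \<circ> (snd d \<circ> \<theta> \<circ> chart_inv c)) w = (snd d' \<circ> (\<lambda>x. \<kappa> (\<theta> x)) \<circ> chart_inv c) w"
    if "w \<in> snd c ` U3" for w
    using that ca by (auto simp: U3_def U_def)
  ultimately have "cholomorphic_vec (snd c ` U3) (snd d' \<circ> (\<lambda>x. \<kappa> (\<theta> x)) \<circ> chart_inv c)"
    by (rule cholomorphic_vec_cong[THEN iffD1, rotated])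
  then show "holo_at (\<lambda>x. \<kappa> (\<theta> x)) p"
    unfolding holo_at_def using ca U3 A(2) B(2) pW
    by (intro exI[of _ c] exI[of _ d'] exI[of _ U3]) (auto simp: U3_def U_def U2_def)
qed

end

subsection \<open>The cotangent bundle\<close>

text \<open>Vectors over the sum index type of the cotangent charts are treated as pairs: the
  \<open>Inl\<close> part is the base point, the \<open>Inr\<close> part the covector.\<close>

definition joinv :: "complex^'k::finite \<Rightarrow> complex^'l::finite \<Rightarrow> complex^('k + 'l)" where
  "joinv a b = (\<chi> k. case k of Inl i \<Rightarrow> a $ i | Inr i \<Rightarrow> b $ i)"

definition fstv :: "complex^('k::finite + 'l::finite) \<Rightarrow> complex^'k" where
  "fstv w = (\<chi> i. w $ Inl i)"

definition sndv :: "complex^('k::finite + 'l::finite) \<Rightarrow> complex^'l" where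
  "sndv w = (\<chi> i. w $ Inr i)"

lemma fstv_joinv [simp]: "fstv (joinv a b) = a"
  and sndv_joinv [simp]: "sndv (joinv a b) = b"
  and joinv_fstv_sndv [simp]: "joinv (fstv w) (sndv w) = w"
  by (auto simp: fstv_def sndv_def joinv_def vec_eq_iff split: sum.split)

lemma joinv_nth [simp]: "joinv a b $ Inl i = a $ i" "joinv a b $ Inr j = b $ j"
  by (auto simp: joinv_def)

lemma fstv_nth [simp]: "fstv w $ i = w $ Inl i"
  and sndv_nth [simp]: "sndv w $ j = w $ Inr j"
  by (auto simp: fstv_def sndv_def)

lemma joinv_eq_iff [simp]: "joinv a b = joinv a' b' \<longleftrightarrow> a = a' \<and> b = b'"
  by (metis fstv_joinv sndv_joinv)

lemma cholomorphic_vec_fstv [simp]: "cholomorphic_vec S fstv"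
  and cholomorphic_vec_sndv [simp]: "cholomorphic_vec S sndv"
  by (auto simp: cholomorphic_vec_def)

lemma cholomorphic_vec_joinv:
  assumes "cholomorphic_vec S f" "cholomorphic_vec S g"
  shows "cholomorphic_vec S (\<lambda>z. joinv (f z) (g z))"
proof -
  have "cholomorphic S (\<lambda>z. joinv (f z) (g z) $ k)" for k
    using assms by (cases k) (auto simp: cholomorphic_vec_def)
  then show ?thesis by (simp add: cholomorphic_vec_def)
qed

lemma continuous_on_fstv [continuous_intros]:
  assumes "continuous_on S f" shows "continuous_on S (\<lambda>x. fstv (f x))"
  using assms unfolding fstv_def by (intro continuous_on_vec_lambda continuous_intros)

lemma continuous_on_sndv [continuous_intros]:
  assumes "continuous_on S f" shows "continuous_on S (\<lambda>x. sndv (f x))"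
  using assms unfolding sndv_def by (intro continuous_on_vec_lambda continuous_intros)

lemma continuous_on_joinv [continuous_intros]:
  assumes "continuous_on S f" "continuous_on S g"
  shows "continuous_on S (\<lambda>x. joinv (f x) (g x))"
proof -
  have "continuous_on S (\<lambda>x. joinv (f x) (g x) $ k)" for k
    using assms by (cases k) (auto intro: continuous_intros)
  then show ?thesis
    using continuous_on_vec_lambda[of S "\<lambda>k x. joinv (f x) (g x) $ k"] by simp
qed

lemma open_fstv_vimage: "open A \<Longrightarrow> open {w. fstv w \<in> A}"
  using open_vimage[of A fstv] continuous_on_fstv[OF continuous_on_id, of UNIV] by (simp add: vimage_def)

context full_atlas
begin

lemma cotangent_chart_eq:
  "cotangent_chart M c = ({(p, l). p \<in> fst c \<and> l \<in> cotangent_space M p},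
     \<lambda>(p, l). joinv (snd c p) (covec_coords M c p l))"
  by (auto simp: cotangent_chart_def coords_UNIV joinv_def covec_coords_def fun_eq_iff vec_eq_iff split: sum.split)

lemma fst_cotangent_chart [simp]: "x \<in> fst (cotangent_chart M c) \<longleftrightarrow> fst x \<in> fst c \<and> snd x \<in> cotangent_space M (fst x)"
  by (auto simp: cotangent_chart_eq)

lemma snd_cotangent_chart [simp]: "snd (cotangent_chart M c) x = joinv (snd c (fst x)) (covec_coords M c (fst x) (snd x))"
  by (auto simp: cotangent_chart_eq split: prod.split)

lemma atlas_cotangent: "atlas (cotangent_bundle M) = cotangent_chart M ` atlas M"
  by (simp add: cotangent_bundle_def)

lemma cotangent_chart_image:
  assumes "c \<in> atlas M" "c' \<in> atlas M"
  shows "snd (cotangent_chart M c) ` (fst (cotangent_chart M c) \<inter> fst (cotangent_chart M c')) =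
    {w. fstv w \<in> snd c ` (fst c \<inter> fst c')}"
proof
  show "{w. fstv w \<in> snd c ` (fst c \<inter> fst c')} \<subseteq>
    snd (cotangent_chart M c) ` (fst (cotangent_chart M c) \<inter> fst (cotangent_chart M c'))"
  proof
    fix w :: "complex^('k + 'k)" assume "w \<in> {w. fstv w \<in> snd c ` (fst c \<inter> fst c')}"
    then obtain p where p: "fstv w = snd c p" "p \<in> fst c" "p \<in> fst c'" by auto
    then have ch: "c \<in> charts_at M p" using assms by (simp add: charts_at_def)
    have "w = snd (cotangent_chart M c) (p, covec_of M c p (sndv w))"
      using ch p(1) by (simp flip: p(1))
    moreover have "(p, covec_of M c p (sndv w)) \<in> fst (cotangent_chart M c) \<inter> fst (cotangent_chart M c')"
      using p ch by simp
    ultimately show "w \<in> snd (cotangent_chart M c) ` (fst (cotangent_chart M c) \<inter> fst (cotangent_chart M c'))"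
      by blast
  qed
qed auto

lemma cotangent_chart_inj: "c \<in> atlas M \<Longrightarrow> inj_on (snd (cotangent_chart M c)) (fst (cotangent_chart M c))"
proof (rule inj_onI)
  fix x y assume c: "c \<in> atlas M" and x: "x \<in> fst (cotangent_chart M c)" and y: "y \<in> fst (cotangent_chart M c)"
    and eq: "snd (cotangent_chart M c) x = snd (cotangent_chart M c) y"
  have e: "snd c (fst x) = snd c (fst y)" "covec_coords M c (fst x) (snd x) = covec_coords M c (fst y) (snd y)"
    and m: "fst x \<in> fst c" "fst y \<in> fst c" "snd x \<in> cotangent_space M (fst x)" "snd y \<in> cotangent_space M (fst y)"
    using eq x y by simp_all
  have "fst x = fst y" by (rule inj_onD[OF chart_inj[OF c] e(1) m(1,2)])
  have ch: "c \<in> charts_at M (fst x)" "c \<in> charts_at M (fst y)" using m c by (simp_all add: charts_at_def)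
  have "snd x = covec_of M c (fst x) (covec_coords M c (fst x) (snd x))"
    using m ch by simp
  also have "\<dots> = covec_of M c (fst y) (covec_coords M c (fst y) (snd y))"
    using e(2) \<open>fst x = fst y\<close> by simp
  also have "\<dots> = snd y"
    using m ch by simp
  finally have "snd x = snd y" .
  with \<open>fst x = fst y\<close> show "x = y" by (simp add: prod_eq_iff)
qed

lemma cotangent_chart_inv:
  assumes "c \<in> atlas M" "p \<in> fst c"
  shows "chart_inv (cotangent_chart M c) (joinv (snd c p) y) = (p, covec_of M c p y)"
proof -
  have ch: "c \<in> charts_at M p" using assms by (simp add: charts_at_def)
  show ?thesis
    using chart_inv_left[OF cotangent_chart_inj[OF assms(1)], of "(p, covec_of M c p y)"] ch assms by simp
qed

text \<open>The covector part of a transition map contains the Jacobian of a transition map of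
  \<open>M\<close>; it is holomorphic because derivatives of holomorphic functions are.\<close>

lemma full_atlas_cotangent: "full_atlas (cotangent_bundle M)"
proof
  show "coords (cotangent_bundle M) = UNIV"
    by (simp add: cotangent_bundle_def coords_UNIV)
  fix C assume "C \<in> atlas (cotangent_bundle M)"
  then obtain c where c: "C = cotangent_chart M c" "c \<in> atlas M" by (auto simp: atlas_cotangent)
  show "inj_on (snd C) (fst C)" using cotangent_chart_inj c by simp
  fix C' assume "C' \<in> atlas (cotangent_bundle M)"
  then obtain c' where c': "C' = cotangent_chart M c'" "c' \<in> atlas M" by (auto simp: atlas_cotangent)
  let ?S = "{w :: complex^('k + 'k). fstv w \<in> snd c ` (fst c \<inter> fst c')}"
  have img: "snd C ` (fst C \<inter> fst C') = ?S" using cotangent_chart_image c c' by simp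
  have opS: "open ?S" by (rule open_fstv_vimage[OF overlap_open[OF c(2) c'(2)]])
  show "open (snd C ` (fst C \<inter> fst C'))" unfolding img by (rule opS)
  have tr: "cholomorphic_vec ?S (\<lambda>w. transition c c' (fstv w))"
    using cholomorphic_vec_compose[OF opS overlap_open[OF c(2) c'(2)] _ transition_holo[OF c(2) c'(2)], of fstv]
    by (auto simp: o_def)
  have "cholomorphic ?S (\<lambda>w. cjac (transition c' c) (transition c c' (fstv w)) $ k $ i)" for k i
  proof -
    have "cholomorphic (snd c' ` (fst c' \<inter> fst c)) (\<lambda>z. cgrad (\<lambda>w. transition c' c w $ k) z $ i)"
      using cholomorphic_cgrad[OF overlap_open[OF c'(2) c(2)], of "\<lambda>w. transition c' c w $ k"] transition_holo[OF c'(2) c(2)]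
      by (auto simp: cholomorphic_vec_def)
    moreover have "(\<lambda>w. transition c c' (fstv w)) ` ?S \<subseteq> snd c' ` (fst c' \<inter> fst c)"
      using c(2) by auto
    ultimately show ?thesis
      using cholomorphic_compose_vec[OF opS overlap_open[OF c'(2) c(2)] tr]
      by (simp add: cjac_def o_def)
  qed
  then have "cholomorphic_vec ?S (\<lambda>w. sndv w v* cjac (transition c' c) (transition c c' (fstv w)))"
    unfolding cholomorphic_vec_def vector_matrix_mult_def
    by (auto intro!: cholomorphic_sum cholomorphic_mult)
  then have hol: "cholomorphic_vec ?S (\<lambda>w. joinv (transition c c' (fstv w)) (sndv w v* cjac (transition c' c) (transition c c' (fstv w))))"
    using tr by (rule cholomorphic_vec_joinv[rotated])
  have "transition C C' w = joinv (transition c c' (fstv w)) (sndv w v* cjac (transition c' c) (transition c c' (fstv w)))"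
    if w: "w \<in> ?S" for w
  proof -
    obtain p where p: "fstv w = snd c p" "p \<in> fst c" "p \<in> fst c'" using w by auto
    then have ch: "c \<in> charts_at M p" "c' \<in> charts_at M p" using c c' by (simp_all add: charts_at_def)
    have "chart_inv C w = (p, covec_of M c p (sndv w))"
      using cotangent_chart_inv[OF c(2) p(2), of "sndv w"] c p(1)[symmetric] by simp
    then have "transition C C' w = joinv (snd c' p) (covec_coords M c' p (covec_of M c p (sndv w)))"
      by (simp add: transition_def c' del: covec_of_covec_coords)
    also have "covec_coords M c' p (covec_of M c p (sndv w)) = sndv w v* jacobian_at c' c p"
      using covec_coords_transform[OF covec_of_in[OF ch(1)] ch, of "sndv w"] ch by simp
    finally show ?thesis using p c by (simp add: jacobian_at_def)
  qed
  then show "cholomorphic_vec (snd C ` (fst C \<inter> fst C')) (transition C C')"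
    unfolding img by (rule cholomorphic_vec_cong[THEN iffD2, OF _ hol])
qed

end

section \<open>The analytic spectrum in coordinates\<close>

lemma full_atlasI:
  assumes "complex_manifold M" "coords M = UNIV"
  shows "full_atlas M"
proof
  show "coords M = UNIV" by fact
  show "inj_on (snd c) (fst c)" if "c \<in> atlas M" for c
    using assms(1) that by (auto simp: complex_manifold_def)
  fix c c' assume c: "c \<in> atlas M" "c' \<in> atlas M"
  then have "openin (top_of_set (coord_space (coords M))) (snd c ` (fst c \<inter> fst c')) \<and> holo_transition c c'"
    using assms(1) by (simp add: complex_manifold_def)
  then show "open (snd c ` (fst c \<inter> fst c'))" "cholomorphic_vec (snd c ` (fst c \<inter> fst c')) (transition c c')"
    by (simp_all add: assms(2) holo_transition_def)
qed

locale generated_F_manifold =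
  fixes M :: "('a, 'n::finite) cmanifold"
    and m :: "('a, 'n) tmult"
    and e :: "'a \<Rightarrow> ('a, 'n) tvec"
    and F :: "'a \<times> ('a, 'n) covec \<Rightarrow> complex"
  assumes massive: "massive_F_manifold M m e"
    and generating: "generating_function M m e F"

sublocale generated_F_manifold \<subseteq> full_atlas M
  using massive by (intro full_atlasI) (auto simp: massive_F_manifold_def F_manifold_def)

sublocale generated_F_manifold \<subseteq> T: full_atlas "cotangent_bundle M"
  by (rule full_atlas_cotangent)

context generated_F_manifold
begin

definition star :: "('a, 'n) chart \<Rightarrow> 'a \<Rightarrow> complex^'n \<Rightarrow> complex^'n \<Rightarrow> complex^'n" where
  "star c p u w = m p (tvec_of M c p u) (tvec_of M c p w) c"

definition L :: "('a \<times> ('a, 'n) covec) set" where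
  "L = analytic_spectrum M m e"

definition Fvals :: "'a \<Rightarrow> complex set" where
  "Fvals p = F ` {x \<in> L. fst x = p}"

definition Fcoord :: "('a, 'n) chart \<Rightarrow> 'a \<Rightarrow> complex^'n \<Rightarrow> complex" where
  "Fcoord c p y = F (p, covec_of M c p y)"

abbreviation chars :: "('a, 'n) chart \<Rightarrow> 'a \<Rightarrow> (complex^'n) set" where
  "chars c p \<equiv> cn_algebra.characters (star c p) (e p c)"

lemma F_man: "F_manifold M m e"
  using massive by (simp add: massive_F_manifold_def)

lemma m_props:
  assumes "p \<in> points M" "u \<in> tangent_space M p" "v \<in> tangent_space M p" "w \<in> tangent_space M p"
  shows "m p u v \<in> tangent_space M p" "m p (u + v) w = m p u w + m p v w"
    "m p (tscale a u) v = tscale a (m p u v)" "m p u v = m p v u" "m p (m p u v) w = m p u (m p v w)"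
    "m p (e p) u = u"
proof -
  note h = F_man[unfolded F_manifold_def, THEN conjunct2, THEN conjunct2, THEN conjunct2, THEN conjunct1,
      THEN bspec, OF assms(1), THEN bspec, OF assms(2), THEN bspec, OF assms(3), THEN bspec, OF assms(4)]
  show "m p u v \<in> tangent_space M p" by (rule h[THEN conjunct1])
  show "m p (u + v) w = m p u w + m p v w" by (rule h[THEN conjunct2, THEN conjunct1])
  show "m p (tscale a u) v = tscale a (m p u v)" by (rule h[THEN conjunct2, THEN conjunct2, THEN conjunct1, THEN spec])
  show "m p u v = m p v u" by (rule h[THEN conjunct2, THEN conjunct2, THEN conjunct2, THEN conjunct1])
  show "m p (m p u v) w = m p u (m p v w)"
    by (rule h[THEN conjunct2, THEN conjunct2, THEN conjunct2, THEN conjunct2, THEN conjunct1])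
  show "m p (e p) u = u" by (rule h[THEN conjunct2, THEN conjunct2, THEN conjunct2, THEN conjunct2, THEN conjunct2])
qed

lemma mult_field:
  assumes "openin (mtop M) W" "vector_field M W X" "vector_field M W Y"
  shows "vector_field M W (\<lambda>p. m p (X p) (Y p))"
  by (rule F_man[unfolded F_manifold_def, THEN conjunct2, THEN conjunct2, THEN conjunct2, THEN conjunct2, THEN conjunct1,
      THEN spec, THEN spec, THEN spec, THEN mp]) (intro conjI assms)

lemma charts_at_points: "c \<in> charts_at M p \<Longrightarrow> p \<in> points M"
  by (auto simp: charts_at_def points_def)

lemma e_field: "vector_field M (points M) e"
  using F_man by (simp add: F_manifold_def)

lemma e_tangent: "p \<in> points M \<Longrightarrow> e p \<in> tangent_space M p"
  using e_field by (simp add: vector_field_def)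

lemma e_holomorphic: "c \<in> atlas M \<Longrightarrow> cholomorphic_vec (snd c ` fst c) (\<lambda>z. e (chart_inv c z) c)"
proof -
  assume c: "c \<in> atlas M"
  then have "cholomorphic_vec (snd c ` (fst c \<inter> points M)) (\<lambda>z. e (chart_inv c z) c)"
    using e_field by (simp add: vector_field_def)
  then show ?thesis using chart_subset[OF c] by (simp add: Int_absorb2)
qed

lemma tvec_of_star:
  assumes "c \<in> charts_at M p"
  shows "tvec_of M c p (star c p u w) = m p (tvec_of M c p u) (tvec_of M c p w)"
  unfolding star_def using assms charts_at_points
  by (intro tangent_eq_tvec_of m_props) (auto intro: tvec_of_in)

lemma algebra_at:
  assumes c: "c \<in> charts_at M p"
  shows "cn_algebra (star c p) (e p c)"
proof
  note p = charts_at_points[OF c]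
  note t = tvec_of_in[OF c]
  fix u v w :: "complex^'n" and a
  show "star c p (u + v) w = star c p u w + star c p v w"
    by (simp add: star_def tvec_of_add[OF c] m_props[OF p t t t])
  show "star c p (a *s u) w = a *s star c p u w"
    by (simp add: star_def tvec_of_scale[OF c] m_props(3)[OF p t t t]) (simp add: tscale_def)
  show "star c p u v = star c p v u"
    by (simp add: star_def m_props(4)[OF p t t t])
  show "star c p (star c p u v) w = star c p u (star c p v w)"
  proof -
    have "star c p (star c p u v) w = m p (m p (tvec_of M c p u) (tvec_of M c p v)) (tvec_of M c p w) c"
      by (simp only: star_def[of c p "star c p u v"] tvec_of_star[OF c])
    moreover have "star c p u (star c p v w) = m p (tvec_of M c p u) (m p (tvec_of M c p v) (tvec_of M c p w)) c"
      by (simp only: star_def[of c p u "star c p v w"] tvec_of_star[OF c])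
    ultimately show ?thesis by (simp only: m_props(5)[OF p t t t])
  qed
  show "star c p (e p c) u = u"
    using m_props(6)[OF p t[of u] t[of u] t[of u]] by (simp add: star_def tangent_eq_tvec_of[OF e_tangent[OF p] c] tvec_of_self[OF c])
qed

text \<open>In another chart the components of a coordinate field are a column of the Jacobian of
  the transition map, whence \<open>cholomorphic_cgrad\<close>.\<close>

lemma coord_field: "c \<in> atlas M \<Longrightarrow> vector_field M (fst c) (\<lambda>p. coord_vec M c p i)"
  unfolding vector_field_def
proof (intro conjI ballI)
  assume c: "c \<in> atlas M"
  show "coord_vec M c p i \<in> tangent_space M p" if "p \<in> fst c" for p
    using that c by (simp add: coord_vec_eq charts_at_def)
  fix c' assume c': "c' \<in> atlas M"
  let ?S = "snd c' ` (fst c' \<inter> fst c)"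
  have "cholomorphic ?S (\<lambda>z. coord_vec M c (chart_inv c' z) i c' $ k)" for k
  proof -
    have "cholomorphic (snd c ` (fst c \<inter> fst c')) (\<lambda>z. cgrad (\<lambda>w. transition c c' w $ k) z $ i)"
      using cholomorphic_cgrad[OF overlap_open[OF c c'], of "\<lambda>w. transition c c' w $ k"] transition_holo[OF c c']
      by (auto simp: cholomorphic_vec_def)
    then have "cholomorphic ?S ((\<lambda>z. cgrad (\<lambda>w. transition c c' w $ k) z $ i) \<circ> transition c' c)"
      by (rule cholomorphic_compose_vec[OF overlap_open[OF c' c] overlap_open[OF c c'] transition_holo[OF c' c]])
         (use c' in auto)
    moreover have "((\<lambda>z. cgrad (\<lambda>w. transition c c' w $ k) z $ i) \<circ> transition c' c) z = coord_vec M c (chart_inv c' z) i c' $ k"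
      if z: "z \<in> ?S" for z
    proof -
      obtain p where p: "z = snd c' p" "p \<in> fst c'" "p \<in> fst c" using z by auto
      then have "c \<in> charts_at M p" "c' \<in> charts_at M p" using c c' by (simp_all add: charts_at_def)
      then show ?thesis using p c c'
        by (simp add: coord_vec_eq tvec_of_apply matrix_vector_cdot jacobian_at_def cjac_def)
    qed
    ultimately show ?thesis by (rule cholomorphic_cong[THEN iffD1, rotated])
  qed
  then show "cholomorphic_vec ?S (\<lambda>z. coord_vec M c (chart_inv c' z) i c')"
    by (simp add: cholomorphic_vec_def)
qed

text \<open>The structure constants are the components of a product of two coordinate fields, which
  is a holomorphic field by the assumption on the multiplication of fields.\<close>

lemma structure_holomorphic:
  assumes c: "c \<in> atlas M"
  shows "cholomorphic_vec (snd c ` fst c) (\<lambda>z. star c (chart_inv c z) (axis i 1) (axis j 1))"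
proof -
  have "vector_field M (fst c) (\<lambda>p. m p (coord_vec M c p i) (coord_vec M c p j))"
    by (rule mult_field[OF openin_chart[OF c] coord_field[OF c] coord_field[OF c]])
  then have "cholomorphic_vec (snd c ` (fst c \<inter> fst c)) (\<lambda>z. m (chart_inv c z) (coord_vec M c (chart_inv c z) i) (coord_vec M c (chart_inv c z) j) c)"
    unfolding vector_field_def using c by blast
  then show ?thesis
    by (simp add: star_def coord_vec_eq)
qed

lemma star_expand:
  assumes "c \<in> charts_at M p"
  shows "star c p u w = (\<Sum>i\<in>UNIV. \<Sum>j\<in>UNIV. (u $ i * w $ j) *s star c p (axis i 1) (axis j 1))"
proof -
  interpret cn_algebra "star c p" "e p c" by (rule algebra_at[OF assms])
  have "star c p u w = star c p (\<Sum>i\<in>UNIV. u $ i *s axis i 1) (\<Sum>i\<in>UNIV. w $ i *s axis i 1)"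
    by (simp only: basis_expansion)
  also have "\<dots> = (\<Sum>i\<in>UNIV. \<Sum>j\<in>UNIV. (u $ i * w $ j) *s star c p (axis i 1) (axis j 1))"
    unfolding sum_left smult_left unfolding sum_right smult_right
    by (simp add: vec.scale_sum_right)
  finally show ?thesis .
qed

lemma chart_inv_charts_at: "c \<in> atlas M \<Longrightarrow> z \<in> snd c ` fst c \<Longrightarrow> c \<in> charts_at M (chart_inv c z)"
  by (simp add: charts_at_def chart_inv_mem)

lemma star_holomorphic:
  assumes c: "c \<in> atlas M" and f: "cholomorphic_vec S f" "open S" "f ` S \<subseteq> snd c ` fst c"
    and u: "cholomorphic_vec S u" and w: "cholomorphic_vec S w"
  shows "cholomorphic_vec S (\<lambda>z. star c (chart_inv c (f z)) (u z) (w z))"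
  unfolding cholomorphic_vec_def
proof
  fix k
  have "cholomorphic S (\<lambda>z. star c (chart_inv c (f z)) (axis i 1) (axis j 1) $ k)" for i j
  proof -
    have "cholomorphic S ((\<lambda>z. star c (chart_inv c z) (axis i 1) (axis j 1) $ k) \<circ> f)"
      by (rule cholomorphic_compose_vec[OF f(2) chart_open[OF c] f(1) _ f(3)])
         (use structure_holomorphic[OF c, of i j] in \<open>simp add: cholomorphic_vec_def\<close>)
    then show ?thesis by (simp add: o_def)
  qed
  then have h: "cholomorphic S (\<lambda>z. (\<Sum>i\<in>UNIV. \<Sum>j\<in>UNIV. (u z $ i * w z $ j) * star c (chart_inv c (f z)) (axis i 1) (axis j 1) $ k))"
    using u w by (auto simp: cholomorphic_vec_def intro!: cholomorphic_sum cholomorphic_mult)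
  show "cholomorphic S (\<lambda>z. star c (chart_inv c (f z)) (u z) (w z) $ k)"
  proof (rule cholomorphic_cong[THEN iffD2, OF _ h])
    fix z assume "z \<in> S"
    then have "c \<in> charts_at M (chart_inv c (f z))" using f(3) chart_inv_charts_at[OF c] by auto
    then show "star c (chart_inv c (f z)) (u z) (w z) $ k =
        (\<Sum>i\<in>UNIV. \<Sum>j\<in>UNIV. (u z $ i * w z $ j) * star c (chart_inv c (f z)) (axis i 1) (axis j 1) $ k)"
      by (subst star_expand) simp_all
  qed
qed

section \<open>The fibres of the analytic spectrum as sets of characters\<close>

lemma L_iff:
  assumes c: "c \<in> charts_at M p"
  shows "(p, covec_of M c p y) \<in> L \<longleftrightarrow> y \<in> chars c p"
proof -
  interpret A: cn_algebra "star c p" "e p c" by (rule algebra_at[OF c])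
  note p = charts_at_points[OF c]
  have "(\<forall>v\<in>tangent_space M p. \<forall>w\<in>tangent_space M p. covec_of M c p y (m p v w) = covec_of M c p y v * covec_of M c p y w)
    \<longleftrightarrow> (\<forall>u v. cdot y (star c p u v) = cdot y u * cdot y v)" (is "?A \<longleftrightarrow> ?B")
  proof
    assume ?A
    show ?B
    proof (intro allI)
      fix u v
      have "covec_of M c p y (m p (tvec_of M c p u) (tvec_of M c p v)) = cdot y u * cdot y v"
        using \<open>?A\<close> c by (simp add: covec_of_apply)
      then show "cdot y (star c p u v) = cdot y u * cdot y v"
        using c by (simp add: covec_of_apply flip: tvec_of_star)
    qed
  next
    assume ?B
    show ?A
    proof (intro ballI)
      fix v w assume vw: "v \<in> tangent_space M p" "w \<in> tangent_space M p"
      have "m p v w = tvec_of M c p (star c p (v c) (w c))"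
        using tvec_of_star[OF c, of "v c" "w c"] tangent_eq_tvec_of[OF _ c] vw by simp
      then show "covec_of M c p y (m p v w) = covec_of M c p y v * covec_of M c p y w"
        using \<open>?B\<close> c vw by (simp add: covec_of_apply)
    qed
  qed
  moreover have "covec_of M c p y (e p) = cdot y (e p c)"
    by (rule covec_of_apply[OF e_tangent[OF p]])
  ultimately show ?thesis
    using c p by (simp add: L_def analytic_spectrum_def A.characters_def)
qed

lemma L_coords:
  assumes "(p, l) \<in> L" "c \<in> charts_at M p"
  shows "l \<in> cotangent_space M p" "covec_coords M c p l \<in> chars c p" "covec_of M c p (covec_coords M c p l) = l"
proof -
  show *: "l \<in> cotangent_space M p" using assms by (simp add: L_def analytic_spectrum_def)
  then show "covec_of M c p (covec_coords M c p l) = l" using assms by simp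
  then show "covec_coords M c p l \<in> chars c p" using L_iff[OF assms(2)] assms(1) by metis
qed

lemma L_fibre:
  assumes "c \<in> charts_at M p"
  shows "{x \<in> L. fst x = p} = (\<lambda>y. (p, covec_of M c p y)) ` chars c p"
proof
  show "{x \<in> L. fst x = p} \<subseteq> (\<lambda>y. (p, covec_of M c p y)) ` chars c p"
  proof
    fix x assume "x \<in> {x \<in> L. fst x = p}"
    then have "(p, snd x) \<in> L" "x = (p, snd x)" by auto
    then show "x \<in> (\<lambda>y. (p, covec_of M c p y)) ` chars c p"
      using L_coords[OF _ assms, of "snd x"] by (metis image_eqI)
  qed
qed (use L_iff[OF assms] in auto)

lemma Fvals_chart:
  assumes "c \<in> charts_at M p"
  shows "Fvals p = Fcoord c p ` chars c p"
  unfolding Fvals_def L_fibre[OF assms] Fcoord_def image_image ..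

lemma finite_Fvals: "p \<in> points M \<Longrightarrow> finite (Fvals p)"
  and card_Fvals_le: "p \<in> points M \<Longrightarrow> card (Fvals p) \<le> CARD('n)"
proof -
  assume "p \<in> points M"
  then obtain c where c: "c \<in> charts_at M p" using points_chart by blast
  interpret A: cn_algebra "star c p" "e p c" by (rule algebra_at[OF c])
  show "finite (Fvals p)" "card (Fvals p) \<le> CARD('n)"
    unfolding Fvals_chart[OF c] using A.finite_characters A.card_characters_le card_image_le[OF A.finite_characters, of "Fcoord c p"]
    by auto
qed

subsection \<open>Idempotents depend holomorphically on the point\<close>

text \<open>The implicit function theorem for u \<circ> u - u = 0 with the base point as parameter,
  obtained from the inverse function theorem for the map \<open>G\<close>, which keeps the base part
  fixed.\<close>

lemma idempotent_extension:
  assumes c: "c \<in> charts_at M p0" and f: "star c p0 f f = f"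
  obtains W u where "open W" "snd c p0 \<in> W" "W \<subseteq> snd c ` fst c" "cholomorphic_vec W u" "u (snd c p0) = f"
    "\<And>z. z \<in> W \<Longrightarrow> star c (chart_inv c z) (u z) (u z) = u z"
proof -
  have ca: "c \<in> atlas M" "p0 \<in> fst c" using c by (auto simp: charts_at_def)
  interpret A: cn_algebra "star c p0" "e p0 c" by (rule algebra_at[OF c])
  define S where "S = {w :: complex^('n + 'n). fstv w \<in> snd c ` fst c}"
  have opS: "open S" unfolding S_def by (rule open_fstv_vimage[OF chart_open[OF ca(1)]])
  \<comment> \<open>The derivative of \<open>u \<mapsto> u \<circ> u - u\<close> at an idempotent \<open>f\<close> is multiplication with \<open>2f - e\<close>, an involution.\<close>
  define G where "G = (\<lambda>w :: complex^('n + 'n). joinv (fstv w) (star c (chart_inv c (fstv w)) (sndv w) (sndv w) - sndv w))"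
  have "cholomorphic_vec S (\<lambda>w. star c (chart_inv c (fstv w)) (sndv w) (sndv w))"
    by (rule star_holomorphic[OF ca(1) _ opS]) (auto simp: S_def)
  then have holG: "cholomorphic_vec S G"
    unfolding G_def by (intro cholomorphic_vec_joinv cholomorphic_vec_fstv)
      (auto simp: cholomorphic_vec_def intro!: cholomorphic_diff)
  define w0 where "w0 = joinv (snd c p0) f"
  have w0S: "w0 \<in> S" using ca by (simp add: w0_def S_def)
  have "x = 0" if x: "cjac G w0 *v x = 0" for x
  proof -
    have DG: "((\<lambda>t. G (w0 + t *s x) $ k) has_field_derivative 0) (at 0)" for k
      using has_field_derivative_complex_line[of "\<lambda>w. G w $ k" "cjac G w0 $ k" w0 0 x]
        has_derivative_vec_nth[OF cholomorphic_vecD[OF opS holG w0S]] x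
      by (simp add: vec_eq_iff matrix_vector_cdot)
    have fx: "x $ Inl i = 0" for i
    proof -
      have "((\<lambda>t. G (w0 + t *s x) $ Inl i) has_field_derivative x $ Inl i) (at 0)"
        by (auto simp: G_def intro!: derivative_eq_intros)
      then show ?thesis using DG DERIV_unique by blast
    qed
    define v where "v = sndv x"
    \<comment> \<open>The product is bilinear, so the derivative of \<open>G\<close> along
      \<open>x\<close> can be read off as the coefficient of t, which is 2f \<circ> v - v in the
      covector slot.\<close>
    have quad: "star c p0 (f + t *s v) (f + t *s v) = f + (2 * t) *s star c p0 f v + (t * t) *s star c p0 v v" for t
      by (simp add: A.add_left A.add_right A.smult_left A.smult_right f A.comm[of v f] vec_eq_iff algebra_simps)
    have "2 * star c p0 f v $ i - v $ i = 0" for i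
    proof -
      have "fstv (w0 + t *s x) = snd c p0" for t
        using fx by (simp add: vec_eq_iff w0_def)
      moreover have "sndv (w0 + t *s x) = f + t *s v" for t
        by (simp add: vec_eq_iff w0_def v_def)
      ultimately have "G (w0 + t *s x) $ Inr i = (2 * t) * star c p0 f v $ i + (t * t) * star c p0 v v $ i - t * v $ i" for t
        using ca quad[of t] by (simp add: G_def)
      moreover have "((\<lambda>t. (2 * t) * star c p0 f v $ i + (t * t) * star c p0 v v $ i - t * v $ i) has_field_derivative
          (2 * star c p0 f v $ i - v $ i)) (at 0)"
        by (auto intro!: derivative_eq_intros)
      ultimately have "((\<lambda>t. G (w0 + t *s x) $ Inr i) has_field_derivative (2 * star c p0 f v $ i - v $ i)) (at 0)"
        by simp
      then show ?thesis using DG[of "Inr i"] by (rule DERIV_unique)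
    qed
    then have v2: "v = 2 *s star c p0 f v" by (simp add: vec_eq_iff)
    \<comment> \<open>Multiplying v = 2f \<circ> v by the idempotent \<open>f\<close> gives f
      \<circ> v = 2f \<circ> v, so this product vanishes and with it \<open>v\<close>.\<close>
    have "star c p0 f v = 2 *s star c p0 f v"
    proof -
      have "star c p0 f v = star c p0 f (2 *s star c p0 f v)" using v2 by simp
      also have "\<dots> = 2 *s star c p0 f v" by (simp add: A.smult_right f flip: A.assoc)
      finally show ?thesis .
    qed
    then have "star c p0 f v = 0" by (simp add: vec_eq_iff)
    then have "v = 0" using v2 by simp
    then have "x $ k = 0" for k
      using fx by (cases k) (auto simp: v_def vec_eq_iff)
    then show ?thesis by (simp add: vec_eq_iff)
  qed
  then have "invertible (cjac G w0)"
    by (auto simp: invertible_left_inverse matrix_left_invertible_ker)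
  then obtain U V g where g: "open U" "U \<subseteq> S" "w0 \<in> U" "open V" "G w0 \<in> V" "homeomorphism U V G g" "cholomorphic_vec V g"
    using holomorphic_inverse_function[OF opS holG w0S] by metis
  \<comment> \<open>The slice on which the second component of \<open>G\<close> is zero; there the
    inverse map returns idempotents.\<close>
  define W where "W = {z. joinv z 0 \<in> V}"
  define u where "u = (\<lambda>z. sndv (g (joinv z 0)) :: complex^'n)"
  have "open W"
    using open_vimage[OF g(4), of "\<lambda>z. joinv z 0"] by (simp add: W_def vimage_def continuous_intros)
  have Gw0: "G w0 = joinv (snd c p0) 0" using ca f by (simp add: G_def w0_def)
  have gW: "g (joinv z 0) \<in> S" "G (g (joinv z 0)) = joinv z 0" if "z \<in> W" for z
    using g that by (auto simp: homeomorphism_def W_def)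
  have fg: "fstv (g (joinv z 0)) = z" if "z \<in> W" for z
    using gW(2)[OF that] by (simp add: G_def)
  show ?thesis
  proof (rule that[OF \<open>open W\<close>])
    show "snd c p0 \<in> W" using g Gw0 by (simp add: W_def)
    show "W \<subseteq> snd c ` fst c" using gW fg by (force simp: S_def)
    have "cholomorphic_vec W (g \<circ> (\<lambda>z. joinv z 0))"
      by (rule cholomorphic_vec_compose[OF \<open>open W\<close> g(4) _ g(7)])
         (auto simp: W_def intro!: cholomorphic_vec_joinv)
    then show "cholomorphic_vec W u" by (simp add: u_def cholomorphic_vec_def)
    have "g (G w0) = w0" using g by (simp add: homeomorphism_def)
    then show "u (snd c p0) = f" by (simp add: u_def flip: Gw0) (simp add: w0_def)
    show "star c (chart_inv c z) (u z) (u z) = u z" if "z \<in> W" for z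
      using gW(2)[OF that] fg[OF that] by (simp add: G_def u_def)
  qed
qed

text \<open>A continuous bound for the structure constants bounds the whole bilinear product. The
  summand 1 in the constant leaves room for a neighbourhood and makes the bound positive.\<close>

lemma star_norm_bound:
  assumes c: "c \<in> charts_at M p0"
  obtains W K where "open W" "snd c p0 \<in> W" "W \<subseteq> snd c ` fst c" "0 < K"
    "\<And>z x y. z \<in> W \<Longrightarrow> norm (star c (chart_inv c z) x y) \<le> K * norm x * norm y"
proof -
  have ca: "c \<in> atlas M" "p0 \<in> fst c" using c by (auto simp: charts_at_def)
  define k where "k = (\<lambda>z. \<Sum>i\<in>UNIV. \<Sum>j\<in>UNIV. norm (star c (chart_inv c z) (axis i 1) (axis j 1)))"
  have "continuous_on (snd c ` fst c) k"
    unfolding k_def by (intro continuous_intros cholomorphic_vec_continuous_on structure_holomorphic ca)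
  then have "open (snd c ` fst c \<inter> k -` {..<k (snd c p0) + 1})"
    by (rule continuous_open_preimage[OF _ chart_open[OF ca(1)]]) simp
  moreover have "norm (star c (chart_inv c z) x y) \<le> (k (snd c p0) + 1) * norm x * norm y"
    if z: "z \<in> snd c ` fst c \<inter> k -` {..<k (snd c p0) + 1}" for z x y
  proof -
    have "norm (star c (chart_inv c z) x y) \<le> (\<Sum>i\<in>UNIV. \<Sum>j\<in>UNIV. norm x * norm y * norm (star c (chart_inv c z) (axis i 1) (axis j 1)))"
      using z chart_inv_charts_at[OF ca(1)]
      by (subst star_expand)
         (auto intro!: sum_norm_le mult_mono Finite_Cartesian_Product.norm_nth_le simp: norm_complex_smult norm_mult)
    also have "\<dots> = norm x * norm y * k z"
      by (simp add: k_def sum_distrib_left)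
    also have "\<dots> \<le> norm x * norm y * (k (snd c p0) + 1)"
      using z by (intro mult_left_mono) auto
    finally show ?thesis by (simp add: mult_ac)
  qed
  moreover have "0 < k (snd c p0) + 1"
    by (auto simp: k_def intro!: add_nonneg_pos sum_nonneg)
  ultimately show ?thesis
    using that[of "snd c ` fst c \<inter> k -` {..<k (snd c p0) + 1}" "k (snd c p0) + 1"] ca by auto
qed

text \<open>If \<open>y $ i\<close> is the largest coordinate of a character, its square is the
  value of \<open>y\<close> on the product of the i-th basis vector with itself, hence at most a
  constant times its modulus. So the modulus itself is bounded. This compactness is behind all
  limits of characters below.\<close>

lemma characters_bounded:
  assumes c: "c \<in> charts_at M p0"
  obtains W K where "open W" "snd c p0 \<in> W" "W \<subseteq> snd c ` fst c" "0 < K"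
    "\<And>z y. z \<in> W \<Longrightarrow> y \<in> chars c (chart_inv c z) \<Longrightarrow> norm y \<le> K"
proof -
  have ca: "c \<in> atlas M" "p0 \<in> fst c" using c by (auto simp: charts_at_def)
  obtain W K where W: "open W" "snd c p0 \<in> W" "W \<subseteq> snd c ` fst c" "0 < K"
    "\<And>z x y. z \<in> W \<Longrightarrow> norm (star c (chart_inv c z) x y) \<le> K * norm x * norm y"
    using star_norm_bound[OF c] by metis
  have bound: "norm y \<le> K * real CARD('n) * real CARD('n)" if z: "z \<in> W" and y: "y \<in> chars c (chart_inv c z)" for z y
  proof -
    interpret A: cn_algebra "star c (chart_inv c z)" "e (chart_inv c z) c"
      by (rule algebra_at[OF chart_inv_charts_at[OF ca(1) subsetD[OF W(3) z]]])
    obtain i where i: "\<And>j. norm (y $ j) \<le> norm (y $ i)"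
    proof -
      have "Max (range (\<lambda>j. norm (y $ j))) \<in> range (\<lambda>j. norm (y $ j))"
        by (rule Max_in) auto
      then obtain i where "Max (range (\<lambda>j. norm (y $ j))) = norm (y $ i)" ..
      moreover have "norm (y $ j) \<le> Max (range (\<lambda>j. norm (y $ j)))" for j
        by (rule Max_ge) auto
      ultimately have *: "norm (y $ j) \<le> norm (y $ i)" for j by simp
      show thesis by (rule that[OF *])
    qed
    have ny: "norm y \<le> real CARD('n) * norm (y $ i)"
      using L2_set_le_sum[of UNIV "\<lambda>j. norm (y $ j)"] norm_vec_def[of y] sum_mono[of UNIV "\<lambda>j. norm (y $ j)" "\<lambda>_. norm (y $ i)"] i by simp
    show ?thesis
    proof (cases "y $ i = 0")
      case True
      then show ?thesis using ny W(4) by simp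
    next
      case False
      have "(norm (y $ i))\<^sup>2 = norm (cdot y (star c (chart_inv c z) (axis i 1) (axis i 1)))"
        using A.characters_mult[OF y, of "axis i 1" "axis i 1"] by (simp add: norm_mult power2_eq_square)
      also have "\<dots> = norm (\<Sum>j\<in>UNIV. y $ j * star c (chart_inv c z) (axis i 1) (axis i 1) $ j)"
        by (simp add: cdot_def)
      also have "\<dots> \<le> (\<Sum>j\<in>(UNIV::'n set). norm (y $ i) * K)"
      proof (rule sum_norm_le)
        fix j
        have "norm (star c (chart_inv c z) (axis i 1) (axis i 1) $ j) \<le> K"
          using W(5)[OF z, of "axis i 1" "axis i 1"] Finite_Cartesian_Product.norm_nth_le order_trans by fastforce
        then show "norm (y $ j * star c (chart_inv c z) (axis i 1) (axis i 1) $ j) \<le> norm (y $ i) * K"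
          using i[of j] by (auto simp: norm_mult intro!: mult_mono)
      qed
      finally have "norm (y $ i) \<le> real CARD('n) * K"
        using False by (simp add: power2_eq_square mult_ac)
      then have "real CARD('n) * norm (y $ i) \<le> real CARD('n) * (real CARD('n) * K)"
        by (intro mult_left_mono) auto
      from order_trans[OF ny this] show ?thesis by (simp only: mult_ac)
    qed
  qed
  show ?thesis
    using that[OF W(1-3), of "K * real CARD('n) * real CARD('n)"] W(4) bound by simp
qed

end

section \<open>Holomorphic frames of idempotents and their dual characters\<close>

context generated_F_manifold
begin

text \<open>The continued idempotents are orthogonal at \<open>p0\<close> only. A product of
  idempotents is an idempotent, and a nonzero idempotent w has norm at least 1/K, since its norm is
  at most K times its square. Products that are small by continuity are therefore zero.\<close>

lemma local_frames:
  assumes c: "c \<in> charts_at M p0" and f: "cn_algebra.frame (star c p0) f"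
  obtains W u where "open W" "snd c p0 \<in> W" "W \<subseteq> snd c ` fst c" "\<And>a. cholomorphic_vec W (u a)"
    "\<And>a. u a (snd c p0) = f a" "\<And>z. z \<in> W \<Longrightarrow> cn_algebra.frame (star c (chart_inv c z)) (\<lambda>a. u a z)"
proof -
  have ca: "c \<in> atlas M" "p0 \<in> fst c" using c by (auto simp: charts_at_def)
  interpret A0: cn_algebra "star c p0" "e p0 c" by (rule algebra_at[OF c])
  have "\<exists>W u. open W \<and> snd c p0 \<in> W \<and> W \<subseteq> snd c ` fst c \<and> cholomorphic_vec W u \<and> u (snd c p0) = f a \<and>
      (\<forall>z\<in>W. star c (chart_inv c z) (u z) (u z) = u z)" for a
  proof -
    have "star c p0 (f a) (f a) = f a" using f by (simp add: A0.frame_def)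
    from idempotent_extension[OF c this] show ?thesis by metis
  qed
  then obtain W u where Wu: "\<And>a. open (W a)" "\<And>a. snd c p0 \<in> W a" "\<And>a. W a \<subseteq> snd c ` fst c"
    "\<And>a. cholomorphic_vec (W a) (u a)" "\<And>a. u a (snd c p0) = f a"
    "\<And>a z. z \<in> W a \<Longrightarrow> star c (chart_inv c z) (u a z) (u a z) = u a z"
    by metis
  obtain W1 K where W1: "open W1" "snd c p0 \<in> W1" "W1 \<subseteq> snd c ` fst c" "0 < K"
    "\<And>z x y. z \<in> W1 \<Longrightarrow> norm (star c (chart_inv c z) x y) \<le> K * norm x * norm y"
    using star_norm_bound[OF c] by metis
  define W0 where "W0 = W1 \<inter> (\<Inter>a. W a)"
  have "open W0"
    unfolding W0_def using Wu(1) W1(1) by (intro open_Int open_INT) auto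
  then have W0: "open W0" "snd c p0 \<in> W0" "W0 \<subseteq> snd c ` fst c"
    using Wu W1 by (auto simp: W0_def)
  have hol: "cholomorphic_vec W0 (u a)" for a
    using Wu(4)[of a] by (rule cholomorphic_vec_subset) (auto simp: W0_def)
  define P where "P = (\<lambda>a b z. star c (chart_inv c z) (u a z) (u b z))"
  have contP: "continuous_on W0 (P a b)" for a b
    unfolding P_def
    by (intro cholomorphic_vec_continuous_on star_holomorphic[OF ca(1)]) (use W0 hol in auto)
  \<comment> \<open>The bound 1/K is the least possible norm of a nonzero idempotent near
    \<open>p0\<close>.\<close>
  define W' where "W' = (\<Inter>a. W0 \<inter> (\<lambda>z. norm (u a z)) -` {0<..}) \<inter>
      (\<Inter>a. \<Inter>b\<in>-{a}. W0 \<inter> (\<lambda>z. norm (P a b z)) -` {..<1/K})"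
  have "open W'"
    unfolding W'_def
    by (intro open_Int open_INT finite_code ballI continuous_open_preimage[OF _ W0(1)] continuous_intros contP
        cholomorphic_vec_continuous_on[OF hol]) auto
  have "P a b (snd c p0) = 0" if "a \<noteq> b" for a b
    using f that ca by (simp add: P_def Wu A0.frame_def)
  moreover have "u a (snd c p0) \<noteq> 0" for a using f by (simp add: Wu A0.frame_def)
  ultimately have p0W': "snd c p0 \<in> W'"
    using W0 W1 by (auto simp: W'_def)
  have "W' \<subseteq> W0" by (auto simp: W'_def)
  have "cn_algebra.frame (star c (chart_inv c z)) (\<lambda>a. u a z)" if z: "z \<in> W'" for z
  proof -
    have zW: "z \<in> W0" "z \<in> W1" "\<And>a. z \<in> W a" "z \<in> snd c ` fst c"
      using subsetD[OF \<open>W' \<subseteq> W0\<close> z] subsetD[OF W0(3)] by (simp_all only:) (auto simp: W0_def)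
    interpret A: cn_algebra "star c (chart_inv c z)" "e (chart_inv c z) c"
      by (rule algebra_at[OF chart_inv_charts_at[OF ca(1) zW(4)]])
    have "star c (chart_inv c z) (u a z) (u b z) = 0" if "a \<noteq> b" for a b
    proof (rule ccontr)
      assume nz: "star c (chart_inv c z) (u a z) (u b z) \<noteq> 0"
      define w where "w = star c (chart_inv c z) (u a z) (u b z)"
      have ww: "star c (chart_inv c z) w w = w"
      proof -
        let ?s = "star c (chart_inv c z)"
        have "?s w w = ?s (u a z) (?s (u b z) w)" unfolding w_def by (rule A.assoc)
        also have "?s (u b z) w = ?s (?s (u a z) (u b z)) (u b z)" unfolding w_def by (rule A.comm)
        also have "\<dots> = w" unfolding w_def A.assoc Wu(6)[OF zW(3)] ..
        also have "?s (u a z) w = w" unfolding w_def A.assoc[symmetric] Wu(6)[OF zW(3)] ..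
        finally show ?thesis .
      qed
      have le: "norm w \<le> K * norm w * norm w" using W1(5)[OF zW(2), of w w] unfolding ww .
      have "0 < norm w" using nz unfolding w_def by (rule zero_less_norm_iff[THEN iffD2])
      then have "1 \<le> K * norm w"
        using le mult_right_le_imp_le[of 1 "norm w" "K * norm w"] by linarith
      moreover have "z \<in> W0 \<inter> (\<lambda>z. norm (P a b z)) -` {..<1/K}"
        using z that unfolding W'_def by blast
      then have "norm w < 1 / K" by (simp add: w_def P_def)
      ultimately show False using W1(4) by (simp add: field_simps)
    qed
    moreover have "u a z \<noteq> 0" for a using z by (auto simp: W'_def)
    ultimately show ?thesis using Wu(6)[OF zW(3)] by (simp add: A.frame_def)
  qed
  then show ?thesis
    using that[OF \<open>open W'\<close> p0W' order_trans[OF \<open>W' \<subseteq> W0\<close> W0(3)], of u] cholomorphic_vec_subset[OF hol \<open>W' \<subseteq> W0\<close>] Wu(5)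
    by simp
qed

text \<open>The characters are the dual basis of the local frame; the point is to write them by a
  formula that shows their holomorphy.\<close>

lemma local_characters:
  assumes c: "c \<in> charts_at M p0" and f: "cn_algebra.frame (star c p0) f"
  obtains W y where "open W" "snd c p0 \<in> W" "W \<subseteq> snd c ` fst c" "\<And>a. cholomorphic_vec W (y a)"
    "\<And>z. z \<in> W \<Longrightarrow> inj (\<lambda>a. y a z)"
    "\<And>z. z \<in> W \<Longrightarrow> chars c (chart_inv c z) = range (\<lambda>a. y a z)"
    "\<And>z x. z \<in> W \<Longrightarrow> (\<And>a. cdot (y a z) x = 0) \<Longrightarrow> x = 0"
    "\<And>a b. cdot (y a (snd c p0)) (f b) = (if a = b then 1 else 0)"
proof -
  have ca: "c \<in> atlas M" "p0 \<in> fst c" using c by (auto simp: charts_at_def)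
  interpret A0: cn_algebra "star c p0" "e p0 c" by (rule algebra_at[OF c])
  obtain W u where W: "open W" "snd c p0 \<in> W" "W \<subseteq> snd c ` fst c" "\<And>a. cholomorphic_vec W (u a)"
    "\<And>a. u a (snd c p0) = f a" "\<And>z. z \<in> W \<Longrightarrow> cn_algebra.frame (star c (chart_inv c z)) (\<lambda>a. u a z)"
    using local_frames[OF c f] by metis
  obtain l where l: "\<And>a b. cdot (l a) (f b) = (if a = b then 1 else 0)"
    using A0.frame_dual[OF f] by metis
  define W' where "W' = (\<Inter>a. W \<inter> (\<lambda>z. cdot (l a) (u a z)) -` (- {0}))"
  have "open W'"
    unfolding W'_def
    by (intro open_INT finite_code ballI continuous_open_preimage[OF _ W(1)] continuous_intros
        cholomorphic_vec_continuous_on[OF W(4)]) auto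
  have W': "snd c p0 \<in> W'" "W' \<subseteq> W" using W l by (auto simp: W'_def)
  \<comment> \<open>Multiplying a vector v with the idempotent \<open>u a z\<close> gives the value
    of the a-th character on v times \<open>u a z\<close>. Applying the fixed form
    \<open>l a\<close>, dual to the frame at \<open>p0\<close>, and dividing recovers this value;
    the denominator is 1 at \<open>p0\<close>.\<close>
  define y where "y = (\<lambda>a z. \<chi> i. cdot (l a) (star c (chart_inv c z) (axis i 1) (u a z)) * inverse (cdot (l a) (u a z)))"
  have hol: "cholomorphic_vec W' (y a)" for a
  proof -
    have u: "cholomorphic_vec W' (u a)" by (rule cholomorphic_vec_subset[OF W(4) W'(2)])
    have s: "cholomorphic_vec W' (\<lambda>z. star c (chart_inv c z) (axis i 1) (u a z))" for i
      by (rule star_holomorphic[OF ca(1) _ \<open>open W'\<close>]) (use u W W' in auto)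
    have nz: "cdot (l a) (u a z) \<noteq> 0" if "z \<in> W'" for z
      using that by (auto simp: W'_def)
    have "cholomorphic W' (\<lambda>z. cdot (l a) (star c (chart_inv c z) (axis i 1) (u a z)) * inverse (cdot (l a) (u a z)))" for i
      by (intro cholomorphic_mult cholomorphic_cdot cholomorphic_inverse u s cholomorphic_vec_const nz)
    then show ?thesis
      by (simp add: y_def cholomorphic_vec_def)
  qed
  have y_dual: "y a z = y' a"
    if z: "z \<in> W'" and y': "\<And>a b. cdot (y' a) (u b z) = (if a = b then 1 else 0)"
      "\<And>v. v = (\<Sum>a\<in>UNIV. cdot (y' a) v *s u a z)" for a z y'
  proof -
    have zW: "z \<in> W" "z \<in> snd c ` fst c" using z W' W by auto
    interpret A: cn_algebra "star c (chart_inv c z)" "e (chart_inv c z) c"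
      by (rule algebra_at[OF chart_inv_charts_at[OF ca(1) zW(2)]])
    have fr: "A.frame (\<lambda>a. u a z)" by (rule W(6)[OF zW(1)])
    have "star c (chart_inv c z) v (u a z) = cdot (y' a) v *s u a z" for v
    proof -
      have "star c (chart_inv c z) v (u a z) = star c (chart_inv c z) (\<Sum>b\<in>UNIV. cdot (y' b) v *s u b z) (u a z)"
        using y'(2)[of v] by simp
      also have "\<dots> = (\<Sum>b\<in>UNIV. if b = a then cdot (y' b) v *s u b z else 0)"
        unfolding A.sum_left A.smult_left using fr by (intro sum.cong) (auto simp: A.frame_def)
      finally show ?thesis by simp
    qed
    moreover have "cdot (l a) (u a z) \<noteq> 0" using z by (auto simp: W'_def)
    ultimately have "cdot (l a) (star c (chart_inv c z) (axis i 1) (u a z)) * inverse (cdot (l a) (u a z)) = y' a $ i" for i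
      by (simp add: cdot_smult_right)
    then show ?thesis
      by (simp add: y_def vec_eq_iff)
  qed
  have main: "inj (\<lambda>a. y a z) \<and> chars c (chart_inv c z) = range (\<lambda>a. y a z) \<and> (\<forall>x. (\<forall>a. cdot (y a z) x = 0) \<longrightarrow> x = 0)
     \<and> (\<forall>a b. cdot (y a z) (u b z) = (if a = b then 1 else 0))"
    if z: "z \<in> W'" for z
  proof -
    have zW: "z \<in> W" "z \<in> snd c ` fst c" using z W' W by auto
    interpret A: cn_algebra "star c (chart_inv c z)" "e (chart_inv c z) c"
      by (rule algebra_at[OF chart_inv_charts_at[OF ca(1) zW(2)]])
    obtain y' where y': "\<And>a b. cdot (y' a) (u b z) = (if a = b then 1 else 0)"
      "\<And>v. v = (\<Sum>a\<in>UNIV. cdot (y' a) v *s u a z)" "A.characters = range y'" "inj y'"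
      "\<And>x. (\<And>a. cdot (y' a) x = 0) \<Longrightarrow> x = 0"
      by (rule A.frame_dual[OF W(6)[OF zW(1)]], rule that) (assumption+, blast)
    have "(\<lambda>a. y a z) = y'" using y_dual[OF z y'(1,2)] by auto
    then have "\<And>a. y a z = y' a" by metis
    then show ?thesis using y' by simp
  qed
  show ?thesis
    by (rule that[OF \<open>open W'\<close> W'(1) order_trans[OF W'(2) W(3)] hol])
       (use main main[OF W'(1)] W(5) in auto)
qed

subsection \<open>Local sections of the analytic spectrum\<close>

text \<open>Subtracting \<open>y a\<close> from the covector part moves the graph of this character
  to the zero section. Since the n characters are different, their graphs are disjoint over
  \<open>W\<close>, and near one graph the spectrum is nothing else.\<close>

lemma section_regular:
  fixes y :: "'n \<Rightarrow> complex^'n \<Rightarrow> complex^'n"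
  assumes c: "c \<in> atlas M" and W: "open W" "W \<subseteq> snd c ` fst c" "\<And>a. cholomorphic_vec W (y a)"
    and y: "\<And>z. z \<in> W \<Longrightarrow> inj (\<lambda>a. y a z)" "\<And>z. z \<in> W \<Longrightarrow> chars c (chart_inv c z) = range (\<lambda>a. y a z)"
    and z0: "z0 \<in> W"
  shows "(chart_inv c z0, covec_of M c (chart_inv c z0) (y a z0)) \<in> reg_points (cotangent_bundle M) L"
proof -
  let ?T = "cotangent_bundle M"
  define C where "C = cotangent_chart M c"
  have C: "C \<in> atlas ?T" using c by (simp add: C_def atlas_cotangent)
  \<comment> \<open>The cylinder over \<open>W\<close> without the graphs of the other characters,
    so that the spectrum inside of it is the graph of \<open>y a\<close> alone.\<close>
  define A where "A = {w :: complex^('n + 'n). fstv w \<in> W} \<inter> (\<Inter>b\<in>-{a}. {w. fstv w \<in> W} \<inter> (\<lambda>w. sndv w - y b (fstv w)) -` (-{0}))"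
  have opW: "open {w :: complex^('n + 'n). fstv w \<in> W}" by (rule open_fstv_vimage[OF W(1)])
  have conty: "continuous_on {w :: complex^('n + 'n). fstv w \<in> W} (\<lambda>w. y b (fstv w))" for b
    by (rule continuous_on_compose2[OF cholomorphic_vec_continuous_on[OF W(3)]]) (auto intro!: continuous_intros)
  have "continuous_on {w :: complex^('n + 'n). fstv w \<in> W} (\<lambda>w. sndv w - y b (fstv w))" for b
    by (intro continuous_on_diff conty continuous_on_sndv continuous_on_id)
  then have "open ({w :: complex^('n + 'n). fstv w \<in> W} \<inter> (\<lambda>w. sndv w - y b (fstv w)) -` (-{0}))" for b
    by (rule continuous_open_preimage[OF _ opW]) auto
  then have "open A"
    unfolding A_def using opW by (intro open_Int open_INT) auto
  have A_iff: "w \<in> A \<longleftrightarrow> fstv w \<in> W \<and> (\<forall>b. b \<noteq> a \<longrightarrow> sndv w \<noteq> y b (fstv w))" for w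
    unfolding A_def Int_iff INT_iff vimage_eq mem_Collect_eq by auto
  define X where "X = {x \<in> fst C. snd C x \<in> A}"
  have X: "openin (mtop ?T) X" "X \<subseteq> fst C"
    unfolding X_def using T.openin_chart_preimage[OF C \<open>open A\<close>] by auto
  have imgX: "snd C ` X = A"
  proof
    have "A \<subseteq> snd C ` fst C"
      using W(2) cotangent_chart_image[OF c c] by (auto simp: A_iff C_def)
    then show "A \<subseteq> snd C ` X" by (auto simp: X_def)
  qed (auto simp: X_def)
  define \<phi> where "\<phi> = (\<lambda>w. joinv (fstv w) (sndv w - y a (fstv w)))"
  define g where "g = (\<lambda>w. joinv (fstv w) (sndv w + y a (fstv w)))"
  have gphi: "g (\<phi> w) = w" "\<phi> (g w) = w" for w by (simp_all add: g_def \<phi>_def)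
  have yhol: "cholomorphic_vec {w :: complex^('n + 'n). fstv w \<in> W} (\<lambda>w. y a (fstv w))"
    using cholomorphic_vec_compose[OF opW W(1) _ W(3), of fstv] by (auto simp: o_def)
  have phihol: "cholomorphic_vec {w. fstv w \<in> W} \<phi>"
    unfolding \<phi>_def using yhol
    by (intro cholomorphic_vec_joinv cholomorphic_vec_fstv) (auto simp: cholomorphic_vec_def intro!: cholomorphic_diff)
  have ghol: "cholomorphic_vec {w. fstv w \<in> W} g"
    unfolding g_def using yhol
    by (intro cholomorphic_vec_joinv cholomorphic_vec_fstv) (auto simp: cholomorphic_vec_def intro!: cholomorphic_add)
  define V where "V = {w. fstv w \<in> W} \<inter> g -` A"
  have "open V"
    unfolding V_def by (rule continuous_open_preimage[OF cholomorphic_vec_continuous_on[OF ghol] opW \<open>open A\<close>])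
  have phiA: "\<phi> ` A = V"
  proof
    show "\<phi> ` A \<subseteq> V" by (auto simp: V_def gphi) (auto simp: A_iff \<phi>_def)
    show "V \<subseteq> \<phi> ` A" unfolding V_def using gphi(2) by (metis (no_types, lifting) IntD2 image_eqI subsetI vimage_eq)
  qed
  define D where "D = (X, \<phi> \<circ> snd C)"
  have comp: "compatible_chart ?T D"
    unfolding D_def
  proof (rule T.compatible_chartI[OF C X _ \<open>open V\<close> _ _ ])
    show "cholomorphic_vec (snd C ` X) \<phi>" unfolding imgX by (rule cholomorphic_vec_subset[OF phihol]) (auto simp: A_iff)
    show "cholomorphic_vec V g" by (rule cholomorphic_vec_subset[OF ghol]) (auto simp: V_def)
    show "\<phi> ` snd C ` X = V" unfolding imgX by (rule phiA)
  qed (rule gphi)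
  let ?J = "range Inl :: ('n + 'n) set"
  have J: "w \<in> coord_space ?J \<longleftrightarrow> sndv w = 0" for w :: "complex^('n + 'n)"
  proof
    assume "w \<in> coord_space ?J"
    then show "sndv w = 0" by (auto simp: coord_space_def vec_eq_iff)
  next
    assume s: "sndv w = 0"
    have "w $ i = 0" if "i \<notin> ?J" for i
      using that arg_cong[OF s, of "\<lambda>v. v $ projr i"] by (cases i) auto
    then show "w \<in> coord_space ?J" by (auto simp: coord_space_def)
  qed
  have onL: "x \<in> L \<longleftrightarrow> sndv (\<phi> (snd C x)) = 0" if x: "x \<in> X" for x
  proof -
    obtain p l where pl: "x = (p, l)" by (cases x)
    have p: "p \<in> fst c" "l \<in> cotangent_space M p" using x pl by (auto simp: X_def C_def)
    have ch: "c \<in> charts_at M p" using p c by (simp add: charts_at_def)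
    have z: "snd c p \<in> W" and ne: "\<And>b. b \<noteq> a \<Longrightarrow> covec_coords M c p l \<noteq> y b (snd c p)"
      using x pl p by (auto simp: X_def A_iff C_def)
    have "x \<in> L \<longleftrightarrow> covec_coords M c p l \<in> chars c p"
      using L_iff[OF ch, of "covec_coords M c p l"] p ch pl by simp
    also have "\<dots> \<longleftrightarrow> covec_coords M c p l = y a (snd c p)"
    proof
      assume "covec_coords M c p l \<in> chars c p"
      then obtain b where "covec_coords M c p l = y b (snd c p)" using y(2)[OF z] c p by auto
      then show "covec_coords M c p l = y a (snd c p)" using ne[of b] by (cases "b = a") auto
    qed (use y(2)[OF z] c p in auto)
    finally show ?thesis by (simp add: \<phi>_def C_def pl)
  qed
  define x0 where "x0 = (chart_inv c z0, covec_of M c (chart_inv c z0) (y a z0))"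
  have z0c: "chart_inv c z0 \<in> fst c" "snd c (chart_inv c z0) = z0" "c \<in> charts_at M (chart_inv c z0)"
    using chart_inv_mem[OF subsetD[OF W(2) z0]] chart_inv_right[OF subsetD[OF W(2) z0]]
      chart_inv_charts_at[OF c subsetD[OF W(2) z0]] by auto
  have x0L: "x0 \<in> L"
    unfolding x0_def L_iff[OF z0c(3)] y(2)[OF z0] by simp
  have x0X: "x0 \<in> X"
    using z0c z0 y(1)[OF z0] by (auto simp: x0_def X_def A_iff C_def inj_def)
  show ?thesis
    unfolding reg_points_def mem_Collect_eq x0_def[symmetric]
  proof (intro conjI exI[of _ D] exI[of _ ?J])
    show "snd D ` (L \<inter> fst D) = snd D ` fst D \<inter> coord_space ?J"
      unfolding D_def using onL J by auto
  qed (use comp x0L x0X in \<open>auto simp: D_def T.coords_UNIV\<close>)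
qed

text \<open>\<open>differential\<close> evaluates in an arbitrarily selected chart of the cotangent
  bundle, so the projection has to be computed for every chart \<open>C'\<close>. It forgets the
  covector part and changes the base chart.\<close>

lemma dir_deriv_base_projection:
  assumes C': "C' \<in> charts_at (cotangent_bundle M) x" and d: "d \<in> charts_at M (fst x)"
  obtains c' where "c' \<in> charts_at M (fst x)" "C' = cotangent_chart M c'"
    "\<And>\<xi>. dir_deriv (snd d \<circ> fst \<circ> chart_inv C') (snd C' x) \<xi> = jacobian_at c' d (fst x) *v fstv \<xi>"
proof -
  obtain c' where c': "C' = cotangent_chart M c'" "c' \<in> atlas M" using C' by (auto simp: charts_at_def atlas_cotangent)
  have x: "fst x \<in> fst c'" "snd x \<in> cotangent_space M (fst x)" using C' c' by (auto simp: charts_at_def)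
  have ch: "c' \<in> charts_at M (fst x)" using x c' by (simp add: charts_at_def)
  have da: "d \<in> atlas M" "fst x \<in> fst d" using d by (auto simp: charts_at_def)
  let ?S = "{w :: complex^('n + 'n). fstv w \<in> snd c' ` (fst c' \<inter> fst d)}"
  have opS: "open ?S" by (rule open_fstv_vimage[OF overlap_open[OF c'(2) da(1)]])
  have xS: "snd C' x \<in> ?S" using x da by (simp add: c')
  have "cholomorphic_vec ?S (transition c' d \<circ> fstv)"
    by (rule cholomorphic_vec_compose[OF opS overlap_open[OF c'(2) da(1)] _ transition_holo[OF c'(2) da(1)]]) auto
  then have D1: "((transition c' d \<circ> fstv) has_derivative (*v) (cjac (transition c' d \<circ> fstv) (snd C' x))) (at (snd C' x))"
    by (rule cholomorphic_vecD[OF opS _ xS])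
  have "linear (fstv :: complex^('n + 'n) \<Rightarrow> _)"
    by (rule linearI) (simp_all add: vec_eq_iff)
  then have blf: "bounded_linear (fstv :: complex^('n + 'n) \<Rightarrow> complex^'n)" by (simp add: linear_conv_bounded_linear)
  have "((\<lambda>w. transition c' d (fstv w)) has_derivative (\<lambda>\<xi>. jacobian_at c' d (fst x) *v fstv \<xi>)) (at (snd C' x))"
    by (rule has_derivative_compose[OF bounded_linear.has_derivative[OF blf has_derivative_ident]])
       (use transition_has_derivative[OF ch d] in \<open>simp add: c'\<close>)
  then have eq: "cjac (transition c' d \<circ> fstv) (snd C' x) *v \<xi> = jacobian_at c' d (fst x) *v fstv \<xi>" for \<xi>
    using has_derivative_unique[OF D1] by (auto simp: o_def fun_eq_iff)
  have "((snd d \<circ> fst \<circ> chart_inv C') has_derivative (*v) (cjac (transition c' d \<circ> fstv) (snd C' x))) (at (snd C' x))"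
  proof (rule has_derivative_transform_within_open[OF D1 opS xS])
    fix w assume "w \<in> ?S"
    then obtain p where p: "fstv w = snd c' p" "p \<in> fst c'" by auto
    have "chart_inv C' w = (p, covec_of M c' p (sndv w))"
      using cotangent_chart_inv[OF c'(2) p(2), of "sndv w"] by (simp add: c'(1) flip: p(1))
    then show "(transition c' d \<circ> fstv) w = (snd d \<circ> fst \<circ> chart_inv C') w"
      using p c' by simp
  qed
  then have "dir_deriv (snd d \<circ> fst \<circ> chart_inv C') (snd C' x) \<xi> = jacobian_at c' d (fst x) *v fstv \<xi>" for \<xi>
    using dir_deriv_eq eq by metis
  then show ?thesis using that ch c' by blast
qed

text \<open>The canonical form applies a covector to the projected velocity; this is the velocity of
  the base curve, whichever chart \<open>differential\<close> has selected.\<close>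

lemma differential_projection:
  assumes curve: "holo_curve (cotangent_bundle M) \<Omega> \<gamma>" "t \<in> \<Omega>" and c: "c \<in> charts_at M (fst (\<gamma> t))"
    and base: "((\<lambda>s. snd c (fst (\<gamma> s))) has_derivative (\<lambda>h. h *s v)) (at t)"
  shows "differential (cotangent_bundle M) M fst (\<gamma> t) (velocity (cotangent_bundle M) \<gamma> t) = tvec_of M c (fst (\<gamma> t)) v"
proof -
  let ?T = "cotangent_bundle M"
  define C' where "C' = (SOME C. C \<in> charts_at ?T (\<gamma> t))"
  have C': "C' \<in> charts_at ?T (\<gamma> t)"
    unfolding C'_def using T.points_chart[OF T.holo_curve_points[OF curve]] by (rule someI_ex)
  show ?thesis
  proof
    fix d
    show "differential ?T M fst (\<gamma> t) (velocity ?T \<gamma> t) d = tvec_of M c (fst (\<gamma> t)) v d"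
    proof (cases "d \<in> charts_at M (fst (\<gamma> t))")
      case True
      obtain c' where c': "c' \<in> charts_at M (fst (\<gamma> t))" "C' = cotangent_chart M c'"
        "\<And>\<xi>. dir_deriv (snd d \<circ> fst \<circ> chart_inv C') (snd C' (\<gamma> t)) \<xi> = jacobian_at c' d (fst (\<gamma> t)) *v fstv \<xi>"
        using dir_deriv_base_projection[OF C' True] by metis
      have ca: "c' \<in> atlas M" "c \<in> atlas M" "fst (\<gamma> t) \<in> fst c" "fst (\<gamma> t) \<in> fst c'" using c' c by (auto simp: charts_at_def)
      have "((\<lambda>s. snd C' (\<gamma> s)) has_derivative (\<lambda>h. h *s velocity ?T \<gamma> t C')) (at t)"
        by (rule T.holo_curveD[OF curve C'])
      then have d1: "((\<lambda>s. snd c' (fst (\<gamma> s))) has_derivative (\<lambda>h. h *s fstv (velocity ?T \<gamma> t C'))) (at t)"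
        unfolding has_derivative_curve_iff
      proof (intro allI, elim allE)
        fix i assume "((\<lambda>s. snd C' (\<gamma> s) $ Inl i) has_field_derivative velocity ?T \<gamma> t C' $ Inl i) (at t)"
        then show "((\<lambda>s. snd c' (fst (\<gamma> s)) $ i) has_field_derivative fstv (velocity ?T \<gamma> t C') $ i) (at t)"
          by (simp add: c'(2))
      qed
      define E where "E = {x \<in> fst C'. snd C' x \<in> {w. fstv w \<in> snd c' ` (fst c' \<inter> fst c)}}"
      have CA: "C' \<in> atlas ?T" using C' by (simp add: charts_at_def)
      have opE: "openin (mtop ?T) E"
        unfolding E_def by (rule T.openin_chart_preimage[OF CA open_fstv_vimage[OF overlap_open[OF ca(1,2)]]])
      have op: "open {s \<in> \<Omega>. \<gamma> s \<in> E}" by (rule T.holo_curve_preimage_open[OF curve(1) opE])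
      have "\<gamma> t \<in> E" using C' ca by (auto simp: E_def charts_at_def c'(2))
      have "((\<lambda>s. transition c c' (snd c (fst (\<gamma> s)))) has_derivative (\<lambda>h. h *s (jacobian_at c c' (fst (\<gamma> t)) *v v))) (at t)"
        by (rule curve_chain_vec[OF base transition_has_derivative[OF c c'(1)]])
      then have d2: "((\<lambda>s. snd c' (fst (\<gamma> s))) has_derivative (\<lambda>h. h *s (jacobian_at c c' (fst (\<gamma> t)) *v v))) (at t)"
      proof (rule has_derivative_transform_within_open[OF _ op])
        show "t \<in> {s \<in> \<Omega>. \<gamma> s \<in> E}" using curve \<open>\<gamma> t \<in> E\<close> by simp
        fix s assume "s \<in> {s \<in> \<Omega>. \<gamma> s \<in> E}"
        then have "fst (\<gamma> s) \<in> fst c'" "snd c' (fst (\<gamma> s)) \<in> snd c' ` (fst c' \<inter> fst c)"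
          by (auto simp: E_def c'(2))
        then have "fst (\<gamma> s) \<in> fst c" using chart_inj[OF ca(1)] by (auto dest: inj_onD)
        then show "transition c c' (snd c (fst (\<gamma> s))) = snd c' (fst (\<gamma> s))" using ca by simp
      qed
      have "fstv (velocity ?T \<gamma> t C') = jacobian_at c c' (fst (\<gamma> t)) *v v"
        using fun_cong[OF has_derivative_unique[OF d1 d2], of 1] by simp
      then show ?thesis
        using True c c' by (simp add: differential_def Let_def flip: C'_def)
          (simp add: tvec_of_apply matrix_vector_mul_assoc jacobian_at_compose)
    next
      case False
      then show ?thesis by (simp add: differential_def Let_def tvec_of_def)
    qed
  qed
qed

text \<open>The pullback of the canonical form by a 1-form, seen as a section, is this 1-form. Hence
  dF = \<alpha> says that on the sheet of \<open>y a\<close> the differential of \<open>F\<close> is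
  \<open>y a\<close> itself. Differentiability comes from the local holomorphic extensions of
  \<open>F\<close>.\<close>

lemma section_generating_function:
  fixes y :: "'n \<Rightarrow> complex^'n \<Rightarrow> complex^'n"
  assumes c: "c \<in> atlas M" and W: "open W" "W \<subseteq> snd c ` fst c" "\<And>a. cholomorphic_vec W (y a)"
    and y: "\<And>z. z \<in> W \<Longrightarrow> inj (\<lambda>a. y a z)" "\<And>z. z \<in> W \<Longrightarrow> chars c (chart_inv c z) = range (\<lambda>a. y a z)"
    and z0: "z0 \<in> W"
  shows "((\<lambda>z. Fcoord c (chart_inv c z) (y a z)) has_derivative cdot (y a z0)) (at z0)"
proof -
  let ?T = "cotangent_bundle M"
  define C where "C = cotangent_chart M c"
  have C: "C \<in> atlas ?T" using c by (simp add: C_def atlas_cotangent)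
  define \<sigma> where "\<sigma> = (\<lambda>z. (chart_inv c z, covec_of M c (chart_inv c z) (y a z)))"
  define Lreg where "Lreg = reg_points ?T L"
  have gen: "\<And>x. x \<in> Lreg \<Longrightarrow> \<exists>W G. openin (mtop ?T) W \<and> x \<in> W \<and> holo_fun ?T W G \<and> (\<forall>y\<in>W \<inter> L. G y = F y)"
     "\<And>\<Omega> \<gamma> t. holo_curve ?T \<Omega> \<gamma> \<Longrightarrow> \<gamma> ` \<Omega> \<subseteq> Lreg \<Longrightarrow> t \<in> \<Omega> \<Longrightarrow> deriv (\<lambda>s. F (\<gamma> s)) t = canonical_form M (\<gamma> t) (velocity ?T \<gamma> t)"
    using generating unfolding generating_function_def Let_def Lreg_def L_def by blast+
  have reg: "\<sigma> z \<in> Lreg" if "z \<in> W" for z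
    unfolding \<sigma>_def Lreg_def using section_regular[OF c W y that] by blast
  have zc: "chart_inv c z \<in> fst c" "snd c (chart_inv c z) = z" "c \<in> charts_at M (chart_inv c z)" if "z \<in> W" for z
    using chart_inv_mem[OF subsetD[OF W(2) that]] chart_inv_right[OF subsetD[OF W(2) that]]
      chart_inv_charts_at[OF c subsetD[OF W(2) that]] by auto
  have C\<sigma>: "snd C (\<sigma> z) = joinv z (y a z)" "\<sigma> z \<in> fst C" "chart_inv C (joinv z (y a z)) = \<sigma> z" if "z \<in> W" for z
    using zc[OF that] cotangent_chart_inv[OF c zc(1)[OF that], of "y a z"] by (simp_all add: C_def \<sigma>_def)
  have Yhol: "cholomorphic_vec W (\<lambda>z. joinv z (y a z))"
    by (intro cholomorphic_vec_joinv W) simp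
  obtain X G where XG: "openin (mtop ?T) X" "\<sigma> z0 \<in> X" "holo_fun ?T X G" "\<forall>y\<in>X \<inter> L. G y = F y"
    using gen(1)[OF reg[OF z0]] by blast
  have opX: "open (snd C ` (fst C \<inter> X))" by (rule T.openin_chart_image[OF XG(1) C])
  define W' where "W' = W \<inter> (\<lambda>z. joinv z (y a z)) -` (snd C ` (fst C \<inter> X))"
  have "open W'"
    unfolding W'_def by (rule continuous_open_preimage[OF cholomorphic_vec_continuous_on[OF Yhol] W(1) opX])
  have z0W': "z0 \<in> W'" using z0 C\<sigma>[OF z0] XG by (auto simp: W'_def simp flip: C\<sigma>(1))
  have "cholomorphic W' ((G \<circ> chart_inv C) \<circ> (\<lambda>z. joinv z (y a z)))"
  proof (rule cholomorphic_compose_vec[OF \<open>open W'\<close> opX])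
    show "cholomorphic_vec W' (\<lambda>z. joinv z (y a z))" by (rule cholomorphic_vec_subset[OF Yhol]) (auto simp: W'_def)
    show "cholomorphic (snd C ` (fst C \<inter> X)) (G \<circ> chart_inv C)" using XG(3) C by (simp add: holo_fun_def)
  qed (auto simp: W'_def)
  moreover have "((G \<circ> chart_inv C) \<circ> (\<lambda>z. joinv z (y a z))) z = F (\<sigma> z)" if "z \<in> W'" for z
  proof -
    have zW: "z \<in> W" using that by (simp add: W'_def)
    have "joinv z (y a z) \<in> snd C ` (fst C \<inter> X)" using that by (simp add: W'_def)
    then obtain x where x: "joinv z (y a z) = snd C x" "x \<in> fst C" "x \<in> X" by blast
    have "\<sigma> z = x" using C\<sigma>[OF zW] x T.chart_inj[OF C] by (auto dest: inj_onD)
    then have "\<sigma> z \<in> X \<inter> L" using reg[OF zW] x by (auto simp: Lreg_def reg_points_def)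
    then show ?thesis using XG(4) C\<sigma>[OF zW] by simp
  qed
  ultimately have holF: "cholomorphic W' (\<lambda>z. F (\<sigma> z))"
    by (rule cholomorphic_cong[THEN iffD1, rotated])
  then have D: "((\<lambda>z. F (\<sigma> z)) has_derivative cdot (cgrad (\<lambda>z. F (\<sigma> z)) z0)) (at z0)"
    by (rule cholomorphicD[OF \<open>open W'\<close> _ z0W'])
  have "cdot (cgrad (\<lambda>z. F (\<sigma> z)) z0) v = cdot (y a z0) v" for v
  proof -
    \<comment> \<open>A complex line lifted to the sheet: a holomorphic curve in the regular part,
      along which dF = \<alpha> may be evaluated.\<close>
    define \<gamma> where "\<gamma> = (\<lambda>t. \<sigma> (z0 + t *s v))"
    define \<Omega> where "\<Omega> = {t. z0 + t *s v \<in> W}"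
    have "open \<Omega>"
      using open_vimage[OF W(1), of "\<lambda>t. z0 + t *s v"] by (simp add: \<Omega>_def vimage_def continuous_intros)
    have line: "((\<lambda>t. z0 + t *s v) has_derivative (\<lambda>h. h *s v)) (at s)" for s
      by (rule complex_line_has_derivative)
    have curve: "holo_curve ?T \<Omega> \<gamma>"
    proof (rule T.holo_curveI[OF \<open>open \<Omega>\<close>])
      fix t assume "t \<in> \<Omega>"
      have "((\<lambda>s. snd C (\<gamma> s)) has_derivative (\<lambda>h. h *s (cjac (\<lambda>z. joinv z (y a z)) (z0 + s *s v) *v v))) (at s)"
        if s: "s \<in> \<Omega>" for s
      proof (rule has_derivative_transform_within_open[OF _ \<open>open \<Omega>\<close> s])
        show "((\<lambda>s. joinv (z0 + s *s v) (y a (z0 + s *s v))) has_derivative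
            (\<lambda>h. h *s (cjac (\<lambda>z. joinv z (y a z)) (z0 + s *s v) *v v))) (at s)"
          by (rule curve_chain_vec[OF line cholomorphic_vecD[OF W(1) Yhol]]) (use s in \<open>simp add: \<Omega>_def\<close>)
      qed (simp add: \<gamma>_def \<Omega>_def C\<sigma>)
      then show "\<exists>c O' g. c \<in> atlas ?T \<and> open O' \<and> t \<in> O' \<and> O' \<subseteq> \<Omega> \<and> \<gamma> ` O' \<subseteq> fst c \<and>
        (\<forall>s\<in>O'. ((\<lambda>s. snd c (\<gamma> s)) has_derivative (\<lambda>h. h *s g s)) (at s))"
        using C \<open>open \<Omega>\<close> \<open>t \<in> \<Omega>\<close> C\<sigma>(2)
        by (intro exI[of _ C] exI[of _ \<Omega>] exI[of _ "\<lambda>s. cjac (\<lambda>z. joinv z (y a z)) (z0 + s *s v) *v v"])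
           (auto simp: \<gamma>_def \<Omega>_def)
    qed
    have 0: "0 \<in> \<Omega>" using z0 by (simp add: \<Omega>_def)
    have \<gamma>0: "\<gamma> 0 = \<sigma> z0" by (simp add: \<gamma>_def)
    have base: "((\<lambda>s. snd c (fst (\<gamma> s))) has_derivative (\<lambda>h. h *s v)) (at 0)"
      by (rule has_derivative_transform_within_open[OF line \<open>open \<Omega>\<close> 0]) (auto simp: \<gamma>_def \<Omega>_def \<sigma>_def zc)
    have c0: "c \<in> charts_at M (fst (\<gamma> 0))" using zc[OF z0] by (simp add: \<gamma>0 \<sigma>_def)
    have "((\<lambda>t. F (\<sigma> (z0 + t *s v))) has_field_derivative cdot (cgrad (\<lambda>z. F (\<sigma> z)) z0) v) (at 0)"
      using has_field_derivative_complex_line[where f = "\<lambda>z. F (\<sigma> z)" and z = z0 and u = 0] D by simp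
    then have "cdot (cgrad (\<lambda>z. F (\<sigma> z)) z0) v = deriv (\<lambda>s. F (\<gamma> s)) 0"
      by (simp add: \<gamma>_def DERIV_imp_deriv)
    also have "\<dots> = canonical_form M (\<gamma> 0) (velocity ?T \<gamma> 0)"
      by (rule gen(2)[OF curve _ 0]) (use reg in \<open>auto simp: \<gamma>_def \<Omega>_def\<close>)
    also have "\<dots> = snd (\<gamma> 0) (tvec_of M c (fst (\<gamma> 0)) v)"
      unfolding canonical_form_def differential_projection[OF curve 0 c0 base] ..
    also have "\<dots> = cdot (y a z0) v"
      using zc[OF z0] by (simp add: \<gamma>0 \<sigma>_def covec_of_apply)
    finally show ?thesis .
  qed
  then have "cdot (cgrad (\<lambda>z. F (\<sigma> z)) z0) = cdot (y a z0)" by auto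
  with D show ?thesis by (simp add: \<sigma>_def Fcoord_def)
qed

end

section \<open>Canonical coordinates\<close>

text \<open>The unit field in canonical coordinates: every character takes the value 1 on
  \<open>e\<close>.\<close>

abbreviation ones :: "complex^'n::finite" where
  "ones \<equiv> (\<chi> a. 1)"

lemma curve_constant_velocity:
  fixes g :: "complex \<Rightarrow> complex^'k::finite"
  assumes "\<And>t. t \<in> ball t0 r \<Longrightarrow> (g has_derivative (\<lambda>h. h *s v)) (at t)" "t \<in> ball t0 r"
  shows "g t = g t0 + (t - t0) *s v"
proof -
  have "0 < r" using assms(2) by (metis ball_eq_empty empty_iff not_le)
  have "g t $ i = g t0 $ i + (t - t0) * v $ i" for i
  proof -
    have D: "((\<lambda>t. g t $ i - (t - t0) * v $ i) has_field_derivative 0) (at s)" if "s \<in> ball t0 r" for s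
    proof -
      have "((\<lambda>t. g t $ i) has_field_derivative v $ i) (at s)"
        using assms(1)[OF that] by (simp add: has_derivative_curve_iff)
      then show ?thesis
        by (auto intro!: derivative_eq_intros)
    qed
    have "(\<lambda>t. g t $ i - (t - t0) * v $ i) constant_on ball t0 r"
      by (rule has_field_derivative_0_imp_constant_on) (use D in auto)
    then have "g t $ i - (t - t0) * v $ i = g t0 $ i - (t0 - t0) * v $ i"
      using assms(2) \<open>0 < r\<close> unfolding constant_on_def by (metis centre_in_ball)
    then show ?thesis by (simp add: algebra_simps)
  qed
  then show ?thesis unfolding vec_eq_iff vector_add_component vector_smult_component by blast
qed

context generated_F_manifold
begin

text \<open>The complement of the bifurcation diagram (\<open>bifurcation_iff\<close>). As there are
  at most n characters, n different values force n characters, and so a frame.\<close>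

definition good :: "'a \<Rightarrow> bool" where
  "good p \<longleftrightarrow> p \<in> points M \<and> card (Fvals p) = CARD('n)"

lemma good_points: "good p \<Longrightarrow> p \<in> points M"
  by (simp add: good_def)

text \<open>All data are written in the chart \<open>c\<close>: the components of \<open>\<psi>\<close> are the values of \<open>F\<close>, the rows of its
  Jacobian \<open>Y\<close> are the characters (this is \<open>dF = \<alpha>\<close>), and \<open>g\<close> is the inverse of \<open>\<psi>\<close>.\<close>

definition canonical_chart ::
    "('a, 'n) chart \<Rightarrow> (complex^'n) set \<Rightarrow> (complex^'n) set \<Rightarrow> (complex^'n \<Rightarrow> complex^'n) \<Rightarrow>
     (complex^'n \<Rightarrow> complex^'n) \<Rightarrow> (complex^'n \<Rightarrow> complex^'n^'n) \<Rightarrow> bool" where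
  "canonical_chart c W V \<psi> g Y \<longleftrightarrow> c \<in> atlas M \<and> open W \<and> W \<subseteq> snd c ` fst c \<and> open V \<and> homeomorphism W V \<psi> g \<and>
     cholomorphic_vec W \<psi> \<and> cholomorphic_vec V g \<and>
     (\<forall>z\<in>W. (\<psi> has_derivative (*v) (Y z)) (at z) \<and> invertible (Y z) \<and>
        (g has_derivative (*v) (matrix_inv (Y z))) (at (\<psi> z)) \<and>
        Fvals (chart_inv c z) = range (\<lambda>a. \<psi> z $ a) \<and> chars c (chart_inv c z) = range (\<lambda>a. Y z $ a) \<and>
        inj (\<lambda>a. \<psi> z $ a) \<and> Y z *v e (chart_inv c z) c = ones \<and>
        (\<forall>a. Fcoord c (chart_inv c z) (Y z $ a) = \<psi> z $ a))"

text \<open>Stated for points that have a frame, where values of \<open>F\<close> may still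
  coincide; the density of the good points starts from such semisimple points.\<close>

lemma frame_canonical:
  assumes c: "c \<in> charts_at M p0" and f: "cn_algebra.frame (star c p0) f"
  obtains W y where "open W" "snd c p0 \<in> W" "W \<subseteq> snd c ` fst c" "\<And>a. cholomorphic_vec W (y a)"
    "\<And>z a. z \<in> W \<Longrightarrow> ((\<lambda>z. Fcoord c (chart_inv c z) (y a z)) has_derivative cdot (y a z)) (at z)"
    "\<And>z. z \<in> W \<Longrightarrow> Fvals (chart_inv c z) = range (\<lambda>a. Fcoord c (chart_inv c z) (y a z))"
    "\<And>z. z \<in> W \<Longrightarrow> chars c (chart_inv c z) = range (\<lambda>a. y a z)"
    "\<And>z x. z \<in> W \<Longrightarrow> \<forall>a. cdot (y a z) x = 0 \<Longrightarrow> x = 0"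
    "\<And>z a. z \<in> W \<Longrightarrow> cdot (y a z) (e (chart_inv c z) c) = 1"
    "\<And>a b. cdot (y a (snd c p0)) (f b) = (if a = b then 1 else 0)"
proof -
  have ca: "c \<in> atlas M" "p0 \<in> fst c" using c by (auto simp: charts_at_def)
  obtain W y where W: "open W" "snd c p0 \<in> W" "W \<subseteq> snd c ` fst c" "\<And>a. cholomorphic_vec W (y a)"
    "\<And>z. z \<in> W \<Longrightarrow> inj (\<lambda>a. y a z)"
    "\<And>z. z \<in> W \<Longrightarrow> chars c (chart_inv c z) = range (\<lambda>a. y a z)"
    "\<And>z x. z \<in> W \<Longrightarrow> (\<And>a. cdot (y a z) x = 0) \<Longrightarrow> x = 0"
    "\<And>a b. cdot (y a (snd c p0)) (f b) = (if a = b then 1 else 0)"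
    by (rule local_characters[OF c f]) blast
  show ?thesis
  proof (rule that[of W y])
    fix z assume z: "z \<in> W"
    have ch: "c \<in> charts_at M (chart_inv c z)" by (rule chart_inv_charts_at[OF ca(1) subsetD[OF W(3) z]])
    interpret A: cn_algebra "star c (chart_inv c z)" "e (chart_inv c z) c" by (rule algebra_at[OF ch])
    show "((\<lambda>z. Fcoord c (chart_inv c z) (y a z)) has_derivative cdot (y a z)) (at z)" for a
      by (rule section_generating_function[OF ca(1) W(1,3,4,5,6) z])
    show "Fvals (chart_inv c z) = range (\<lambda>a. Fcoord c (chart_inv c z) (y a z))"
      unfolding Fvals_chart[OF ch] W(6)[OF z] by (simp add: image_image)
    have "y a z \<in> A.characters" for a unfolding W(6)[OF z] by simp
    then show "cdot (y a z) (e (chart_inv c z) c) = 1" for a by (rule A.characters_one)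
  qed (use W in blast)+
qed

lemma good_frame:
  assumes "good p" "c \<in> charts_at M p"
  shows "\<exists>f. cn_algebra.frame (star c p) f"
proof -
  interpret A: cn_algebra "star c p" "e p c" by (rule algebra_at[OF assms(2)])
  have "card (Fvals p) \<le> card A.characters"
    unfolding Fvals_chart[OF assms(2)] by (rule card_image_le[OF A.finite_characters])
  then have "card A.characters = CARD('n)"
    using assms(1) A.card_characters_le by (simp add: good_def)
  then show ?thesis by (rule A.frame_exists)
qed

text \<open>The Jacobian of the n values has the characters as rows and is therefore invertible. The
  domain is first shrunk until the values are different at each of its points.\<close>

lemma good_canonical_chart:
  assumes p0: "good p0" and c: "c \<in> charts_at M p0"
  obtains W V \<psi> g Y where "canonical_chart c W V \<psi> g Y" "snd c p0 \<in> W"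
proof -
  have ca: "c \<in> atlas M" "p0 \<in> fst c" using c by (auto simp: charts_at_def)
  obtain f where f: "cn_algebra.frame (star c p0) f" using good_frame[OF p0 c] by blast
  obtain W y where W: "open W" "snd c p0 \<in> W" "W \<subseteq> snd c ` fst c" "\<And>a. cholomorphic_vec W (y a)"
    "\<And>z a. z \<in> W \<Longrightarrow> ((\<lambda>z. Fcoord c (chart_inv c z) (y a z)) has_derivative cdot (y a z)) (at z)"
    "\<And>z. z \<in> W \<Longrightarrow> Fvals (chart_inv c z) = range (\<lambda>a. Fcoord c (chart_inv c z) (y a z))"
    "\<And>z. z \<in> W \<Longrightarrow> chars c (chart_inv c z) = range (\<lambda>a. y a z)"
    "\<And>z x. z \<in> W \<Longrightarrow> \<forall>a. cdot (y a z) x = 0 \<Longrightarrow> x = 0"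
    "\<And>z a. z \<in> W \<Longrightarrow> cdot (y a z) (e (chart_inv c z) c) = 1"
    "\<And>a b. cdot (y a (snd c p0)) (f b) = (if a = b then 1 else 0)"
    by (rule frame_canonical[OF c f], rule that) assumption+
  define \<psi> where "\<psi> = (\<lambda>z. \<chi> a. Fcoord c (chart_inv c z) (y a z))"
  define Y where "Y = (\<lambda>z. \<chi> a. y a z)"
  have D: "(\<psi> has_derivative (*v) (Y z)) (at z)" if "z \<in> W" for z
    by (rule has_derivative_vecI) (simp add: \<psi>_def Y_def W(5)[OF that])
  have hol: "cholomorphic_vec W \<psi>" using D by (rule cholomorphic_vecI)
  have inv: "invertible (Y z)" if "z \<in> W" for z
    unfolding invertible_left_inverse matrix_left_invertible_ker
    using W(8)[OF that] by (simp add: vec_eq_iff matrix_vector_cdot Y_def)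
  have Fv: "Fvals (chart_inv c z) = range (\<lambda>a. \<psi> z $ a)" if "z \<in> W" for z
    unfolding W(6)[OF that] by (simp add: \<psi>_def)
  have cont: "continuous_on W (\<lambda>z. \<psi> z $ a)" for a
    using cholomorphic_continuous_on hol by (auto simp: cholomorphic_vec_def)
  define W1 where "W1 = W \<inter> (\<Inter>a. \<Inter>b\<in>-{a}. W \<inter> (\<lambda>z. \<psi> z $ a - \<psi> z $ b) -` (-{0}))"
  have opab: "open (W \<inter> (\<lambda>z. \<psi> z $ a - \<psi> z $ b) -` (-{0}))" for a b
    by (rule continuous_open_preimage[OF continuous_on_diff[OF cont cont] W(1)]) auto
  have "open W1" unfolding W1_def by (intro open_Int open_INT ballI W(1) opab finite)
  have W1_iff: "z \<in> W1 \<longleftrightarrow> z \<in> W \<and> inj (\<lambda>a. \<psi> z $ a)" for z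
    unfolding W1_def Int_iff INT_iff vimage_eq inj_def by auto
  have "inj (\<lambda>a. \<psi> (snd c p0) $ a)"
  proof -
    have "card (range (\<lambda>a. \<psi> (snd c p0) $ a)) = CARD('n)"
      using p0 Fv[OF W(2)] ca by (simp add: good_def)
    then show ?thesis by (simp add: eq_card_imp_inj_on)
  qed
  then have z0: "snd c p0 \<in> W1" using W by (simp add: W1_iff)
  have hol1: "cholomorphic_vec W1 \<psi>" by (rule cholomorphic_vec_subset[OF hol]) (simp add: W1_def)
  have jac: "cjac \<psi> z = Y z" if "z \<in> W" for z by (rule cjac_eq[OF D[OF that]])
  have "invertible (cjac \<psi> (snd c p0))" using inv jac W by simp
  then obtain U V g where g: "open U" "U \<subseteq> W1" "snd c p0 \<in> U" "open V" "\<psi> (snd c p0) \<in> V" "homeomorphism U V \<psi> g"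
    "cholomorphic_vec V g" "\<And>z. z \<in> U \<Longrightarrow> cjac g (\<psi> z) = matrix_inv (cjac \<psi> z)"
    by (rule holomorphic_inverse_function[OF \<open>open W1\<close> hol1 z0]) blast
  have "canonical_chart c U V \<psi> g Y"
    unfolding canonical_chart_def
  proof (intro conjI ballI)
    have "W1 \<subseteq> W" using W1_iff by blast
    then show "U \<subseteq> snd c ` fst c" using g(2) W(3) by (meson order_trans)
    show "cholomorphic_vec U \<psi>" by (rule cholomorphic_vec_subset[OF hol1 g(2)])
    fix z assume z: "z \<in> U"
    then have zW: "z \<in> W" "inj (\<lambda>a. \<psi> z $ a)" using g(2) W1_iff by auto
    have "\<psi> z \<in> V" using g(6) z by (auto simp: homeomorphism_def)
    from cholomorphic_vecD[OF g(4,7) this] show "(g has_derivative (*v) (matrix_inv (Y z))) (at (\<psi> z))"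
      unfolding g(8)[OF z] jac[OF zW(1)] .
    show "Y z *v e (chart_inv c z) c = ones"
      using W(9)[OF zW(1)] by (simp add: vec_eq_iff matrix_vector_cdot Y_def)
    show "chars c (chart_inv c z) = range (\<lambda>a. Y z $ a)" using W(7)[OF zW(1)] by (simp add: Y_def)
    show "\<forall>a. Fcoord c (chart_inv c z) (Y z $ a) = \<psi> z $ a" by (simp add: Y_def \<psi>_def)
  qed (use g ca D Fv inv W1_iff in auto)
  then show ?thesis using that g(3) by blast
qed

lemma canonical_chartD:
  assumes "canonical_chart c W V \<psi> g Y"
  shows "c \<in> atlas M" "open W" "W \<subseteq> snd c ` fst c" "open V" "cholomorphic_vec W \<psi>" "cholomorphic_vec V g"
    "\<And>z. z \<in> W \<Longrightarrow> \<psi> z \<in> V" "\<And>z. z \<in> W \<Longrightarrow> g (\<psi> z) = z" "\<And>w. w \<in> V \<Longrightarrow> g w \<in> W" "\<And>w. w \<in> V \<Longrightarrow> \<psi> (g w) = w"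
    "\<And>z. z \<in> W \<Longrightarrow> (\<psi> has_derivative (*v) (Y z)) (at z)" "\<And>z. z \<in> W \<Longrightarrow> invertible (Y z)"
    "\<And>z. z \<in> W \<Longrightarrow> (g has_derivative (*v) (matrix_inv (Y z))) (at (\<psi> z))"
    "\<And>z. z \<in> W \<Longrightarrow> Fvals (chart_inv c z) = range (\<lambda>a. \<psi> z $ a)"
    "\<And>z. z \<in> W \<Longrightarrow> chars c (chart_inv c z) = range (\<lambda>a. Y z $ a)"
    "\<And>z. z \<in> W \<Longrightarrow> inj (\<lambda>a. \<psi> z $ a)" "\<And>z. z \<in> W \<Longrightarrow> Y z *v e (chart_inv c z) c = ones"
    "\<And>z a. z \<in> W \<Longrightarrow> Fcoord c (chart_inv c z) (Y z $ a) = \<psi> z $ a"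
  using assms unfolding canonical_chart_def homeomorphism_def by auto

lemma canonical_chart_point:
  assumes "canonical_chart c W V \<psi> g Y" "p \<in> fst c" "snd c p \<in> W"
  shows "p \<in> points M" "c \<in> charts_at M p" "chart_inv c (snd c p) = p" "good p" "Fvals p = range (\<lambda>a. \<psi> (snd c p) $ a)"
proof -
  note C = canonical_chartD[OF assms(1)]
  show p: "p \<in> points M" "c \<in> charts_at M p" "chart_inv c (snd c p) = p"
    using C(1) assms chart_subset[of c] by (auto simp: charts_at_def)
  show Fv: "Fvals p = range (\<lambda>a. \<psi> (snd c p) $ a)" using C(14)[OF assms(3)] p by simp
  show "good p" using p C(16)[OF assms(3)] by (simp add: good_def Fv card_image)
qed

lemma canonical_chart_inv_point:
  assumes "canonical_chart c W V \<psi> g Y" "z \<in> W"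
  shows "chart_inv c z \<in> fst c" "snd c (chart_inv c z) = z"
  using canonical_chartD(3)[OF assms(1)] assms(2) by (simp_all add: chart_inv_mem chart_inv_right subset_eq)

text \<open>Evaluating all n characters at once is the isomorphism onto the componentwise
  algebra.\<close>

lemma good_semisimple:
  assumes "good p"
  shows "semisimple_at M m p"
proof -
  obtain c where c: "c \<in> charts_at M p" using points_chart[OF good_points[OF assms]] by blast
  interpret A: cn_algebra "star c p" "e p c" by (rule algebra_at[OF c])
  obtain f where f: "A.frame f" using good_frame[OF assms c] by blast
  obtain y where y: "\<And>a b. cdot (y a) (f b) = (if a = b then 1 else 0)"
    "\<And>v. v = (\<Sum>a\<in>UNIV. cdot (y a) v *s f a)" "A.characters = range y" "\<And>x. (\<And>a. cdot (y a) x = 0) \<Longrightarrow> x = 0"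
    by (rule A.frame_dual[OF f], rule that) (assumption+, blast)
  define \<Phi> where "\<Phi> = (\<lambda>v :: ('a, 'n) tvec. \<chi> a. cdot (y a) (v c))"
  have "bij_betw \<Phi> (tangent_space M p) UNIV"
    unfolding bij_betw_def
  proof
    show "inj_on \<Phi> (tangent_space M p)"
    proof (rule inj_onI)
      fix v w assume vw: "v \<in> tangent_space M p" "w \<in> tangent_space M p" "\<Phi> v = \<Phi> w"
      then have "v c - w c = 0" by (intro y(4)) (simp add: \<Phi>_def vec_eq_iff cdot_diff_right)
      then show "v = w" using tangent_eqI[OF vw(1,2) c] by simp
    qed
    have "x \<in> \<Phi> ` tangent_space M p" for x
    proof
      show "x = \<Phi> (tvec_of M c p (\<Sum>a\<in>UNIV. x $ a *s f a))"
        using c by (simp add: \<Phi>_def vec_eq_iff cdot_sum_right cdot_smult_right y(1) if_distrib cong: if_cong)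
    qed (use c in simp)
    then show "\<Phi> ` tangent_space M p = UNIV" by auto
  qed
  moreover have "\<Phi> (m p v w) = \<Phi> v * \<Phi> w" if vw: "v \<in> tangent_space M p" "w \<in> tangent_space M p" for v w
  proof -
    have "m p v w c = star c p (v c) (w c)"
      unfolding star_def tangent_eq_tvec_of[OF vw(1) c] tangent_eq_tvec_of[OF vw(2) c] ..
    moreover have "y a \<in> A.characters" for a using y(3) by simp
    ultimately have "cdot (y a) (m p v w c) = cdot (y a) (v c) * cdot (y a) (w c)" for a
      using A.characters_mult by simp
    then show ?thesis by (simp add: \<Phi>_def vec_eq_iff)
  qed
  moreover have "\<Phi> (v + w) = \<Phi> v + \<Phi> w" "\<Phi> (tscale a v) = a *s \<Phi> v" for v w a
    by (simp_all add: \<Phi>_def vec_eq_iff cdot_add_right tscale_def cdot_smult_right)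
  ultimately show ?thesis unfolding semisimple_at_def by blast
qed

subsection \<open>Integral curves of the unit field\<close>

text \<open>In canonical coordinates \<open>e\<close> is the constant field \<open>ones\<close>, so
  integral curves are complex affine lines there.\<close>

lemma integral_curve_canonical:
  assumes \<gamma>: "integral_curve M e \<Omega> \<gamma>" and t0: "t0 \<in> \<Omega>" and C: "canonical_chart c W V \<psi> g Y"
    and \<gamma>t0: "\<gamma> t0 \<in> fst c" "snd c (\<gamma> t0) \<in> W"
  obtains r where "0 < r" "ball t0 r \<subseteq> \<Omega>" "\<And>t. t \<in> ball t0 r \<Longrightarrow> \<gamma> t \<in> fst c" "\<And>t. t \<in> ball t0 r \<Longrightarrow> snd c (\<gamma> t) \<in> W"
    "\<And>t. t \<in> ball t0 r \<Longrightarrow> \<psi> (snd c (\<gamma> t)) = \<psi> (snd c (\<gamma> t0)) + (t - t0) *s ones"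
proof -
  note CD = canonical_chartD[OF C]
  have curve: "holo_curve M \<Omega> \<gamma>" using \<gamma> by (simp add: integral_curve_def)
  have "open {s \<in> \<Omega>. \<gamma> s \<in> {p \<in> fst c. snd c p \<in> W}}"
    by (rule holo_curve_preimage_open[OF curve openin_chart_preimage[OF CD(1,2)]])
  then obtain r where r: "0 < r" "ball t0 r \<subseteq> {s \<in> \<Omega>. \<gamma> s \<in> {p \<in> fst c. snd c p \<in> W}}"
    using t0 \<gamma>t0 openE by (metis (no_types, lifting) mem_Collect_eq)
  have D: "((\<lambda>s. \<psi> (snd c (\<gamma> s))) has_derivative (\<lambda>h. h *s ones)) (at t)" if t: "t \<in> ball t0 r" for t
  proof -
    have t': "t \<in> \<Omega>" "\<gamma> t \<in> fst c" "snd c (\<gamma> t) \<in> W" using r t by auto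
    have ch: "c \<in> charts_at M (\<gamma> t)" "chart_inv c (snd c (\<gamma> t)) = \<gamma> t" using canonical_chart_point[OF C t'(2,3)] by auto
    have "((\<lambda>s. snd c (\<gamma> s)) has_derivative (\<lambda>h. h *s e (\<gamma> t) c)) (at t)"
      using holo_curveD[OF curve t'(1) ch(1)] \<gamma> t' by (simp add: integral_curve_def)
    from curve_chain_vec[OF this CD(11)[OF t'(3)]] show ?thesis
      using CD(17)[OF t'(3)] ch by simp
  qed
  show ?thesis
    by (rule that[OF r(1) _ _ _ curve_constant_velocity[OF D]]) (use r in auto)
qed

lemma integral_curve_shift:
  assumes "integral_curve M e \<Omega> \<gamma>"
  shows "integral_curve M e ((\<lambda>t. t - a) ` \<Omega>) (\<lambda>t. \<gamma> (t + a))"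
proof -
  have curve: "holo_curve M \<Omega> \<gamma>" "connected \<Omega>" "\<And>t. t \<in> \<Omega> \<Longrightarrow> velocity M \<gamma> t = e (\<gamma> t)"
    using assms by (auto simp: integral_curve_def)
  have D: "((\<lambda>s. snd c (\<gamma> (s + a))) has_derivative (\<lambda>h. h *s velocity M \<gamma> (t + a) c)) (at t)"
    if "t + a \<in> \<Omega>" "c \<in> charts_at M (\<gamma> (t + a))" for t c
    using holo_curveD[OF curve(1) that] unfolding has_derivative_curve_iff by (simp add: DERIV_shift)
  have iff: "t \<in> (\<lambda>t. t - a) ` \<Omega> \<longleftrightarrow> t + a \<in> \<Omega>" for t by force
  have "open ((\<lambda>t. t - a) ` \<Omega>)"
    using curve(1) open_translation_subtract by (auto simp: holo_curve_def)
  then have "holo_curve M ((\<lambda>t. t - a) ` \<Omega>) (\<lambda>t. \<gamma> (t + a))"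
  proof (rule holo_curveI)
    fix t assume t: "t \<in> (\<lambda>t. t - a) ` \<Omega>"
    then have t': "t + a \<in> \<Omega>" by (simp add: iff)
    obtain c where c: "c \<in> charts_at M (\<gamma> (t + a))" using points_chart[OF holo_curve_points[OF curve(1) t']] by blast
    have ca: "c \<in> atlas M" "\<gamma> (t + a) \<in> fst c" using c by (auto simp: charts_at_def)
    have "open {s \<in> \<Omega>. \<gamma> s \<in> fst c}" by (rule holo_curve_preimage_open[OF curve(1) openin_chart[OF ca(1)]])
    then have "open ((\<lambda>t. t - a) ` {s \<in> \<Omega>. \<gamma> s \<in> fst c})" by (rule open_translation_subtract)
    moreover have "(\<lambda>t. t - a) ` {s \<in> \<Omega>. \<gamma> s \<in> fst c} = {s. s + a \<in> \<Omega> \<and> \<gamma> (s + a) \<in> fst c}" by force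
    ultimately show "\<exists>c O' g. c \<in> atlas M \<and> open O' \<and> t \<in> O' \<and> O' \<subseteq> (\<lambda>t. t - a) ` \<Omega> \<and> (\<lambda>t. \<gamma> (t + a)) ` O' \<subseteq> fst c \<and>
        (\<forall>s\<in>O'. ((\<lambda>s. snd c (\<gamma> (s + a))) has_derivative (\<lambda>h. h *s g s)) (at s))"
      using ca t' D
      by (intro exI[of _ c] exI[of _ "{s. s + a \<in> \<Omega> \<and> \<gamma> (s + a) \<in> fst c}"] exI[of _ "\<lambda>s. velocity M \<gamma> (s + a) c"])
         (auto simp: iff charts_at_def)
  qed
  moreover have "velocity M (\<lambda>t. \<gamma> (t + a)) t = e (\<gamma> (t + a))" if t: "t \<in> (\<lambda>t. t - a) ` \<Omega>" for t
  proof
    fix c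
    have t': "t + a \<in> \<Omega>" using t by (simp add: iff)
    show "velocity M (\<lambda>t. \<gamma> (t + a)) t c = e (\<gamma> (t + a)) c"
    proof (cases "c \<in> charts_at M (\<gamma> (t + a))")
      case True
      then show ?thesis using velocity_eqI[OF True D[OF t' True]] curve(3)[OF t'] by simp
    next
      case False
      then have "velocity M \<gamma> (t + a) c = 0" by (simp add: velocity_def)
      then have "e (\<gamma> (t + a)) c = 0" unfolding curve(3)[OF t'] .
      then show ?thesis using False by (simp add: velocity_def)
    qed
  qed
  moreover have "connected ((\<lambda>t. t - a) ` \<Omega>)"
    using curve(2) by (intro connected_continuous_image continuous_intros)
  ultimately show ?thesis by (simp add: integral_curve_def)
qed

text \<open>Lines in canonical coordinates, pulled back to \<open>M\<close>. With direction
  \<open>ones\<close> they are the flow lines of \<open>e\<close>; with directions in a coordinate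
  hyperplane they realize the tangent vectors of the discriminant.\<close>

lemma canonical_curve:
  assumes C: "canonical_chart c W V \<psi> g Y" and w: "\<forall>s\<in>ball 0 r. w + s *s v \<in> V"
  defines "\<gamma> \<equiv> \<lambda>s. chart_inv c (g (w + s *s v))"
  shows "holo_curve M (ball 0 r) \<gamma>"
    "\<And>s. s \<in> ball 0 r \<Longrightarrow> \<gamma> s \<in> fst c" "\<And>s. s \<in> ball 0 r \<Longrightarrow> snd c (\<gamma> s) \<in> W"
    "\<And>s. s \<in> ball 0 r \<Longrightarrow> \<psi> (snd c (\<gamma> s)) = w + s *s v"
    "\<And>s. s \<in> ball 0 r \<Longrightarrow> velocity M \<gamma> s c = matrix_inv (Y (snd c (\<gamma> s))) *v v"
proof -
  note CD = canonical_chartD[OF C]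
  show pt: "\<gamma> s \<in> fst c" and ptW: "snd c (\<gamma> s) \<in> W" and pt\<psi>: "\<psi> (snd c (\<gamma> s)) = w + s *s v"
    if "s \<in> ball 0 r" for s
    using canonical_chart_inv_point[OF C CD(9)[OF bspec[OF w that]]] CD(9,10)[OF bspec[OF w that]] by (auto simp: \<gamma>_def)
  have eq: "snd c (\<gamma> s) = g (w + s *s v)" if "s \<in> ball 0 r" for s
    using canonical_chart_inv_point[OF C CD(9)[OF bspec[OF w that]]] by (simp add: \<gamma>_def)
  have D: "((\<lambda>s. snd c (\<gamma> s)) has_derivative (\<lambda>h. h *s (matrix_inv (Y (snd c (\<gamma> s))) *v v))) (at s)"
    if s: "s \<in> ball 0 r" for s
  proof (rule has_derivative_transform_within_open[OF _ open_ball s])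
    show "((\<lambda>s. g (w + s *s v)) has_derivative (\<lambda>h. h *s (matrix_inv (Y (snd c (\<gamma> s))) *v v))) (at s)"
      by (rule curve_chain_vec[OF complex_line_has_derivative]) (use CD(13)[OF ptW[OF s]] pt\<psi>[OF s] in simp)
  qed (simp add: eq)
  show "holo_curve M (ball 0 r) \<gamma>"
  proof (rule holo_curveI)
    fix t :: complex assume "t \<in> ball 0 r"
    then show "\<exists>c' O' g'. c' \<in> atlas M \<and> open O' \<and> t \<in> O' \<and> O' \<subseteq> ball 0 r \<and> \<gamma> ` O' \<subseteq> fst c' \<and>
       (\<forall>s\<in>O'. ((\<lambda>s. snd c' (\<gamma> s)) has_derivative (\<lambda>h. h *s g' s)) (at s))"
      using CD(1) D pt
      by (intro exI[of _ c] exI[of _ "ball 0 r"] exI[of _ "\<lambda>s. matrix_inv (Y (snd c (\<gamma> s))) *v v"]) auto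
  qed simp
  show "velocity M \<gamma> s c = matrix_inv (Y (snd c (\<gamma> s))) *v v" if "s \<in> ball 0 r" for s
    by (rule velocity_eqI[OF _ D[OF that]]) (use pt[OF that] CD(1) in \<open>simp add: charts_at_def\<close>)
qed

lemma canonical_flow_curve:
  assumes C: "canonical_chart c W V \<psi> g Y" and w: "\<forall>s\<in>ball 0 r. w + s *s ones \<in> V"
  shows "integral_curve M e (ball 0 r) (\<lambda>s. chart_inv c (g (w + s *s ones)))" (is "integral_curve M e _ ?\<gamma>")
proof -
  note CD = canonical_chartD[OF C]
  note \<gamma> = canonical_curve[OF C w]
  have "velocity M ?\<gamma> t = e (?\<gamma> t)" if t: "t \<in> ball 0 r" for t
  proof (rule tangent_eqI[OF velocity_tangent[OF \<gamma>(1) t]])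
    show ch: "c \<in> charts_at M (?\<gamma> t)" using \<gamma>(2)[OF t] CD(1) by (simp add: charts_at_def)
    show "e (?\<gamma> t) \<in> tangent_space M (?\<gamma> t)"
      by (rule e_tangent[OF charts_at_points[OF ch]])
    have "e (?\<gamma> t) c = matrix_inv (Y (snd c (?\<gamma> t))) *v (Y (snd c (?\<gamma> t)) *v e (?\<gamma> t) c)"
      using matrix_inv_inverse[OF CD(12)[OF \<gamma>(3)[OF t]]] by (simp add: matrix_vector_mul_assoc)
    then show "velocity M ?\<gamma> t c = e (?\<gamma> t) c"
      using CD(17)[OF \<gamma>(3)[OF t]] \<gamma>(5)[OF t] canonical_chart_point(3)[OF C \<gamma>(2)[OF t] \<gamma>(3)[OF t]] by simp
  qed
  with \<gamma>(1) show ?thesis by (simp add: integral_curve_def)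
qed

subsection \<open>Limits of values of the generating function\<close>

text \<open>Bounded characters have convergent subsequences, the equations of a character are closed
  conditions, and \<open>F\<close> is continuous on \<open>L\<close>. The limits for different
  indices may coincide; ruling this out is left to the applications.\<close>

lemma Fvals_limit:
  assumes c: "c \<in> charts_at M q" and z: "z \<longlonglongrightarrow> snd c q" "\<And>k. z k \<in> snd c ` fst c"
    and f: "\<And>k a. f k a \<in> Fvals (chart_inv c (z k))"
  obtains r h where "strict_mono (r :: nat \<Rightarrow> nat)" "\<And>a :: 'n. h a \<in> Fvals q" "\<And>a. (\<lambda>k. f (r k) a) \<longlonglongrightarrow> h a"
proof -
  have ca: "c \<in> atlas M" "q \<in> fst c" using c by (auto simp: charts_at_def)
  interpret Aq: cn_algebra "star c q" "e q c" by (rule algebra_at[OF c])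
  have chz: "c \<in> charts_at M (chart_inv c (z k))" for k by (rule chart_inv_charts_at[OF ca(1) z(2)])
  have "\<exists>y. y \<in> chars c (chart_inv c (z k)) \<and> f k a = Fcoord c (chart_inv c (z k)) y" for k a
    using f[of k a] unfolding Fvals_chart[OF chz] by auto
  then obtain y where y: "\<And>k a. y k a \<in> chars c (chart_inv c (z k))" "\<And>k a. f k a = Fcoord c (chart_inv c (z k)) (y k a)"
    by metis
  obtain W K where W: "open W" "snd c q \<in> W" "W \<subseteq> snd c ` fst c" "0 < K"
    "\<And>z y. z \<in> W \<Longrightarrow> y \<in> chars c (chart_inv c z) \<Longrightarrow> norm y \<le> K"
    using characters_bounded[OF c] by metis
  obtain N where N: "\<And>k. N \<le> k \<Longrightarrow> z k \<in> W"
    using topological_tendstoD[OF z(1) W(1,2)] by (auto simp: eventually_sequentially)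
  \<comment> \<open>The n sequences of characters are the rows of one sequence of matrices, so that
    a common subsequence is obtained.\<close>
  define Yk where "Yk = (\<lambda>k. \<chi> a. y (k + N) a)"
  have "norm (Yk k) \<le> real CARD('n) * K" for k
  proof -
    have "norm (Yk k) \<le> (\<Sum>a\<in>UNIV. norm (Yk k $ a))"
      unfolding norm_vec_def[of "Yk k"] by (rule L2_set_le_sum) simp
    also have "\<dots> \<le> (\<Sum>a\<in>(UNIV::'n set). K)"
      by (intro sum_mono) (use W(5)[OF N y(1)] in \<open>simp add: Yk_def\<close>)
    finally show ?thesis by simp
  qed
  then have "bounded (range Yk)" by (auto simp: bounded_iff)
  then obtain l s where s: "strict_mono s" "(Yk \<circ> s) \<longlonglongrightarrow> l"
    using bounded_imp_convergent_subsequence by metis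
  define r where "r = (\<lambda>k. s k + N)"
  have r: "strict_mono r" using s(1) by (simp add: r_def strict_mono_def)
  have yl: "(\<lambda>k. y (r k) a) \<longlonglongrightarrow> l $ a" for a
    using tendsto_vec_nth[OF s(2), of a] by (simp add: Yk_def r_def o_def)
  have zr: "(\<lambda>k. z (r k)) \<longlonglongrightarrow> snd c q" using LIMSEQ_subseq_LIMSEQ[OF z(1) r] by (simp add: o_def)
  have lim: "(\<lambda>k. h (z (r k))) \<longlonglongrightarrow> h (snd c q)" if "cholomorphic_vec (snd c ` fst c) h" for h :: "complex^'n \<Rightarrow> complex^'n"
    using continuous_on_tendsto_compose[OF cholomorphic_vec_continuous_on[OF that] zr] z(2) ca by auto
  have la: "l $ a \<in> Aq.characters" for a
    unfolding Aq.characters_def mem_Collect_eq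
  proof (intro conjI allI)
    have "(\<lambda>k. cdot (y (r k) a) (e (chart_inv c (z (r k))) c)) \<longlonglongrightarrow> cdot (l $ a) (e q c)"
      using tendsto_cdot[OF yl[of a] lim[OF e_holomorphic[OF ca(1)]]] ca by simp
    moreover have "cdot (y (r k) a) (e (chart_inv c (z (r k))) c) = 1" for k
      using cn_algebra.characters_one[OF algebra_at[OF chz] y(1)] by simp
    ultimately show "cdot (l $ a) (e q c) = 1" by (simp add: LIMSEQ_const_iff)
    fix u v
    have "(\<lambda>k. cdot (y (r k) a) (star c (chart_inv c (z (r k))) u v)) \<longlonglongrightarrow> cdot (l $ a) (star c q u v)"
      using tendsto_cdot[OF yl[of a] lim[OF star_holomorphic[OF ca(1) cholomorphic_vec_ident chart_open[OF ca(1)] _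
          cholomorphic_vec_const cholomorphic_vec_const, of u v]]] ca by simp
    moreover have "cdot (y (r k) a) (star c (chart_inv c (z (r k))) u v) = cdot (y (r k) a) u * cdot (y (r k) a) v" for k
      using cn_algebra.characters_mult[OF algebra_at[OF chz] y(1)] by simp
    ultimately have "(\<lambda>k. cdot (y (r k) a) u * cdot (y (r k) a) v) \<longlonglongrightarrow> cdot (l $ a) (star c q u v)" by simp
    moreover have "(\<lambda>k. cdot (y (r k) a) u * cdot (y (r k) a) v) \<longlonglongrightarrow> cdot (l $ a) u * cdot (l $ a) v"
      by (intro tendsto_intros yl)
    ultimately show "cdot (l $ a) (star c q u v) = cdot (l $ a) u * cdot (l $ a) v" by (rule LIMSEQ_unique)
  qed
  define h where "h = (\<lambda>a. Fcoord c q (l $ a))"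
  have "(\<lambda>k. f (r k) a) \<longlonglongrightarrow> h a" for a
  proof (rule topological_tendstoI)
    fix S assume S: "open S" "h a \<in> S"
    let ?T = "cotangent_bundle M"
    define C where "C = cotangent_chart M c"
    have C: "C \<in> atlas ?T" using ca by (simp add: C_def atlas_cotangent)
    have "continuous_map (subtopology (mtop ?T) L) euclidean F"
      using generating by (simp add: generating_function_def Let_def L_def)
    then have "openin (subtopology (mtop ?T) L) {x \<in> topspace (subtopology (mtop ?T) L). F x \<in> S}"
      using S(1) by (simp add: continuous_map_def)
    then obtain X where X: "openin (mtop ?T) X" "{x \<in> topspace (subtopology (mtop ?T) L). F x \<in> S} = X \<inter> L"
      by (auto simp: openin_subtopology)
    define x where "x = (\<lambda>k. (chart_inv c (z (r k)), covec_of M c (chart_inv c (z (r k))) (y (r k) a)))"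
    define xq where "xq = (q, covec_of M c q (l $ a))"
    have xL: "x k \<in> L" "x k \<in> fst C" for k
      using L_iff[OF chz, of "r k"] y(1) chz[of "r k"] by (auto simp: x_def C_def charts_at_def)
    have xqL: "xq \<in> L" "xq \<in> fst C"
      using L_iff[OF c] la c by (auto simp: xq_def C_def charts_at_def)
    have "xq \<in> topspace (mtop ?T)" using xqL T.chart_subset[OF C] by (auto simp: topspace_mtop)
    then have "xq \<in> X" using X(2) xqL S(2) by (auto simp: h_def Fcoord_def xq_def)
    have op: "open (snd C ` (fst C \<inter> X))" by (rule T.openin_chart_image[OF X(1) C])
    have sx: "snd C (x k) = joinv (z (r k)) (y (r k) a)" for k
      using chz[of "r k"] chart_inv_right[OF z(2)[of "r k"]] by (simp add: C_def x_def)
    have "(\<lambda>k. snd C (x k)) \<longlonglongrightarrow> snd C xq"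
    proof (rule vec_tendstoI)
      fix i
      show "(\<lambda>k. snd C (x k) $ i) \<longlonglongrightarrow> snd C xq $ i"
        unfolding sx using tendsto_vec_nth[OF zr] tendsto_vec_nth[OF yl[of a]] c
        by (cases i) (simp_all add: C_def xq_def)
    qed
    then have "\<forall>\<^sub>F k in sequentially. snd C (x k) \<in> snd C ` (fst C \<inter> X)"
      by (rule topological_tendstoD[OF _ op]) (use xqL \<open>xq \<in> X\<close> in auto)
    then show "\<forall>\<^sub>F k in sequentially. f (r k) a \<in> S"
    proof (rule eventually_mono)
      fix k assume "snd C (x k) \<in> snd C ` (fst C \<inter> X)"
      then have "x k \<in> X" using xL(2)[of k] T.chart_inj[OF C] by (auto dest: inj_onD)
      then have "x k \<in> X \<inter> L" using xL by blast
      then have "F (x k) \<in> S" unfolding X(2)[symmetric] by simp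
      then show "f (r k) a \<in> S" by (simp add: y(2) Fcoord_def x_def)
    qed
  qed
  moreover have "h a \<in> Fvals q" for a unfolding Fvals_chart[OF c] h_def using la by simp
  ultimately show ?thesis using that r by blast
qed

text \<open>The times with these properties form an open and closed part of the connected domain.
  Openness: the flow is a translation in canonical coordinates. Closedness: the n translated values
  have n different limits, all of them values at the limit point, which is therefore good.\<close>

lemma Fvals_transport:
  assumes \<gamma>: "integral_curve M e \<Omega> \<gamma>" and t0: "t0 \<in> \<Omega>" "good (\<gamma> t0)" and t: "t \<in> \<Omega>"
  shows "good (\<gamma> t)" "Fvals (\<gamma> t) = (\<lambda>x. x + (t - t0)) ` Fvals (\<gamma> t0)"
proof -
  have curve: "holo_curve M \<Omega> \<gamma>" "connected \<Omega>" "open \<Omega>" using \<gamma> by (auto simp: integral_curve_def holo_curve_def)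
  define A where "A = {t \<in> \<Omega>. good (\<gamma> t) \<and> Fvals (\<gamma> t) = (\<lambda>x. x + (t - t0)) ` Fvals (\<gamma> t0)}"
  have "t0 \<in> A" using t0 by (simp add: A_def)
  have "open A"
  proof (subst open_contains_ball, intro ballI)
    fix t1 assume t1: "t1 \<in> A"
    then have t1': "t1 \<in> \<Omega>" "good (\<gamma> t1)" "Fvals (\<gamma> t1) = (\<lambda>x. x + (t1 - t0)) ` Fvals (\<gamma> t0)" by (auto simp: A_def)
    obtain c where c: "c \<in> charts_at M (\<gamma> t1)" using points_chart[OF good_points[OF t1'(2)]] by blast
    then have cm: "\<gamma> t1 \<in> fst c" by (simp add: charts_at_def)
    obtain W V \<psi> g Y where C: "canonical_chart c W V \<psi> g Y" "snd c (\<gamma> t1) \<in> W"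
      using good_canonical_chart[OF t1'(2) c] by metis
    obtain r where r: "0 < r" "ball t1 r \<subseteq> \<Omega>" "\<And>t. t \<in> ball t1 r \<Longrightarrow> \<gamma> t \<in> fst c" "\<And>t. t \<in> ball t1 r \<Longrightarrow> snd c (\<gamma> t) \<in> W"
      "\<And>t. t \<in> ball t1 r \<Longrightarrow> \<psi> (snd c (\<gamma> t)) = \<psi> (snd c (\<gamma> t1)) + (t - t1) *s ones"
      by (rule integral_curve_canonical[OF \<gamma> t1'(1) C(1) cm C(2)]) blast
    have "s \<in> A" if s: "s \<in> ball t1 r" for s
    proof -
      note P = canonical_chart_point[OF C(1) r(3)[OF s] r(4)[OF s]]
      have "Fvals (\<gamma> s) = (\<lambda>x. x + (s - t1)) ` Fvals (\<gamma> t1)"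
        unfolding P(5) canonical_chart_point(5)[OF C(1) cm C(2)] r(5)[OF s] by (auto simp: image_image)
      also have "\<dots> = (\<lambda>x. x + (s - t0)) ` Fvals (\<gamma> t0)"
        unfolding t1'(3) image_image by (simp add: algebra_simps)
      finally show ?thesis using P r(2) s by (auto simp: A_def)
    qed
    then show "\<exists>e>0. ball t1 e \<subseteq> A" using r(1) by blast
  qed
  have "t1 \<in> A" if t1: "t1 \<in> \<Omega>" "t1 \<in> closure A" for t1
  proof -
    obtain ts where ts: "\<And>k. ts k \<in> A" "ts \<longlonglongrightarrow> t1" using t1(2) by (auto simp: closure_sequential)
    obtain c where c: "c \<in> charts_at M (\<gamma> t1)" using points_chart[OF holo_curve_points[OF curve(1) t1(1)]] by blast
    then have ca: "c \<in> atlas M" "\<gamma> t1 \<in> fst c" by (auto simp: charts_at_def)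
    have "open {s \<in> \<Omega>. \<gamma> s \<in> fst c}" by (rule holo_curve_preimage_open[OF curve(1) openin_chart[OF ca(1)]])
    then obtain N where N: "\<And>k. N \<le> k \<Longrightarrow> \<gamma> (ts k) \<in> fst c"
      using topological_tendstoD[OF ts(2), of "{s \<in> \<Omega>. \<gamma> s \<in> fst c}"] t1 ca by (auto simp: eventually_sequentially)
    define us where "us = (\<lambda>k. ts (k + N))"
    have us: "us \<longlonglongrightarrow> t1" "\<And>k. \<gamma> (us k) \<in> fst c" "\<And>k. us k \<in> A"
      using LIMSEQ_ignore_initial_segment[OF ts(2)] N ts(1) by (auto simp: us_def)
    have "continuous (at t1) (\<lambda>s. snd c (\<gamma> s))"
      using has_derivative_continuous[OF holo_curveD[OF curve(1) t1(1) c]] .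
    then have zl: "(\<lambda>k. snd c (\<gamma> (us k))) \<longlonglongrightarrow> snd c (\<gamma> t1)"
      using us(1) by (simp add: continuous_at_sequentially o_def)
    obtain s where s: "bij_betw s (UNIV :: 'n set) (Fvals (\<gamma> t0))"
      using t0 finite_Fvals[of "\<gamma> t0"] by (metis finite_same_card_bij finite_code good_def)
    have fk: "s a + (us k - t0) \<in> Fvals (chart_inv c (snd c (\<gamma> (us k))))" for k a
    proof -
      have "s a \<in> Fvals (\<gamma> t0)" using s by (auto simp: bij_betw_def)
      then show ?thesis using us(3)[of k] us(2)[of k] ca by (auto simp: A_def)
    qed
    obtain r h where r: "strict_mono (r :: nat \<Rightarrow> nat)" "\<And>a. h a \<in> Fvals (\<gamma> t1)" "\<And>a. (\<lambda>k. s a + (us (r k) - t0)) \<longlonglongrightarrow> h a"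
    proof (rule Fvals_limit[where f = "\<lambda>k a. s a + (us k - t0)", OF c zl _ fk])
      show "snd c (\<gamma> (us k)) \<in> snd c ` fst c" for k using us(2) by blast
    qed (rule that)
    have "h a = s a + (t1 - t0)" for a
    proof (rule LIMSEQ_unique[OF r(3)])
      have "(\<lambda>k. us (r k)) \<longlonglongrightarrow> t1" using LIMSEQ_subseq_LIMSEQ[OF us(1) r(1)] by (simp add: o_def)
      then show "(\<lambda>k. s a + (us (r k) - t0)) \<longlonglongrightarrow> s a + (t1 - t0)" by (intro tendsto_intros)
    qed
    then have "s a + (t1 - t0) \<in> Fvals (\<gamma> t1)" for a using r(2)[of a] by simp
    moreover have "Fvals (\<gamma> t0) = range s" using s by (simp add: bij_betw_def)
    ultimately have sub: "(\<lambda>x. x + (t1 - t0)) ` Fvals (\<gamma> t0) \<subseteq> Fvals (\<gamma> t1)" by auto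
    have P: "\<gamma> t1 \<in> points M" by (rule holo_curve_points[OF curve(1) t1(1)])
    have cd: "card ((\<lambda>x. x + (t1 - t0)) ` Fvals (\<gamma> t0)) = CARD('n)"
      using t0(2) by (subst card_image) (auto simp: good_def inj_on_def)
    have "(\<lambda>x. x + (t1 - t0)) ` Fvals (\<gamma> t0) = Fvals (\<gamma> t1)"
      by (rule card_seteq[OF finite_Fvals[OF P] sub]) (use cd card_Fvals_le[OF P] in simp)
    then show ?thesis using P cd t1 by (auto simp: A_def good_def)
  qed
  then have "closedin (top_of_set \<Omega>) A"
    by (auto simp: closedin_closed_eq closedin_limpt A_def closure_def) 
  moreover have "openin (top_of_set \<Omega>) A"
    using \<open>open A\<close> by (simp add: A_def openin_open_eq[OF curve(3)])
  ultimately have "A = \<Omega>"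
    using curve(2) \<open>t0 \<in> A\<close> unfolding connected_clopen by blast
  then show "good (\<gamma> t)" "Fvals (\<gamma> t) = (\<lambda>x. x + (t - t0)) ` Fvals (\<gamma> t0)" using t by (auto simp: A_def)
qed

end

section \<open>Genericity\<close>

lemma eventually_nonzero_of_derivative:
  assumes "(f has_field_derivative D) (at (x::complex))" "D \<noteq> 0"
  shows "\<forall>\<^sub>F t in at x. f t \<noteq> 0"
proof (cases "f x = 0")
  case True
  have "((\<lambda>t. (f t - f x) / (t - x)) \<longlongrightarrow> D) (at x)"
    using assms(1) by (simp add: has_field_derivative_iff)
  then have "\<forall>\<^sub>F t in at x. (f t - f x) / (t - x) \<noteq> 0"
    using assms(2) by (rule tendsto_imp_eventually_ne)
  then show ?thesis by (rule eventually_mono) (use True in auto)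
next
  case False
  have "(f \<longlongrightarrow> f x) (at x)"
    using DERIV_isCont[OF assms(1)] by (simp add: isCont_def)
  then show ?thesis using False by (rule tendsto_imp_eventually_ne)
qed

text \<open>The one-variable identity theorem on the complex line through \<open>x1\<close> and
  \<open>z\<close>; this line meets the ball in a convex, hence connected, set.\<close>

lemma cholomorphic_identity_on_ball:
  assumes h: "cholomorphic (ball z0 r) h" and V: "open V" "x1 \<in> V" "V \<subseteq> ball z0 r" "\<And>z. z \<in> V \<Longrightarrow> h z = 0"
    and z: "z \<in> ball z0 r"
  shows "h z = 0"
proof -
  define S where "S = {t. x1 + t *s (z - x1) \<in> ball z0 r}"
  define S' where "S' = {t. x1 + t *s (z - x1) \<in> V}"
  have op: "open {t. x1 + t *s (z - x1) \<in> X}" if "open X" for X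
    using open_vimage[OF that, of "\<lambda>t. x1 + t *s (z - x1)"] by (simp add: vimage_def continuous_intros)
  have "convex S"
    unfolding convex_def
  proof (intro ballI allI impI)
    fix t s and u v :: real assume *: "t \<in> S" "s \<in> S" "0 \<le> u" "0 \<le> v" "u + v = 1"
    have "x1 + (u *\<^sub>R t + v *\<^sub>R s) *s (z - x1) = u *\<^sub>R (x1 + t *s (z - x1)) + v *\<^sub>R (x1 + s *s (z - x1))"
    proof -
      have "x1 = (u + v) *\<^sub>R x1" using * by simp
      then show ?thesis
        by (simp add: vec_eq_iff scaleR_conv_of_real[where 'a = complex] algebra_simps)
    qed
    also have "\<dots> \<in> ball z0 r"
      using * convexD[OF convex_ball, of "x1 + t *s (z - x1)" z0 r "x1 + s *s (z - x1)" u v] by (simp add: S_def)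
    finally show "u *\<^sub>R t + v *\<^sub>R s \<in> S" by (simp add: S_def)
  qed
  have "(\<lambda>t. h (x1 + t *s (z - x1))) holomorphic_on S"
    by (rule cholomorphic_holomorphic_line[OF open_ball h]) (simp add: S_def)
  moreover have "open S'" "open S" unfolding S_def S'_def by (rule op[OF V(1)], rule op[OF open_ball])
  moreover have "0 \<in> S'" using V(2) by (simp add: S'_def)
  then have "S' \<noteq> {}" by blast
  moreover have "h (x1 + t *s (z - x1)) = 0" if "t \<in> S'" for t using that V(4) by (simp add: S'_def)
  moreover have "S' \<subseteq> S" using V(3) by (auto simp: S_def S'_def)
  moreover have "1 \<in> S" using z by (simp add: S_def)
  ultimately have "h (x1 + 1 *s (z - x1)) = 0"
    by (intro analytic_continuation_open[of S' S "\<lambda>t. h (x1 + t *s (z - x1))" "\<lambda>_. 0" 1])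
       (simp_all add: convex_connected[OF \<open>convex S\<close>])
  then show ?thesis by simp
qed

context full_atlas
begin

text \<open>The interior is closed: near a point of its closure the local equations vanish on an
  open part of a coordinate ball and so on the whole ball. Connectedness leaves only the empty set,
  as \<open>K\<close> is proper.\<close>

lemma analytic_subset_interior_empty:
  assumes conn: "connected_space (mtop M)" and K: "analytic_subset M K" "K \<noteq> points M"
  shows "mtop M interior_of K = {}"
proof -
  let ?I = "mtop M interior_of K"
  have "closedin (mtop M) ?I"
  proof -
    have "p \<in> ?I" if p: "p \<in> mtop M closure_of ?I" for p
    proof -
      have pM: "p \<in> points M" using p closure_of_subset_topspace[of "mtop M"] by (auto simp: topspace_mtop)
      obtain W G where W: "openin (mtop M) W" "p \<in> W" "\<forall>g\<in>G. holo_fun M W g" "K \<inter> W = {x\<in>W. \<forall>g\<in>G. g x = 0}"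
        using K(1) pM unfolding analytic_subset_def by blast
      obtain c where c: "c \<in> charts_at M p" using points_chart[OF pM] by blast
      have ca: "c \<in> atlas M" "p \<in> fst c" using c by (auto simp: charts_at_def)
      obtain r where r: "0 < r" "ball (snd c p) r \<subseteq> snd c ` (fst c \<inter> W)"
        using openE[OF openin_chart_image[OF W(1) ca(1)], of "snd c p"] W(2) ca by blast
      define U where "U = chart_inv c ` ball (snd c p) r"
      have rsub: "ball (snd c p) r \<subseteq> snd c ` fst c" using r(2) by blast
      have U: "openin (mtop M) U" unfolding U_def by (rule openin_chart_inv_image[OF ca(1) open_ball rsub])
      have pU: "p \<in> U" unfolding U_def using r(1) ca by (metis centre_in_ball chart_inv_snd image_eqI)
      have UW: "U \<subseteq> W" "U \<subseteq> fst c" unfolding U_def using r(2) ca by auto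
      obtain x where x: "x \<in> ?I" "x \<in> U" using p U pU by (metis in_closure_of)
      have "g y = 0" if g: "g \<in> G" and y: "y \<in> U" for g y
      proof -
        have h: "cholomorphic (ball (snd c p) r) (g \<circ> chart_inv c)"
          using W(3) g ca r(2) by (auto simp: holo_fun_def intro: cholomorphic_subset)
        define V where "V = snd c ` (fst c \<inter> (?I \<inter> U))"
        have V: "open V" unfolding V_def by (rule openin_chart_image[OF _ ca(1)]) (use U in auto)
        have xV: "snd c x \<in> V" using x UW by (auto simp: V_def)
        have Vb: "V \<subseteq> ball (snd c p) r"
          using rsub ca by (auto simp: V_def U_def chart_inv_right subset_eq)
        have "(g \<circ> chart_inv c) z = 0" if "z \<in> V" for z
        proof -
          obtain q where q: "z = snd c q" "q \<in> fst c" "q \<in> ?I" "q \<in> U" using \<open>z \<in> V\<close> by (auto simp: V_def)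
          have "q \<in> K \<inter> W" using q UW interior_of_subset by fastforce
          then show ?thesis using W(4) g q ca by auto
        qed
        moreover obtain z where "y = chart_inv c z" "z \<in> ball (snd c p) r" using y by (auto simp: U_def)
        ultimately show ?thesis using cholomorphic_identity_on_ball[OF h V xV Vb] by simp
      qed
      then have "U \<subseteq> K" using W(4) UW by blast
      then show ?thesis using U pU by (auto simp: interior_of_def)
    qed
    then have "mtop M closure_of ?I \<subseteq> ?I" by blast
    then show ?thesis
      by (metis closure_of_subset_eq openin_interior_of openin_subset)
  qed
  then have "?I = {} \<or> ?I = topspace (mtop M)"
    using conn openin_interior_of unfolding connected_space_clopen_in by blast
  moreover have "K \<subseteq> points M" using K(1) by (simp add: analytic_subset_def)
  then have "?I \<noteq> topspace (mtop M)"
    using K(2) interior_of_subset[of "mtop M" K] by (auto simp: topspace_mtop)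
  ultimately show ?thesis by blast
qed

end

context generated_F_manifold
begin

lemma semisimple_frame:
  assumes ss: "semisimple_at M m p" and c: "c \<in> charts_at M p"
  shows "\<exists>f. cn_algebra.frame (star c p) f"
proof -
  interpret A: cn_algebra "star c p" "e p c" by (rule algebra_at[OF c])
  obtain \<Phi> where bij: "bij_betw \<Phi> (tangent_space M p) (UNIV :: (complex^'n) set)"
    and lin: "\<And>v w. v\<in>tangent_space M p \<Longrightarrow> w\<in>tangent_space M p \<Longrightarrow> \<Phi> (m p v w) = \<Phi> v * \<Phi> w"
       "\<And>v a. v\<in>tangent_space M p \<Longrightarrow> \<Phi> (tscale a v) = a *s \<Phi> v"
    using ss unfolding semisimple_at_def by blast
  define u where "u = (\<lambda>i. inv_into (tangent_space M p) \<Phi> (axis i 1))"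
  have u: "u i \<in> tangent_space M p" "\<Phi> (u i) = axis i 1" for i
    using bij by (auto simp: u_def bij_betw_def f_inv_into_f inv_into_into)
  have inj: "v = w" if "v \<in> tangent_space M p" "w \<in> tangent_space M p" "\<Phi> v = \<Phi> w" for v w
    using bij that by (auto simp: bij_betw_def dest: inj_onD)
  have p: "p \<in> points M" by (rule charts_at_points[OF c])
  have \<Phi>0: "\<Phi> 0 = 0"
    using lin(2)[OF tangent_zero, of 0] by (simp add: tscale_def zero_fun_def)
  have prod: "axis i 1 * axis j 1 = (if i = j then axis i 1 else (0 :: complex^'n))" for i j
    by (auto simp: vec_eq_iff axis_def)
  have mu: "m p (u i) (u j) = (if i = j then u i else 0)" for i j
    using m_props(1)[OF p u(1)[of i] u(1)[of j] u(1)[of i]]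
    by (intro inj) (auto simp: lin(1)[OF u(1) u(1)] u prod \<Phi>0 tangent_zero)
  have "A.frame (\<lambda>i. u i c)"
    unfolding A.frame_def
  proof (intro conjI allI)
    show "u i c \<noteq> 0" for i
    proof
      assume "u i c = 0"
      then have "u i = 0" using tangent_eqI[OF u(1) tangent_zero c] by simp
      then have "axis i 1 $ i = (0 :: complex)" using u(2)[of i] \<Phi>0 by simp
      then show False by simp
    qed
    show "star c p (u i c) (u j c) = (if i = j then u i c else 0)" for i j
      unfolding star_def tangent_eq_tvec_of[OF u(1) c] mu by simp
  qed
  then show ?thesis by blast
qed

text \<open>At a semisimple point the values of \<open>F\<close> may coincide, but their
  differentials, the characters, are independent. A direction \<open>v\<close> on which the
  characters take the different integers \<open>k a\<close> makes the values separate at once along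
  the line in this direction.\<close>

lemma good_dense:
  assumes O: "openin (mtop M) O'" "O' \<noteq> {}"
  shows "\<exists>p\<in>O'. good p"
proof -
  obtain K where K: "analytic_subset M K" "K \<noteq> points M" "\<forall>p\<in>points M - K. semisimple_at M m p"
    using massive by (auto simp: massive_F_manifold_def)
  have "connected_space (mtop M)" using F_man by (simp add: F_manifold_def)
  then have "mtop M interior_of K = {}" by (rule analytic_subset_interior_empty[OF _ K(1,2)])
  then have "\<not> O' \<subseteq> K" using O by (auto simp: interior_of_def)
  then obtain p where p: "p \<in> O'" "p \<notin> K" by blast
  have pM: "p \<in> points M" using p openin_subset[OF O(1)] by (auto simp: topspace_mtop)
  obtain c where c: "c \<in> charts_at M p" using points_chart[OF pM] by blast
  have ca: "c \<in> atlas M" "p \<in> fst c" using c by (auto simp: charts_at_def)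
  have "semisimple_at M m p" using K(3) pM p by blast
  then obtain f where f: "cn_algebra.frame (star c p) f" using semisimple_frame[OF _ c] by blast
  obtain W y where W: "open W" "snd c p \<in> W" "W \<subseteq> snd c ` fst c" "\<And>a. cholomorphic_vec W (y a)"
    "\<And>z a. z \<in> W \<Longrightarrow> ((\<lambda>z. Fcoord c (chart_inv c z) (y a z)) has_derivative cdot (y a z)) (at z)"
    "\<And>z. z \<in> W \<Longrightarrow> Fvals (chart_inv c z) = range (\<lambda>a. Fcoord c (chart_inv c z) (y a z))"
    "\<And>z. z \<in> W \<Longrightarrow> chars c (chart_inv c z) = range (\<lambda>a. y a z)"
    "\<And>z x. z \<in> W \<Longrightarrow> \<forall>a. cdot (y a z) x = 0 \<Longrightarrow> x = 0"
    "\<And>z a. z \<in> W \<Longrightarrow> cdot (y a z) (e (chart_inv c z) c) = 1"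
    "\<And>a b. cdot (y a (snd c p)) (f b) = (if a = b then 1 else 0)"
    by (rule frame_canonical[OF c f], rule that) assumption+
  obtain k :: "'n \<Rightarrow> nat" where "inj k"
    using finite_imp_inj_to_nat_seg[OF finite_class.finite_UNIV, where 'a1 = 'n] by blast
  define v where "v = (\<Sum>b\<in>UNIV. of_nat (k b) *s f b)"
  have yv: "cdot (y a (snd c p)) v = of_nat (k a)" for a
    by (simp add: v_def cdot_sum_right cdot_smult_right W(10) if_distrib cong: if_cong)
  define \<Phi> where "\<Phi> = (\<lambda>a z. Fcoord c (chart_inv c z) (y a z))"
  have "\<forall>\<^sub>F t in at 0. \<Phi> a (snd c p + t *s v) - \<Phi> b (snd c p + t *s v) \<noteq> 0" if "a \<noteq> b" for a b
  proof (rule eventually_nonzero_of_derivative)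
    have "((\<lambda>t. \<Phi> a (snd c p + t *s v)) has_field_derivative of_nat (k a)) (at 0)" for a
      unfolding \<Phi>_def yv[symmetric]
      by (rule has_field_derivative_complex_line) (use W(5)[OF W(2)] in simp)
    from DERIV_diff[OF this[of a] this[of b]]
    show "((\<lambda>t. \<Phi> a (snd c p + t *s v) - \<Phi> b (snd c p + t *s v)) has_field_derivative (of_nat (k a) - of_nat (k b))) (at 0)" .
    show "of_nat (k a) - of_nat (k b) \<noteq> (0 :: complex)" using \<open>inj k\<close> that by (auto simp: inj_def)
  qed
  then have ev1: "\<forall>\<^sub>F t in at 0. \<forall>a b. a \<noteq> b \<longrightarrow> \<Phi> a (snd c p + t *s v) \<noteq> \<Phi> b (snd c p + t *s v)"
    by (simp add: eventually_all_finite)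
  have "open (W \<inter> snd c ` (fst c \<inter> O'))" by (intro open_Int W(1) openin_chart_image O ca)
  moreover have "((\<lambda>t. snd c p + t *s v) \<longlongrightarrow> snd c p + 0 *s v) (at 0)"
    using complex_line_has_derivative[of "snd c p" v 0 UNIV] has_derivative_continuous
    by (fastforce simp: continuous_at)
  ultimately have ev2: "\<forall>\<^sub>F t in at 0. snd c p + t *s v \<in> W \<inter> snd c ` (fst c \<inter> O')"
    using W(2) p ca by (intro topological_tendstoD) auto
  have "\<exists>t. (\<forall>a b. a \<noteq> b \<longrightarrow> \<Phi> a (snd c p + t *s v) \<noteq> \<Phi> b (snd c p + t *s v)) \<and> snd c p + t *s v \<in> W \<inter> snd c ` (fst c \<inter> O')"
    using eventually_happens'[OF _ eventually_conj[OF ev1 ev2]] by simp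
  then obtain t where t: "\<forall>a b. a \<noteq> b \<longrightarrow> \<Phi> a (snd c p + t *s v) \<noteq> \<Phi> b (snd c p + t *s v)"
    "snd c p + t *s v \<in> W" "snd c p + t *s v \<in> snd c ` (fst c \<inter> O')" by blast
  define z where "z = snd c p + t *s v"
  obtain q where q: "z = snd c q" "q \<in> fst c" "q \<in> O'" using t(3) by (auto simp: z_def)
  have "inj (\<lambda>a. \<Phi> a z)" using t(1) by (auto simp: inj_def z_def)
  then have "card (Fvals q) = CARD('n)"
    using W(6)[OF t(2)] q ca by (simp add: \<Phi>_def card_image flip: z_def)
  then have "good q" using q ca chart_subset[OF ca(1)] by (auto simp: good_def)
  then show ?thesis using q by blast
qed

section \<open>Good points and the discriminant in canonical charts\<close>

lemma good_open: "openin (mtop M) {p. good p}"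
proof (subst openin_subopen, intro ballI)
  fix p assume "p \<in> {p. good p}"
  then have p: "good p" by simp
  obtain c where c: "c \<in> charts_at M p" using points_chart[OF good_points[OF p]] by blast
  obtain W V \<psi> g Y where C: "canonical_chart c W V \<psi> g Y" "snd c p \<in> W" using good_canonical_chart[OF p c] by metis
  have "openin (mtop M) {x \<in> fst c. snd c x \<in> W}"
    by (rule openin_chart_preimage[OF canonical_chartD(1,2)[OF C(1)]])
  then show "\<exists>T. openin (mtop M) T \<and> p \<in> T \<and> T \<subseteq> {p. good p}"
    using canonical_chart_point(4)[OF C(1)] c C(2) by (intro exI[of _ "{x \<in> fst c. snd c x \<in> W}"]) (auto simp: charts_at_def)
qed

lemma canonical_chart_restrict:
  assumes C: "canonical_chart c W V \<psi> g Y" and W': "open W'" "W' \<subseteq> W"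
  shows "canonical_chart c W' (\<psi> ` W') \<psi> g Y"
proof -
  note CD = canonical_chartD[OF C]
  have "\<psi> ` W' = V \<inter> g -` W'"
    using CD(7-10) W'(2) by (auto simp: image_iff) (metis)
  then have op: "open (\<psi> ` W')"
    using continuous_open_preimage[OF cholomorphic_vec_continuous_on[OF CD(6)] CD(4) W'(1)] by simp
  have sub: "\<psi> ` W' \<subseteq> V" using CD(7) W'(2) by blast
  have "homeomorphism W' (\<psi> ` W') \<psi> g"
    using C W'(2) CD(7,8) unfolding canonical_chart_def
    by (intro homeomorphism_of_subsets[of W V \<psi> g W' "\<psi> ` W'"]) (auto)
  then show ?thesis
    using C W' op cholomorphic_vec_subset[OF CD(5) W'(2)] cholomorphic_vec_subset[OF CD(6) sub]
    unfolding canonical_chart_def by (auto)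
qed

lemma discriminant_iff: "p \<in> discriminant M m e F \<longleftrightarrow> 0 \<in> Fvals p"
proof
  assume "p \<in> discriminant M m e F"
  then obtain x where "x \<in> L" "F x = 0" "p = fst x" by (auto simp: discriminant_def L_def)
  then show "0 \<in> Fvals p" unfolding Fvals_def by (intro image_eqI[of _ _ x]) auto
next
  assume "0 \<in> Fvals p"
  then obtain x where "x \<in> L" "F x = 0" "p = fst x" by (auto simp: Fvals_def)
  then show "p \<in> discriminant M m e F" unfolding discriminant_def L_def by blast
qed

lemma discriminant_points: "discriminant M m e F \<subseteq> points M"
  by (auto simp: discriminant_def analytic_spectrum_def)

lemma bifurcation_iff: "p \<in> bifurcation_diagram M m e F \<longleftrightarrow> p \<in> points M \<and> \<not> good p"
  using card_Fvals_le[of p] by (auto simp: bifurcation_diagram_def good_def Fvals_def L_def)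

text \<open>Exactly one of the n different values at \<open>q\<close> is zero. Where the others stay
  nonzero, the discriminant is the single coordinate hyperplane with index
  \<open>a0\<close>.\<close>

lemma good_discriminant_chart:
  assumes q: "good q" "q \<in> discriminant M m e F" and c: "c \<in> charts_at M q"
  obtains W V \<psi> g Y a0 where "canonical_chart c W V \<psi> g Y" "snd c q \<in> W" "\<psi> (snd c q) $ a0 = 0"
    "\<And>x. x \<in> fst c \<Longrightarrow> snd c x \<in> W \<Longrightarrow> x \<in> discriminant M m e F \<longleftrightarrow> \<psi> (snd c x) $ a0 = 0"
proof -
  obtain W V \<psi> g Y where C: "canonical_chart c W V \<psi> g Y" "snd c q \<in> W" using good_canonical_chart[OF q(1) c] by metis
  note CD = canonical_chartD[OF C(1)]
  have qc: "q \<in> fst c" using c by (simp add: charts_at_def)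
  have "0 \<in> range (\<lambda>a. \<psi> (snd c q) $ a)"
    using q(2) canonical_chart_point(5)[OF C(1) qc C(2)] by (simp add: discriminant_iff)
  then obtain a0 where a0: "\<psi> (snd c q) $ a0 = 0" by (metis imageE)
  define W' where "W' = W \<inter> (\<Inter>b\<in>-{a0}. W \<inter> (\<lambda>z. \<psi> z $ b) -` (-{0}))"
  have cont: "continuous_on W (\<lambda>z. \<psi> z $ b)" for b
    using CD(5) cholomorphic_continuous_on by (auto simp: cholomorphic_vec_def)
  have opb: "open (W \<inter> (\<lambda>z. \<psi> z $ b) -` (-{0}))" for b
    by (rule continuous_open_preimage[OF cont CD(2)]) auto
  have "open (\<Inter>b\<in>-{a0}. W \<inter> (\<lambda>z. \<psi> z $ b) -` (-{0}))"
    by (intro open_INT ballI finite opb)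
  then have "open W'"
    unfolding W'_def by (rule open_Int[OF CD(2)])
  have W'_iff: "z \<in> W' \<longleftrightarrow> z \<in> W \<and> (\<forall>b. b \<noteq> a0 \<longrightarrow> \<psi> z $ b \<noteq> 0)" for z
    unfolding W'_def Int_iff INT_iff vimage_eq by auto
  have z0: "snd c q \<in> W'"
    unfolding W'_iff using CD(16)[OF C(2)] C(2) a0 by (metis injD)
  have sub: "W' \<subseteq> W" using W'_iff by blast
  show ?thesis
  proof (rule that[OF canonical_chart_restrict[OF C(1) \<open>open W'\<close> sub] z0 a0])
    fix x assume x: "x \<in> fst c" "snd c x \<in> W'"
    then have "snd c x \<in> W" "\<And>b. b \<noteq> a0 \<Longrightarrow> \<psi> (snd c x) $ b \<noteq> 0" by (auto simp: W'_iff)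
    then show "x \<in> discriminant M m e F \<longleftrightarrow> \<psi> (snd c x) $ a0 = 0"
      using canonical_chart_point(5)[OF C(1) x(1)] unfolding discriminant_iff by (auto simp: image_iff) metis
  qed
qed

lemma good_discriminant_regular:
  assumes q: "good q" "q \<in> discriminant M m e F"
  shows "q \<in> reg_points M (discriminant M m e F)"
proof -
  obtain c where c: "c \<in> charts_at M q" using points_chart[OF good_points[OF q(1)]] by blast
  have qc: "q \<in> fst c" using c by (simp add: charts_at_def)
  obtain W V \<psi> g Y a0 where C: "canonical_chart c W V \<psi> g Y" "snd c q \<in> W" "\<psi> (snd c q) $ a0 = 0"
    "\<And>x. x \<in> fst c \<Longrightarrow> snd c x \<in> W \<Longrightarrow> x \<in> discriminant M m e F \<longleftrightarrow> \<psi> (snd c x) $ a0 = 0"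
    by (rule good_discriminant_chart[OF q c]) (rule that)
  note CD = canonical_chartD[OF C(1)]
  define X where "X = {x \<in> fst c. snd c x \<in> W}"
  have X: "openin (mtop M) X" "X \<subseteq> fst c" unfolding X_def using openin_chart_preimage[OF CD(1,2)] by auto
  have img: "snd c ` X = W" using CD(3) by (auto simp: X_def)
  have "compatible_chart M (X, \<psi> \<circ> snd c)"
  proof (rule compatible_chartI[OF CD(1) X _ CD(4,6)])
    show "cholomorphic_vec (snd c ` X) \<psi>" unfolding img by (rule CD(5))
    show "\<psi> ` snd c ` X = V" unfolding img using CD(7,9,10) by (auto simp: image_iff) metis
    show "g (\<psi> (snd c p)) = snd c p" if "p \<in> X" for p using CD(8) that by (simp add: X_def)
  qed
  moreover have "(\<psi> \<circ> snd c) ` (discriminant M m e F \<inter> X) = (\<psi> \<circ> snd c) ` X \<inter> coord_space (UNIV - {a0})"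
    using C(4) by (auto simp: X_def coord_space_def)
  ultimately show ?thesis
    unfolding reg_points_def using q qc C(2)
    by (intro CollectI conjI exI[of _ "(X, \<psi> \<circ> snd c)"] exI[of _ "UNIV - {a0}"]) (auto simp: coords_UNIV X_def)
qed

end

section \<open>Orbits of the unit field\<close>

locale standard_F_manifold = generated_F_manifold M m e F
  for M :: "('a, 'n::finite) cmanifold" and m :: "('a, 'n) tmult" and e :: "'a \<Rightarrow> ('a, 'n) tvec"
    and F :: "'a \<times> ('a, 'n) covec \<Rightarrow> complex" +
  fixes N :: "('b, 'm::finite) cmanifold" and pr :: "'a \<Rightarrow> 'b"
  assumes standard: "standard_form M e (discriminant M m e F) N pr"
begin

definition D :: "'a set" where
  "D = discriminant M m e F"

text \<open>The parametrization of a whole orbit provided by the standard form, normalized to start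
  at \<open>p\<close>. Its injectivity is the source of the uniqueness of flow times.\<close>

definition orbit_curve :: "'a \<Rightarrow> complex set \<Rightarrow> (complex \<Rightarrow> 'a) \<Rightarrow> bool" where
  "orbit_curve p \<Omega> \<gamma> \<longleftrightarrow> integral_curve M e \<Omega> \<gamma> \<and> bij_betw \<gamma> \<Omega> {q\<in>points M. pr q = pr p} \<and> 0 \<in> \<Omega> \<and> \<gamma> 0 = p"

lemma D_iff: "p \<in> D \<longleftrightarrow> 0 \<in> Fvals p"
  by (simp add: D_def discriminant_iff)

lemma D_points: "p \<in> D \<Longrightarrow> p \<in> points M"
  using discriminant_points by (auto simp: D_def)

lemma pr_continuous: "continuous_map (mtop M) (mtop N) pr"
proof -
  have "continuous_map (subtopology (mtop M) (points M)) (mtop N) pr"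
    using standard by (simp add: standard_form_def holo_map_def)
  then show ?thesis by (simp flip: topspace_mtop)
qed

lemma N_Hausdorff: "Hausdorff_space (mtop N)"
  using standard by (simp add: standard_form_def complex_manifold_def)

lemma pr_points: "pr ` points M = points N"
  using standard by (simp add: standard_form_def)

lemma pr_preimage_open: "openin (mtop N) V \<Longrightarrow> openin (mtop M) {p \<in> points M. pr p \<in> V}"
  using openin_continuous_map_preimage[OF pr_continuous] by (simp add: topspace_mtop)

lemma covering: "branched_covering M N D pr CARD('n)"
  using standard by (simp add: standard_form_def D_def)

lemma fibre_orbit: "p \<in> points M \<Longrightarrow> {q\<in>points M. pr q = pr p} = flow_orbit M e p"
  using standard by (simp add: standard_form_def)

lemma orbit_curve_exists:
  assumes "p \<in> points M"
  obtains \<Omega> \<gamma> where "orbit_curve p \<Omega> \<gamma>"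
proof -
  obtain \<Omega> \<gamma> where *: "integral_curve M e \<Omega> \<gamma>" "bij_betw \<gamma> \<Omega> {q\<in>points M. pr q = pr p}"
    using standard assms unfolding standard_form_def by blast
  then obtain a where a: "a \<in> \<Omega>" "\<gamma> a = p" using assms by (auto simp: bij_betw_def image_iff set_eq_iff) metis
  have "bij_betw (\<lambda>t. \<gamma> (t + a)) ((\<lambda>t. t - a) ` \<Omega>) {q\<in>points M. pr q = pr p}"
  proof -
    have "bij_betw (\<lambda>t. t + a) ((\<lambda>t. t - a) ` \<Omega>) \<Omega>"
      by (rule bij_betwI[where g = "\<lambda>t. t - a"]) auto
    from bij_betw_trans[OF this *(2)] show ?thesis by (simp add: o_def)
  qed
  then have "orbit_curve p ((\<lambda>t. t - a) ` \<Omega>) (\<lambda>t. \<gamma> (t + a))"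
    using integral_curve_shift[OF *(1), of a] a by (auto simp: orbit_curve_def image_iff)
  then show ?thesis by (rule that)
qed

lemma orbit_curve_shift:
  assumes "orbit_curve p \<Omega> \<gamma>" "a \<in> \<Omega>"
  shows "orbit_curve (\<gamma> a) ((\<lambda>t. t - a) ` \<Omega>) (\<lambda>t. \<gamma> (t + a))"
proof -
  have *: "integral_curve M e \<Omega> \<gamma>" "bij_betw \<gamma> \<Omega> {q\<in>points M. pr q = pr p}" using assms by (auto simp: orbit_curve_def)
  have "pr (\<gamma> a) = pr p" using *(2) assms(2) by (auto simp: bij_betw_def)
  moreover have "bij_betw (\<lambda>t. \<gamma> (t + a)) ((\<lambda>t. t - a) ` \<Omega>) {q\<in>points M. pr q = pr p}"
  proof -
    have "bij_betw (\<lambda>t. t + a) ((\<lambda>t. t - a) ` \<Omega>) \<Omega>"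
      by (rule bij_betwI[where g = "\<lambda>t. t - a"]) auto
    from bij_betw_trans[OF this *(2)] show ?thesis by (simp add: o_def)
  qed
  ultimately show ?thesis
    using integral_curve_shift[OF *(1), of a] assms by (auto simp: orbit_curve_def image_iff)
qed

lemma integral_curve_points: "integral_curve M e \<Omega> \<gamma> \<Longrightarrow> t \<in> \<Omega> \<Longrightarrow> \<gamma> t \<in> points M"
  using holo_curve_points by (auto simp: integral_curve_def)

lemma integral_curve_fibre:
  assumes \<gamma>: "integral_curve M e \<Omega> \<gamma>" and st: "s \<in> \<Omega>" "t \<in> \<Omega>"
  shows "pr (\<gamma> t) = pr (\<gamma> s)"
proof -
  note P = integral_curve_points[OF \<gamma>]
  have "flow_rel M e (t - s) (\<gamma> s) (\<gamma> t)"
    unfolding flow_rel_def using integral_curve_shift[OF \<gamma>, of s] st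
    by (intro exI[of _ "(\<lambda>t. t - s) ` \<Omega>"] exI[of _ "\<lambda>t. \<gamma> (t + s)"]) auto
  then have "\<gamma> t \<in> flow_orbit M e (\<gamma> s)"
    unfolding flow_orbit_def using P[OF st(2)] by blast
  then show ?thesis using fibre_orbit[OF P[OF st(1)]] by blast
qed

lemma orbit_curve_Fvals:
  assumes "orbit_curve p \<Omega> \<gamma>" "good p" "t \<in> \<Omega>"
  shows "good (\<gamma> t)" "Fvals (\<gamma> t) = (\<lambda>x. x + t) ` Fvals p" "\<gamma> t \<in> points M" "pr (\<gamma> t) = pr p"
proof -
  have *: "integral_curve M e \<Omega> \<gamma>" "0 \<in> \<Omega>" "\<gamma> 0 = p" using assms by (auto simp: orbit_curve_def)
  show "good (\<gamma> t)" "Fvals (\<gamma> t) = (\<lambda>x. x + t) ` Fvals p"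
    using Fvals_transport[OF *(1,2) _ assms(3)] assms(2) *(3) by simp_all
  show "\<gamma> t \<in> points M" "pr (\<gamma> t) = pr p" using assms by (auto simp: orbit_curve_def bij_betw_def)
qed

lemma fibre_time:
  assumes "orbit_curve p \<Omega> \<gamma>" "q \<in> points M" "pr q = pr p"
  obtains t where "t \<in> \<Omega>" "\<gamma> t = q"
  using assms unfolding orbit_curve_def bij_betw_def by (metis (mono_tags, lifting) imageE mem_Collect_eq)

text \<open>The bifurcation diagram is a union of fibres of \<open>pr\<close>, because values are
  transported along orbits.\<close>

lemma good_fibre:
  assumes "good p" "q \<in> points M" "pr q = pr p"
  shows "good q"
proof -
  obtain \<Omega> \<gamma> where o: "orbit_curve p \<Omega> \<gamma>" using orbit_curve_exists[OF good_points[OF assms(1)]] by blast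
  obtain t where "t \<in> \<Omega>" "\<gamma> t = q" using fibre_time[OF o assms(2,3)] by blast
  then show ?thesis using orbit_curve_Fvals[OF o assms(1)] by blast
qed

text \<open>Any other integral curve stays in the fibre, hence on \<open>\<gamma>\<close>, and in a
  canonical chart both move by translation; so near each time it is a time shift of
  \<open>\<gamma>\<close>. In particular its times cannot leave \<open>\<Omega>\<close>.\<close>

lemma orbit_curve_unique:
  assumes o: "orbit_curve p \<Omega> \<gamma>" and p: "good p"
    and \<delta>: "integral_curve M e \<Omega>' \<delta>" "0 \<in> \<Omega>'" "\<delta> 0 = p" and t: "t \<in> \<Omega>'"
  shows "t \<in> \<Omega> \<and> \<delta> t = \<gamma> t"
proof (rule connected_induction_simple[where S = \<Omega>' and a = 0 and P = "\<lambda>t. t \<in> \<Omega> \<and> \<delta> t = \<gamma> t"])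
  show "connected \<Omega>'" using \<delta> by (simp add: integral_curve_def)
  show "0 \<in> \<Omega> \<and> \<delta> 0 = \<gamma> 0" using o \<delta> by (simp add: orbit_curve_def)
  have \<gamma>: "integral_curve M e \<Omega> \<gamma>" and inj: "inj_on \<gamma> \<Omega>" using o by (auto simp: orbit_curve_def bij_betw_def)
  fix t1 assume t1: "t1 \<in> \<Omega>'"
  have d1: "\<delta> t1 \<in> points M" "pr (\<delta> t1) = pr p"
    using integral_curve_points[OF \<delta>(1) t1] integral_curve_fibre[OF \<delta>(1,2) t1] \<delta>(3) by auto
  then obtain s1 where s1: "s1 \<in> \<Omega>" "\<gamma> s1 = \<delta> t1" using fibre_time[OF o] by blast
  have gd: "good (\<delta> t1)" by (rule good_fibre[OF p d1])
  obtain c where c: "c \<in> charts_at M (\<delta> t1)" using points_chart[OF d1(1)] by blast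
  then have cm: "\<delta> t1 \<in> fst c" by (simp add: charts_at_def)
  obtain W V \<psi> g Y where C: "canonical_chart c W V \<psi> g Y" "snd c (\<delta> t1) \<in> W" using good_canonical_chart[OF gd c] by metis
  note CD = canonical_chartD[OF C(1)]
  obtain r1 where r1: "0 < r1" "ball t1 r1 \<subseteq> \<Omega>'" "\<And>t. t \<in> ball t1 r1 \<Longrightarrow> \<delta> t \<in> fst c" "\<And>t. t \<in> ball t1 r1 \<Longrightarrow> snd c (\<delta> t) \<in> W"
      "\<And>t. t \<in> ball t1 r1 \<Longrightarrow> \<psi> (snd c (\<delta> t)) = \<psi> (snd c (\<delta> t1)) + (t - t1) *s ones"
    by (rule integral_curve_canonical[OF \<delta>(1) t1 C(1) cm C(2)]) blast
  have s1c: "\<gamma> s1 \<in> fst c" "snd c (\<gamma> s1) \<in> W" using s1 cm C(2) by auto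
  obtain r2 where r2: "0 < r2" "ball s1 r2 \<subseteq> \<Omega>" "\<And>t. t \<in> ball s1 r2 \<Longrightarrow> \<gamma> t \<in> fst c" "\<And>t. t \<in> ball s1 r2 \<Longrightarrow> snd c (\<gamma> t) \<in> W"
      "\<And>t. t \<in> ball s1 r2 \<Longrightarrow> \<psi> (snd c (\<gamma> t)) = \<psi> (snd c (\<gamma> s1)) + (t - s1) *s ones"
    by (rule integral_curve_canonical[OF \<gamma> s1(1) C(1) s1c]) blast
  define r where "r = min r1 r2"
  have eq: "s1 + (t - t1) \<in> \<Omega> \<and> \<delta> t = \<gamma> (s1 + (t - t1))" if t: "t \<in> ball t1 r" for t
  proof -
    have b1: "t \<in> ball t1 r1" and b2: "s1 + (t - t1) \<in> ball s1 r2"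
      using t by (auto simp: r_def dist_norm norm_minus_commute)
    have "\<psi> (snd c (\<delta> t)) = \<psi> (snd c (\<gamma> (s1 + (t - t1))))" using r1(5)[OF b1] r2(5)[OF b2] s1 by simp
    then have "snd c (\<delta> t) = snd c (\<gamma> (s1 + (t - t1)))" using CD(8)[OF r1(4)[OF b1]] CD(8)[OF r2(4)[OF b2]] by metis
    then show ?thesis using chart_inj[OF CD(1)] r1(3)[OF b1] r2(3)[OF b2] r2(2) b2 by (auto dest: inj_onD)
  qed
  show "\<exists>T. openin (top_of_set \<Omega>') T \<and> t1 \<in> T \<and> (\<forall>x\<in>T. \<forall>y\<in>T. x \<in> \<Omega> \<and> \<delta> x = \<gamma> x \<longrightarrow> y \<in> \<Omega> \<and> \<delta> y = \<gamma> y)"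
  proof (intro exI[of _ "ball t1 r"] conjI ballI impI)
    have "ball t1 r \<subseteq> \<Omega>'" using r1(2) by (auto simp: r_def)
    then show "openin (top_of_set \<Omega>') (ball t1 r)" by (simp add: open_subset)
    show "t1 \<in> ball t1 r" using r1(1) r2(1) by (simp add: r_def)
    fix x y assume x: "x \<in> ball t1 r" "x \<in> \<Omega> \<and> \<delta> x = \<gamma> x" and y: "y \<in> ball t1 r"
    then have "\<gamma> x = \<gamma> (s1 + (x - t1))" using eq by metis
    \<comment> \<open>Agreement at one time and the injectivity of \<open>\<gamma>\<close> make the
      time shift zero, so agreement spreads to the whole ball.\<close>
    then have "x = s1 + (x - t1)" using inj x eq[OF x(1)] by (auto dest: inj_onD)
    then have "s1 = t1" by simp
    then show "y \<in> \<Omega>" "\<delta> y = \<gamma> y" using eq[OF y] by auto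
  qed
qed (use \<delta> t in auto)

text \<open>\<open>flow_rel\<close> allows an arbitrary integral curve; at a good point uniqueness
  reduces it to the one curve that parametrizes the orbit.\<close>

lemma flow_rel_iff:
  assumes o: "orbit_curve p \<Omega> \<gamma>" and p: "good p"
  shows "flow_rel M e s p q \<longleftrightarrow> s \<in> \<Omega> \<and> \<gamma> s = q"
proof
  assume "flow_rel M e s p q"
  then obtain \<Omega>' \<delta> where "integral_curve M e \<Omega>' \<delta>" "0 \<in> \<Omega>'" "s \<in> \<Omega>'" "\<delta> 0 = p" "\<delta> s = q"
    unfolding flow_rel_def by blast
  then show "s \<in> \<Omega> \<and> \<gamma> s = q" using orbit_curve_unique[OF o p, of \<Omega>' \<delta> s] by auto
next
  assume "s \<in> \<Omega> \<and> \<gamma> s = q"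
  then show "flow_rel M e s p q" using o unfolding flow_rel_def orbit_curve_def by blast
qed

section \<open>Additivity and uniqueness of flow times at good points\<close>

lemma flow_rel_trans:
  assumes p: "good p" and 1: "flow_rel M e s p q" and 2: "flow_rel M e t q q'"
  shows "flow_rel M e (s + t) p q'"
proof -
  obtain \<Omega> \<gamma> where o: "orbit_curve p \<Omega> \<gamma>" using orbit_curve_exists[OF good_points[OF p]] by blast
  have s: "s \<in> \<Omega>" "\<gamma> s = q" using 1 flow_rel_iff[OF o p] by auto
  have q: "good q" using orbit_curve_Fvals(1)[OF o p s(1)] s by simp
  have o2: "orbit_curve q ((\<lambda>t. t - s) ` \<Omega>) (\<lambda>t. \<gamma> (t + s))" using orbit_curve_shift[OF o s(1)] s by simp
  have "t \<in> (\<lambda>t. t - s) ` \<Omega>" "\<gamma> (t + s) = q'" using 2 flow_rel_iff[OF o2 q] by auto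
  then have "s + t \<in> \<Omega>" "\<gamma> (s + t) = q'" by (auto simp: add.commute)
  then show ?thesis using flow_rel_iff[OF o p] by blast
qed

lemma flow_rel_Fvals:
  assumes p: "good p" and f: "flow_rel M e s p q"
  shows "good q" "Fvals q = (\<lambda>x. x + s) ` Fvals p" "q \<in> points M" "pr q = pr p"
proof -
  obtain \<Omega> \<gamma> where o: "orbit_curve p \<Omega> \<gamma>" using orbit_curve_exists[OF good_points[OF p]] by blast
  have s: "s \<in> \<Omega>" "\<gamma> s = q" using f flow_rel_iff[OF o p] by auto
  show "good q" "Fvals q = (\<lambda>x. x + s) ` Fvals p" "q \<in> points M" "pr q = pr p"
    using orbit_curve_Fvals[OF o p s(1)] s by auto
qed

lemma flow_rel_exists:
  assumes p: "good p" and q: "q \<in> points M" "pr q = pr p"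
  obtains s where "flow_rel M e s p q"
proof -
  obtain \<Omega> \<gamma> where o: "orbit_curve p \<Omega> \<gamma>" using orbit_curve_exists[OF good_points[OF p]] by blast
  obtain s where "s \<in> \<Omega>" "\<gamma> s = q" using fibre_time[OF o q] by blast
  then show ?thesis using flow_rel_iff[OF o p] that by blast
qed

lemma flow_rel_zero:
  assumes p: "good p" and f: "flow_rel M e 0 p q"
  shows "q = p"
proof -
  obtain \<Omega> \<gamma> where o: "orbit_curve p \<Omega> \<gamma>" using orbit_curve_exists[OF good_points[OF p]] by blast
  then show ?thesis using f flow_rel_iff[OF o p] by (auto simp: orbit_curve_def)
qed

lemma flow_rel_functional:
  assumes p: "good p" and f: "flow_rel M e s p q" "flow_rel M e s p q'"
  shows "q = q'"
proof -
  obtain \<Omega> \<gamma> where o: "orbit_curve p \<Omega> \<gamma>" using orbit_curve_exists[OF good_points[OF p]] by blast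
  then show ?thesis using f flow_rel_iff[OF o p] by auto
qed

section \<open>The discriminant over a point outside of the bifurcation diagram\<close>

lemma D_fibre_finite: "y \<in> points N \<Longrightarrow> finite {x \<in> D. pr x = y}"
  using covering by (simp add: branched_covering_def)

lemma D_fibre_nonempty:
  assumes "y \<in> points N" obtains x where "x \<in> D" "pr x = y"
proof -
  have "y \<in> pr ` D" using covering assms by (simp add: branched_covering_def)
  then show ?thesis using that by blast
qed

lemma zero_mem_shift: "0 \<in> (\<lambda>x. x + t) ` S \<longleftrightarrow> - t \<in> S" for t :: complex
proof
  assume "0 \<in> (\<lambda>x. x + t) ` S"
  then obtain x where "x \<in> S" "x + t = 0" by auto
  then show "- t \<in> S" by (simp add: add_eq_0_iff2)
qed (auto simp: image_iff intro: bexI[of _ "- t"])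

text \<open>The flow adds its time to all values, so a point of \<open>D\<close> reached at time t
  contributes the value -t at \<open>p\<close>; different points are reached at different
  times.\<close>

lemma D_fibre_times:
  assumes p: "good p"
  obtains t where "\<And>q. q \<in> D \<Longrightarrow> pr q = pr p \<Longrightarrow> flow_rel M e (t q) p q"
    "inj_on (\<lambda>q. - t q) {q \<in> D. pr q = pr p}" "(\<lambda>q. - t q) ` {q \<in> D. pr q = pr p} \<subseteq> Fvals p"
proof -
  define Q where "Q = {q \<in> D. pr q = pr p}"
  have "\<exists>t. \<forall>q\<in>Q. flow_rel M e (t q) p q"
  proof (intro bchoice ballI)
    fix q assume "q \<in> Q"
    then have "q \<in> points M" "pr q = pr p" using D_points by (auto simp: Q_def)
    from flow_rel_exists[OF p this] show "\<exists>t. flow_rel M e t p q" by blast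
  qed
  then obtain t where t: "\<And>q. q \<in> Q \<Longrightarrow> flow_rel M e (t q) p q" by blast
  have "inj_on (\<lambda>q. - t q) Q"
  proof (rule inj_onI)
    fix q q' assume q: "q \<in> Q" "q' \<in> Q" "- t q = - t q'"
    then show "q = q'" using flow_rel_functional[OF p t[OF q(1)]] t[OF q(2)] by simp
  qed
  moreover have "(\<lambda>q. - t q) ` Q \<subseteq> Fvals p"
  proof
    fix s assume "s \<in> (\<lambda>q. - t q) ` Q"
    then obtain q where q: "q \<in> Q" "s = - t q" by blast
    then have "0 \<in> Fvals q" by (simp add: Q_def D_iff)
    then show "s \<in> Fvals p" unfolding flow_rel_Fvals(2)[OF p t[OF q(1)]] q(2) zero_mem_shift .
  qed
  ultimately show ?thesis using that t by (auto simp: Q_def)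
qed

text \<open>A symmetric function of the values needs no numbering. This one recovers the flow time
  and thereby shows that the time between two nearby points of one orbit is small.\<close>

lemma sum_Fvals_shift:
  assumes p: "good p" and f: "flow_rel M e s p q"
  shows "\<Sum>(Fvals q) = \<Sum>(Fvals p) + of_nat CARD('n) * s"
proof -
  have "\<Sum>(Fvals q) = (\<Sum>x\<in>Fvals p. x + s)"
    unfolding flow_rel_Fvals(2)[OF p f] by (rule sum.reindex_cong[of "\<lambda>x. x + s"]) (auto simp: inj_on_def)
  then show ?thesis using p by (simp add: sum.distrib good_def)
qed

text \<open>If \<open>x\<close> and \<open>x'\<close> in \<open>D\<close> differ by the flow time t,
  then -t is a value at \<open>x\<close>. Near \<open>q\<close> the time is small, while all values
  except the one with index \<open>a0\<close> stay away from 0; so -t is that value, which vanishes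
  on \<open>D\<close>.\<close>

lemma D_locally_injective_good:
  assumes q: "good q" "q \<in> D"
  obtains U where "openin (mtop M) U" "q \<in> U"
    "\<And>x x'. x \<in> U \<Longrightarrow> x' \<in> U \<Longrightarrow> x \<in> D \<Longrightarrow> x' \<in> D \<Longrightarrow> pr x = pr x' \<Longrightarrow> x = x'"
proof -
  obtain c where c: "c \<in> charts_at M q" using points_chart[OF good_points[OF q(1)]] by blast
  have qc: "q \<in> fst c" using c by (simp add: charts_at_def)
  obtain W V \<psi> g Y a0 where C: "canonical_chart c W V \<psi> g Y" "snd c q \<in> W" "\<psi> (snd c q) $ a0 = 0"
    "\<And>x. x \<in> fst c \<Longrightarrow> snd c x \<in> W \<Longrightarrow> x \<in> discriminant M m e F \<longleftrightarrow> \<psi> (snd c x) $ a0 = 0"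
    by (rule good_discriminant_chart[OF q[unfolded D_def] c]) (rule that)
  note CD = canonical_chartD[OF C(1)]
  define z0 where "z0 = snd c q"
  have ne: "\<psi> z0 $ b \<noteq> 0" if "b \<noteq> a0" for b
    using CD(16)[OF C(2)] C(3) that by (metis injD z0_def)
  \<comment> \<open>A quarter of the least nonzero value in modulus: below, t is at most 2\<epsilon>
    and a coordinate varies by less than \<epsilon>, together less than 4\<epsilon>. The element 1
    keeps the minimum meaningful for n = 1.\<close>
  define \<epsilon> where "\<epsilon> = Min (insert 1 ((\<lambda>b. norm (\<psi> z0 $ b)) ` (UNIV - {a0}))) / 4"
  have \<epsilon>: "0 < \<epsilon>" "4 * \<epsilon> \<le> norm (\<psi> z0 $ b)" if "b \<noteq> a0" for b
    using ne that by (auto simp: \<epsilon>_def)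
  have \<epsilon>0: "0 < \<epsilon>" using ne by (auto simp: \<epsilon>_def)
  define W' where "W' = W \<inter> (\<lambda>z. norm (\<psi> z - \<psi> z0)) -` {..<\<epsilon>}"
  have "open W'"
    unfolding W'_def
    by (rule continuous_open_preimage[OF _ CD(2)]) (intro continuous_intros cholomorphic_vec_continuous_on CD(5), simp)
  define U where "U = {x \<in> fst c. snd c x \<in> W'}"
  have near: "norm (\<psi> (snd c x) $ a - \<psi> z0 $ a) < \<epsilon>" if "x \<in> U" for x a
    using that Finite_Cartesian_Product.norm_nth_le[of "\<psi> (snd c x) - \<psi> z0" a] by (auto simp: U_def W'_def)
  have Ux: "x \<in> fst c" "snd c x \<in> W" if "x \<in> U" for x using that by (auto simp: U_def W'_def)
  note Fx = canonical_chart_point[OF C(1) Ux]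
  have sumF: "\<Sum>(Fvals x) = (\<Sum>a\<in>UNIV. \<psi> (snd c x) $ a)" if "x \<in> U" for x
    unfolding Fx(5)[OF that that] using sum.reindex[OF CD(16)[OF Ux(2)[OF that]], of "\<lambda>x. x"] by simp
  show ?thesis
  proof (rule that[of U])
    show "openin (mtop M) U" unfolding U_def by (rule openin_chart_preimage[OF CD(1) \<open>open W'\<close>])
    show "q \<in> U" using qc C(2) \<epsilon>0 by (simp add: U_def W'_def z0_def)
    fix x x' assume x: "x \<in> U" "x' \<in> U" "x \<in> D" "x' \<in> D" "pr x = pr x'"
    have gx: "good x" by (rule Fx(4)[OF x(1) x(1)])
    obtain t where t: "flow_rel M e t x x'" using flow_rel_exists[OF gx D_points[OF x(4)]] x(5) by metis
    have "of_nat CARD('n) * t = (\<Sum>a\<in>UNIV. \<psi> (snd c x') $ a - \<psi> (snd c x) $ a)"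
      using sum_Fvals_shift[OF gx t] by (simp add: sumF x sum_subtractf)
    also have "norm \<dots> \<le> (\<Sum>a\<in>(UNIV::'n set). 2 * \<epsilon>)"
    proof (rule sum_norm_le)
      fix a
      have "\<psi> (snd c x') $ a - \<psi> (snd c x) $ a = (\<psi> (snd c x') $ a - \<psi> z0 $ a) - (\<psi> (snd c x) $ a - \<psi> z0 $ a)" by simp
      also have "norm \<dots> \<le> norm (\<psi> (snd c x') $ a - \<psi> z0 $ a) + norm (\<psi> (snd c x) $ a - \<psi> z0 $ a)"
        by (rule norm_triangle_ineq4)
      finally show "norm (\<psi> (snd c x') $ a - \<psi> (snd c x) $ a) \<le> 2 * \<epsilon>" using near[OF x(1), of a] near[OF x(2), of a] by linarith
    qed
    finally have nt: "norm t \<le> 2 * \<epsilon>" by (simp add: norm_mult)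
    have "- t \<in> Fvals x"
      using x(4) unfolding D_iff flow_rel_Fvals(2)[OF gx t] zero_mem_shift .
    then obtain a where a: "- t = \<psi> (snd c x) $ a" unfolding Fx(5)[OF x(1) x(1)] by blast
    have "a = a0"
    proof (rule ccontr)
      assume "a \<noteq> a0"
      have "norm (\<psi> z0 $ a) \<le> norm (\<psi> (snd c x) $ a) + norm (\<psi> (snd c x) $ a - \<psi> z0 $ a)"
        by (metis norm_minus_commute norm_triangle_sub)
      moreover have "norm (\<psi> (snd c x) $ a) = norm t" unfolding a[symmetric] by simp
      ultimately show False using \<epsilon>(2)[OF \<open>a \<noteq> a0\<close>] near[OF x(1), of a] nt \<epsilon>0 by linarith
    qed
    then have "t = 0" using C(4)[OF Ux[OF x(1)]] x(3) a by (simp add: D_def)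
    then show "x = x'" using flow_rel_zero[OF gx, of x'] t by simp
  qed
qed

text \<open>Properness makes \<open>pr\<close> closed on \<open>D\<close>. The image of the part of
  \<open>D\<close> outside of the given neighbourhoods is therefore closed, and it misses
  \<open>y\<close>.\<close>

lemma D_fibre_neighbourhood:
  assumes y: "y \<in> points N" and U: "\<And>q. q \<in> D \<Longrightarrow> pr q = y \<Longrightarrow> openin (mtop M) (U q) \<and> q \<in> U q"
  obtains V where "openin (mtop N) V" "y \<in> V" "\<And>x. x \<in> D \<Longrightarrow> pr x \<in> V \<Longrightarrow> \<exists>q\<in>D. pr q = y \<and> x \<in> U q"
proof -
  define Q where "Q = {q \<in> D. pr q = y}"
  define R where "R = D - (\<Union>q\<in>Q. U q)"
  have tD: "topspace (subtopology (mtop M) D) = D" using D_points by (auto simp: topspace_mtop)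
  have "openin (mtop M) (\<Union>q\<in>Q. U q)" using U by (auto simp: Q_def)
  then have "closedin (subtopology (mtop M) D) R"
    unfolding R_def closedin_def tD by (auto simp: openin_subtopology Diff_Diff_Int intro!: exI[of _ "\<Union>q\<in>Q. U q"])
  moreover have "proper_map (subtopology (mtop M) D) (mtop N) pr" using covering by (simp add: branched_covering_def)
  ultimately have cl: "closedin (mtop N) (pr ` R)"
    using proper_imp_closed_map by (auto simp: closed_map_def)
  show ?thesis
  proof (rule that[of "points N - pr ` R"])
    show "openin (mtop N) (points N - pr ` R)" using cl by (simp add: closedin_def topspace_mtop)
    show "y \<in> points N - pr ` R" using y U by (auto simp: R_def Q_def)
    fix x assume "x \<in> D" "pr x \<in> points N - pr ` R"
    then have "x \<notin> R" by blast
    then show "\<exists>q\<in>D. pr q = y \<and> x \<in> U q" using \<open>x \<in> D\<close> by (auto simp: R_def Q_def)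
  qed
qed

lemma covering_sections:
  obtains A where "subtopology (mtop M) D interior_of {x\<in>D. pr x \<in> A} = {}"
    "\<And>y. y\<in>points N - A \<Longrightarrow> \<exists>V s. openin (mtop N) V \<and> y \<in> V \<and>
           (\<forall>k<CARD('n). holo_map N V M (s k) \<and> (\<forall>x\<in>V. pr (s k x) = x)) \<and>
           (\<forall>k<CARD('n). \<forall>l<CARD('n). k \<noteq> l \<longrightarrow> s k ` V \<inter> s l ` V = {}) \<and>
           {x\<in>D. pr x \<in> V} = (\<Union>k<CARD('n). s k ` V)"
  using covering[unfolded branched_covering_def, THEN conjunct2, THEN conjunct2, THEN conjunct2]
  by (elim exE conjE) (rule that, assumption, drule bspec)

text \<open>At most n points, since their times give different values of \<open>F\<close> at
  \<open>p\<close>. At least n, since a nearby fibre with n points is caught by the neighbourhoods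
  of the points over \<open>pr p\<close>, each of which contains at most one point of that
  fibre.\<close>

lemma D_fibre_card:
  assumes p: "good p"
  shows "card {q \<in> D. pr q = pr p} = CARD('n)"
proof -
  define Q where "Q = {q \<in> D. pr q = pr p}"
  have y: "pr p \<in> points N" using pr_points good_points[OF p] by blast
  have finQ: "finite Q" unfolding Q_def by (rule D_fibre_finite[OF y])
  have gQ: "good q" if "q \<in> Q" for q using good_fibre[OF p] that D_points by (auto simp: Q_def)
  obtain t where "inj_on (\<lambda>q. - t q) {q \<in> D. pr q = pr p}" "(\<lambda>q. - t q) ` {q \<in> D. pr q = pr p} \<subseteq> Fvals p"
    by (rule D_fibre_times[OF p]) (rule that)
  then have le: "card Q \<le> CARD('n)"
    using card_inj_on_le[OF _ _ finite_Fvals[OF good_points[OF p]]] p by (simp add: good_def Q_def)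
  have "\<exists>U. openin (mtop M) U \<and> q \<in> U \<and> (\<forall>x x'. x \<in> U \<longrightarrow> x' \<in> U \<longrightarrow> x \<in> D \<longrightarrow> x' \<in> D \<longrightarrow> pr x = pr x' \<longrightarrow> x = x')"
    if "q \<in> Q" for q
  proof -
    have "q \<in> D" using that by (simp add: Q_def)
    from D_locally_injective_good[OF gQ[OF that] this] show ?thesis by metis
  qed
  then obtain U where U: "\<And>q. q \<in> Q \<Longrightarrow> openin (mtop M) (U q) \<and> q \<in> U q"
    "\<And>q x x'. q \<in> Q \<Longrightarrow> x \<in> U q \<Longrightarrow> x' \<in> U q \<Longrightarrow> x \<in> D \<Longrightarrow> x' \<in> D \<Longrightarrow> pr x = pr x' \<Longrightarrow> x = x'"
    by metis
  obtain V where V: "openin (mtop N) V" "pr p \<in> V" "\<And>x. x \<in> D \<Longrightarrow> pr x \<in> V \<Longrightarrow> \<exists>q\<in>D. pr q = pr p \<and> x \<in> U q"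
    using D_fibre_neighbourhood[OF y, of U] U(1) by (auto simp: Q_def)
  obtain A where A: "subtopology (mtop M) D interior_of {x\<in>D. pr x \<in> A} = {}"
    "\<And>y. y\<in>points N - A \<Longrightarrow> \<exists>V s. openin (mtop N) V \<and> y \<in> V \<and>
           (\<forall>k<CARD('n). holo_map N V M (s k) \<and> (\<forall>x\<in>V. pr (s k x) = x)) \<and>
           (\<forall>k<CARD('n). \<forall>l<CARD('n). k \<noteq> l \<longrightarrow> s k ` V \<inter> s l ` V = {}) \<and>
           {x\<in>D. pr x \<in> V} = (\<Union>k<CARD('n). s k ` V)"
    by (rule covering_sections) (rule that)
  \<comment> \<open>The fibre of \<open>p\<close> may lie over the exceptional set \<open>A\<close>
    of the covering. The part of \<open>D\<close> over \<open>A\<close> has empty interior in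
    \<open>D\<close>, so a nearby fibre avoids it.\<close>
  obtain q1 where q1: "q1 \<in> D" "pr q1 = pr p" using D_fibre_nonempty[OF y] by blast
  have "openin (subtopology (mtop M) D) (D \<inter> {x \<in> points M. pr x \<in> V})"
    using pr_preimage_open[OF V(1)] by (auto simp: openin_subtopology)
  moreover have "q1 \<in> D \<inter> {x \<in> points M. pr x \<in> V}" using q1 V D_points by auto
  ultimately have "\<not> D \<inter> {x \<in> points M. pr x \<in> V} \<subseteq> {x\<in>D. pr x \<in> A}"
    using A(1) unfolding interior_of_def by blast
  then obtain x where x: "x \<in> D" "pr x \<in> V" "pr x \<notin> A" by auto
  have "pr x \<in> points N - A" using x pr_points D_points by blast
  from A(2)[OF this] obtain V' s where s': "pr x \<in> V'"
      "\<forall>k<CARD('n). holo_map N V' M (s k) \<and> (\<forall>x\<in>V'. pr (s k x) = x)"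
      "\<forall>k<CARD('n). \<forall>l<CARD('n). k \<noteq> l \<longrightarrow> s k ` V' \<inter> s l ` V' = {}" "{x\<in>D. pr x \<in> V'} = (\<Union>k<CARD('n). s k ` V')"
    by (elim exE conjE) (rule that)
  define w where "w = (\<lambda>k. s k (pr x))"
  have w: "w k \<in> D" "pr (w k) = pr x" if k: "k < CARD('n)" for k
  proof -
    have wk: "w k \<in> s k ` V'" unfolding w_def using s'(1) by (rule imageI)
    then have "w k \<in> {x\<in>D. pr x \<in> V'}" unfolding s'(4) using k by (intro UN_I[of k]) auto
    then show "w k \<in> D" by simp
    show "pr (w k) = pr x"
      unfolding w_def by (rule s'(2)[THEN spec, THEN mp, OF k, THEN conjunct2, THEN bspec, OF s'(1)])
  qed
  have winj: "k = l" if k: "k < CARD('n)" and l: "l < CARD('n)" and eq: "w k = w l" for k l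
  proof (rule ccontr)
    assume "k \<noteq> l"
    then have "s k ` V' \<inter> s l ` V' = {}"
      by (rule s'(3)[THEN spec, THEN mp, OF k, THEN spec, THEN mp, OF l, THEN mp])
    moreover have "w k \<in> s k ` V'" unfolding w_def using s'(1) by (rule imageI)
    moreover have "w k \<in> s l ` V'" unfolding eq unfolding w_def using s'(1) by (rule imageI)
    ultimately show False by (meson disjoint_iff)
  qed
  have "\<exists>q. q \<in> Q \<and> w k \<in> U q" if "k < CARD('n)" for k
    using V(3)[OF w(1)[OF that]] w(2)[OF that] x(2) by (auto simp: Q_def)
  then obtain h where h: "\<And>k. k < CARD('n) \<Longrightarrow> h k \<in> Q \<and> w k \<in> U (h k)" by metis
  have "inj_on h {..<CARD('n)}"
  proof (rule inj_onI)
    fix k l assume kl: "k \<in> {..<CARD('n)}" "l \<in> {..<CARD('n)}" "h k = h l"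
    then have "w k = w l" using U(2)[of "h k" "w k" "w l"] h[of k] h[of l] w[of k] w[of l] by simp
    then show "k = l" using winj kl by simp
  qed
  then have "card {..<CARD('n)} \<le> card Q" by (rule card_inj_on_le) (use h finQ in auto)
  then show ?thesis using le by (simp add: Q_def)
qed

text \<open>By counting, the injection of the fibre of \<open>D\<close> into the values at
  \<open>p\<close> is onto; so the orbit really extends to each of the times -x.\<close>

lemma D_times:
  assumes p: "good p" and x: "x \<in> Fvals p"
  obtains q where "flow_rel M e (- x) p q" "q \<in> D" "pr q = pr p"
proof -
  define Q where "Q = {q \<in> D. pr q = pr p}"
  obtain t where t: "\<And>q. q \<in> D \<Longrightarrow> pr q = pr p \<Longrightarrow> flow_rel M e (t q) p q"
    and inj': "inj_on (\<lambda>q. - t q) {q \<in> D. pr q = pr p}" and sub': "(\<lambda>q. - t q) ` {q \<in> D. pr q = pr p} \<subseteq> Fvals p"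
    by (rule D_fibre_times[OF p]) (rule that)
  note inj = inj'[folded Q_def] and sub = sub'[folded Q_def]
  have "(\<lambda>q. - t q) ` Q = Fvals p"
    by (rule card_seteq[OF finite_Fvals[OF good_points[OF p]] sub])
       (use p D_fibre_card[OF p] card_image[OF inj] in \<open>simp add: good_def Q_def\<close>)
  then obtain q where "q \<in> Q" "x = - t q" using x by blast
  then show ?thesis using that t by (auto simp: Q_def)
qed

end

section \<open>Hyperplanes and the flow\<close>

context generated_F_manifold
begin

text \<open>The kernel of the character with value \<open>x\<close>, described through
  \<open>L\<close> so that neither a chart nor a numbering is involved. At a good point each value
  of \<open>F\<close> belongs to exactly one character.\<close>

definition hyper :: "'a \<Rightarrow> complex \<Rightarrow> ('a, 'n) tvec set" where
  "hyper p x = {v \<in> tangent_space M p. \<forall>l. (p, l) \<in> L \<and> F (p, l) = x \<longrightarrow> l v = 0}"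

lemma good_Fcoord_inj:
  assumes p: "good p" and c: "c \<in> charts_at M p"
  shows "inj_on (Fcoord c p) (chars c p)" "card (chars c p) = CARD('n)"
proof -
  interpret A: cn_algebra "star c p" "e p c" by (rule algebra_at[OF c])
  obtain f where "A.frame f" using good_frame[OF p c] by blast
  then show card: "card A.characters = CARD('n)" by (rule A.card_characters_frame)
  have "card (Fcoord c p ` A.characters) = card A.characters"
    using p card by (simp add: good_def Fvals_chart[OF c])
  then show "inj_on (Fcoord c p) A.characters" by (rule eq_card_imp_inj_on[OF A.finite_characters])
qed

lemma hyper_chart:
  assumes p: "good p" and c: "c \<in> charts_at M p" and y: "y \<in> chars c p"
  shows "hyper p (Fcoord c p y) = {v \<in> tangent_space M p. cdot y (v c) = 0}"
proof -
  have "(\<forall>l. (p, l) \<in> L \<and> F (p, l) = Fcoord c p y \<longrightarrow> l v = 0) \<longleftrightarrow> cdot y (v c) = 0"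
    if v: "v \<in> tangent_space M p" for v
  proof
    assume "\<forall>l. (p, l) \<in> L \<and> F (p, l) = Fcoord c p y \<longrightarrow> l v = 0"
    then show "cdot y (v c) = 0"
      using L_iff[OF c, of y] y covec_of_apply[OF v, of c y] by (auto simp: Fcoord_def)
  next
    assume y0: "cdot y (v c) = 0"
    show "\<forall>l. (p, l) \<in> L \<and> F (p, l) = Fcoord c p y \<longrightarrow> l v = 0"
    proof (intro allI impI, elim conjE)
      fix l assume l: "(p, l) \<in> L" "F (p, l) = Fcoord c p y"
      note lc = L_coords[OF l(1) c]
      have "Fcoord c p (covec_coords M c p l) = Fcoord c p y"
        using l(2) unfolding Fcoord_def lc(3) .
      then have "covec_coords M c p l = y"
        using good_Fcoord_inj(1)[OF p c] lc(2) y by (auto dest: inj_onD)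
      then show "l v = 0" using cotangent_apply[OF lc(1) c v] y0 by simp
    qed
  qed
  then show ?thesis by (auto simp: hyper_def)
qed

lemma hyper_canonical:
  assumes C: "canonical_chart c W V \<psi> g Y" and p: "p \<in> fst c" "snd c p \<in> W"
  shows "hyper p (\<psi> (snd c p) $ a) = {v \<in> tangent_space M p. (Y (snd c p) *v v c) $ a = 0}"
proof -
  note P = canonical_chart_point[OF C p]
  note CD = canonical_chartD[OF C]
  have "Y (snd c p) $ a \<in> chars c p" using CD(15)[OF p(2)] P(3) by simp
  from hyper_chart[OF P(4,2) this] show ?thesis
    using CD(18)[OF p(2), of a] P(3) by (simp add: matrix_vector_cdot)
qed

text \<open>The source chart is the one selected inside \<open>differential\<close>, so it can be
  obtained but not prescribed; the target chart is free.\<close>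

lemma differential_chart:
  assumes \<theta>: "holo_map M W M \<theta>" "openin (mtop M) W" "q \<in> W" and d: "d \<in> charts_at M (\<theta> q)"
  obtains c where "c \<in> charts_at M q"
    "\<And>v. differential M M \<theta> q v = tvec_of M d (\<theta> q) (cjac (snd d \<circ> \<theta> \<circ> chart_inv c) (snd c q) *v v c)"
proof -
  define c where "c = (SOME c. c \<in> charts_at M q)"
  have "q \<in> points M" using openin_subset[OF \<theta>(2)] \<theta>(3) by (auto simp: topspace_mtop)
  then have c: "c \<in> charts_at M q" unfolding c_def by (rule someI_ex[OF points_chart])
  have ca: "c \<in> atlas M" "q \<in> fst c" using c by (auto simp: charts_at_def)
  let ?\<Theta> = "snd d \<circ> \<theta> \<circ> chart_inv c"
  define U where "U = {x \<in> W. \<theta> x \<in> fst d} \<inter> fst c"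
  note A = holo_map_chartD[OF \<theta> c d, folded U_def]
  have D: "(?\<Theta> has_derivative (*v) (cjac ?\<Theta> (snd c q))) (at (snd c q))"
    by (rule cholomorphic_vecD[OF A(3,4)]) (use A(2) in blast)
  have "differential M M \<theta> q v = tvec_of M d (\<theta> q) (cjac ?\<Theta> (snd c q) *v v c)" for v
  proof
    fix d'
    show "differential M M \<theta> q v d' = tvec_of M d (\<theta> q) (cjac ?\<Theta> (snd c q) *v v c) d'"
    proof (cases "d' \<in> charts_at M (\<theta> q)")
      case True
      have da: "d \<in> atlas M" "\<theta> q \<in> fst d" using d by (auto simp: charts_at_def)
      have "(transition d d' has_derivative (*v) (jacobian_at d d' (\<theta> q))) (at (?\<Theta> (snd c q)))"
        using transition_has_derivative[OF d True] ca by simp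
      then have D': "(transition d d' \<circ> ?\<Theta> has_derivative (*v) (jacobian_at d d' (\<theta> q) ** cjac ?\<Theta> (snd c q))) (at (snd c q))"
        by (rule has_derivative_eq_rhs[OF diff_chain_at[OF D]]) (auto simp: matrix_vector_mul_assoc)
      have "(snd d' \<circ> \<theta> \<circ> chart_inv c has_derivative (*v) (jacobian_at d d' (\<theta> q) ** cjac ?\<Theta> (snd c q))) (at (snd c q))"
        by (rule has_derivative_transform_within_open[OF D' A(3)]) (use A(2) da ca in \<open>auto simp: U_def\<close>)
      from dir_deriv_eq[OF this] show ?thesis
        using True d by (simp add: differential_def Let_def tvec_of_apply matrix_vector_mul_assoc flip: c_def)
    next
      case False
      then show ?thesis by (simp add: differential_def Let_def tvec_of_def)
    qed
  qed
  then show ?thesis using that c by blast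
qed

text \<open>A curve in the discriminant keeps the vanishing canonical coordinate at 0, which
  constrains its velocity. Conversely a line in canonical coordinates whose direction lies in the
  hyperplane stays in the discriminant.\<close>

lemma tangent_to_discriminant:
  assumes q: "good q" "q \<in> discriminant M m e F"
  shows "tangent_to M (discriminant M m e F) q = hyper q 0"
proof -
  obtain c where c: "c \<in> charts_at M q" using points_chart[OF good_points[OF q(1)]] by blast
  have qc: "q \<in> fst c" using c by (simp add: charts_at_def)
  obtain W V \<psi> g Y a0 where C: "canonical_chart c W V \<psi> g Y" "snd c q \<in> W" "\<psi> (snd c q) $ a0 = 0"
    "\<And>x. x \<in> fst c \<Longrightarrow> snd c x \<in> W \<Longrightarrow> x \<in> discriminant M m e F \<longleftrightarrow> \<psi> (snd c x) $ a0 = 0"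
    by (rule good_discriminant_chart[OF q c]) (rule that)
  note CD = canonical_chartD[OF C(1)]
  have H: "hyper q 0 = {v \<in> tangent_space M q. (Y (snd c q) *v v c) $ a0 = 0}"
    using hyper_canonical[OF C(1) qc C(2), of a0] C(3) by simp
  show ?thesis
  proof
    show "tangent_to M (discriminant M m e F) q \<subseteq> hyper q 0"
    proof
      fix v assume "v \<in> tangent_to M (discriminant M m e F) q"
      then obtain \<gamma> \<Omega> where \<gamma>: "v = velocity M \<gamma> 0" "holo_curve M \<Omega> \<gamma>" "0 \<in> \<Omega>" "\<gamma> 0 = q" "\<gamma> ` \<Omega> \<subseteq> discriminant M m e F"
        unfolding tangent_to_def by blast
      have vT: "v \<in> tangent_space M q" using velocity_tangent[OF \<gamma>(2,3)] \<gamma> by simp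
      have op: "open {s \<in> \<Omega>. \<gamma> s \<in> {x \<in> fst c. snd c x \<in> W}}"
        by (rule holo_curve_preimage_open[OF \<gamma>(2) openin_chart_preimage[OF CD(1,2)]])
      have "((\<lambda>s. snd c (\<gamma> s)) has_derivative (\<lambda>h. h *s v c)) (at 0)"
        using holo_curveD[OF \<gamma>(2,3)] c \<gamma> by simp
      from curve_chain_vec[OF this] have "((\<lambda>s. \<psi> (snd c (\<gamma> s))) has_derivative (\<lambda>h. h *s (Y (snd c q) *v v c))) (at 0)"
        using CD(11)[OF C(2)] \<gamma>(4) by simp
      then have d1: "((\<lambda>s. \<psi> (snd c (\<gamma> s)) $ a0) has_field_derivative (Y (snd c q) *v v c) $ a0) (at 0)"
        by (simp add: has_derivative_curve_iff)
      have d2: "((\<lambda>s. \<psi> (snd c (\<gamma> s)) $ a0) has_field_derivative 0) (at 0)"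
      proof (rule has_field_derivative_transform_within_open[OF DERIV_const op])
        show "0 \<in> {s \<in> \<Omega>. \<gamma> s \<in> {x \<in> fst c. snd c x \<in> W}}" using \<gamma> qc C(2) by simp
        fix s assume "s \<in> {s \<in> \<Omega>. \<gamma> s \<in> {x \<in> fst c. snd c x \<in> W}}"
        then show "0 = \<psi> (snd c (\<gamma> s)) $ a0" using C(4)[of "\<gamma> s"] \<gamma>(5) by auto
      qed
      show "v \<in> hyper q 0" unfolding H using vT DERIV_unique[OF d1 d2] by simp
    qed
    show "hyper q 0 \<subseteq> tangent_to M (discriminant M m e F) q"
    proof
      fix v assume "v \<in> hyper q 0"
      then have v: "v \<in> tangent_space M q" "(Y (snd c q) *v v c) $ a0 = 0" unfolding H by auto
      define w where "w = Y (snd c q) *v v c"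
      define z0 where "z0 = \<psi> (snd c q)"
      have "open {s. z0 + s *s w \<in> V}"
        using open_vimage[OF CD(4), of "\<lambda>s. z0 + s *s w"] by (simp add: vimage_def continuous_intros)
      moreover have "0 \<in> {s. z0 + s *s w \<in> V}" using CD(7)[OF C(2)] by (simp add: z0_def)
      ultimately obtain r where r: "0 < r" "ball 0 r \<subseteq> {s. z0 + s *s w \<in> V}" by (meson openE)
      have rV: "\<forall>s\<in>ball 0 r. z0 + s *s w \<in> V" using r by auto
      define \<gamma> where "\<gamma> = (\<lambda>s. chart_inv c (g (z0 + s *s w)))"
      note K = canonical_curve[OF C(1) rV]
      have \<gamma>: "holo_curve M (ball 0 r) \<gamma>" "\<And>s. s \<in> ball 0 r \<Longrightarrow> \<gamma> s \<in> fst c"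
        "\<And>s. s \<in> ball 0 r \<Longrightarrow> snd c (\<gamma> s) \<in> W" "\<And>s. s \<in> ball 0 r \<Longrightarrow> \<psi> (snd c (\<gamma> s)) = z0 + s *s w"
        "\<And>s. s \<in> ball 0 r \<Longrightarrow> velocity M \<gamma> s c = matrix_inv (Y (snd c (\<gamma> s))) *v w"
        unfolding \<gamma>_def by (fact K)+
      have \<gamma>0: "\<gamma> 0 = q" using CD(8)[OF C(2)] CD(1) qc by (simp add: \<gamma>_def z0_def)
      have 0: "0 \<in> ball (0 :: complex) r" using r by simp
      have "velocity M \<gamma> 0 = v"
      proof (rule tangent_eqI[OF _ v(1) c])
        show "velocity M \<gamma> 0 \<in> tangent_space M q" using velocity_tangent[OF \<gamma>(1) 0] \<gamma>0 by simp
        show "velocity M \<gamma> 0 c = v c"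
        proof -
          have "velocity M \<gamma> 0 c = matrix_inv (Y (snd c (\<gamma> 0))) *v w" by (rule \<gamma>(5)[OF 0])
          then show ?thesis
            unfolding \<gamma>0 using matrix_inv_inverse[OF CD(12)[OF C(2)]] by (simp add: w_def matrix_vector_mul_assoc)
        qed
      qed
      moreover have "\<gamma> ` ball 0 r \<subseteq> discriminant M m e F"
      proof
        fix x assume "x \<in> \<gamma> ` ball 0 r"
        then obtain s where s: "s \<in> ball 0 r" "x = \<gamma> s" by blast
        have "\<psi> (snd c x) $ a0 = (z0 + s *s w) $ a0" unfolding s(2) \<gamma>(4)[OF s(1)] ..
        then have "\<psi> (snd c x) $ a0 = 0" using C(3) v(2) by (simp add: z0_def w_def)
        then show "x \<in> discriminant M m e F" using C(4) \<gamma>(2,3)[OF s(1)] s by simp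
      qed
      ultimately show "v \<in> tangent_to M (discriminant M m e F) q"
        unfolding tangent_to_def using \<gamma>(1) 0 \<gamma>0 by blast
    qed
  qed
qed

end

context standard_F_manifold
begin

text \<open>In canonical coordinates at both ends, a flow map is a translation up to a permutation of the
  coordinates; this determines its differential.\<close>

lemma flow_differential_hyper:
  assumes q: "good q" and W0: "openin (mtop M) W0" "q \<in> W0" and \<theta>: "holo_map M W0 M \<theta>" "\<theta> q = p"
    and flow: "\<And>x. x \<in> W0 \<Longrightarrow> flow_rel M e s x (\<theta> x)" and x: "x \<in> Fvals q"
  shows "differential M M \<theta> q ` hyper q x = hyper p (x + s)"
proof -
  have p: "good p" "Fvals p = (\<lambda>x. x + s) ` Fvals q"
    using flow_rel_Fvals[OF q flow[OF W0(2)]] \<theta>(2) by auto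
  obtain d where d: "d \<in> charts_at M p" using points_chart[OF good_points[OF p(1)]] by blast
  obtain c where c: "c \<in> charts_at M q"
    and diff: "\<And>v. differential M M \<theta> q v = tvec_of M d p (cjac (snd d \<circ> \<theta> \<circ> chart_inv c) (snd c q) *v v c)"
    using differential_chart[OF \<theta>(1) W0] d unfolding \<theta>(2) by metis
  have ca: "c \<in> atlas M" "q \<in> fst c" "d \<in> atlas M" "p \<in> fst d" using c d by (auto simp: charts_at_def)
  obtain W V \<psi> g Y where C: "canonical_chart c W V \<psi> g Y" "snd c q \<in> W" using good_canonical_chart[OF q c] by metis
  obtain W2 V2 \<psi>2 g2 Y2 where C2: "canonical_chart d W2 V2 \<psi>2 g2 Y2" "snd d p \<in> W2" using good_canonical_chart[OF p(1) d] by metis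
  note CD = canonical_chartD[OF C(1)] and CD2 = canonical_chartD[OF C2(1)]
  define \<Theta> where "\<Theta> = snd d \<circ> \<theta> \<circ> chart_inv c"
  define A where "A = cjac \<Theta> (snd c q)"
  have d': "d \<in> charts_at M (\<theta> q)" using d \<theta>(2) by simp
  define U where "U = {x \<in> W0. \<theta> x \<in> fst d} \<inter> fst c"
  note U = holo_map_chartD[OF \<theta>(1) W0 c d', folded U_def \<Theta>_def]
  have zU: "snd c q \<in> snd c ` U" using U(2) by blast
  have DA: "(\<Theta> has_derivative (*v) A) (at (snd c q))"
    unfolding A_def by (rule cholomorphic_vecD[OF U(3,4) zU])
  have \<Theta>q: "\<Theta> (snd c q) = snd d p" using ca \<theta>(2) by (simp add: \<Theta>_def)
  define S where "S = snd c ` U \<inter> \<Theta> -` W2"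
  have opS0: "open S" unfolding S_def
    by (rule continuous_open_preimage[OF cholomorphic_vec_continuous_on[OF U(4)] U(3) CD2(2)])
  define S1 where "S1 = S \<inter> W"
  have S1: "open S1" "snd c q \<in> S1" using opS0 CD(2) zU \<Theta>q C C2 by (auto simp: S1_def S_def)
  have FS: "range (\<lambda>b. \<psi>2 (\<Theta> z) $ b) = (\<lambda>x. x + s) ` range (\<lambda>a. \<psi> z $ a)" if z: "z \<in> S1" for z
  proof -
    obtain x where x: "z = snd c x" "x \<in> W0" "\<theta> x \<in> fst d" "x \<in> fst c" using z by (auto simp: S1_def S_def U_def)
    have zW: "snd c x \<in> W" "snd d (\<theta> x) \<in> W2" using z x ca by (auto simp: S1_def S_def \<Theta>_def)
    note X = canonical_chart_point[OF C(1) x(4) zW(1)] and TX = canonical_chart_point[OF C2(1) x(3) zW(2)]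
    show ?thesis
      using flow_rel_Fvals(2)[OF X(4) flow[OF x(2)]] X(5) TX(5) x ca by (simp add: \<Theta>_def)
  qed
  have "\<psi> (snd c q) $ a + s \<in> range (\<lambda>b. \<psi>2 (snd d p) $ b)" for a
    using FS[OF S1(2)] by (auto simp: \<Theta>q)
  then have "\<exists>b. \<psi> (snd c q) $ a + s = \<psi>2 (snd d p) $ b" for a by blast
  \<comment> \<open>\<open>\<sigma> a\<close> is the number at \<open>p\<close> of the value that is
    the a-th one at \<open>q\<close>, shifted by \<open>s\<close>.\<close>
  then obtain \<sigma> where \<sigma>: "\<And>a. \<psi> (snd c q) $ a + s = \<psi>2 (snd d p) $ \<sigma> a" by metis
  have contS: "continuous_on S1 (\<lambda>z. \<psi> z $ a + s - \<psi>2 (\<Theta> z) $ b)" for a b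
  proof -
    have 1: "continuous_on S1 \<psi>"
      by (rule continuous_on_subset[OF cholomorphic_vec_continuous_on[OF CD(5)]]) (auto simp: S1_def)
    have 2: "continuous_on S1 \<Theta>"
      by (rule continuous_on_subset[OF cholomorphic_vec_continuous_on[OF U(4)]]) (auto simp: S1_def S_def)
    have 3: "continuous_on S1 (\<lambda>z. \<psi>2 (\<Theta> z))"
      by (rule continuous_on_compose2[OF cholomorphic_vec_continuous_on[OF CD2(5)] 2]) (auto simp: S1_def S_def)
    show ?thesis using 1 3 by (intro continuous_intros)
  qed
  have eqD: "(Y2 (snd d p) *v (A *v v)) $ \<sigma> a = (Y (snd c q) *v v) $ a" for v a
  proof -
    have op: "open (S1 \<inter> (\<lambda>z. \<psi> z $ a + s - \<psi>2 (\<Theta> z) $ b) -` (-{0}))" for b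
      by (rule continuous_open_preimage[OF contS S1(1)]) auto
    \<comment> \<open>Near \<open>q\<close> the shifted a-th value still differs from all image
      coordinates other than \<open>\<sigma> a\<close>. As it has to be one of them, the matching of
      coordinates persists on a neighbourhood and may be differentiated.\<close>
    define S2 where "S2 = S1 \<inter> (\<Inter>b\<in>-{\<sigma> a}. S1 \<inter> (\<lambda>z. \<psi> z $ a + s - \<psi>2 (\<Theta> z) $ b) -` (-{0}))"
    have "open (\<Inter>b\<in>-{\<sigma> a}. S1 \<inter> (\<lambda>z. \<psi> z $ a + s - \<psi>2 (\<Theta> z) $ b) -` (-{0}))"
      by (intro open_INT ballI finite op)
    then have "open S2" unfolding S2_def by (rule open_Int[OF S1(1)])
    have S2_iff: "z \<in> S2 \<longleftrightarrow> z \<in> S1 \<and> (\<forall>b. b \<noteq> \<sigma> a \<longrightarrow> \<psi> z $ a + s \<noteq> \<psi>2 (\<Theta> z) $ b)" for z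
      unfolding S2_def Int_iff INT_iff vimage_eq by auto
    have "snd c q \<in> S2"
      unfolding S2_iff \<Theta>q \<sigma> using S1(2) CD2(16)[OF C2(2)] by (metis injD)
    have loc: "\<psi>2 (\<Theta> z) $ \<sigma> a = \<psi> z $ a + s" if "z \<in> S2" for z
    proof -
      have "\<psi> z $ a + s \<in> range (\<lambda>b. \<psi>2 (\<Theta> z) $ b)" using that FS[of z] by (simp add: S2_iff)
      then show ?thesis using that by (metis S2_iff rangeE)
    qed
    have "(\<psi>2 has_derivative (*v) (Y2 (snd d p))) (at (\<Theta> (snd c q)))" using CD2(11)[OF C2(2)] \<Theta>q by simp
    from diff_chain_at[OF DA this]
    have "((\<psi>2 \<circ> \<Theta>) has_derivative (*v) (Y2 (snd d p) ** A)) (at (snd c q))"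
      by (simp add: o_def matrix_vector_mul_assoc)
    from has_derivative_vec_nth[OF this, of "\<sigma> a"]
    have "((\<lambda>z. \<psi>2 (\<Theta> z) $ \<sigma> a) has_derivative cdot ((Y2 (snd d p) ** A) $ \<sigma> a)) (at (snd c q))" by simp
    then have d1: "((\<lambda>z. \<psi> z $ a + s) has_derivative cdot ((Y2 (snd d p) ** A) $ \<sigma> a)) (at (snd c q))"
      by (rule has_derivative_transform_within_open[OF _ \<open>open S2\<close> \<open>snd c q \<in> S2\<close>]) (rule loc)
    have d2: "((\<lambda>z. \<psi> z $ a + s) has_derivative cdot (Y (snd c q) $ a)) (at (snd c q))"
      using has_derivative_add[OF has_derivative_vec_nth[OF CD(11)[OF C(2)], of a] has_derivative_const, of s] by simp
    have "cdot ((Y2 (snd d p) ** A) $ \<sigma> a) v = cdot (Y (snd c q) $ a) v"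
      using has_derivative_unique[OF d1 d2] by metis
    then show ?thesis by (simp add: matrix_vector_mul_assoc matrix_vector_cdot)
  qed
  have invA: "invertible A"
    unfolding invertible_left_inverse matrix_left_invertible_ker
  proof (intro allI impI)
    fix v assume "A *v v = 0"
    then have "(Y (snd c q) *v v) $ a = 0" for a using eqD[of v a] by simp
    then have "Y (snd c q) *v v = 0" by (simp add: vec_eq_iff)
    then show "v = 0" using matrix_inv_inverse(1)[OF CD(12)[OF C(2)]]
      by (metis matrix_vector_mul_assoc matrix_vector_mul_lid matrix_vector_mult_0_right)
  qed
  obtain a where a: "x = \<psi> (snd c q) $ a"
    using x canonical_chart_point(5)[OF C(1) ca(2) C(2)] by auto
  have Hq: "hyper q x = {v \<in> tangent_space M q. (Y (snd c q) *v v c) $ a = 0}"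
    unfolding a by (rule hyper_canonical[OF C(1) ca(2) C(2)])
  have Hp: "hyper p (x + s) = {v \<in> tangent_space M p. (Y2 (snd d p) *v v d) $ \<sigma> a = 0}"
    unfolding a \<sigma> by (rule hyper_canonical[OF C2(1) ca(4) C2(2)])
  show ?thesis
  proof
    show "differential M M \<theta> q ` hyper q x \<subseteq> hyper p (x + s)"
      unfolding Hq Hp diff using d eqD by (auto simp flip: \<Theta>_def A_def)
    show "hyper p (x + s) \<subseteq> differential M M \<theta> q ` hyper q x"
    proof
      fix w assume "w \<in> hyper p (x + s)"
      then have w: "w \<in> tangent_space M p" "(Y2 (snd d p) *v w d) $ \<sigma> a = 0" unfolding Hp by auto
      define v where "v = tvec_of M c q (matrix_inv A *v w d)"
      have Av: "A *v v c = w d" using c matrix_inv_inverse(2)[OF invA] by (simp add: v_def matrix_vector_mul_assoc)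
      have "v \<in> hyper q x" unfolding Hq using c eqD[of "v c" a] w(2) Av by (simp add: v_def)
      moreover have "differential M M \<theta> q v = w"
        unfolding diff using Av tangent_eq_tvec_of[OF w(1) d] by (simp flip: \<Theta>_def A_def)
      ultimately show "w \<in> differential M M \<theta> q ` hyper q x" by blast
    qed
  qed
qed

section \<open>Holomorphic flow maps along an orbit\<close>

lemma flow_rel_self: "x \<in> points M \<Longrightarrow> flow_rel M e 0 x x"
  using orbit_curve_exists[of x] unfolding flow_rel_def orbit_curve_def by metis

text \<open>Translation by \<open>u *s ones\<close> in canonical coordinates. Half of the radius
  \<open>r\<close> is reserved for the starting point and half for the translation, so that one
  \<open>\<rho>\<close> serves all points of \<open>X\<close>.\<close>

lemma local_flow:
  assumes p: "good p"
  obtains X \<rho> \<kappa> where "openin (mtop M) X" "p \<in> X" "0 < \<rho>"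
    "\<And>u. norm u < \<rho> \<Longrightarrow> holo_map M X M (\<kappa> u)"
    "\<And>u x. norm u < \<rho> \<Longrightarrow> x \<in> X \<Longrightarrow> flow_rel M e u x (\<kappa> u x)"
proof -
  obtain c where c: "c \<in> charts_at M p" using points_chart[OF good_points[OF p]] by blast
  obtain W V \<psi> g Y where C: "canonical_chart c W V \<psi> g Y" "snd c p \<in> W" using good_canonical_chart[OF p c] by metis
  note CD = canonical_chartD[OF C(1)]
  have pc: "p \<in> fst c" using c by (simp add: charts_at_def)
  obtain r where r: "0 < r" "ball (\<psi> (snd c p)) r \<subseteq> V" using openE[OF CD(4) CD(7)[OF C(2)]] by blast
  define \<rho> where "\<rho> = r / 2 / (norm (ones :: complex^'n) + 1)"
  have \<rho>: "0 < \<rho>" using r by (simp add: \<rho>_def add_nonneg_pos)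
  have small: "norm (u *s (ones :: complex^'n)) < r / 2" if "norm u < \<rho>" for u
  proof -
    have "norm (u *s (ones :: complex^'n)) \<le> norm u * (norm (ones :: complex^'n) + 1)"
      by (simp add: norm_complex_smult mult_left_mono)
    also have "\<dots> < \<rho> * (norm (ones :: complex^'n) + 1)"
      using that by (intro mult_strict_right_mono) (auto intro: add_nonneg_pos)
    also have "norm (ones :: complex^'n) + 1 \<noteq> 0" using norm_ge_zero[of "ones :: complex^'n"] by linarith
    then have "\<rho> * (norm (ones :: complex^'n) + 1) = r / 2" unfolding \<rho>_def by (metis nonzero_divide_eq_eq)
    finally show ?thesis .
  qed
  define W' where "W' = W \<inter> \<psi> -` ball (\<psi> (snd c p)) (r/2)"
  have "open W'" unfolding W'_def
    by (rule continuous_open_preimage[OF cholomorphic_vec_continuous_on[OF CD(5)] CD(2) open_ball])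
  have inV: "\<psi> z + u *s ones \<in> V" if "z \<in> W'" "norm u < \<rho>" for z u
  proof -
    have "dist (\<psi> (snd c p)) (\<psi> z + u *s ones) \<le> dist (\<psi> (snd c p)) (\<psi> z) + norm (u *s (ones :: complex^'n))"
      by (metis dist_triangle add_left_cancel dist_norm norm_minus_commute add_diff_cancel_left')
    also have "\<dots> < r" using that small[OF that(2)] by (simp add: W'_def)
    finally show ?thesis using r by auto
  qed
  define X where "X = {x \<in> fst c. snd c x \<in> W'}"
  define \<kappa> where "\<kappa> = (\<lambda>u x. chart_inv c (g (\<psi> (snd c x) + u *s ones)))"
  have X: "openin (mtop M) X" unfolding X_def by (rule openin_chart_preimage[OF CD(1) \<open>open W'\<close>])
  have WW': "W' \<subseteq> W" by (auto simp: W'_def)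
  have imgX: "snd c ` X = W'" using CD(3) WW' by (force simp: X_def)
  have \<kappa>c: "\<kappa> u x \<in> fst c" "snd c (\<kappa> u x) = g (\<psi> (snd c x) + u *s ones)" if "x \<in> X" "norm u < \<rho>" for u x
    using canonical_chart_inv_point[OF C(1) CD(9)[OF inV[of "snd c x" u]]] that by (auto simp: X_def \<kappa>_def)
  show ?thesis
  proof (rule that[OF X _ \<rho>])
    show "p \<in> X" using pc C(2) r by (simp add: X_def W'_def)
    fix u :: complex assume u: "norm u < \<rho>"
    show "holo_map M X M (\<kappa> u)"
    proof (rule holo_mapI[OF X])
      fix x assume "x \<in> X"
      have "cholomorphic_vec W' (\<lambda>z. \<psi> z + u *s ones)"
        using cholomorphic_vec_subset[OF CD(5) WW'] by (auto simp: cholomorphic_vec_def intro!: cholomorphic_add)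
      from cholomorphic_vec_compose[OF \<open>open W'\<close> CD(4) this CD(6)]
      have "cholomorphic_vec W' (g \<circ> (\<lambda>z. \<psi> z + u *s ones))" using inV u by auto
      moreover have "(g \<circ> (\<lambda>z. \<psi> z + u *s ones)) z = (snd c \<circ> \<kappa> u \<circ> chart_inv c) z" if z: "z \<in> W'" for z
      proof -
        obtain x where "z = snd c x" "x \<in> X" using z imgX by blast
        then show ?thesis using \<kappa>c u CD(1) by (simp add: X_def)
      qed
      ultimately have "cholomorphic_vec W' (snd c \<circ> \<kappa> u \<circ> chart_inv c)"
        by (rule cholomorphic_vec_cong[THEN iffD1, rotated])
      then show "holo_at (\<kappa> u) x"
        unfolding holo_at_def using CD(1) X \<open>x \<in> X\<close> \<kappa>c u imgX
        by (intro exI[of _ c] exI[of _ c] exI[of _ X]) (auto simp: X_def)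
    qed
    fix x assume x: "x \<in> X"
    have "integral_curve M e (ball 0 \<rho>) (\<lambda>s. chart_inv c (g (\<psi> (snd c x) + s *s ones)))"
      by (rule canonical_flow_curve[OF C(1)]) (use inV x in \<open>auto simp: X_def\<close>)
    then show "flow_rel M e u x (\<kappa> u x)"
      unfolding flow_rel_def using \<rho> u x CD(1,8) WW'
      by (intro exI[of _ "ball 0 \<rho>"] exI[of _ "\<lambda>s. \<kappa> s x"]) (auto simp: \<kappa>_def X_def subset_eq)
  qed
qed

text \<open>The time \<open>s\<close> may be far beyond the reach of a canonical chart. The times
  reached by a holomorphic flow map near \<open>q\<close> are propagated through the connected
  domain of the orbit curve by composing with local flows, forwards or backwards.\<close>

lemma flow_map_exists:
  assumes q: "good q" and f: "flow_rel M e s q p"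
  obtains W \<theta> where "openin (mtop M) W" "q \<in> W" "holo_map M W M \<theta>" "\<theta> q = p" "\<And>x. x \<in> W \<Longrightarrow> flow_rel M e s x (\<theta> x)"
proof -
  obtain \<Omega> \<gamma> where o: "orbit_curve q \<Omega> \<gamma>" using orbit_curve_exists[OF good_points[OF q]] by blast
  have s: "s \<in> \<Omega>" "\<gamma> s = p" using f flow_rel_iff[OF o q] by auto
  have \<gamma>: "integral_curve M e \<Omega> \<gamma>" "0 \<in> \<Omega>" "\<gamma> 0 = q" using o by (auto simp: orbit_curve_def)
  define P where "P = (\<lambda>t. \<exists>W \<theta>. openin (mtop M) W \<and> q \<in> W \<and> holo_map M W M \<theta> \<and> \<theta> q = \<gamma> t \<and> (\<forall>x\<in>W. flow_rel M e t x (\<theta> x)))"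
  have "P s"
  proof (rule connected_induction_simple[where S = \<Omega> and a = 0 and P = P])
    show "connected \<Omega>" using \<gamma> by (simp add: integral_curve_def)
    have "holo_map M (points M) M (\<lambda>x. x)"
    proof (rule holo_mapI)
      show "openin (mtop M) (points M)" by (metis openin_topspace topspace_mtop)
      fix x assume "x \<in> points M"
      from points_chart[OF this] obtain c where "c \<in> charts_at M x" by blast
      then have c: "c \<in> atlas M" "x \<in> fst c" by (auto simp: charts_at_def)
      have "cholomorphic_vec (snd c ` fst c) (snd c \<circ> (\<lambda>x. x) \<circ> chart_inv c)"
        by (rule cholomorphic_vec_cong[THEN iffD2, OF _ cholomorphic_vec_ident]) (use c in auto)
      then show "holo_at (\<lambda>x. x) x"
        unfolding holo_at_def using c openin_chart[OF c(1)] by (intro exI[of _ c] exI[of _ "fst c"]) auto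
    qed
    moreover have "openin (mtop M) (points M)" by (metis openin_topspace topspace_mtop)
    ultimately show "P 0"
      unfolding P_def using \<gamma>(3) good_points[OF q] flow_rel_self by (intro exI[of _ "points M"] exI[of _ "\<lambda>x. x"]) auto
    fix t0 assume t0: "t0 \<in> \<Omega>"
    have g0: "good (\<gamma> t0)" by (rule orbit_curve_Fvals(1)[OF o q t0])
    obtain X \<rho> \<kappa> where K: "openin (mtop M) X" "\<gamma> t0 \<in> X" "0 < \<rho>" "\<And>u. norm u < \<rho> \<Longrightarrow> holo_map M X M (\<kappa> u)"
      "\<And>u x. norm u < \<rho> \<Longrightarrow> x \<in> X \<Longrightarrow> flow_rel M e u x (\<kappa> u x)"
      by (rule local_flow[OF g0]) (rule that)
    have "holo_curve M \<Omega> \<gamma>" using \<gamma> by (simp add: integral_curve_def)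
    then have opT: "open ({t \<in> \<Omega>. \<gamma> t \<in> X} \<inter> ball t0 (\<rho>/2))"
      using holo_curve_preimage_open K(1) by blast
    show "\<exists>T. openin (top_of_set \<Omega>) T \<and> t0 \<in> T \<and> (\<forall>x\<in>T. \<forall>y\<in>T. P x \<longrightarrow> P y)"
    proof (intro exI[of _ "{t \<in> \<Omega>. \<gamma> t \<in> X} \<inter> ball t0 (\<rho>/2)"] conjI ballI impI)
      show "openin (top_of_set \<Omega>) ({t \<in> \<Omega>. \<gamma> t \<in> X} \<inter> ball t0 (\<rho>/2))"
        using opT by (intro open_subset) auto
      show "t0 \<in> {t \<in> \<Omega>. \<gamma> t \<in> X} \<inter> ball t0 (\<rho>/2)" using t0 K by simp
      fix t t' assume t: "t \<in> {t \<in> \<Omega>. \<gamma> t \<in> X} \<inter> ball t0 (\<rho>/2)" and t': "t' \<in> {t \<in> \<Omega>. \<gamma> t \<in> X} \<inter> ball t0 (\<rho>/2)"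
      assume "P t"
      then obtain W \<theta> where W: "openin (mtop M) W" "q \<in> W" "holo_map M W M \<theta>" "\<theta> q = \<gamma> t" "\<And>x. x\<in>W \<Longrightarrow> flow_rel M e t x (\<theta> x)"
        unfolding P_def by blast
      have u: "norm (t' - t) < \<rho>"
      proof -
        have "dist t' t \<le> dist t0 t' + dist t0 t" by (rule dist_triangle3)
        also have "\<dots> < \<rho>" using t t' by simp
        finally show ?thesis by (simp add: dist_norm)
      qed
      \<comment> \<open>Flow times have been shown to add only from good starting points; these form
        an open set, to which the map is restricted.\<close>
      define W1 where "W1 = W \<inter> {x. good x}"
      have W1: "openin (mtop M) W1" unfolding W1_def using W(1) good_open by blast
      have h1: "holo_map M W1 M \<theta>"
      proof (rule holo_mapI[OF W1])
        fix x assume x: "x \<in> W1"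
        then have xW: "x \<in> W" by (simp add: W1_def)
        have "x \<in> points M" using x good_points by (auto simp: W1_def)
        then obtain c where c: "c \<in> charts_at M x" using points_chart by blast
        obtain d where d: "d \<in> charts_at M (\<theta> x)" using points_chart[OF holo_map_points[OF W(3,1) xW]] by blast
        note H = holo_map_chartD[OF W(3,1) xW c d]
        show "holo_at \<theta> x"
          unfolding holo_at_def using H c d
          by (intro exI[of _ c] exI[of _ d] exI[of _ "{x \<in> W. \<theta> x \<in> fst d} \<inter> fst c"]) (auto simp: charts_at_def)
      qed
      have "holo_map M {x \<in> W1. \<theta> x \<in> X} M (\<lambda>x. \<kappa> (t' - t) (\<theta> x))"
        by (rule holo_map_compose[OF h1 W1 K(4)[OF u] K(1)])
      moreover have "openin (mtop M) {x \<in> W1. \<theta> x \<in> X}" by (rule holo_map_preimage_open[OF h1 W1 K(1)])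
      moreover have q1: "q \<in> {x \<in> W1. \<theta> x \<in> X}" using W(2,4) q t by (simp add: W1_def)
      moreover have fl: "flow_rel M e t' x (\<kappa> (t' - t) (\<theta> x))" if x: "x \<in> {x \<in> W1. \<theta> x \<in> X}" for x
      proof -
        have "good x" "flow_rel M e t x (\<theta> x)" "\<theta> x \<in> X" using x W(5) by (auto simp: W1_def)
        then show ?thesis using flow_rel_trans[OF _ _ K(5)[OF u], of x t "\<theta> x"] by simp
      qed
      moreover have "\<kappa> (t' - t) (\<theta> q) = \<gamma> t'"
        using fl[OF q1] flow_rel_iff[OF o q] by simp
      ultimately show "P t'" unfolding P_def by (intro exI[of _ "{x \<in> W1. \<theta> x \<in> X}"] exI[of _ "\<lambda>x. \<kappa> (t' - t) (\<theta> x)"]) simp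
    qed
  qed (use \<gamma> s in auto)
  then show ?thesis unfolding P_def s(2) using that by metis
qed

end

section \<open>Characterisation of the idempotents\<close>

context generated_F_manifold
begin

lemma idempotent_frame_iff:
  assumes c: "c \<in> charts_at M p"
  shows "idempotent_frame M m p f \<longleftrightarrow> (\<forall>i. f i \<in> tangent_space M p) \<and> cn_algebra.frame (star c p) (\<lambda>i. f i c)"
proof (cases "\<forall>i. f i \<in> tangent_space M p")
  case True
  interpret A: cn_algebra "star c p" "e p c" by (rule algebra_at[OF c])
  have f: "f i \<in> tangent_space M p" for i using True by blast
  have p: "p \<in> points M" by (rule charts_at_points[OF c])
  have eq_iff: "u = v \<longleftrightarrow> u c = v c" if "u \<in> tangent_space M p" "v \<in> tangent_space M p" for u v
    using tangent_eqI[OF that c] by auto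
  have "f i \<noteq> 0 \<longleftrightarrow> f i c \<noteq> 0" for i
    using eq_iff[OF f tangent_zero, of i] by simp
  moreover have "m p (f i) (f j) = (if i = j then f i else 0) \<longleftrightarrow> star c p (f i c) (f j c) = (if i = j then f i c else 0)" for i j
  proof -
    have "m p (f i) (f j) c = star c p (f i c) (f j c)"
      unfolding star_def tangent_eq_tvec_of[OF f c] ..
    moreover have "(if i = j then f i else 0) \<in> tangent_space M p" using f tangent_zero by simp
    ultimately show ?thesis
      using eq_iff[OF m_props(1)[OF p f f f], of "if i = j then f i else 0" i j] by simp
  qed
  ultimately show ?thesis using True by (simp add: idempotent_frame_def A.frame_def)
qed (auto simp: idempotent_frame_def)

lemma coord_hyperplane_frame:
  assumes c: "c \<in> charts_at M p" and f: "\<And>i. f i \<in> tangent_space M p"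
    and y: "\<And>a b. cdot (y a) (f b c) = (if a = b then 1 else 0)" "\<And>v. v = (\<Sum>a\<in>UNIV. cdot (y a) v *s f a c)"
  shows "coord_hyperplane f k = {v \<in> tangent_space M p. cdot (y k) (v c) = 0}"
proof
  show "coord_hyperplane f k \<subseteq> {v \<in> tangent_space M p. cdot (y k) (v c) = 0}"
  proof
    fix v assume "v \<in> coord_hyperplane f k"
    then obtain a where a: "v = (\<Sum>i\<in>UNIV - {k}. tscale (a i) (f i))" by (auto simp: coord_hyperplane_def)
    have "v \<in> tangent_space M p" unfolding a by (intro tangent_sum tangent_scale f)
    moreover have "cdot (y k) (v c) = (\<Sum>i\<in>UNIV - {k}. a i * cdot (y k) (f i c))"
      by (simp add: a sum_tvec_apply tscale_def cdot_sum_right cdot_smult_right)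
    then have "cdot (y k) (v c) = 0" by (simp add: y(1))
    ultimately show "v \<in> {v \<in> tangent_space M p. cdot (y k) (v c) = 0}" by simp
  qed
  show "{v \<in> tangent_space M p. cdot (y k) (v c) = 0} \<subseteq> coord_hyperplane f k"
  proof
    fix v assume "v \<in> {v \<in> tangent_space M p. cdot (y k) (v c) = 0}"
    then have v: "v \<in> tangent_space M p" "cdot (y k) (v c) = 0" by auto
    have "v = (\<Sum>i\<in>UNIV - {k}. tscale (cdot (y i) (v c)) (f i))"
    proof (rule tangent_eqI[OF v(1) tangent_sum c])
      have "(\<Sum>a\<in>UNIV. cdot (y a) (v c) *s f a c) = (\<Sum>i\<in>UNIV - {k}. cdot (y i) (v c) *s f i c)"
        using v(2) by (subst sum.remove[of UNIV k]) auto
      then show "v c = (\<Sum>i\<in>UNIV - {k}. tscale (cdot (y i) (v c)) (f i)) c"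
        using y(2)[of "v c"] by (simp add: sum_tvec_apply tscale_def)
    qed (intro tangent_scale f)
    then show "v \<in> coord_hyperplane f k"
      unfolding coord_hyperplane_def by (intro CollectI exI[of _ "\<lambda>i. cdot (y i) (v c)"] conjI TrueI)
  qed
qed

lemma idempotent_frame_properties:
  assumes p: "good p" and f: "idempotent_frame M m p f"
  shows "cond_unit e p f" "range (coord_hyperplane f) = hyper p ` Fvals p"
proof -
  obtain c where c: "c \<in> charts_at M p" using points_chart[OF good_points[OF p]] by blast
  interpret A: cn_algebra "star c p" "e p c" by (rule algebra_at[OF c])
  have fT: "\<And>i. f i \<in> tangent_space M p" and fr: "A.frame (\<lambda>i. f i c)" using f idempotent_frame_iff[OF c] by auto
  obtain y where y: "\<And>a b. cdot (y a) (f b c) = (if a = b then 1 else 0)"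
    "\<And>v. v = (\<Sum>a\<in>UNIV. cdot (y a) v *s f a c)" "A.characters = range y" "e p c = (\<Sum>a\<in>UNIV. f a c)"
    by (rule A.frame_dual[OF fr], rule that) assumption+
  show "cond_unit e p f"
    unfolding cond_unit_def
    by (rule tangent_eqI[OF e_tangent[OF good_points[OF p]] tangent_sum c]) (simp_all add: fT y(4) sum_tvec_apply)
  have "coord_hyperplane f k = hyper p (Fcoord c p (y k))" for k
  proof -
    have "y k \<in> A.characters" using y(3) by simp
    from hyper_chart[OF p c this] show ?thesis
      using coord_hyperplane_frame[where f = f and y = y, OF c fT y(1,2)] by simp
  qed
  then have "range (coord_hyperplane f) = hyper p ` (Fcoord c p ` range y)" by (simp add: image_image)
  then show "range (coord_hyperplane f) = hyper p ` Fvals p" unfolding Fvals_chart[OF c] y(3) .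
qed

lemma good_idempotent_frame:
  assumes p: "good p"
  shows "\<exists>f. idempotent_frame M m p f"
proof -
  obtain c where c: "c \<in> charts_at M p" using points_chart[OF good_points[OF p]] by blast
  obtain f where "cn_algebra.frame (star c p) f" using good_frame[OF p c] by blast
  then have "idempotent_frame M m p (\<lambda>i. tvec_of M c p (f i))"
    using c by (simp add: idempotent_frame_iff[OF c])
  then show ?thesis by blast
qed

text \<open>The vector \<open>f i\<close> lies in every hyperplane except the i-th, and this
  intersection is the line of one idempotent. The condition on the unit fixes the factor: the dual
  form of that idempotent takes the value 1 on \<open>e\<close>.\<close>

lemma frame_unique:
  assumes p: "good p" and f0: "idempotent_frame M m p f0"
    and f: "\<And>i. f i \<in> tangent_space M p" "cond_unit e p f" "range (coord_hyperplane f) = range (coord_hyperplane f0)"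
  shows "\<exists>\<sigma>. bij \<sigma> \<and> f = f0 \<circ> \<sigma>"
proof -
  obtain c where c: "c \<in> charts_at M p" using points_chart[OF good_points[OF p]] by blast
  interpret A: cn_algebra "star c p" "e p c" by (rule algebra_at[OF c])
  have fT: "\<And>i. f0 i \<in> tangent_space M p" and fr: "A.frame (\<lambda>i. f0 i c)" using f0 idempotent_frame_iff[OF c] by auto
  obtain y where y: "\<And>a b. cdot (y a) (f0 b c) = (if a = b then 1 else 0)"
    "\<And>v. v = (\<Sum>a\<in>UNIV. cdot (y a) v *s f0 a c)" "e p c = (\<Sum>a\<in>UNIV. f0 a c)"
    by (rule A.frame_dual[OF fr], rule that) assumption+
  note H0 = coord_hyperplane_frame[where f = f0 and y = y, OF c fT y(1,2)]
  have inj0: "inj (coord_hyperplane f0)"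
  proof (rule injI)
    fix k l assume eq: "coord_hyperplane f0 k = coord_hyperplane f0 l"
    show "k = l"
    proof (rule ccontr)
      assume "k \<noteq> l"
      then have "f0 l \<in> coord_hyperplane f0 k" unfolding H0 using fT y(1) by simp
      then have "f0 l \<in> coord_hyperplane f0 l" by (simp only: eq)
      then show False unfolding H0 using y(1) by simp
    qed
  qed
  \<comment> \<open>The n hyperplanes of \<open>f0\<close> are different, so those of
    \<open>f\<close> are too, and matching equal hyperplanes defines a permutation.\<close>
  have "card (range (coord_hyperplane f)) = CARD('n)" unfolding f(3) using inj0 by (rule card_image)
  then have injf: "inj (coord_hyperplane f)" by (intro eq_card_imp_inj_on) auto
  have "coord_hyperplane f k \<in> range (coord_hyperplane f0)" for k unfolding f(3)[symmetric] by simp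
  then have "\<exists>l. coord_hyperplane f k = coord_hyperplane f0 l" for k by blast
  then obtain \<sigma> where \<sigma>: "\<And>k. coord_hyperplane f k = coord_hyperplane f0 (\<sigma> k)" by metis
  have "inj \<sigma>" by (rule injI) (metis \<sigma> injf injD)
  then have bij: "bij \<sigma>" by (simp add: bij_def finite_UNIV_inj_surj)
  have mem: "f i \<in> coord_hyperplane f k" if "i \<noteq> k" for i k
  proof -
    have "(\<Sum>j\<in>UNIV - {k}. tscale (if j = i then 1 else 0) (f j)) = (\<Sum>j\<in>UNIV - {k}. if j = i then f j else 0)"
      by (intro sum.cong) (auto simp: tscale_def)
    also have "\<dots> = f i" using that by (simp add: sum.delta)
    finally have "f i = (\<Sum>j\<in>UNIV - {k}. tscale (if j = i then 1 else 0) (f j))" by (rule sym)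
    then show ?thesis
      unfolding coord_hyperplane_def by (intro CollectI exI[of _ "\<lambda>j. if j = i then 1 else 0"] conjI TrueI)
  qed
  have z: "cdot (y (\<sigma> k)) (f i c) = 0" if "i \<noteq> k" for i k
    using mem[OF that] unfolding \<sigma> H0 by simp
  have fi: "f i c = cdot (y (\<sigma> i)) (f i c) *s f0 (\<sigma> i) c" for i
  proof -
    have "cdot (y a) (f i c) = 0" if a: "a \<noteq> \<sigma> i" for a
    proof -
      obtain k where k: "a = \<sigma> k" using bij_is_surj[OF bij] by (rule surjE)
      have "i \<noteq> k" using a k by auto
      from z[OF this] show ?thesis unfolding k .
    qed
    then have "(\<Sum>a\<in>UNIV. cdot (y a) (f i c) *s f0 a c) = cdot (y (\<sigma> i)) (f i c) *s f0 (\<sigma> i) c"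
      by (subst sum.remove[of UNIV "\<sigma> i"]) auto
    then show ?thesis using y(2)[of "f i c"] by simp
  qed
  have one: "cdot (y (\<sigma> j)) (f j c) = 1" for j
  proof -
    have "cdot (y (\<sigma> j)) (e p c) = 1"
      unfolding y(3) by (simp add: cdot_sum_right y(1))
    moreover have "e p c = (\<Sum>i\<in>UNIV. f i c)" using f(2) by (simp add: cond_unit_def sum_tvec_apply)
    ultimately have "(\<Sum>i\<in>UNIV. cdot (y (\<sigma> j)) (f i c)) = 1" by (simp add: cdot_sum_right)
    moreover have "(\<Sum>i\<in>UNIV. cdot (y (\<sigma> j)) (f i c)) = cdot (y (\<sigma> j)) (f j c)"
      using z by (subst sum.remove[of UNIV j]) auto
    ultimately show ?thesis by simp
  qed
  have "f i = f0 (\<sigma> i)" for i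
    by (rule tangent_eqI[OF f(1) fT c]) (use fi[of i] one[of i] in simp)
  then have "f = f0 \<circ> \<sigma>" by auto
  then show ?thesis using bij by blast
qed

end

section \<open>The tangent hyperplanes of the discriminant and their shifts\<close>

context standard_F_manifold
begin

lemma tangent_hyperplanes_good:
  assumes p: "good p"
  shows "tangent_hyperplanes M D pr p = (\<lambda>q. (q, hyper q 0)) ` {q \<in> D. pr q = pr p}"
proof -
  have gq: "good q" if "q \<in> D" "pr q = pr p" for q using good_fibre[OF p D_points] that by blast
  have "q \<in> reg_points M D \<longleftrightarrow> q \<in> D" if "pr q = pr p" for q
  proof
    assume "q \<in> D"
    then show "q \<in> reg_points M D" using good_discriminant_regular[OF gq[OF _ that]] by (simp add: D_def)
  qed (simp add: reg_points_def)
  moreover have "tangent_to M D q = hyper q 0" if "q \<in> D" "pr q = pr p" for q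
    using tangent_to_discriminant[OF gq[OF that]] that by (simp add: D_def)
  ultimately show ?thesis unfolding tangent_hyperplanes_def by auto
qed

lemma flow_rel_diff:
  assumes x: "good x" and f: "flow_rel M e s x y" "flow_rel M e t x z"
  shows "flow_rel M e (t - s) y z"
proof -
  obtain \<Omega> \<gamma> where o: "orbit_curve x \<Omega> \<gamma>" using orbit_curve_exists[OF good_points[OF x]] by blast
  have st: "s \<in> \<Omega>" "\<gamma> s = y" "t \<in> \<Omega>" "\<gamma> t = z" using f flow_rel_iff[OF o x] by auto
  have o2: "orbit_curve y ((\<lambda>t. t - s) ` \<Omega>) (\<lambda>t. \<gamma> (t + s))" using orbit_curve_shift[OF o st(1)] st by simp
  have "good y" using flow_rel_Fvals(1)[OF x f(1)] .
  from flow_rel_iff[OF o2 this] show ?thesis using st by auto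
qed

text \<open>At a point of \<open>D\<close> the tangent hyperplane belongs to the value 0. The flow
  of time s to \<open>p\<close> takes it to the hyperplane of the value s, and by
  \<open>D_times\<close> every value at \<open>p\<close> occurs.\<close>

lemma shifted_hyperplanes:
  assumes p: "good p"
  shows "{H'. \<exists>(q, H)\<in>tangent_hyperplanes M D pr p. flow_shift M e q p H H'} = hyper p ` Fvals p"
proof
  show "{H'. \<exists>(q, H)\<in>tangent_hyperplanes M D pr p. flow_shift M e q p H H'} \<subseteq> hyper p ` Fvals p"
  proof
    fix H' assume "H' \<in> {H'. \<exists>(q, H)\<in>tangent_hyperplanes M D pr p. flow_shift M e q p H H'}"
    then obtain q where q: "q \<in> D" "pr q = pr p" and "flow_shift M e q p (hyper q 0) H'"
      unfolding tangent_hyperplanes_good[OF p] by auto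
    then obtain s W \<theta> where s: "openin (mtop M) W" "q \<in> W" "holo_map M W M \<theta>" "\<theta> q = p"
      "\<And>x. x \<in> W \<Longrightarrow> flow_rel M e s x (\<theta> x)" "H' = differential M M \<theta> q ` hyper q 0"
      unfolding flow_shift_def by blast
    have gq: "good q" by (rule good_fibre[OF p D_points[OF q(1)] q(2)])
    have 0: "0 \<in> Fvals q" using q(1) by (simp add: D_iff)
    have "H' = hyper p (0 + s)" unfolding s(6) by (rule flow_differential_hyper[OF gq s(1-5) 0])
    moreover have "0 + s \<in> Fvals p" using flow_rel_Fvals(2)[OF gq s(5)[OF s(2)]] s(4) 0 by auto
    ultimately show "H' \<in> hyper p ` Fvals p" by blast
  qed
  show "hyper p ` Fvals p \<subseteq> {H'. \<exists>(q, H)\<in>tangent_hyperplanes M D pr p. flow_shift M e q p H H'}"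
  proof
    fix H' assume "H' \<in> hyper p ` Fvals p"
    then obtain x where x: "x \<in> Fvals p" "H' = hyper p x" by blast
    obtain q where q: "flow_rel M e (- x) p q" "q \<in> D" "pr q = pr p" using D_times[OF p x(1)] by metis
    have gq: "good q" by (rule good_fibre[OF p D_points[OF q(2)] q(3)])
    have "flow_rel M e x q p"
      using flow_rel_diff[OF p q(1) flow_rel_self[OF good_points[OF p]]] by simp
    then obtain W \<theta> where s: "openin (mtop M) W" "q \<in> W" "holo_map M W M \<theta>" "\<theta> q = p" "\<And>z. z \<in> W \<Longrightarrow> flow_rel M e x z (\<theta> z)"
      by (rule flow_map_exists[OF gq]) (rule that)
    have 0: "0 \<in> Fvals q" using q(2) by (simp add: D_iff)
    have "H' = differential M M \<theta> q ` hyper q 0"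
      using flow_differential_hyper[OF gq s 0] x(2) by simp
    then have "flow_shift M e q p (hyper q 0) H'" unfolding flow_shift_def using s by blast
    moreover have "(q, hyper q 0) \<in> tangent_hyperplanes M D pr p" unfolding tangent_hyperplanes_good[OF p] using q by blast
    ultimately show "H' \<in> {H'. \<exists>(q, H)\<in>tangent_hyperplanes M D pr p. flow_shift M e q p H H'}" by blast
  qed
qed

lemma cond_hyperplanes_iff:
  assumes p: "good p"
  shows "cond_hyperplanes M e D pr p f \<longleftrightarrow> range (coord_hyperplane f) = hyper p ` Fvals p"
proof -
  have y: "pr p \<in> points N" using pr_points good_points[OF p] by blast
  have "inj_on (\<lambda>q. (q, hyper q 0)) {q \<in> D. pr q = pr p}" by (rule inj_onI) simp
  then have "finite (tangent_hyperplanes M D pr p)" "card (tangent_hyperplanes M D pr p) = CARD('n)"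
    unfolding tangent_hyperplanes_good[OF p] using D_fibre_finite[OF y] D_fibre_card[OF p] by (auto simp: card_image)
  then show ?thesis unfolding cond_hyperplanes_def shifted_hyperplanes[OF p] by auto
qed

lemma good_conditions:
  assumes p: "good p"
  shows "\<exists>f. idempotent_frame M m p f"
    "idempotent_frame M m p f \<Longrightarrow> cond_unit e p f \<and> cond_hyperplanes M e D pr p f"
    "idempotent_frame M m p f0 \<Longrightarrow> (\<And>i. f i \<in> tangent_space M p) \<Longrightarrow> cond_unit e p f \<Longrightarrow> cond_hyperplanes M e D pr p f \<Longrightarrow>
       \<exists>\<sigma>. bij \<sigma> \<and> f = f0 \<circ> \<sigma>"
proof -
  show "\<exists>f. idempotent_frame M m p f" by (rule good_idempotent_frame[OF p])
  show "cond_unit e p f \<and> cond_hyperplanes M e D pr p f" if "idempotent_frame M m p f"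
    using idempotent_frame_properties[OF p that] by (simp add: cond_hyperplanes_iff[OF p])
  assume f0: "idempotent_frame M m p f0" and f: "\<And>i. f i \<in> tangent_space M p" "cond_unit e p f" "cond_hyperplanes M e D pr p f"
  have "range (coord_hyperplane f) = range (coord_hyperplane f0)"
    using f(3) idempotent_frame_properties(2)[OF p f0] by (simp add: cond_hyperplanes_iff[OF p])
  from frame_unique[OF p f0 f(1,2) this] show "\<exists>\<sigma>. bij \<sigma> \<and> f = f0 \<circ> \<sigma>" .
qed

end

section \<open>Regular points of the discriminant\<close>

context standard_F_manifold
begin

lemma M_Hausdorff: "Hausdorff_space (mtop M)"
  using F_man by (simp add: F_manifold_def complex_manifold_def)

text \<open>Density of the good points in \<open>M\<close> says nothing about the thin set
  \<open>D\<close>. But goodness is a property of the fibre, so a local section of the covering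
  lifts a nearby good fibre to a good point of \<open>D\<close>.\<close>

lemma good_discriminant_dense:
  assumes O': "openin (mtop M) O'" and q: "q \<in> O'" "q \<in> D"
  shows "\<exists>x\<in>O'. x \<in> D \<and> good x"
proof -
  obtain A where A: "subtopology (mtop M) D interior_of {x\<in>D. pr x \<in> A} = {}"
    "\<And>y. y\<in>points N - A \<Longrightarrow> \<exists>V s. openin (mtop N) V \<and> y \<in> V \<and>
           (\<forall>k<CARD('n). holo_map N V M (s k) \<and> (\<forall>x\<in>V. pr (s k x) = x)) \<and>
           (\<forall>k<CARD('n). \<forall>l<CARD('n). k \<noteq> l \<longrightarrow> s k ` V \<inter> s l ` V = {}) \<and>
           {x\<in>D. pr x \<in> V} = (\<Union>k<CARD('n). s k ` V)"
    by (rule covering_sections) (rule that)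
  have "openin (subtopology (mtop M) D) (D \<inter> O')" using O' by (auto simp: openin_subtopology)
  then have "\<not> D \<inter> O' \<subseteq> {x\<in>D. pr x \<in> A}"
    using A(1) q unfolding interior_of_def by blast
  then obtain x where x: "x \<in> D" "x \<in> O'" "pr x \<notin> A" by auto
  have "pr x \<in> points N - A" using x pr_points D_points by blast
  from A(2)[OF this] obtain V s where s: "openin (mtop N) V" "pr x \<in> V"
      "\<forall>k<CARD('n). holo_map N V M (s k) \<and> (\<forall>x\<in>V. pr (s k x) = x)" "{x\<in>D. pr x \<in> V} = (\<Union>k<CARD('n). s k ` V)"
    by (elim exE conjE) (rule that)
  have "x \<in> (\<Union>k<CARD('n). s k ` V)" unfolding s(4)[symmetric] using x(1) s(2) by simp
  then obtain k y where k: "k < CARD('n)" "y \<in> V" "x = s k y" by blast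
  have sk: "holo_map N V M (s k)" "\<And>y. y \<in> V \<Longrightarrow> pr (s k y) = y" using s(3) k(1) by auto
  have tV: "topspace (subtopology (mtop N) V) = V" using openin_subset[OF s(1)] by auto
  have "openin (subtopology (mtop N) V) {v \<in> V. s k v \<in> O'}"
    using openin_continuous_map_preimage[OF _ O', of "subtopology (mtop N) V" "s k"] sk(1) unfolding tV holo_map_def by blast
  then have "openin (mtop N) {v \<in> V. s k v \<in> O'}" using s(1) by (simp add: openin_open_subtopology)
  then have op: "openin (mtop M) {p \<in> points M. pr p \<in> {v \<in> V. s k v \<in> O'}}" by (rule pr_preimage_open)
  have "x \<in> {p \<in> points M. pr p \<in> {v \<in> V. s k v \<in> O'}}" using k x sk(2) D_points by auto
  then obtain p where p: "p \<in> points M" "pr p \<in> V" "s k (pr p) \<in> O'" "good p" using good_dense[OF op] by blast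
  have "s k (pr p) \<in> (\<Union>k<CARD('n). s k ` V)" using k(1) p(2) by blast
  then have "s k (pr p) \<in> D" unfolding s(4)[symmetric] by simp
  moreover from this have "good (s k (pr p))" by (intro good_fibre[OF p(4)] D_points sk(2)[OF p(2)])
  ultimately show ?thesis using p(3) by blast
qed

text \<open>Near a regular point of the discriminant, its conormal at the generic points is proportional to a
  character.  Characters take the value \<open>1\<close> on \<open>e\<close> and are locally bounded, so that the conormal cannot
  vanish on \<open>e\<close> in the limit.\<close>

lemma regular_point_transversal:
  assumes q: "q \<in> reg_points M D"
  obtains c W h where "c \<in> charts_at M q" "open W" "snd c q \<in> W" "W \<subseteq> snd c ` fst c" "cholomorphic W h"
    "\<And>x. x \<in> D \<Longrightarrow> x \<in> fst c \<Longrightarrow> snd c x \<in> W \<Longrightarrow> h (snd c x) = 0"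
    "cdot (cgrad h (snd c q)) (e q c) \<noteq> 0"
proof -
  obtain C J where C: "compatible_chart M C" "q \<in> fst C" "snd C ` (D \<inter> fst C) = snd C ` fst C \<inter> coord_space J" and qD: "q \<in> D"
    using q unfolding reg_points_def by blast
  note CC = C(1)[unfolded compatible_chart_def coords_UNIV coord_space_UNIV]
  have opC: "openin (mtop M) (fst C)" and injC: "inj_on (snd C) (fst C)" and opC': "open (snd C ` fst C)" using CC by auto
  have DC: "x \<in> D \<longleftrightarrow> snd C x \<in> coord_space J" if "x \<in> fst C" for x
  proof
    assume "x \<in> D"
    then show "snd C x \<in> coord_space J" using C(3) that by blast
  next
    assume "snd C x \<in> coord_space J"
    then have "snd C x \<in> snd C ` (D \<inter> fst C)" using C(3) that by blast
    then show "x \<in> D" using injC that by (auto dest: inj_onD)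
  qed
  have "q \<in> points M" using qD by (rule D_points)
  then obtain c where c: "c \<in> charts_at M q" using points_chart by blast
  have ca: "c \<in> atlas M" "q \<in> fst c" using c by (auto simp: charts_at_def)
  \<comment> \<open>\<open>reg_points\<close> does not fix the dimension. If all coordinates were
    free, \<open>D\<close> would contain an open set; at a good point of it the vanishing canonical
    coordinate would have differential 0, but this differential takes the value 1 on
    \<open>e\<close>.\<close>
  have "J \<noteq> UNIV"
  proof
    assume "J = UNIV"
    then have XD: "fst C \<subseteq> D" using DC by auto
    obtain x where x: "x \<in> fst C" "x \<in> D" "good x" using good_discriminant_dense[OF opC C(2) qD] by blast
    obtain cx where cx: "cx \<in> charts_at M x" using points_chart[OF good_points[OF x(3)]] by blast
    have xc: "x \<in> fst cx" "cx \<in> atlas M" using cx by (auto simp: charts_at_def)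
    obtain W V \<psi> g Y a0 where K: "canonical_chart cx W V \<psi> g Y" "snd cx x \<in> W" "\<psi> (snd cx x) $ a0 = 0"
      "\<And>x. x \<in> fst cx \<Longrightarrow> snd cx x \<in> W \<Longrightarrow> x \<in> discriminant M m e F \<longleftrightarrow> \<psi> (snd cx x) $ a0 = 0"
      by (rule good_discriminant_chart[OF x(3) x(2)[unfolded D_def] cx]) (rule that)
    note KD = canonical_chartD[OF K(1)]
    have op: "open (W \<inter> snd cx ` (fst cx \<inter> fst C))" by (rule open_Int[OF KD(2) openin_chart_image[OF opC xc(2)]])
    have z: "snd cx x \<in> W \<inter> snd cx ` (fst cx \<inter> fst C)" using K(2) x xc by blast
    have d1: "((\<lambda>z. \<psi> z $ a0) has_derivative cdot (Y (snd cx x) $ a0)) (at (snd cx x))"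
      by (rule has_derivative_vec_nth[OF KD(11)[OF K(2)]])
    have d2: "((\<lambda>z. \<psi> z $ a0) has_derivative (\<lambda>_. 0)) (at (snd cx x))"
    proof (rule has_derivative_transform_within_open[OF has_derivative_const op z])
      fix w assume w: "w \<in> W \<inter> snd cx ` (fst cx \<inter> fst C)"
      then obtain y where "w = snd cx y" "y \<in> fst cx" "y \<in> fst C" by blast
      then show "0 = \<psi> w $ a0" using K(4)[of y] w XD by (auto simp: D_def)
    qed
    have "cdot (Y (snd cx x) $ a0) v = 0" for v using has_derivative_unique[OF d1 d2] by metis
    moreover have "cdot (Y (snd cx x) $ a0) (e x cx) = 1"
      using arg_cong[OF KD(17)[OF K(2)], of "\<lambda>v. v $ a0"] xc by (simp add: matrix_vector_cdot)
    ultimately show False by simp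
  qed
  then obtain j where j: "j \<notin> J" by blast
  define X where "X = fst c \<inter> fst C"
  have X: "openin (mtop M) X" unfolding X_def using openin_chart[OF ca(1)] opC by blast
  have opX: "open (snd c ` X)" using openin_chart_image[OF X ca(1)] by (simp add: X_def)
  define \<tau> where "\<tau> = transition c C"
  have \<tau>hol: "cholomorphic_vec (snd c ` X) \<tau>"
    using CC ca(1) by (simp add: holo_transition_def \<tau>_def X_def)
  \<comment> \<open>A local equation for \<open>D\<close>: a coordinate of the straightening chart
    that is not free on \<open>D\<close>, read in the chart \<open>c\<close>.\<close>
  define h where "h = (\<lambda>z. \<tau> z $ j)"
  have hhol: "cholomorphic (snd c ` X) h" using \<tau>hol by (simp add: cholomorphic_vec_def h_def)
  have h0: "h (snd c x) = 0" if "x \<in> D" "x \<in> X" for x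
    using DC[of x] that j ca(1) by (auto simp: h_def \<tau>_def X_def coord_space_def transition_def)
  have zq: "snd c q \<in> snd c ` X" using ca C(2) by (simp add: X_def)
  have hq: "cgrad h (snd c q) \<noteq> 0"
  proof
    assume 0: "cgrad h (snd c q) = 0"
    define \<tau>' where "\<tau>' = transition C c"
    have hol': "cholomorphic_vec (snd C ` X) \<tau>'"
      using CC ca(1) unfolding holo_transition_def \<tau>'_def X_def Int_commute[of "fst c" "fst C"] by blast
    have \<tau>X: "\<tau> ` snd c ` X = snd C ` X" using ca(1) by (force simp: \<tau>_def X_def)
    have \<tau>z: "\<tau> (snd c q) \<in> snd C ` X" using \<tau>X zq by blast
    have "\<exists>g. ((\<lambda>w. \<tau>' w $ i) has_derivative cdot g) (at (\<tau> (snd c q)) within snd C ` X)" for i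
    proof -
      obtain f' where f': "((\<lambda>w. \<tau>' w $ i) has_derivative f') (at (\<tau> (snd c q)) within snd C ` X)" "\<forall>c v. f' (c *s v) = c * f' v"
        using hol' \<tau>z unfolding cholomorphic_vec_def cholomorphic_def by blast
      have "f' = cdot (\<chi> i. f' (axis i 1))"
        using f' by (intro complex_linear_eq_cdot) (auto simp: has_derivative_def bounded_linear.linear)
      then show ?thesis using f' by metis
    qed
    then obtain g where g: "\<And>i. ((\<lambda>w. \<tau>' w $ i) has_derivative cdot (g i)) (at (\<tau> (snd c q)) within snd C ` X)" by metis
    \<comment> \<open>The derivative of the inverse transition is taken within the image of
      \<open>X\<close>. Its composite with \<open>\<tau>\<close> is the identity near
      \<open>snd c q\<close>, which makes the Jacobian of \<open>\<tau>\<close> invertible, against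
      the zero row assumed.\<close>
    have D': "(\<tau>' has_derivative (*v) (\<chi> i. g i)) (at (\<tau> (snd c q)) within \<tau> ` snd c ` X)"
      unfolding \<tau>X by (rule has_derivative_vecI) (simp add: g)
    have D1: "(\<tau> has_derivative (*v) (cjac \<tau> (snd c q))) (at (snd c q) within snd c ` X)"
      by (rule has_derivative_at_withinI[OF cholomorphic_vecD[OF opX \<tau>hol zq]])
    have "((\<tau>' \<circ> \<tau>) has_derivative ((*v) (\<chi> i. g i) \<circ> (*v) (cjac \<tau> (snd c q)))) (at (snd c q) within snd c ` X)"
      by (rule diff_chain_within[OF D1 D'])
    then have "((\<tau>' \<circ> \<tau>) has_derivative (*v) ((\<chi> i. g i) ** cjac \<tau> (snd c q))) (at (snd c q))"
      unfolding at_within_open[OF zq opX] by (rule has_derivative_eq_rhs) (auto simp: matrix_vector_mul_assoc)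
    then have "((\<lambda>z. z) has_derivative (*v) ((\<chi> i. g i) ** cjac \<tau> (snd c q))) (at (snd c q))"
      by (rule has_derivative_transform_within_open[OF _ opX zq])
         (use ca(1) chart_inv_left[OF injC] in \<open>auto simp: \<tau>_def \<tau>'_def X_def transition_def\<close>)
    from has_derivative_unique[OF this has_derivative_ident]
    have "(\<chi> i. g i) ** cjac \<tau> (snd c q) = mat 1"
      by (metis matrix_eq matrix_vector_mul_lid)
    then have inv: "cjac \<tau> (snd c q) ** (\<chi> i. g i) = mat 1" by (simp add: matrix_left_right_inverse)
    have "cjac \<tau> (snd c q) $ j = 0" using 0 by (simp add: cjac_def h_def)
    then have "(cjac \<tau> (snd c q) *v ((\<chi> i. g i) *v axis j 1)) $ j = 0" by (simp add: matrix_vector_cdot)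
    then show False by (simp add: matrix_vector_mul_assoc inv)
  qed
  obtain W1 K where W1: "open W1" "snd c q \<in> W1" "W1 \<subseteq> snd c ` fst c" "0 < K"
    "\<And>z y. z \<in> W1 \<Longrightarrow> y \<in> chars c (chart_inv c z) \<Longrightarrow> norm y \<le> K"
    using characters_bounded[OF c] by metis
  \<comment> \<open>\<open>G\<close> is at most 0 where the conormal is bounded by K times its value
    on \<open>e\<close>. This closed condition passes from the good points of \<open>D\<close> to
    \<open>q\<close>; if the conormal vanished on \<open>e\<close> at \<open>q\<close>, then
    \<open>G\<close> would be positive there.\<close>
  define G where "G = (\<lambda>z. norm (cgrad h z) - K * norm (cdot (cgrad h z) (e (chart_inv c z) c)))"
  have bound: "G (snd c x) \<le> 0" if x: "x \<in> D" "good x" "x \<in> X" "snd c x \<in> W1" for x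
  proof -
    have xc: "x \<in> fst c" using x(3) by (simp add: X_def)
    have cx: "c \<in> charts_at M x" using xc ca by (simp add: charts_at_def)
    have zx: "snd c x \<in> snd c ` X" using x(3) by blast
    obtain W V \<psi> g Y a0 where K: "canonical_chart c W V \<psi> g Y" "snd c x \<in> W" "\<psi> (snd c x) $ a0 = 0"
      "\<And>x. x \<in> fst c \<Longrightarrow> snd c x \<in> W \<Longrightarrow> x \<in> discriminant M m e F \<longleftrightarrow> \<psi> (snd c x) $ a0 = 0"
      by (rule good_discriminant_chart[OF x(2) x(1)[unfolded D_def] cx]) (rule that)
    note KD = canonical_chartD[OF K(1)]
    define y where "y = Y (snd c x) $ a0"
    have ye: "cdot y (e x c) = 1"
      using arg_cong[OF KD(17)[OF K(2)], of "\<lambda>v. v $ a0"] xc ca by (simp add: matrix_vector_cdot y_def)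
    have "y \<in> chars c (chart_inv c (snd c x))" unfolding KD(15)[OF K(2)] y_def by simp
    then have ny: "norm y \<le> K" using W1(5)[OF x(4)] by blast
    have Hx: "hyper x 0 = {v \<in> tangent_space M x. cdot y (v c) = 0}"
      using hyper_canonical[OF K(1) xc K(2), of a0] K(3) by (simp add: matrix_vector_cdot y_def)
    \<comment> \<open>The kernel of the character is the tangent space of \<open>D\<close> at
      \<open>x\<close>, and \<open>h\<close> is constantly 0 along curves in
      \<open>D\<close>.\<close>
    have van: "cdot (cgrad h (snd c x)) v = 0" if v: "cdot y v = 0" for v
    proof -
      have "tvec_of M c x v \<in> hyper x 0" unfolding Hx using cx v by simp
      then have "tvec_of M c x v \<in> tangent_to M D x" using tangent_to_discriminant[OF x(2)] x(1) by (simp add: D_def)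
      then obtain \<gamma> \<Omega> where \<gamma>: "tvec_of M c x v = velocity M \<gamma> 0" "holo_curve M \<Omega> \<gamma>" "0 \<in> \<Omega>" "\<gamma> 0 = x" "\<gamma> ` \<Omega> \<subseteq> D"
        unfolding tangent_to_def by blast
      have "((\<lambda>s. snd c (\<gamma> s)) has_derivative (\<lambda>t. t *s v)) (at 0)"
        using holo_curveD[OF \<gamma>(2,3), of c] cx \<gamma>(4) by (simp flip: \<gamma>(1))
      then have d1: "((\<lambda>s. h (snd c (\<gamma> s))) has_field_derivative cdot (cgrad h (snd c x)) v) (at 0)"
        by (rule curve_chain_scalar) (use cholomorphicD[OF opX hhol zx] \<gamma>(4) in simp)
      have op: "open {s \<in> \<Omega>. \<gamma> s \<in> X}" by (rule holo_curve_preimage_open[OF \<gamma>(2) X])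
      have d2: "((\<lambda>s. h (snd c (\<gamma> s))) has_field_derivative 0) (at 0)"
      proof (rule has_field_derivative_transform_within_open[OF DERIV_const op])
        show "0 \<in> {s \<in> \<Omega>. \<gamma> s \<in> X}" using \<gamma>(3,4) x(3) by simp
        show "0 = h (snd c (\<gamma> s))" if s: "s \<in> {s \<in> \<Omega>. \<gamma> s \<in> X}" for s
        proof -
          have "\<gamma> s \<in> D" "\<gamma> s \<in> X" using s \<gamma>(5) by blast+
          from h0[OF this] show ?thesis by (rule sym)
        qed
      qed
      show ?thesis by (rule DERIV_unique[OF d1 d2])
    qed
    define \<kappa> where "\<kappa> = cdot (cgrad h (snd c x)) (e x c)"
    have "cgrad h (snd c x) $ i = (\<kappa> *s y) $ i" for i
    proof -
      have "cdot (cgrad h (snd c x)) (axis i 1 - y $ i *s e x c) = 0"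
        by (rule van) (simp add: cdot_diff_right cdot_smult_right ye)
      then show ?thesis by (simp add: cdot_diff_right cdot_smult_right \<kappa>_def mult.commute)
    qed
    then have "cgrad h (snd c x) = \<kappa> *s y" by (simp add: vec_eq_iff)
    then have "norm (cgrad h (snd c x)) = norm \<kappa> * norm y" by (simp add: norm_complex_smult)
    also have "\<dots> \<le> norm \<kappa> * K" by (rule mult_left_mono[OF ny]) simp
    finally show ?thesis using xc ca by (simp add: G_def \<kappa>_def mult.commute)
  qed
  have econt: "continuous_on (snd c ` X) (\<lambda>z. e (chart_inv c z) c)"
    by (rule continuous_on_subset[OF cholomorphic_vec_continuous_on[OF e_holomorphic[OF ca(1)]]]) (auto simp: X_def)
  have Gcont: "continuous_on (snd c ` X) G"
    unfolding G_def by (intro continuous_intros continuous_on_cgrad[OF opX hhol] econt)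
  have "G (snd c q) \<le> 0"
  proof (rule ccontr)
    assume "\<not> G (snd c q) \<le> 0"
    define S where "S = (snd c ` X \<inter> G -` {0<..}) \<inter> W1"
    have "open S" unfolding S_def by (intro open_Int continuous_open_preimage[OF Gcont opX] W1(1)) simp
    then have op: "openin (mtop M) {x \<in> fst c. snd c x \<in> S}" by (rule openin_chart_preimage[OF ca(1)])
    have "q \<in> {x \<in> fst c. snd c x \<in> S}" using \<open>\<not> G (snd c q) \<le> 0\<close> zq W1(2) ca by (simp add: S_def)
    then obtain x where x: "x \<in> fst c" "snd c x \<in> S" "x \<in> D" "good x" using good_discriminant_dense[OF op _ qD] by blast
    obtain x' where "snd c x = snd c x'" "x' \<in> X" using x(2) by (auto simp: S_def)
    then have "x \<in> X" using x(1) chart_inj[OF ca(1)] by (auto simp: X_def dest: inj_onD)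
    then show False using bound[OF x(3,4)] x(2) by (simp add: S_def)
  qed
  then have ne: "cdot (cgrad h (snd c q)) (e q c) \<noteq> 0" using hq ca by (auto simp: G_def)
  show ?thesis
  proof (rule that[OF c opX zq _ hhol _ ne])
    show "snd c ` X \<subseteq> snd c ` fst c" by (auto simp: X_def)
    fix x assume x: "x \<in> D" "x \<in> fst c" "snd c x \<in> snd c ` X"
    then obtain x' where "snd c x = snd c x'" "x' \<in> X" by blast
    then have "x \<in> X" using x(2) chart_inj[OF ca(1)] by (auto simp: X_def dest: inj_onD)
    then show "h (snd c x) = 0" by (rule h0[OF x(1)])
  qed
qed

text \<open>The orbits outside of the bifurcation diagram cannot end inside of a chart, as they are full fibres
  of \<open>pr\<close>.  So the flow of a small time stays near its starting point, uniformly up to the bifurcation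
  diagram; no existence theorem for differential equations is needed.\<close>

lemma flow_confined:
  assumes c: "c \<in> atlas M" and r: "cball z0 (2 * r) \<subseteq> snd c ` fst c"
    and B: "\<And>z. z \<in> cball z0 (2 * r) \<Longrightarrow> norm (e (chart_inv c z) c) \<le> B"
    and x: "good x" "x \<in> fst c" "snd c x \<in> ball z0 r" and o: "orbit_curve x \<Omega> \<gamma>" and s: "B * norm s < r" and B0: "0 \<le> B"
    and t: "t \<in> {0..1}"
  shows "of_real t * s \<in> \<Omega> \<and> \<gamma> (of_real t * s) \<in> fst c \<and> snd c (\<gamma> (of_real t * s)) \<in> ball z0 (2 * r)"
proof -
  define P where "P = (\<lambda>t::real. of_real t * s \<in> \<Omega> \<and> \<gamma> (of_real t * s) \<in> fst c \<and> snd c (\<gamma> (of_real t * s)) \<in> ball z0 (2 * r))"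
  define \<beta> where "\<beta> = (\<lambda>t::real. snd c (\<gamma> (of_real t * s)))"
  have \<gamma>: "integral_curve M e \<Omega> \<gamma>" "0 \<in> \<Omega>" "\<gamma> 0 = x" using o by (auto simp: orbit_curve_def)
  have curve: "holo_curve M \<Omega> \<gamma>" using \<gamma> by (simp add: integral_curve_def)
  have r0: "0 < r" using x(3) by (metis ball_eq_empty empty_iff not_le)
  have P0: "P 0" using \<gamma> x r0 by (auto simp: P_def)
  have D\<beta>: "(\<beta> has_derivative (\<lambda>h. (of_real h * s) *s e (\<gamma> (of_real t * s)) c)) (at t within S)" if "P t" for t S
  proof -
    have "c \<in> charts_at M (\<gamma> (of_real t * s))" using that c by (simp add: P_def charts_at_def)
    then have "((\<lambda>u. snd c (\<gamma> u)) has_derivative (\<lambda>h. h *s e (\<gamma> (of_real t * s)) c)) (at (of_real t * s))"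
      using holo_curveD[OF curve, of "of_real t * s" c] that \<gamma>(1) by (simp add: P_def integral_curve_def)
    then show ?thesis
      unfolding \<beta>_def
      by (rule has_derivative_compose[of "\<lambda>t. of_real t * s" "\<lambda>h. of_real h * s" t S, rotated])
         (auto intro!: derivative_eq_intros)
  qed
  have eB: "norm (e (\<gamma> (of_real t * s)) c) \<le> B" if "P t" for t
    using B[of "snd c (\<gamma> (of_real t * s))"] that c by (simp add: P_def)
  have lip: "norm (\<beta> b - \<beta> a) \<le> B * norm s * norm (b - a)"
    if "\<And>t. t \<in> {0..T} \<Longrightarrow> P t" "a \<in> {0..T}" "b \<in> {0..T}" for a b T
  proof (rule differentiable_bound[of "{0..T}" \<beta> "\<lambda>t h. (of_real h * s) *s e (\<gamma> (of_real t * s)) c"])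
    show "(\<beta> has_derivative (\<lambda>h. (of_real h * s) *s e (\<gamma> (of_real t * s)) c)) (at t within {0..T})" if "t \<in> {0..T}" for t
      by (rule D\<beta>) (use \<open>t \<in> {0..T}\<close> \<open>\<And>t. t \<in> {0..T} \<Longrightarrow> P t\<close> in blast)
    show "onorm (\<lambda>h. (of_real h * s) *s e (\<gamma> (of_real t * s)) c) \<le> B * norm s" if "t \<in> {0..T}" for t
    proof (rule onorm_le)
      fix h :: real
      have "norm (e (\<gamma> (of_real t * s)) c) \<le> B" using eB \<open>t \<in> {0..T}\<close> \<open>\<And>t. t \<in> {0..T} \<Longrightarrow> P t\<close> by blast
      then have "norm h * norm s * norm (e (\<gamma> (of_real t * s)) c) \<le> norm h * norm s * B" by (intro mult_left_mono) auto
      then show "norm ((of_real h * s) *s e (\<gamma> (of_real t * s)) c) \<le> B * norm s * norm h"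
        by (simp add: norm_complex_smult norm_mult mult_ac)
    qed
  qed (use that in auto)
  define A where "A = {t\<in>{0..1}. \<forall>t'\<in>{0..t}. P t'}"
  have A0: "0 \<in> A" using P0 by (simp add: A_def)
  have bdd: "bdd_above A" by (auto simp: A_def intro: bdd_aboveI[of _ 1])
  \<comment> \<open>The supremum of the fractions of the time \<open>s\<close> up to which the orbit
    exists and stays in the doubled ball; the aim is T = 1.\<close>
  define T where "T = Sup A"
  have T0: "0 \<le> T" unfolding T_def by (rule cSup_upper[OF A0 bdd])
  have T1: "T \<le> 1" unfolding T_def
  proof (rule cSup_least)
    show "A \<noteq> {}" using A0 by blast
  qed (simp add: A_def)
  have below: "P t" if "0 \<le> t" "t < T" for t
  proof -
    obtain a where "a \<in> A" "t < a" using less_cSupD[of A t] \<open>t < T\<close> A0 unfolding T_def by blast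
    then show ?thesis using \<open>0 \<le> t\<close> by (auto simp: A_def)
  qed
  have PT: "P T"
  proof (cases "T = 0")
    case True
    then show ?thesis using P0 by simp
  next
    case False
    \<comment> \<open>The denominator is at least 2, so the times are non-negative and strictly
      below T.\<close>
    define tk where "tk = (\<lambda>k::nat. T - T / (real k + 2))"
    have tk: "0 \<le> tk k" "tk k < T" for k
      using T0 False by (auto simp: tk_def field_simps)
    have tkT: "tk \<longlonglongrightarrow> T" unfolding tk_def by real_asymp
    have lipk: "norm (\<beta> b - \<beta> a) \<le> B * norm s * norm (b - a)" if "0 \<le> a" "a < T" "0 \<le> b" "b < T" for a b
      by (rule lip[of "max a b"]) (use that below in auto)
    have "Cauchy (\<lambda>k. \<beta> (tk k))"
    proof (rule metric_CauchyI)
      fix \<epsilon> :: real assume \<epsilon>: "0 < \<epsilon>"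
      have "Cauchy tk" using tkT by (rule LIMSEQ_imp_Cauchy)
      moreover have "0 < \<epsilon> / (B * norm s + 1)" using \<epsilon> B0 by (intro divide_pos_pos add_nonneg_pos mult_nonneg_nonneg) auto
      ultimately obtain K where K: "\<And>m n. K \<le> m \<Longrightarrow> K \<le> n \<Longrightarrow> dist (tk m) (tk n) < \<epsilon> / (B * norm s + 1)"
        unfolding Cauchy_def by blast
      have pos: "0 < B * norm s + 1" using B0 by (intro add_nonneg_pos mult_nonneg_nonneg) auto
      have "dist (\<beta> (tk m)) (\<beta> (tk n)) < \<epsilon>" if "K \<le> m" "K \<le> n" for m n
      proof -
        have "dist (\<beta> (tk m)) (\<beta> (tk n)) \<le> B * norm s * dist (tk m) (tk n)"
          using lipk[of "tk n" "tk m"] tk by (simp add: dist_norm)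
        also have "\<dots> \<le> (B * norm s + 1) * dist (tk m) (tk n)" by (intro mult_right_mono) auto
        also have "\<dots> < \<epsilon>" using K[OF that] pos by (simp add: field_simps)
        finally show ?thesis .
      qed
      then show "\<exists>K. \<forall>m\<ge>K. \<forall>n\<ge>K. dist (\<beta> (tk m)) (\<beta> (tk n)) < \<epsilon>" by blast
    qed
    then obtain w where w: "(\<lambda>k. \<beta> (tk k)) \<longlonglongrightarrow> w" by (auto simp: Cauchy_convergent_iff convergent_def)
    have "norm (w - \<beta> 0) \<le> B * norm s"
    proof (rule LIMSEQ_le_const2)
      show "(\<lambda>k. norm (\<beta> (tk k) - \<beta> 0)) \<longlonglongrightarrow> norm (w - \<beta> 0)" by (intro tendsto_intros w)
      have "norm (\<beta> (tk k) - \<beta> 0) \<le> B * norm s" for k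
      proof -
        have "norm (\<beta> (tk k) - \<beta> 0) \<le> B * norm s * norm (tk k - 0)" using tk[of k] by (intro lipk) auto
        also have "\<dots> \<le> B * norm s * 1"
          by (rule mult_left_mono) (use tk[of k] T1 B0 in auto)
        finally show ?thesis by simp
      qed
      then show "\<exists>N. \<forall>n\<ge>N. norm (\<beta> (tk n) - \<beta> 0) \<le> B * norm s" by blast
    qed
    then have "dist (\<beta> 0) w < r" using s by (simp add: dist_norm norm_minus_commute)
    moreover have "dist z0 (\<beta> 0) < r" using x(3) \<gamma>(3) by (simp add: \<beta>_def)
    ultimately have wball: "w \<in> ball z0 (2 * r)" using dist_triangle[of z0 w "\<beta> 0"] by simp
    then have wimg: "w \<in> snd c ` fst c" using r by auto
    define zs where "zs = chart_inv c w"
    have zs: "zs \<in> fst c" "snd c zs = w" using chart_inv_mem[OF wimg] chart_inv_right[OF wimg] by (auto simp: zs_def)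
    have zsM: "zs \<in> points M" using zs c chart_subset by blast
    have ev: "\<forall>\<^sub>F k in sequentially. \<gamma> (of_real (tk k) * s) \<in> R" if R: "openin (mtop M) R" "zs \<in> R" for R
    proof -
      have "\<forall>\<^sub>F k in sequentially. \<beta> (tk k) \<in> snd c ` (fst c \<inter> R)"
        by (rule topological_tendstoD[OF w openin_chart_image[OF R(1) c]]) (use zs R in blast)
      then show ?thesis
      proof (rule eventually_mono)
        fix k assume "\<beta> (tk k) \<in> snd c ` (fst c \<inter> R)"
        then obtain y where y: "\<beta> (tk k) = snd c y" "y \<in> fst c" "y \<in> R" by blast
        have "\<gamma> (of_real (tk k) * s) \<in> fst c" using below[OF tk] by (simp add: P_def)
        then have "\<gamma> (of_real (tk k) * s) = y" using y chart_inj[OF c] by (auto simp: \<beta>_def dest: inj_onD)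
        then show "\<gamma> (of_real (tk k) * s) \<in> R" using y by simp
      qed
    qed
    have orb: "pr (\<gamma> (of_real (tk k) * s)) = pr x" for k
      using orbit_curve_Fvals(4)[OF o x(1)] below[OF tk] by (simp add: P_def)
    \<comment> \<open>Points of the orbit space are closed, so the limit point lies in the fibre of
      \<open>x\<close>; therefore it is good and possesses a local flow.\<close>
    have "pr zs = pr x"
    proof (rule ccontr)
      assume ne: "pr zs \<noteq> pr x"
      have "pr x \<in> points N" using pr_points good_points[OF x(1)] by blast
      then have "closedin (mtop N) {pr x}"
        using Hausdorff_imp_t1_space[OF N_Hausdorff] by (simp add: t1_space_closedin_singleton topspace_mtop)
      then have "openin (mtop N) (points N - {pr x})" by (simp add: closedin_def topspace_mtop)
      from pr_preimage_open[OF this]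
      have "\<forall>\<^sub>F k in sequentially. \<gamma> (of_real (tk k) * s) \<in> {p \<in> points M. pr p \<in> points N - {pr x}}"
        by (rule ev) (use zsM ne pr_points in blast)
      then show False using orb eventually_happens[of _ sequentially] by fastforce
    qed
    then have gz: "good zs" by (rule good_fibre[OF x(1) zsM])
    obtain X \<rho> \<kappa> where K: "openin (mtop M) X" "zs \<in> X" "0 < \<rho>" "\<And>u. norm u < \<rho> \<Longrightarrow> holo_map M X M (\<kappa> u)"
      "\<And>u x. norm u < \<rho> \<Longrightarrow> x \<in> X \<Longrightarrow> flow_rel M e u x (\<kappa> u x)"
      by (rule local_flow[OF gz]) (rule that)
    have tks: "(\<lambda>k. of_real (tk k) * s) \<longlonglongrightarrow> of_real T * s" by (intro tendsto_intros tkT)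
    have "\<forall>\<^sub>F k in sequentially. dist (of_real (tk k) * s) (of_real T * s) < \<rho>"
      by (rule tendstoD[OF tks K(3)])
    from eventually_happens'[OF _ eventually_conj[OF this ev[OF K(1,2)]]]
    obtain k where k: "dist (of_real (tk k) * s) (of_real T * s) < \<rho>" "\<gamma> (of_real (tk k) * s) \<in> X" by auto
    \<comment> \<open>From a late point near \<open>zs\<close> the local flow runs past the
      remaining time. By uniqueness of orbits the time T then belongs to
      \<open>\<Omega>\<close>.\<close>
    have fk: "flow_rel M e (of_real (tk k) * s) x (\<gamma> (of_real (tk k) * s))"
      using flow_rel_iff[OF o x(1)] below[OF tk] by (simp add: P_def)
    have "norm (of_real T * s - of_real (tk k) * s) < \<rho>" using k(1) by (simp add: dist_norm norm_minus_commute)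
    from flow_rel_trans[OF x(1) fk K(5)[OF this k(2)]]
    have "flow_rel M e (of_real (tk k) * s + (of_real T * s - of_real (tk k) * s)) x
        (\<kappa> (of_real T * s - of_real (tk k) * s) (\<gamma> (of_real (tk k) * s)))" .
    then have T\<Omega>: "of_real T * s \<in> \<Omega>" using flow_rel_iff[OF o x(1)] by simp
    have "\<gamma> (of_real T * s) = zs"
    proof (rule ccontr)
      assume "\<gamma> (of_real T * s) \<noteq> zs"
      moreover have "\<gamma> (of_real T * s) \<in> topspace (mtop M)" "zs \<in> topspace (mtop M)"
        using orbit_curve_Fvals(3)[OF o x(1) T\<Omega>] zsM by (auto simp: topspace_mtop)
      ultimately obtain U1 U2 where U: "openin (mtop M) U1" "openin (mtop M) U2" "\<gamma> (of_real T * s) \<in> U1" "zs \<in> U2" "disjnt U1 U2"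
        using M_Hausdorff unfolding Hausdorff_space_def by metis
      have "\<forall>\<^sub>F k in sequentially. of_real (tk k) * s \<in> {u \<in> \<Omega>. \<gamma> u \<in> U1}"
        by (rule topological_tendstoD[OF tks holo_curve_preimage_open[OF curve U(1)]]) (use T\<Omega> U in simp)
      from eventually_happens'[OF _ eventually_conj[OF this ev[OF U(2,4)]]] show False
        using U(5) by (auto simp: disjnt_iff)
    qed
    then show ?thesis using T\<Omega> zs wball by (simp add: P_def)
  qed
  have PA: "P t" if "0 \<le> t" "t \<le> T" for t
    using below[of t] PT that by (cases "t = T") auto
  have "T = 1"
  proof (rule ccontr)
    assume "T \<noteq> 1"
    then have "T < 1" using T1 by simp
    define S where "S = {u \<in> \<Omega>. \<gamma> u \<in> {x \<in> fst c. snd c x \<in> ball z0 (2 * r)}}"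
    have "open S" unfolding S_def by (rule holo_curve_preimage_open[OF curve openin_chart_preimage[OF c open_ball]])
    then have "open ((\<lambda>t::real. of_real t * s) -` S)" by (intro open_vimage continuous_intros)
    moreover have "T \<in> (\<lambda>t::real. of_real t * s) -` S" using PT by (simp add: S_def P_def)
    ultimately obtain \<delta> where \<delta>: "0 < \<delta>" "ball T \<delta> \<subseteq> (\<lambda>t::real. of_real t * s) -` S" by (meson openE)
    define T' where "T' = min 1 (T + \<delta> / 2)"
    have T': "T < T'" "T' \<le> 1" "T' < T + \<delta>" using \<delta>(1) \<open>T < 1\<close> by (auto simp: T'_def)
    have "P t" if "t \<in> {0..T'}" for t
    proof (cases "t \<le> T")
      case True
      then show ?thesis using PA that by simp
    next
      case False
      then have "t \<in> ball T \<delta>" using that T' by (simp add: dist_real_def)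
      then show ?thesis using \<delta>(2) by (auto simp: S_def P_def)
    qed
    then have "T' \<in> A" using T' T0 by (simp add: A_def)
    then have "T' \<le> T" unfolding T_def by (rule cSup_upper[OF _ bdd])
    then show False using T' by simp
  qed
  then show ?thesis using PA[of t] t by (simp add: P_def)
qed

text \<open>Along an orbit the local equation \<open>h\<close> grows at nearly the constant rate
  \<open>\<kappa>\<close>, which is nonzero by transversality. So it cannot vanish at both ends of a
  short piece of an orbit.\<close>

lemma regular_point_no_return:
  assumes q: "q \<in> reg_points M D"
  obtains U \<epsilon> where "openin (mtop M) U" "q \<in> U" "0 < \<epsilon>"
    "\<And>x z s. x \<in> U \<Longrightarrow> x \<in> D \<Longrightarrow> good x \<Longrightarrow> flow_rel M e s x z \<Longrightarrow> z \<in> D \<Longrightarrow> norm s < \<epsilon> \<Longrightarrow> s = 0"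
proof -
  obtain c W h where W: "c \<in> charts_at M q" "open W" "snd c q \<in> W" "W \<subseteq> snd c ` fst c" "cholomorphic W h"
    "\<And>x. x \<in> D \<Longrightarrow> x \<in> fst c \<Longrightarrow> snd c x \<in> W \<Longrightarrow> h (snd c x) = 0"
    "cdot (cgrad h (snd c q)) (e q c) \<noteq> 0"
    by (rule regular_point_transversal[OF q]) (rule that)
  have ca: "c \<in> atlas M" "q \<in> fst c" using W(1) by (auto simp: charts_at_def)
  define \<kappa> where "\<kappa> = cdot (cgrad h (snd c q)) (e q c)"
  define f where "f = (\<lambda>z. cdot (cgrad h z) (e (chart_inv c z) c))"
  define B where "B = norm (e q c) + 1"
  have B0: "0 < B" by (simp add: B_def add_nonneg_pos)
  have econt: "continuous_on W (\<lambda>z. e (chart_inv c z) c)"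
    by (rule continuous_on_subset[OF cholomorphic_vec_continuous_on[OF e_holomorphic[OF ca(1)]] W(4)])
  have fcont: "continuous_on W f" unfolding f_def by (intro continuous_intros continuous_on_cgrad[OF W(2,5)] econt)
  \<comment> \<open>On this set the derivative of \<open>h\<close> along \<open>e\<close> differs
    from \<open>\<kappa>\<close> by less than half of its modulus, and \<open>e\<close> is bounded
    by \<open>B\<close>, as needed to confine the flow.\<close>
  define S where "S = (W \<inter> (\<lambda>z. norm (f z - \<kappa>)) -` {..<norm \<kappa> / 2}) \<inter> (W \<inter> (\<lambda>z. norm (e (chart_inv c z) c)) -` {..<B})"
  have "open S"
    unfolding S_def
    by (intro open_Int continuous_open_preimage[OF _ W(2)] continuous_on_norm continuous_on_diff fcont econt continuous_on_const) auto
  moreover have "snd c q \<in> S" using W(3,7) ca by (simp add: S_def f_def \<kappa>_def B_def)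
  ultimately obtain R where R: "0 < R" "cball (snd c q) R \<subseteq> S" by (meson open_contains_cball)
  define r where "r = R / 2"
  have r: "0 < r" "cball (snd c q) (2 * r) \<subseteq> S" using R by (auto simp: r_def)
  define U where "U = {x \<in> fst c. snd c x \<in> ball (snd c q) r}"
  show ?thesis
  proof (rule that[of U "r / B"])
    show "openin (mtop M) U" unfolding U_def by (rule openin_chart_preimage[OF ca(1) open_ball])
    show "q \<in> U" using ca r by (simp add: U_def)
    show "0 < r / B" using r B0 by simp
    fix x z s assume x: "x \<in> U" "x \<in> D" "good x" and fl: "flow_rel M e s x z" and z: "z \<in> D" and s: "norm s < r / B"
    have sB: "B * norm s < r" using s B0 by (simp add: field_simps)
    have xc: "x \<in> fst c" "snd c x \<in> ball (snd c q) r" using x by (auto simp: U_def)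
    obtain \<Omega> \<gamma> where o: "orbit_curve x \<Omega> \<gamma>" using orbit_curve_exists[OF good_points[OF x(3)]] by blast
    have zs: "\<gamma> s = z" using fl flow_rel_iff[OF o x(3)] by simp
    have \<gamma>: "integral_curve M e \<Omega> \<gamma>" "0 \<in> \<Omega>" "\<gamma> 0 = x" using o by (auto simp: orbit_curve_def)
    have curve: "holo_curve M \<Omega> \<gamma>" using \<gamma> by (simp add: integral_curve_def)
    have img: "cball (snd c q) (2 * r) \<subseteq> snd c ` fst c" using r(2) W(4) by (auto simp: S_def)
    have eB: "norm (e (chart_inv c z) c) \<le> B" if "z \<in> cball (snd c q) (2 * r)" for z
      using r(2) that by (auto simp: S_def subset_eq less_imp_le)
    have conf: "of_real t * s \<in> \<Omega>" "\<gamma> (of_real t * s) \<in> fst c" "snd c (\<gamma> (of_real t * s)) \<in> ball (snd c q) (2 * r)"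
      if "t \<in> {0..1}" for t
      using flow_confined[OF ca(1) img eB x(3) xc o sB less_imp_le[OF B0] that] by auto
    \<comment> \<open>The deviation of \<open>h\<close> from linear growth along the segment of
      times. With both ends on \<open>D\<close> it changes by the full amount of s\<kappa>, whereas
      the mean value inequality permits only half of it.\<close>
    define \<phi> where "\<phi> = (\<lambda>t::real. h (snd c (\<gamma> (of_real t * s))) - of_real t * s * \<kappa>)"
    have "norm (\<phi> 1 - \<phi> 0) \<le> norm s * norm \<kappa> / 2 * norm (1 - 0 :: real)"
    proof (rule differentiable_bound[of "{0..1}" \<phi> "\<lambda>t h. of_real h * s * (f (snd c (\<gamma> (of_real t * s))) - \<kappa>)"])
      fix t :: real assume t: "t \<in> {0..1}"
      define w where "w = snd c (\<gamma> (of_real t * s))"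
      have wS: "w \<in> S" using conf[OF t] r(2) by (auto simp: w_def)
      have ch: "c \<in> charts_at M (\<gamma> (of_real t * s))" using conf[OF t] ca by (simp add: charts_at_def)
      have "((\<lambda>u. snd c (\<gamma> u)) has_derivative (\<lambda>h. h *s e (\<gamma> (of_real t * s)) c)) (at (of_real t * s))"
        using holo_curveD[OF curve conf(1)[OF t] ch] conf(1)[OF t] \<gamma>(1) by (simp add: integral_curve_def)
      then have "((\<lambda>u. h (snd c (\<gamma> u))) has_field_derivative cdot (cgrad h w) (e (\<gamma> (of_real t * s)) c)) (at (of_real t * s))"
        by (rule curve_chain_scalar) (use cholomorphicD[OF W(2,5), of w] wS in \<open>simp add: w_def S_def\<close>)
      also have "cdot (cgrad h w) (e (\<gamma> (of_real t * s)) c) = f w" using conf[OF t] ca by (simp add: f_def w_def)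
      finally have "((\<lambda>u. h (snd c (\<gamma> u))) has_derivative (\<lambda>k. f w * k)) (at (of_real t * s))"
        by (simp add: has_field_derivative_def)
      then have "((\<lambda>t. h (snd c (\<gamma> (of_real t * s)))) has_derivative (\<lambda>k. f w * (of_real k * s))) (at t within {0..1})"
        by (rule has_derivative_compose[of "\<lambda>t. of_real t * s" "\<lambda>h. of_real h * s" t "{0..1}", rotated])
           (auto intro!: derivative_eq_intros)
      then show "(\<phi> has_derivative (\<lambda>h. of_real h * s * (f (snd c (\<gamma> (of_real t * s))) - \<kappa>))) (at t within {0..1})"
        unfolding \<phi>_def w_def[symmetric] by (auto intro!: derivative_eq_intros simp: algebra_simps)
      have "norm (f w - \<kappa>) \<le> norm \<kappa> / 2" using wS by (simp add: S_def)
      then have "norm (of_real k * s * (f w - \<kappa>)) \<le> norm s * norm \<kappa> / 2 * norm k" for k :: real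
        using mult_left_mono[of "norm (f w - \<kappa>)" "norm \<kappa> / 2" "norm k * norm s"] by (simp add: norm_mult mult_ac)
      then show "onorm (\<lambda>h. of_real h * s * (f (snd c (\<gamma> (of_real t * s))) - \<kappa>)) \<le> norm s * norm \<kappa> / 2"
        unfolding w_def[symmetric] by (rule onorm_le)
    qed auto
    moreover have "\<phi> 1 = - (s * \<kappa>)"
    proof -
      have "z \<in> fst c" "snd c z \<in> W" using conf[of 1] zs r(2) by (auto simp: S_def)
      then show ?thesis using W(6)[OF z] zs by (simp add: \<phi>_def)
    qed
    moreover have "\<phi> 0 = 0"
    proof -
      have "snd c x \<in> W" using conf[of 0] \<gamma>(3) r(2) by (auto simp: S_def)
      then show ?thesis using W(6)[OF x(2) xc(1)] \<gamma>(3) by (simp add: \<phi>_def)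
    qed
    ultimately have "norm s * norm \<kappa> \<le> norm s * norm \<kappa> / 2" by (simp add: norm_mult)
    moreover have "0 \<le> norm s * norm \<kappa>" by simp
    ultimately have "norm s * norm \<kappa> = 0" by linarith
    then show "s = 0" using W(7) by (simp add: \<kappa>_def)
  qed
qed

end

section \<open>The bifurcation diagram and the recovery of the multiplication\<close>

context standard_F_manifold
begin

text \<open>The finite fibre of \<open>D\<close> over \<open>pr p\<close> yields one no-return time
  \<open>\<delta>\<close>, and properness puts all of \<open>D\<close> over nearby orbits under its
  control. Only one point \<open>q1\<close> of the fibre has to be reached by a limit, since
  goodness is constant on fibres.\<close>

lemma regular_fibre_good:
  assumes p: "p \<in> points M" and reg: "\<And>q. q \<in> D \<Longrightarrow> pr q = pr p \<Longrightarrow> q \<in> reg_points M D"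
  shows "good p"
proof -
  define Q where "Q = {q \<in> D. pr q = pr p}"
  have y: "pr p \<in> points N" using pr_points p by blast
  have finQ: "finite Q" unfolding Q_def by (rule D_fibre_finite[OF y])
  obtain q1 where q1: "q1 \<in> D" "pr q1 = pr p" by (rule D_fibre_nonempty[OF y])
  have "\<forall>q\<in>Q. \<exists>U \<epsilon>. openin (mtop M) U \<and> q \<in> U \<and> 0 < \<epsilon> \<and>
      (\<forall>x z s. x \<in> U \<longrightarrow> x \<in> D \<longrightarrow> good x \<longrightarrow> flow_rel M e s x z \<longrightarrow> z \<in> D \<longrightarrow> norm s < \<epsilon> \<longrightarrow> s = 0)"
  proof
    fix q assume "q \<in> Q"
    then have q: "q \<in> reg_points M D" using reg by (simp add: Q_def)
    obtain U \<epsilon> where "openin (mtop M) U" "q \<in> U" "0 < \<epsilon>"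
      "\<And>x z s. x \<in> U \<Longrightarrow> x \<in> D \<Longrightarrow> good x \<Longrightarrow> flow_rel M e s x z \<Longrightarrow> z \<in> D \<Longrightarrow> norm s < \<epsilon> \<Longrightarrow> s = 0"
      by (rule regular_point_no_return[OF q]) (rule that)
    then show "\<exists>U \<epsilon>. openin (mtop M) U \<and> q \<in> U \<and> 0 < \<epsilon> \<and>
      (\<forall>x z s. x \<in> U \<longrightarrow> x \<in> D \<longrightarrow> good x \<longrightarrow> flow_rel M e s x z \<longrightarrow> z \<in> D \<longrightarrow> norm s < \<epsilon> \<longrightarrow> s = 0)"
      by blast
  qed
  from bchoice[OF this] obtain U where "\<forall>q\<in>Q. \<exists>\<epsilon>. openin (mtop M) (U q) \<and> q \<in> U q \<and> 0 < \<epsilon> \<and>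
      (\<forall>x z s. x \<in> U q \<longrightarrow> x \<in> D \<longrightarrow> good x \<longrightarrow> flow_rel M e s x z \<longrightarrow> z \<in> D \<longrightarrow> norm s < \<epsilon> \<longrightarrow> s = 0)" by blast
  from bchoice[OF this] obtain \<epsilon> where U: "\<forall>q\<in>Q. openin (mtop M) (U q) \<and> q \<in> U q \<and> 0 < \<epsilon> q \<and>
      (\<forall>x z s. x \<in> U q \<longrightarrow> x \<in> D \<longrightarrow> good x \<longrightarrow> flow_rel M e s x z \<longrightarrow> z \<in> D \<longrightarrow> norm s < \<epsilon> q \<longrightarrow> s = 0)" by blast
  obtain V where V: "openin (mtop N) V" "pr p \<in> V" "\<And>x. x \<in> D \<Longrightarrow> pr x \<in> V \<Longrightarrow> \<exists>q\<in>D. pr q = pr p \<and> x \<in> U q"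
  proof (rule D_fibre_neighbourhood[OF y, of U])
    show "openin (mtop M) (U q) \<and> q \<in> U q" if "q \<in> D" "pr q = pr p" for q using U that by (simp add: Q_def)
  qed (rule that)
  define \<delta> where "\<delta> = Min (\<epsilon> ` Q)"
  have q1Q: "q1 \<in> Q" using q1 by (simp add: Q_def)
  have \<delta>0: "0 < \<delta>" unfolding \<delta>_def using finQ q1Q U by (subst Min_gr_iff) auto
  have \<delta>le: "\<delta> \<le> \<epsilon> q" if "q \<in> Q" for q unfolding \<delta>_def using finQ that by simp
  have sep: "\<delta> \<le> norm (a - b)" if x: "x \<in> D" "good x" "pr x \<in> V" and ab: "a \<in> Fvals x" "b \<in> Fvals x" "a \<noteq> b" for x a b
  proof (rule ccontr)
    assume "\<not> \<delta> \<le> norm (a - b)"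
    obtain u where u: "flow_rel M e (- a) x u" "u \<in> D" "pr u = pr x" by (rule D_times[OF x(2) ab(1)])
    obtain v where v: "flow_rel M e (- b) x v" "v \<in> D" "pr v = pr x" by (rule D_times[OF x(2) ab(2)])
    obtain q where q: "q \<in> D" "pr q = pr p" "u \<in> U q" using V(3)[OF u(2)] u(3) x(3) by auto
    have qQ: "q \<in> Q" using q by (simp add: Q_def)
    \<comment> \<open>The values \<open>a\<close> and \<open>b\<close> are the negatives of the
      times at which the orbit of \<open>x\<close> meets \<open>D\<close>, so their difference is a
      flow time between two points of \<open>D\<close>.\<close>
    have "flow_rel M e (- b - - a) u v" by (rule flow_rel_diff[OF x(2) u(1) v(1)])
    moreover have "good u" by (rule flow_rel_Fvals(1)[OF x(2) u(1)])
    moreover have "norm (- b - - a) < \<epsilon> q" using \<open>\<not> \<delta> \<le> norm (a - b)\<close> \<delta>le[OF qQ] by simp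
    ultimately have "- b - - a = 0" using U qQ q(3) u(2) v(2) by blast
    then show False using ab(3) by simp
  qed
  have q1M: "q1 \<in> points M" by (rule D_points[OF q1(1)])
  obtain c where c: "c \<in> charts_at M q1" using points_chart[OF q1M] by blast
  have ca: "c \<in> atlas M" "q1 \<in> fst c" using c by (auto simp: charts_at_def)
  have "\<exists>x. x \<in> D \<and> good x \<and> pr x \<in> V \<and> x \<in> fst c \<and> dist (snd c q1) (snd c x) < inverse (real (Suc k))" for k
  proof -
    have "openin (mtop M) ({x \<in> fst c. snd c x \<in> ball (snd c q1) (inverse (real (Suc k)))} \<inter> {p \<in> points M. pr p \<in> V})"
      by (intro openin_Int openin_chart_preimage[OF ca(1) open_ball] pr_preimage_open[OF V(1)])
    from good_discriminant_dense[OF this _ q1(1)] show ?thesis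
      using ca(2) q1M q1(2) V(2) by auto
  qed
  then obtain x where x: "\<And>k. x k \<in> D" "\<And>k. good (x k)" "\<And>k. pr (x k) \<in> V" "\<And>k. x k \<in> fst c"
    "\<And>k. dist (snd c q1) (snd c (x k)) < inverse (real (Suc k))" by metis
  have lim: "(\<lambda>k. snd c (x k)) \<longlonglongrightarrow> snd c q1"
  proof (rule metric_LIMSEQ_I)
    fix r :: real assume "0 < r"
    then obtain K where K: "inverse (real (Suc K)) < r" using reals_Archimedean by blast
    show "\<exists>K. \<forall>k\<ge>K. dist (snd c (x k)) (snd c q1) < r"
    proof (intro exI allI impI)
      fix k assume "K \<le> k"
      then have "inverse (real (Suc k)) \<le> inverse (real (Suc K))" by (intro le_imp_inverse_le) auto
      then show "dist (snd c (x k)) (snd c q1) < r" using x(5)[of k] K unfolding dist_commute[of _ "snd c q1"] by linarith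
    qed
  qed
  have "\<exists>f. bij_betw f (UNIV :: 'n set) (Fvals (x k))" for k
    by (rule finite_same_card_bij) (use x(2)[of k] finite_Fvals[OF good_points[OF x(2)]] in \<open>simp_all add: good_def\<close>)
  then obtain f where f: "\<And>k. bij_betw (f k) (UNIV :: 'n set) (Fvals (x k))" by metis
  have fv: "f k a \<in> Fvals (chart_inv c (snd c (x k)))" for k a
    using f[of k] x(4)[of k] ca(1) by (auto simp: bij_betw_def)
  obtain r h where h: "strict_mono (r :: nat \<Rightarrow> nat)" "\<And>a :: 'n. h a \<in> Fvals q1" "\<And>a. (\<lambda>k. f (r k) a) \<longlonglongrightarrow> h a"
    by (rule Fvals_limit[OF c lim imageI[OF x(4)] fv]) (rule that)
  have "inj h"
  proof (rule injI, rule ccontr)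
    fix a b assume ab: "h a = h b" "a \<noteq> b"
    have "\<delta> \<le> norm (h a - h b)"
    proof (rule LIMSEQ_le_const)
      show "(\<lambda>k. norm (f (r k) a - f (r k) b)) \<longlonglongrightarrow> norm (h a - h b)" by (intro tendsto_intros h)
      have "\<delta> \<le> norm (f (r k) a - f (r k) b)" for k
        using f[of "r k"] ab(2) by (intro sep[OF x(1,2,3)[of "r k"]]) (auto simp: bij_betw_def dest: injD)
      then show "\<exists>N. \<forall>k\<ge>N. \<delta> \<le> norm (f (r k) a - f (r k) b)" by blast
    qed
    then show False using ab(1) \<delta>0 by simp
  qed
  then have "CARD('n) \<le> card (Fvals q1)"
    using h(2) by (intro card_inj_on_le[of h]) (auto intro: finite_Fvals q1M)
  then have "good q1" using card_Fvals_le[OF q1M] q1M by (simp add: good_def)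
  then show ?thesis by (rule good_fibre[OF _ p]) (simp add: q1(2))
qed

lemma good_iff:
  assumes p: "p \<in> points M"
  shows "good p \<longleftrightarrow> pr p \<notin> pr ` sing_points M D"
proof
  assume g: "good p"
  show "pr p \<notin> pr ` sing_points M D"
  proof
    assume "pr p \<in> pr ` sing_points M D"
    then obtain q where q: "q \<in> D" "q \<notin> reg_points M D" "pr q = pr p" by (auto simp: sing_points_def)
    have "good q" by (rule good_fibre[OF g D_points[OF q(1)] q(3)])
    then show False using good_discriminant_regular[of q] q by (simp add: D_def)
  qed
next
  assume n: "pr p \<notin> pr ` sing_points M D"
  show "good p"
  proof (rule regular_fibre_good[OF p], rule ccontr)
    fix q assume q: "q \<in> D" "pr q = pr p" "q \<notin> reg_points M D"
    then have "q \<in> sing_points M D" by (simp add: sing_points_def)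
    then show False using n q(2) by (metis imageI)
  qed
qed

lemma bifurcation_diagram_eq: "bifurcation_diagram M m e F = {p \<in> points M. pr p \<in> pr ` sing_points M D}"
  unfolding set_eq_iff bifurcation_iff mem_Collect_eq using good_iff by blast

end

text \<open>The dual forms depend on the vectors of the frame only. With any \<open>y\<close> dual
  to \<open>f\<close> the product is therefore expressed by the frame alone, which allows two
  algebras to be compared.\<close>

lemma (in cn_algebra) frame_product:
  assumes f: "frame f" and y: "\<And>a b. cdot (y a) (f b) = (if a = b then 1 else 0)"
  shows "star u v = (\<Sum>a\<in>UNIV. (cdot (y a) u * cdot (y a) v) *s f a)"
proof -
  obtain y' where y': "\<And>a b. cdot (y' a) (f b) = (if a = b then 1 else 0)"
    "\<And>v. v = (\<Sum>a\<in>UNIV. cdot (y' a) v *s f a)" "characters = range y'"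
    by (rule frame_dual[OF f], rule that) assumption+
  have eq: "cdot (y' a) w = cdot (y a) w" for a w
  proof -
    have "cdot (y a) w = cdot (y a) (\<Sum>b\<in>UNIV. cdot (y' b) w *s f b)" using y'(2)[of w] by simp
    also have "\<dots> = (\<Sum>b\<in>UNIV. if a = b then cdot (y' b) w else 0)"
      unfolding cdot_sum_right cdot_smult_right y by (intro sum.cong) auto
    finally show ?thesis by simp
  qed
  have "star u v = (\<Sum>a\<in>UNIV. cdot (y' a) (star u v) *s f a)" by (rule y'(2))
  also have "\<dots> = (\<Sum>a\<in>UNIV. (cdot (y' a) u * cdot (y' a) v) *s f a)"
    by (intro sum.cong refl) (simp add: characters_mult y'(3))
  finally show ?thesis unfolding eq .
qed

section \<open>Comparison of two multiplications with the same unit field and discriminant\<close>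

context standard_F_manifold
begin

text \<open>By \<open>good_iff\<close> goodness is a condition on \<open>D\<close> and
  \<open>pr\<close>, so both structures have the same good points. There both frames satisfy the
  same two conditions and agree up to numbering.\<close>

lemma star_eq_good:
  assumes S: "standard_F_manifold M m' e F' N pr" and D: "discriminant M m' e F' = D"
    and p: "good p" and c: "c \<in> charts_at M p"
  shows "generated_F_manifold.star M m' c p u v = star c p u v"
proof -
  interpret P: standard_F_manifold M m' e F' N pr by (rule S)
  have PD: "P.D = D" unfolding P.D_def by (rule D)
  have p': "P.good p" using p good_iff[OF good_points[OF p]] P.good_iff[OF good_points[OF p]] by (simp add: PD)
  obtain f where f: "idempotent_frame M m p f" using good_conditions(1)[OF p] by blast
  obtain f' where f': "idempotent_frame M m' p f'" using P.good_conditions(1)[OF p'] by blast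
  have "cond_unit e p f'" "cond_hyperplanes M e D pr p f'"
    using P.good_conditions(2)[OF p' f'] by (simp_all add: PD)
  moreover have "f' i \<in> tangent_space M p" for i using f' by (simp add: idempotent_frame_def)
  ultimately obtain \<sigma> where \<sigma>: "bij \<sigma>" "f' = f \<circ> \<sigma>" using good_conditions(3)[OF p f, of f'] by blast
  interpret A: cn_algebra "star c p" "e p c" by (rule algebra_at[OF c])
  interpret B: cn_algebra "P.star c p" "e p c" by (rule P.algebra_at[OF c])
  have fr: "A.frame (\<lambda>i. f i c)" using f idempotent_frame_iff[OF c] by blast
  have fr': "B.frame (\<lambda>i. f' i c)" using f' P.idempotent_frame_iff[OF c] by blast
  obtain y where y: "\<And>a b. cdot (y a) (f b c) = (if a = b then 1 else 0)"
    by (rule A.frame_dual[OF fr], rule that) assumption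
  have y': "cdot (y (\<sigma> a)) (f' b c) = (if a = b then 1 else 0)" for a b
    unfolding \<sigma>(2) o_def y using bij_is_inj[OF \<sigma>(1)] by (auto dest: injD)
  have "P.star c p u v = (\<Sum>a\<in>UNIV. (cdot (y (\<sigma> a)) u * cdot (y (\<sigma> a)) v) *s f' a c)"
    by (rule B.frame_product[OF fr' y'])
  also have "\<dots> = (\<Sum>a\<in>UNIV. (cdot (y a) u * cdot (y a) v) *s f a c)"
    unfolding \<sigma>(2) o_def by (rule sum.reindex_bij_betw[OF \<sigma>(1)])
  also have "\<dots> = star c p u v" by (rule A.frame_product[OF fr y, symmetric])
  finally show ?thesis .
qed

lemma multiplication_determined:
  assumes S: "standard_F_manifold M m' e F' N pr" and D: "discriminant M m' e F' = D"
    and p: "p \<in> points M" and v: "v \<in> tangent_space M p" and w: "w \<in> tangent_space M p"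
  shows "m' p v w = m p v w"
proof -
  interpret P: standard_F_manifold M m' e F' N pr by (rule S)
  obtain c where c: "c \<in> charts_at M p" using points_chart[OF p] by blast
  have ca: "c \<in> atlas M" "p \<in> fst c" using c by (auto simp: charts_at_def)
  \<comment> \<open>The coordinate vectors of \<open>v\<close> and \<open>w\<close> are kept
    constant and only the base point moves; so \<open>G\<close> is continuous on the chart and
    vanishes at its good points, which are dense.\<close>
  define G where "G = (\<lambda>z. P.star c (chart_inv c z) (v c) (w c) - star c (chart_inv c z) (v c) (w c))"
  have op: "open (snd c ` fst c)" by (rule chart_open[OF ca(1)])
  have const: "cholomorphic_vec (snd c ` fst c) (\<lambda>z. u)" for u :: "complex^'n"
    by (simp add: cholomorphic_vec_def cholomorphic_const)
  have id: "cholomorphic_vec (snd c ` fst c) (\<lambda>z. z)"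
    by (simp add: cholomorphic_vec_def cholomorphic_nth)
  have Gcont: "continuous_on (snd c ` fst c) G"
    unfolding G_def
    by (intro continuous_intros cholomorphic_vec_continuous_on star_holomorphic P.star_holomorphic ca(1) const id op) auto
  have "G (snd c p) = 0"
  proof (rule ccontr)
    assume ne: "G (snd c p) \<noteq> 0"
    define R where "R = snd c ` fst c \<inter> G -` (- {0})"
    have "open R" unfolding R_def by (rule continuous_open_preimage[OF Gcont op]) (simp add: open_Compl)
    then have o: "openin (mtop M) {x \<in> fst c. snd c x \<in> R}" by (rule openin_chart_preimage[OF ca(1)])
    have "p \<in> {x \<in> fst c. snd c x \<in> R}" using ca(2) ne by (simp add: R_def)
    then obtain x where x: "x \<in> fst c" "snd c x \<in> R" "good x" using good_dense[OF o] by blast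
    have "c \<in> charts_at M x" using x(1) ca(1) by (simp add: charts_at_def)
    from star_eq_good[OF S D x(3) this] have "G (snd c x) = 0" using x(1) ca(1) by (simp add: G_def)
    then show False using x(2) by (simp add: R_def)
  qed
  then have "P.star c p (v c) (w c) = star c p (v c) (w c)" using ca by (simp add: G_def)
  then have "m' p v w c = m p v w c"
    unfolding P.star_def star_def tangent_eq_tvec_of[OF v c] tangent_eq_tvec_of[OF w c] .
  then show ?thesis by (rule tangent_eqI[OF P.m_props(1)[OF p v w w] m_props(1)[OF p v w w] c])
qed

end

theorem corollary11p6:
  fixes M :: "('a, 'n::finite) cmanifold"
    and m :: "('a, 'n) tmult"
    and e :: "'a \<Rightarrow> ('a, 'n) tvec"
    and F :: "'a \<times> ('a, 'n) covec \<Rightarrow> complex"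
    and N :: "('b, 'm::finite) cmanifold"
    and pr :: "'a \<Rightarrow> 'b"
  assumes "massive_F_manifold M m e"
    and "generating_function M m e F"
    and "standard_form M e (discriminant M m e F) N pr"
  shows "let D = discriminant M m e F; B = bifurcation_diagram M m e F in
    (\<forall>p \<in> points M - B. semisimple_at M m p) \<and>
    B = {p \<in> points M. pr p \<in> pr ` sing_points M D} \<and>
    (\<forall>p \<in> points M - B.
       (\<exists>f. idempotent_frame M m p f) \<and>
       (\<forall>f. idempotent_frame M m p f \<longrightarrow> cond_unit e p f \<and> cond_hyperplanes M e D pr p f) \<and>
       (\<forall>f g. (\<forall>i. f i \<in> tangent_space M p) \<and> cond_unit e p f \<and> cond_hyperplanes M e D pr p f \<and>
              (\<forall>i. g i \<in> tangent_space M p) \<and> cond_unit e p g \<and> cond_hyperplanes M e D pr p g \<longrightarrow>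
              (\<exists>\<sigma>. bij \<sigma> \<and> g = f \<circ> \<sigma>))) \<and>
    (\<forall>m' F'. massive_F_manifold M m' e \<and> generating_function M m' e F' \<and>
       discriminant M m' e F' = D \<longrightarrow>
       (\<forall>p \<in> points M. \<forall>v \<in> tangent_space M p. \<forall>w \<in> tangent_space M p. m' p v w = m p v w))"
proof -
  interpret standard_F_manifold M m e F N pr
    by unfold_locales (rule assms)+
  have good: "good p" if "p \<in> points M - bifurcation_diagram M m e F" for p
    using that by (simp add: bifurcation_iff)
  have uniq: "\<exists>\<sigma>. bij \<sigma> \<and> g = f \<circ> \<sigma>"
    if p: "good p"
      and f: "\<forall>i. f i \<in> tangent_space M p" "cond_unit e p f" "cond_hyperplanes M e D pr p f"
      and g: "\<forall>i. g i \<in> tangent_space M p" "cond_unit e p g" "cond_hyperplanes M e D pr p g" for p f g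
  proof -
    \<comment> \<open>Two arbitrary families satisfying the conditions are compared through an
      idempotent frame, of which both are permutations.\<close>
    obtain f0 where f0: "idempotent_frame M m p f0" using good_conditions(1)[OF p] by blast
    obtain \<sigma> where \<sigma>: "bij \<sigma>" "f = f0 \<circ> \<sigma>" using good_conditions(3)[OF p f0 _ f(2,3)] f(1) by blast
    obtain \<tau> where \<tau>: "bij \<tau>" "g = f0 \<circ> \<tau>" using good_conditions(3)[OF p f0 _ g(2,3)] g(1) by blast
    have "f \<circ> (inv \<sigma> \<circ> \<tau>) = f0 \<circ> (\<sigma> \<circ> inv \<sigma>) \<circ> \<tau>" by (simp only: \<sigma>(2) o_assoc)
    also have "\<dots> = g" using bij_is_surj[OF \<sigma>(1)] by (simp add: surj_iff \<tau>(2))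
    finally have "g = f \<circ> (inv \<sigma> \<circ> \<tau>)" by (rule sym)
    moreover have "bij (inv \<sigma> \<circ> \<tau>)" by (intro bij_comp bij_imp_bij_inv \<sigma>(1) \<tau>(1))
    ultimately show ?thesis by blast
  qed
  have mult: "m' p v w = m p v w"
    if "massive_F_manifold M m' e" "generating_function M m' e F'" and D': "discriminant M m' e F' = D"
      and "p \<in> points M" "v \<in> tangent_space M p" "w \<in> tangent_space M p" for m' F' p v w
  proof (rule multiplication_determined[OF _ D' that(4-6)])
    \<comment> \<open>The standard form refers to the multiplication and the generating function
      only through the discriminant, so it carries over to the second structure.\<close>
    show "standard_F_manifold M m' e F' N pr"
      by unfold_locales (use that(1,2) standard in \<open>simp_all add: D' D_def\<close>)
  qed
  show ?thesis
    unfolding Let_def D_def[symmetric]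
  proof (intro conjI ballI allI impI)
    fix p assume "p \<in> points M - bifurcation_diagram M m e F"
    then show "semisimple_at M m p" by (rule good_semisimple[OF good])
  next
    show "bifurcation_diagram M m e F = {p \<in> points M. pr p \<in> pr ` sing_points M D}" by (rule bifurcation_diagram_eq)
  next
    fix p assume "p \<in> points M - bifurcation_diagram M m e F"
    then show "\<exists>f. idempotent_frame M m p f" by (rule good_conditions(1)[OF good])
  next
    fix p f assume p: "p \<in> points M - bifurcation_diagram M m e F" and f: "idempotent_frame M m p f"
    from good_conditions(2)[OF good[OF p] f]
    show "cond_unit e p f" "cond_hyperplanes M e D pr p f" by blast+
  next
    fix p f g assume p: "p \<in> points M - bifurcation_diagram M m e F"
      and fg: "(\<forall>i. f i \<in> tangent_space M p) \<and> cond_unit e p f \<and> cond_hyperplanes M e D pr p f \<and>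
              (\<forall>i. g i \<in> tangent_space M p) \<and> cond_unit e p g \<and> cond_hyperplanes M e D pr p g"
    then show "\<exists>\<sigma>. bij \<sigma> \<and> g = f \<circ> \<sigma>" by (intro uniq[OF good[OF p]]) blast+
  next
    fix m' F' p v w
    assume "massive_F_manifold M m' e \<and> generating_function M m' e F' \<and> discriminant M m' e F' = D"
      and "p \<in> points M" "v \<in> tangent_space M p" "w \<in> tangent_space M p"
    then show "m' p v w = m p v w" using mult by blast
  qed
qed

end
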